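(* Let $A$ be an artin algebra with Jacobson radical $J$. Let $P$ be an indecomposable projective module and $I$ an indecomposable injective module in $\mathrm{mod}\,A$. (1) Suppose that $\mathrm{rad}\,P=M_1\oplus\cdots\oplus M_s$, where $M_i$ is of Loewy length $c_i$ such that $\mathrm{soc}\,M_i\cong Ae_i/Je_i$ with $e_i$ a primitive idempotent in $A$, for $i=1,\ldots,s$. Then $$\ell(D\mathrm{Tr}(P/\mathrm{soc}\,P))\ \ge\ \sum_{i=1}^s\ell(e_iA/e_iJ^{c_i+1})-1\ \ge\ (s-1)+\sum_{i=1}^s c_i\ \ge\ 2s-1.$$ (2) Suppose that $I/\mathrm{soc}\,I=N_1\oplus\cdots\oplus N_t$, where $N_i$ is of Loewy length $c_i$ such that $\mathrm{top}\,N_i\cong Ae_i/Je_i$ with $e_i\in A$ a primitive idempotent, for $i=1,\ldots,t$. Then $$\ell(\mathrm{Tr}D(\mathrm{rad}\,I))\ \ge\ \sum_{i=1}^t\ell(Ae_i/J^{c_i+1}e_i)-1\ \ge\ (t-1)+\sum_{i=1}^t c_i\ \ge\ 2t-1.$$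
   Context: $A$ is an artin $R$-algebra, where $R$ is a commutative artinian ring; $\mathrm{mod}\,A$ is the category of finitely generated left $A$-modules. $\ell(M)$ is the composition length of a module $M$ (left or right); $\mathrm{top}\,M=M/\mathrm{rad}\,M$; the Loewy length of $M$ is the least $n\ge 0$ with $J^nM=0$. $D=\mathrm{Hom}_R(-,I_R)$ is the standard duality between finitely generated left and right $A$-modules, with $I_R$ a minimal injective cogenerator of $\mathrm{mod}\,R$, and $\mathrm{Tr}$ is the Auslander–Bridger transpose, so $D\mathrm{Tr}$ and $\mathrm{Tr}D$ are the Auslander–Reiten translates. *)

theory Defs
  imports "HOL-Algebra.Module" "HOL-Algebra.Ideal_Product" "HOL-Library.FuncSet"
begin

text \<open>The locale \<^locale>\<open>module\<close> requires a commutative base ring. We keep its record type and its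
  predicate \<^const>\<open>submodule\<close>, which do not. The fields mult and one of a record that represents a
  module are irrelevant and are left undefined where a module is built from scratch.
  A right module over A is a left module over the opposite ring of A.\<close>

locale left_module = A?: ring A + M?: abelian_group M
  for A :: "('a, 'k) ring_scheme" (structure) and M :: "('a, 'm) module" (structure) +
  assumes lsmult_closed: "\<lbrakk>a \<in> carrier A; x \<in> carrier M\<rbrakk> \<Longrightarrow> a \<odot>\<^bsub>M\<^esub> x \<in> carrier M"
    and lsmult_l_distr: "\<lbrakk>a \<in> carrier A; b \<in> carrier A; x \<in> carrier M\<rbrakk> \<Longrightarrow>
      (a \<oplus>\<^bsub>A\<^esub> b) \<odot>\<^bsub>M\<^esub> x = a \<odot>\<^bsub>M\<^esub> x \<oplus>\<^bsub>M\<^esub> b \<odot>\<^bsub>M\<^esub> x"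
    and lsmult_r_distr: "\<lbrakk>a \<in> carrier A; x \<in> carrier M; y \<in> carrier M\<rbrakk> \<Longrightarrow>
      a \<odot>\<^bsub>M\<^esub> (x \<oplus>\<^bsub>M\<^esub> y) = a \<odot>\<^bsub>M\<^esub> x \<oplus>\<^bsub>M\<^esub> a \<odot>\<^bsub>M\<^esub> y"
    and lsmult_assoc: "\<lbrakk>a \<in> carrier A; b \<in> carrier A; x \<in> carrier M\<rbrakk> \<Longrightarrow>
      (a \<otimes>\<^bsub>A\<^esub> b) \<odot>\<^bsub>M\<^esub> x = a \<odot>\<^bsub>M\<^esub> (b \<odot>\<^bsub>M\<^esub> x)"
    and lsmult_one: "x \<in> carrier M \<Longrightarrow> \<one>\<^bsub>A\<^esub> \<odot>\<^bsub>M\<^esub> x = x"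

definition opp :: "('a, 'k) ring_scheme \<Rightarrow> ('a, 'k) ring_scheme" where
  "opp A = A\<lparr>mult := \<lambda>x y. y \<otimes>\<^bsub>A\<^esub> x\<rparr>"

lemma opp_opp: "opp (opp A) = A"
  by (simp add: opp_def)

definition regular_module :: "('a, 'k) ring_scheme \<Rightarrow> ('a, 'a) module" where
  "regular_module A = \<lparr>carrier = carrier A, mult = undefined, one = undefined,
     zero = \<zero>\<^bsub>A\<^esub>, add = add A, smult = mult A\<rparr>"

definition quot_module :: "('a, 'm) module \<Rightarrow> 'm set \<Rightarrow> ('a, 'm set) module" where
  "quot_module M N = \<lparr>carrier = a_rcosets\<^bsub>M\<^esub> N, mult = undefined, one = undefined,
     zero = N, add = set_add M,
     smult = \<lambda>a X. \<Union>x\<in>X. N +>\<^bsub>M\<^esub> (a \<odot>\<^bsub>M\<^esub> x)\<rparr>"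

text \<open>Homomorphisms are extensional, so that equality of homomorphisms is equality in HOL.\<close>

definition mod_hom :: "('a, 'k) ring_scheme \<Rightarrow> ('a, 'm) module \<Rightarrow> ('a, 'n) module \<Rightarrow> ('m \<Rightarrow> 'n) set"
  where "mod_hom A M N = {f \<in> carrier M \<rightarrow>\<^sub>E carrier N.
     (\<forall>x\<in>carrier M. \<forall>y\<in>carrier M. f (x \<oplus>\<^bsub>M\<^esub> y) = f x \<oplus>\<^bsub>N\<^esub> f y) \<and>
     (\<forall>a\<in>carrier A. \<forall>x\<in>carrier M. f (a \<odot>\<^bsub>M\<^esub> x) = a \<odot>\<^bsub>N\<^esub> f x)}"

definition mod_iso :: "('a, 'k) ring_scheme \<Rightarrow> ('a, 'm) module \<Rightarrow> ('a, 'n) module \<Rightarrow> bool" where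
  "mod_iso A M N \<longleftrightarrow> (\<exists>f\<in>mod_hom A M N. bij_betw f (carrier M) (carrier N))"

definition submod_span :: "('a, 'k) ring_scheme \<Rightarrow> ('a, 'm) module \<Rightarrow> 'm set \<Rightarrow> 'm set" where
  "submod_span A M S = \<Inter>{N. submodule N A M \<and> S \<subseteq> N}"

definition fg_module :: "('a, 'k) ring_scheme \<Rightarrow> ('a, 'm) module \<Rightarrow> bool" where
  "fg_module A M \<longleftrightarrow> left_module A M \<and>
     (\<exists>S. finite S \<and> S \<subseteq> carrier M \<and> submod_span A M S = carrier M)"

definition simple_module :: "('a, 'k) ring_scheme \<Rightarrow> ('a, 'm) module \<Rightarrow> bool" where
  "simple_module A M \<longleftrightarrow> carrier M \<noteq> {\<zero>\<^bsub>M\<^esub>} \<and>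
     (\<forall>N. submodule N A M \<longrightarrow> N = {\<zero>\<^bsub>M\<^esub>} \<or> N = carrier M)"

definition composition_series ::
    "('a, 'k) ring_scheme \<Rightarrow> ('a, 'm) module \<Rightarrow> nat \<Rightarrow> (nat \<Rightarrow> 'm set) \<Rightarrow> bool" where
  "composition_series A M n N \<longleftrightarrow> N 0 = {\<zero>\<^bsub>M\<^esub>} \<and> N n = carrier M \<and>
     (\<forall>i\<le>n. submodule (N i) A M) \<and>
     (\<forall>i<n. N i \<subseteq> N (Suc i) \<and> simple_module A (quot_module (M\<lparr>carrier := N (Suc i)\<rparr>) (N i)))"

text \<open>By Jordan--Hoelder all composition series of a module have the same number of factors, so the
  LEAST operator only names it. Finitely generated modules over an artin algebra have one.\<close>

definition comp_length :: "('a, 'k) ring_scheme \<Rightarrow> ('a, 'm) module \<Rightarrow> nat" where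
  "comp_length A M = (LEAST n. \<exists>N. composition_series A M n N)"

definition maximal_submodule :: "('a, 'k) ring_scheme \<Rightarrow> ('a, 'm) module \<Rightarrow> 'm set \<Rightarrow> bool" where
  "maximal_submodule A M N \<longleftrightarrow> submodule N A M \<and> N \<noteq> carrier M \<and>
     (\<forall>L. submodule L A M \<and> N \<subseteq> L \<longrightarrow> L = N \<or> L = carrier M)"

definition rad :: "('a, 'k) ring_scheme \<Rightarrow> ('a, 'm) module \<Rightarrow> 'm set" where
  "rad A M = carrier M \<inter> \<Inter>{N. maximal_submodule A M N}"

definition module_top :: "('a, 'k) ring_scheme \<Rightarrow> ('a, 'm) module \<Rightarrow> ('a, 'm set) module" where
  "module_top A M = quot_module M (rad A M)"

definition soc :: "('a, 'k) ring_scheme \<Rightarrow> ('a, 'm) module \<Rightarrow> 'm set" where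
  "soc A M = submod_span A M (\<Union>{S. submodule S A M \<and> simple_module A (M\<lparr>carrier := S\<rparr>)})"

definition jacobson_radical :: "('a, 'k) ring_scheme \<Rightarrow> 'a set" where
  "jacobson_radical A = rad A (regular_module A)"

primrec ideal_power :: "('a, 'k) ring_scheme \<Rightarrow> 'a set \<Rightarrow> nat \<Rightarrow> 'a set" where
  "ideal_power A I 0 = carrier A"
| "ideal_power A I (Suc n) = ideal_prod A I (ideal_power A I n)"

definition ideal_times_module :: "('a, 'k) ring_scheme \<Rightarrow> 'a set \<Rightarrow> ('a, 'm) module \<Rightarrow> 'm set" where
  "ideal_times_module A I M = submod_span A M {a \<odot>\<^bsub>M\<^esub> x | a x. a \<in> I \<and> x \<in> carrier M}"

definition loewy_length :: "('a, 'k) ring_scheme \<Rightarrow> ('a, 'm) module \<Rightarrow> nat" where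
  "loewy_length A M =
     (LEAST n. ideal_times_module A (ideal_power A (jacobson_radical A) n) M = {\<zero>\<^bsub>M\<^esub>})"

text \<open>M is the internal direct sum of its submodules N 1, ..., N s; for s = 0 this says M = 0.\<close>

definition internal_direct_sum ::
    "('a, 'k) ring_scheme \<Rightarrow> ('a, 'm) module \<Rightarrow> nat \<Rightarrow> (nat \<Rightarrow> 'm set) \<Rightarrow> bool" where
  "internal_direct_sum A M s N \<longleftrightarrow> (\<forall>i\<in>{1..s}. submodule (N i) A M) \<and>
     (\<forall>x\<in>carrier M. \<exists>!f. f \<in> (\<Pi>\<^sub>E i\<in>{1..s}. N i) \<and> x = finsum M f {1..s})"

definition indecomposable :: "('a, 'k) ring_scheme \<Rightarrow> ('a, 'm) module \<Rightarrow> bool" where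
  "indecomposable A M \<longleftrightarrow> carrier M \<noteq> {\<zero>\<^bsub>M\<^esub>} \<and>
     (\<forall>X Y. submodule X A M \<and> submodule Y A M \<and> X \<inter> Y = {\<zero>\<^bsub>M\<^esub>} \<and> X <+>\<^bsub>M\<^esub> Y = carrier M
        \<longrightarrow> X = {\<zero>\<^bsub>M\<^esub>} \<or> Y = {\<zero>\<^bsub>M\<^esub>})"

definition primitive_idempotent :: "('a, 'k) ring_scheme \<Rightarrow> 'a \<Rightarrow> bool" where
  "primitive_idempotent A e \<longleftrightarrow> e \<in> carrier A \<and> e \<otimes>\<^bsub>A\<^esub> e = e \<and> e \<noteq> \<zero>\<^bsub>A\<^esub> \<and>
     (\<forall>f\<in>carrier A. \<forall>g\<in>carrier A.
        f \<otimes>\<^bsub>A\<^esub> f = f \<and> g \<otimes>\<^bsub>A\<^esub> g = g \<and> f \<otimes>\<^bsub>A\<^esub> g = \<zero>\<^bsub>A\<^esub> \<and> g \<otimes>\<^bsub>A\<^esub> f = \<zero>\<^bsub>A\<^esub> \<and> e = f \<oplus>\<^bsub>A\<^esub> g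
        \<longrightarrow> f = \<zero>\<^bsub>A\<^esub> \<or> g = \<zero>\<^bsub>A\<^esub>)"

text \<open>For a two-sided ideal N: the left module Ae/Ne and the right module eA/eN, the latter as a
  module over the opposite ring. The multiplicative cosets are Ae, Ne, eA and eN.\<close>

definition left_factor :: "('a, 'k) ring_scheme \<Rightarrow> 'a \<Rightarrow> 'a set \<Rightarrow> ('a, 'a set) module" where
  "left_factor A e N =
     quot_module ((regular_module A)\<lparr>carrier := carrier A #>\<^bsub>A\<^esub> e\<rparr>) (N #>\<^bsub>A\<^esub> e)"

definition right_factor :: "('a, 'k) ring_scheme \<Rightarrow> 'a \<Rightarrow> 'a set \<Rightarrow> ('a, 'a set) module" where
  "right_factor A e N =
     quot_module ((regular_module (opp A))\<lparr>carrier := e <#\<^bsub>A\<^esub> carrier A\<rparr>) (e <#\<^bsub>A\<^esub> N)"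

text \<open>Lifting and extension problems are posed in the category of finitely generated modules. Every
  finitely generated module is isomorphic to a quotient of a finite free module, whose elements
  are cosets of functions from an initial segment of the naturals to A; so letting the test modules
  range over records with elements of the following type covers the whole category.\<close>

type_synonym 'a fgtype = "(nat \<Rightarrow> 'a) set"

definition projective :: "('a, 'k) ring_scheme \<Rightarrow> ('a, 'm) module \<Rightarrow> bool" where
  "projective A P \<longleftrightarrow> fg_module A P \<and>
     (\<forall>(X :: ('a, 'a fgtype) module) (Y :: ('a, 'a fgtype) module) g f.
        fg_module A X \<and> fg_module A Y \<and> g \<in> mod_hom A X Y \<and> g ` carrier X = carrier Y \<and>
        f \<in> mod_hom A P Y \<longrightarrow> (\<exists>h\<in>mod_hom A P X. compose (carrier P) g h = f))"

definition injective :: "('a, 'k) ring_scheme \<Rightarrow> ('a, 'm) module \<Rightarrow> bool" where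
  "injective A I \<longleftrightarrow> fg_module A I \<and>
     (\<forall>(X :: ('a, 'a fgtype) module) (Y :: ('a, 'a fgtype) module) g f.
        fg_module A X \<and> fg_module A Y \<and> g \<in> mod_hom A X Y \<and> inj_on g (carrier X) \<and>
        f \<in> mod_hom A X I \<longrightarrow> (\<exists>h\<in>mod_hom A Y I. compose (carrier X) h g = f))"

definition cogenerator :: "('a, 'k) ring_scheme \<Rightarrow> ('a, 'm) module \<Rightarrow> bool" where
  "cogenerator A E \<longleftrightarrow> fg_module A E \<and>
     (\<forall>(X :: ('a, 'a fgtype) module). fg_module A X \<longrightarrow>
        (\<forall>x\<in>carrier X. x \<noteq> \<zero>\<^bsub>X\<^esub> \<longrightarrow> (\<exists>f\<in>mod_hom A X E. f x \<noteq> \<zero>\<^bsub>E\<^esub>)))"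

definition minimal_injective_cogenerator :: "('a, 'k) ring_scheme \<Rightarrow> ('a, 'm) module \<Rightarrow> bool" where
  "minimal_injective_cogenerator A E \<longleftrightarrow> injective A E \<and> cogenerator A E \<and>
     (\<forall>E'. submodule E' A E \<and> injective A (E\<lparr>carrier := E'\<rparr>) \<and> cogenerator A (E\<lparr>carrier := E'\<rparr>)
        \<longrightarrow> E' = carrier E)"

definition artinian :: "('r, 'k) ring_scheme \<Rightarrow> bool" where
  "artinian R \<longleftrightarrow> (\<forall>I :: nat \<Rightarrow> 'r set.
     (\<forall>n. ideal (I n) R) \<and> (\<forall>n. I (Suc n) \<subseteq> I n) \<longrightarrow> (\<exists>n. \<forall>m\<ge>n. I m = I n))"

text \<open>As in the library's locale for commutative algebras, one record carries both the ring A and its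
  R-module structure.\<close>

locale artin_algebra = module R A + A: ring A
  for R :: "('r, 'k) ring_scheme" (structure) and A :: "('r, 'a) module" (structure) +
  assumes artinian_R: "artinian R"
    and fg_over_R: "fg_module R A"
    and smult_mult_left: "\<lbrakk>r \<in> carrier R; x \<in> carrier A; y \<in> carrier A\<rbrakk> \<Longrightarrow>
      r \<odot>\<^bsub>A\<^esub> (x \<otimes>\<^bsub>A\<^esub> y) = (r \<odot>\<^bsub>A\<^esub> x) \<otimes>\<^bsub>A\<^esub> y"
    and smult_mult_right: "\<lbrakk>r \<in> carrier R; x \<in> carrier A; y \<in> carrier A\<rbrakk> \<Longrightarrow>
      r \<odot>\<^bsub>A\<^esub> (x \<otimes>\<^bsub>A\<^esub> y) = x \<otimes>\<^bsub>A\<^esub> (r \<odot>\<^bsub>A\<^esub> y)"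

definition restrict_scalars :: "('r, 'a) module \<Rightarrow> ('a, 'm) module \<Rightarrow> ('r, 'm) module" where
  "restrict_scalars A M = \<lparr>carrier = carrier M, mult = undefined, one = undefined,
     zero = \<zero>\<^bsub>M\<^esub>, add = add M, smult = \<lambda>r x. (r \<odot>\<^bsub>A\<^esub> \<one>\<^bsub>A\<^esub>) \<odot>\<^bsub>M\<^esub> x\<rparr>"

text \<open>The standard duality sends an A-module M to the module of R-homomorphisms from M to E over the
  opposite ring.\<close>

definition std_dual ::
    "('r, 'k) ring_scheme \<Rightarrow> ('r, 'i) module \<Rightarrow> ('r, 'a) module \<Rightarrow> ('a, 'm) module \<Rightarrow> ('a, 'm \<Rightarrow> 'i) module"
  where "std_dual R E A M = \<lparr>carrier = mod_hom R (restrict_scalars A M) E,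
     mult = undefined, one = undefined,
     zero = (\<lambda>x\<in>carrier M. \<zero>\<^bsub>E\<^esub>),
     add = (\<lambda>f g. \<lambda>x\<in>carrier M. f x \<oplus>\<^bsub>E\<^esub> g x),
     smult = (\<lambda>a f. \<lambda>x\<in>carrier M. f (a \<odot>\<^bsub>M\<^esub> x))\<rparr>"

text \<open>The A-homomorphisms from M to A, as a module over the opposite ring.\<close>

definition ring_dual :: "('a, 'k) ring_scheme \<Rightarrow> ('a, 'm) module \<Rightarrow> ('a, 'm \<Rightarrow> 'a) module" where
  "ring_dual A M = \<lparr>carrier = mod_hom A M (regular_module A),
     mult = undefined, one = undefined,
     zero = (\<lambda>x\<in>carrier M. \<zero>\<^bsub>A\<^esub>),
     add = (\<lambda>f g. \<lambda>x\<in>carrier M. f x \<oplus>\<^bsub>A\<^esub> g x),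
     smult = (\<lambda>a f. \<lambda>x\<in>carrier M. f x \<otimes>\<^bsub>A\<^esub> a)\<rparr>"

definition mod_ker :: "('a, 'm) module \<Rightarrow> ('a, 'n) module \<Rightarrow> ('m \<Rightarrow> 'n) \<Rightarrow> 'm set" where
  "mod_ker M N f = {x \<in> carrier M. f x = \<zero>\<^bsub>N\<^esub>}"

definition superfluous :: "('a, 'k) ring_scheme \<Rightarrow> ('a, 'm) module \<Rightarrow> 'm set \<Rightarrow> bool" where
  "superfluous A M K \<longleftrightarrow> submodule K A M \<and>
     (\<forall>L. submodule L A M \<and> K <+>\<^bsub>M\<^esub> L = carrier M \<longrightarrow> L = carrier M)"

definition projective_cover ::
    "('a, 'k) ring_scheme \<Rightarrow> ('a, 'p) module \<Rightarrow> ('a, 'm) module \<Rightarrow> ('p \<Rightarrow> 'm) \<Rightarrow> bool" where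
  "projective_cover A P M g \<longleftrightarrow> projective A P \<and> g \<in> mod_hom A P M \<and>
     g ` carrier P = carrier M \<and> superfluous A P (mod_ker P M g)"

text \<open>A minimal projective presentation: an exact sequence P1, P0, M, 0 with maps f and g such that g
  and the corestriction of f to the kernel of g are projective covers.\<close>

definition min_proj_presentation ::
    "('a, 'k) ring_scheme \<Rightarrow> ('a, 'p1) module \<Rightarrow> ('a, 'p0) module \<Rightarrow> ('p1 \<Rightarrow> 'p0) \<Rightarrow> ('p0 \<Rightarrow> 'm)
      \<Rightarrow> ('a, 'm) module \<Rightarrow> bool" where
  "min_proj_presentation A P1 P0 f g M \<longleftrightarrow> projective_cover A P0 M g \<and>
     projective_cover A P1 (P0\<lparr>carrier := mod_ker P0 M g\<rparr>) f"

text \<open>The transpose is the cokernel of the map that f induces between the duals. Minimal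
  projective presentations are unique up to isomorphism, hence so is the result.\<close>

definition Tr ::
    "('a, 'k) ring_scheme \<Rightarrow> ('a, 'm) module \<Rightarrow> ('a, ('a fgtype \<Rightarrow> 'a) set) module" where
  "Tr A M =
     (let (P1, P0, f, g) =
        (SOME (P1 :: ('a, 'a fgtype) module, P0 :: ('a, 'a fgtype) module, f, g).
           min_proj_presentation A P1 P0 f g M)
      in quot_module (ring_dual A P1) ((\<lambda>h. compose (carrier P1) h f) ` carrier (ring_dual A P0)))"

text \<open>Both translates return modules over A (up to the identity opp_opp).\<close>

definition DTr ::
    "('r, 'k) ring_scheme \<Rightarrow> ('r, 'i) module \<Rightarrow> ('r, 'a) module \<Rightarrow> ('a, 'm) module
      \<Rightarrow> ('a, ('a fgtype \<Rightarrow> 'a) set \<Rightarrow> 'i) module" where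
  "DTr R E A M = std_dual R E (opp A) (Tr A M)"

definition TrD ::
    "('r, 'k) ring_scheme \<Rightarrow> ('r, 'i) module \<Rightarrow> ('r, 'a) module \<Rightarrow> ('a, 'm) module
      \<Rightarrow> ('a, ('a fgtype \<Rightarrow> 'a) set) module" where
  "TrD R E A M = Tr (opp A) (std_dual R E A M)"

end

theory Submission
  imports Defs
begin

text \<open>Both parts follow from one estimate. Let \<open>Q\<close> be a local projective module with nonzero elements
  \<open>u\<^sub>i = e\<^sub>i u\<^sub>i\<close> of \<open>J\<^bsup>c\<^esup> Q\<close>, where \<open>c = c\<^sub>i\<close>, such that the sum \<open>K\<close> of the \<open>A u\<^sub>i\<close> is direct and contained in \<open>rad Q\<close>,
  and let \<open>X = Q/K\<close>. The direct sum of the \<open>A e\<^sub>i\<close> is a projective cover of \<open>K\<close>, so \<open>Tr X\<close> is the cokernel of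
  the map \<open>h \<mapsto> (h u\<^sub>i)\<^sub>i\<close> from \<open>Hom(Q, A)\<close> to the direct sum of the \<open>e\<^sub>i A\<close>. If \<open>h Q \<subseteq> J\<close> then \<open>h u\<^sub>i \<in> J\<^bsup>c+1\<^esup>\<close>; otherwise
  \<open>h\<close> generates \<open>Hom(Q, A)\<close>, because \<open>Q\<close> is local. So the image of this map in the direct sum of the
  \<open>e\<^sub>i A / e\<^sub>i J\<^bsup>c+1\<^esup>\<close> has length at most one.

  For part (1) take \<open>Q = P\<close> and for \<open>u\<^sub>i\<close> a generator of the socle of \<open>M\<^sub>i\<close>. For part (2) take \<open>Q = D I\<close> over the
  opposite ring and for \<open>u\<^sub>i\<close> a functional on \<open>I\<close> that factors through the top of \<open>N\<^sub>i\<close>; it lies in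
  \<open>J\<^bsup>c\<^esup> Q\<close> because an element of \<open>I\<close> killed by \<open>J\<^bsup>c\<^esup>\<close> maps to the radical of \<open>N\<^sub>i\<close>.\<close>

section \<open>Modules and homomorphisms\<close>

text \<open>\<open>Tr\<close> chooses its presentation by \<open>SOME\<close>, so the estimate is
  needed for every minimal projective presentation of \<open>X\<close>. An arbitrary one is compared
  with the model given by the \<open>u\<close> (\<open>presentation_generators\<close>), and the
  model, copied to the type over which the choice ranges, shows that a presentation exists. Lengths
  are compared by one inequality, \<open>strict_le_wcov\<close>: a strict chain is no longer than a
  chain of steps with nothing in between. Such steps may be trivial, so they survive annihilators
  and sums; the loss of 1 in the estimate is one of them. Each summand is at least
  \<open>c i + 1\<close> because the powers \<open>e J^m\<close> drop strictly from
  \<open>m = 0\<close> to \<open>m = c i + 1\<close>. The second part needs every submodule of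
  \<open>D I\<close> to be an annihilator. This rests on minimality of \<open>E\<close>: isomorphic
  simple submodules of \<open>E\<close> coincide, so annihilation turns a step into a step. All
  finiteness comes from \<open>artinian_fin\<close>, which derives finite length from the descending
  chain condition on the ideals of \<open>R\<close>.\<close>

context left_module
begin

lemma smult_l_zero: "x \<in> carrier M \<Longrightarrow> \<zero>\<^bsub>A\<^esub> \<odot>\<^bsub>M\<^esub> x = \<zero>\<^bsub>M\<^esub>"
  by (metis A.r_zero A.zero_closed M.add.l_cancel_one lsmult_closed lsmult_l_distr)

lemma smult_r_zero: "a \<in> carrier A \<Longrightarrow> a \<odot>\<^bsub>M\<^esub> \<zero>\<^bsub>M\<^esub> = \<zero>\<^bsub>M\<^esub>"
  by (metis M.r_zero M.zero_closed M.add.l_cancel_one lsmult_closed lsmult_r_distr)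

lemma smult_l_minus: "a \<in> carrier A \<Longrightarrow> x \<in> carrier M \<Longrightarrow> (\<ominus>\<^bsub>A\<^esub> a) \<odot>\<^bsub>M\<^esub> x = \<ominus>\<^bsub>M\<^esub> (a \<odot>\<^bsub>M\<^esub> x)"
  by (metis A.a_inv_closed A.l_neg M.minus_equality lsmult_closed lsmult_l_distr smult_l_zero)

lemma smult_r_minus: "a \<in> carrier A \<Longrightarrow> x \<in> carrier M \<Longrightarrow> a \<odot>\<^bsub>M\<^esub> (\<ominus>\<^bsub>M\<^esub> x) = \<ominus>\<^bsub>M\<^esub> (a \<odot>\<^bsub>M\<^esub> x)"
  by (metis M.a_inv_closed M.l_neg M.minus_equality lsmult_closed lsmult_r_distr smult_r_zero)

text \<open>Negation is multiplication by \<open>- 1\<close>, so closure under it follows from the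
  scalar condition. Submodules are checked in this form from here on.\<close>

lemma submodule_iff:
  "submodule H A M \<longleftrightarrow> H \<subseteq> carrier M \<and> \<zero>\<^bsub>M\<^esub> \<in> H \<and> (\<forall>x\<in>H. \<forall>y\<in>H. x \<oplus>\<^bsub>M\<^esub> y \<in> H) \<and>
     (\<forall>a\<in>carrier A. \<forall>x\<in>H. a \<odot>\<^bsub>M\<^esub> x \<in> H)"
proof
  assume "submodule H A M"
  then interpret S: submodule H A M .
  show "H \<subseteq> carrier M \<and> \<zero>\<^bsub>M\<^esub> \<in> H \<and> (\<forall>x\<in>H. \<forall>y\<in>H. x \<oplus>\<^bsub>M\<^esub> y \<in> H) \<and>
     (\<forall>a\<in>carrier A. \<forall>x\<in>H. a \<odot>\<^bsub>M\<^esub> x \<in> H)"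
    using S.subset S.one_closed S.m_closed by auto
next
  assume H: "H \<subseteq> carrier M \<and> \<zero>\<^bsub>M\<^esub> \<in> H \<and> (\<forall>x\<in>H. \<forall>y\<in>H. x \<oplus>\<^bsub>M\<^esub> y \<in> H) \<and>
     (\<forall>a\<in>carrier A. \<forall>x\<in>H. a \<odot>\<^bsub>M\<^esub> x \<in> H)"
  have "\<ominus>\<^bsub>M\<^esub> x \<in> H" if "x \<in> H" for x
    using H that smult_l_minus[of "\<one>\<^bsub>A\<^esub>" x] lsmult_one by (metis A.a_inv_closed A.one_closed subsetD)
  then show "submodule H A M"
    using H by (unfold_locales) (auto simp flip: a_inv_def)
qed

lemma sub_carr: "submodule H A M \<Longrightarrow> x \<in> H \<Longrightarrow> x \<in> carrier M"
  and sub_zero: "submodule H A M \<Longrightarrow> \<zero>\<^bsub>M\<^esub> \<in> H"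
  and sub_add: "submodule H A M \<Longrightarrow> x \<in> H \<Longrightarrow> y \<in> H \<Longrightarrow> x \<oplus>\<^bsub>M\<^esub> y \<in> H"
  and sub_smult: "submodule H A M \<Longrightarrow> a \<in> carrier A \<Longrightarrow> x \<in> H \<Longrightarrow> a \<odot>\<^bsub>M\<^esub> x \<in> H"
  by (auto simp: submodule_iff)

lemma sub_neg: "submodule H A M \<Longrightarrow> x \<in> H \<Longrightarrow> \<ominus>\<^bsub>M\<^esub> x \<in> H"
  using smult_l_minus[of "\<one>\<^bsub>A\<^esub>" x] lsmult_one
  by (metis A.a_inv_closed A.one_closed sub_carr sub_smult)

lemma sub_diff: "submodule H A M \<Longrightarrow> x \<in> H \<Longrightarrow> y \<in> H \<Longrightarrow> x \<ominus>\<^bsub>M\<^esub> y \<in> H"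
  by (simp add: a_minus_def sub_add sub_neg)

lemma mdiff_add: "x \<in> carrier M \<Longrightarrow> y \<in> carrier M \<Longrightarrow> (x \<ominus>\<^bsub>M\<^esub> y) \<oplus>\<^bsub>M\<^esub> y = x"
  by (simp add: a_minus_def M.a_assoc M.l_neg)

lemma diff_eq_zero: "x \<in> carrier M \<Longrightarrow> y \<in> carrier M \<Longrightarrow> x \<ominus>\<^bsub>M\<^esub> y = \<zero>\<^bsub>M\<^esub> \<longleftrightarrow> x = y"
  by (metis M.r_neg M.l_zero a_minus_def mdiff_add)

lemma diff_mem_iff: "submodule H A M \<Longrightarrow> y \<in> H \<Longrightarrow> x \<in> carrier M \<Longrightarrow> x \<ominus>\<^bsub>M\<^esub> y \<in> H \<longleftrightarrow> x \<in> H"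
  by (metis mdiff_add sub_add sub_carr sub_diff)

lemma madd_diff: "x \<in> carrier M \<Longrightarrow> y \<in> carrier M \<Longrightarrow> (x \<oplus>\<^bsub>M\<^esub> y) \<ominus>\<^bsub>M\<^esub> y = x"
  by (simp add: a_minus_def M.a_assoc M.r_neg)

lemma add_mem_iff: "submodule H A M \<Longrightarrow> y \<in> H \<Longrightarrow> x \<in> carrier M \<Longrightarrow> x \<oplus>\<^bsub>M\<^esub> y \<in> H \<longleftrightarrow> x \<in> H"
  using madd_diff[of x y] sub_add[of H x y] sub_diff[of H "x \<oplus>\<^bsub>M\<^esub> y" y] sub_carr[of H y] by auto

lemma smult_diff: "a \<in> carrier A \<Longrightarrow> x \<in> carrier M \<Longrightarrow> y \<in> carrier M \<Longrightarrow>
    a \<odot>\<^bsub>M\<^esub> (x \<ominus>\<^bsub>M\<^esub> y) = a \<odot>\<^bsub>M\<^esub> x \<ominus>\<^bsub>M\<^esub> a \<odot>\<^bsub>M\<^esub> y"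
  by (simp add: a_minus_def lsmult_r_distr smult_r_minus)

lemma diff_smult: "a \<in> carrier A \<Longrightarrow> b \<in> carrier A \<Longrightarrow> x \<in> carrier M \<Longrightarrow>
    (a \<ominus>\<^bsub>A\<^esub> b) \<odot>\<^bsub>M\<^esub> x = a \<odot>\<^bsub>M\<^esub> x \<ominus>\<^bsub>M\<^esub> b \<odot>\<^bsub>M\<^esub> x"
  by (simp add: a_minus_def lsmult_l_distr smult_l_minus)

lemma submodule_carrier: "submodule (carrier M) A M"
  by (auto simp: submodule_iff lsmult_closed)

lemma submodule_zero: "submodule {\<zero>\<^bsub>M\<^esub>} A M"
  by (auto simp: submodule_iff smult_r_zero)

lemma submodule_Int: "submodule H A M \<Longrightarrow> submodule K A M \<Longrightarrow> submodule (H \<inter> K) A M"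
  by (auto simp: submodule_iff)

lemma submodule_Inter:
  assumes "S \<noteq> {}" "\<And>X. X \<in> S \<Longrightarrow> submodule X A M" shows "submodule (\<Inter>S) A M"
proof -
  have "\<Inter>S \<subseteq> carrier M" using assms sub_carr by blast
  then show ?thesis using assms by (auto simp: submodule_iff)
qed

lemma mem_set_add: "z \<in> X <+>\<^bsub>M\<^esub> Y \<longleftrightarrow> (\<exists>x\<in>X. \<exists>y\<in>Y. z = x \<oplus>\<^bsub>M\<^esub> y)"
  by (auto simp: set_add_def')

lemma submodule_set_add:
  assumes H: "submodule H A M" and K: "submodule K A M" shows "submodule (H <+>\<^bsub>M\<^esub> K) A M"
  unfolding submodule_iff
proof (intro conjI ballI)
  show "H <+>\<^bsub>M\<^esub> K \<subseteq> carrier M"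
    using sub_carr[OF H] sub_carr[OF K] by (auto simp: mem_set_add)
  show "\<zero>\<^bsub>M\<^esub> \<in> H <+>\<^bsub>M\<^esub> K"
    using sub_zero[OF H] sub_zero[OF K] M.l_zero[OF M.zero_closed] mem_set_add by metis
next
  fix x y assume "x \<in> H <+>\<^bsub>M\<^esub> K" "y \<in> H <+>\<^bsub>M\<^esub> K"
  then obtain h k h' k' where *: "h \<in> H" "h' \<in> H" "k \<in> K" "k' \<in> K"
    "x = h \<oplus>\<^bsub>M\<^esub> k" "y = h' \<oplus>\<^bsub>M\<^esub> k'" by (auto simp: mem_set_add)
  then have "x \<oplus>\<^bsub>M\<^esub> y = (h \<oplus>\<^bsub>M\<^esub> h') \<oplus>\<^bsub>M\<^esub> (k \<oplus>\<^bsub>M\<^esub> k')"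
    using sub_carr[OF H] sub_carr[OF K] by (simp add: M.add.m_ac)
  then show "x \<oplus>\<^bsub>M\<^esub> y \<in> H <+>\<^bsub>M\<^esub> K"
    unfolding mem_set_add using * sub_add[OF H] sub_add[OF K] by blast
next
  fix a x assume a: "a \<in> carrier A" "x \<in> H <+>\<^bsub>M\<^esub> K"
  then obtain h k where *: "h \<in> H" "k \<in> K" "x = h \<oplus>\<^bsub>M\<^esub> k" by (auto simp: mem_set_add)
  then have "a \<odot>\<^bsub>M\<^esub> x = a \<odot>\<^bsub>M\<^esub> h \<oplus>\<^bsub>M\<^esub> a \<odot>\<^bsub>M\<^esub> k"
    using a sub_carr[OF H] sub_carr[OF K] lsmult_r_distr by simp
  then show "a \<odot>\<^bsub>M\<^esub> x \<in> H <+>\<^bsub>M\<^esub> K"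
    unfolding mem_set_add using * sub_smult[OF H a(1)] sub_smult[OF K a(1)] by blast
qed

lemma set_add_upper:
  assumes H: "submodule H A M" and K: "submodule K A M"
  shows "H \<subseteq> H <+>\<^bsub>M\<^esub> K" "K \<subseteq> H <+>\<^bsub>M\<^esub> K"
  using sub_zero[OF H] sub_zero[OF K] sub_carr[OF H] sub_carr[OF K] M.l_zero M.r_zero
  unfolding subset_iff mem_set_add by metis+

lemma set_add_least: "submodule L A M \<Longrightarrow> H \<subseteq> L \<Longrightarrow> K \<subseteq> L \<Longrightarrow> H <+>\<^bsub>M\<^esub> K \<subseteq> L"
  by (auto simp: mem_set_add intro!: sub_add)

definition cyc :: "'m \<Rightarrow> 'm set" where "cyc x = {a \<odot>\<^bsub>M\<^esub> x | a. a \<in> carrier A}"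

lemma mem_cyc: "z \<in> cyc x \<longleftrightarrow> (\<exists>a\<in>carrier A. z = a \<odot>\<^bsub>M\<^esub> x)" by (auto simp: cyc_def)

lemma submodule_cyc: assumes "x \<in> carrier M" shows "submodule (cyc x) A M"
  unfolding submodule_iff
proof (intro conjI ballI)
  show "cyc x \<subseteq> carrier M" using assms lsmult_closed by (auto simp: mem_cyc)
  show "\<zero>\<^bsub>M\<^esub> \<in> cyc x" using smult_l_zero[OF assms] mem_cyc by (metis A.zero_closed)
  show "y \<oplus>\<^bsub>M\<^esub> z \<in> cyc x" if "y \<in> cyc x" "z \<in> cyc x" for y z
    using that assms lsmult_l_distr[of _ _ x] by (auto simp: mem_cyc) (metis A.add.m_closed)
  show "a \<odot>\<^bsub>M\<^esub> z \<in> cyc x" if "a \<in> carrier A" "z \<in> cyc x" for a z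
    using that assms lsmult_assoc[of a _ x] by (auto simp: mem_cyc) (metis A.m_closed)
qed

lemma cyc_self: "x \<in> carrier M \<Longrightarrow> x \<in> cyc x"
  unfolding mem_cyc by (metis A.one_closed lsmult_one)

lemma cyc_least: "submodule H A M \<Longrightarrow> x \<in> H \<Longrightarrow> cyc x \<subseteq> H"
  using sub_smult by (auto simp: mem_cyc)

lemma left_module_sub: assumes H: "submodule H A M" shows "left_module A (M\<lparr>carrier := H\<rparr>)"
proof -
  have "abelian_group (M\<lparr>carrier := H\<rparr>)"
  proof (rule abelian_groupI)
    fix x assume "x \<in> carrier (M\<lparr>carrier := H\<rparr>)"
    then show "\<exists>y\<in>carrier (M\<lparr>carrier := H\<rparr>). y \<oplus>\<^bsub>M\<lparr>carrier := H\<rparr>\<^esub> x = \<zero>\<^bsub>M\<lparr>carrier := H\<rparr>\<^esub>"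
      using sub_neg[OF H] sub_carr[OF H] M.l_neg by (intro bexI[of _ "\<ominus>\<^bsub>M\<^esub> x"]) auto
  qed (use H sub_carr[OF H] in \<open>auto simp: submodule_iff M.add.m_ac\<close>)
  then show ?thesis
    using H sub_carr[OF H] lsmult_l_distr lsmult_r_distr lsmult_assoc lsmult_one sub_smult[OF H]
    by (auto simp: left_module_def left_module_axioms_def A.ring_axioms)
qed

lemma submodule_sub_iff:
  assumes H: "submodule H A M"
  shows "submodule N A (M\<lparr>carrier := H\<rparr>) \<longleftrightarrow> submodule N A M \<and> N \<subseteq> H"
  using sub_carr[OF H] unfolding left_module.submodule_iff[OF left_module_sub[OF H]] submodule_iff
  by auto

lemma finsum_sub:
  assumes H: "submodule H A M" and f: "f \<in> S \<rightarrow> H"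
  shows "finsum (M\<lparr>carrier := H\<rparr>) f S = finsum M f S"
proof (cases "finite S")
  case True
  interpret H: left_module A "M\<lparr>carrier := H\<rparr>" by (rule left_module_sub[OF H])
  from True f show ?thesis
  proof (induction S)
    case (insert x S)
    then have "f \<in> S \<rightarrow> carrier M" "f x \<in> carrier M" using sub_carr[OF H] by auto
    then show ?case using insert by simp
  qed simp
next
  case False
  then show ?thesis by (simp add: finsum_def finprod_def)
qed

lemma sub_finsum:
  assumes H: "submodule H A M" and f: "f \<in> S \<rightarrow> H"
  shows "finsum M f S \<in> H"
proof -
  interpret H: left_module A "M\<lparr>carrier := H\<rparr>" by (rule left_module_sub[OF H])
  show ?thesis using H.M.finsum_closed[of f S] f finsum_sub[OF assms] by simp
qed

lemma finsum_smult:
  assumes "a \<in> carrier A" "f \<in> S \<rightarrow> carrier M"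
  shows "a \<odot>\<^bsub>M\<^esub> finsum M f S = finsum M (\<lambda>i. a \<odot>\<^bsub>M\<^esub> f i) S"
proof (cases "finite S")
  case True
  then show ?thesis using assms(2)
  proof (induction S)
    case (insert x S)
    then have "f \<in> S \<rightarrow> carrier M" "f x \<in> carrier M" "(\<lambda>i. a \<odot>\<^bsub>M\<^esub> f i) \<in> S \<rightarrow> carrier M"
      "a \<odot>\<^bsub>M\<^esub> f x \<in> carrier M"
      using lsmult_closed assms(1) by auto
    then show ?case using insert assms(1) lsmult_r_distr by simp
  qed (simp add: smult_r_zero assms)
qed (simp add: M.finsum_infinite smult_r_zero assms)

text \<open>\<open>X + A y\<close> lies strictly above \<open>X\<close> and inside \<open>Y\<close>,
  so it is \<open>Y\<close>. In this way an element outside the smaller of two neighbouring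
  submodules serves as a generator of the larger one.\<close>

lemma cover_gen:
  assumes "submodule X A M" "submodule Y A M" "X \<subseteq> Y" "y \<in> Y" "y \<notin> X"
    and "\<And>Z. submodule Z A M \<Longrightarrow> X \<subseteq> Z \<Longrightarrow> Z \<subseteq> Y \<Longrightarrow> Z = X \<or> Z = Y"
  shows "X <+>\<^bsub>M\<^esub> cyc y = Y"
proof -
  have y: "y \<in> carrier M" using assms sub_carr by auto
  have "X \<subseteq> X <+>\<^bsub>M\<^esub> cyc y" "y \<in> X <+>\<^bsub>M\<^esub> cyc y"
    using set_add_upper[OF assms(1) submodule_cyc[OF y]] cyc_self[OF y] by auto
  moreover have "X <+>\<^bsub>M\<^esub> cyc y \<subseteq> Y" using set_add_least cyc_least assms by metis
  ultimately show ?thesis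
    using assms(5) assms(6)[OF submodule_set_add[OF assms(1) submodule_cyc[OF y]]] by auto
qed

end

lemma mod_homI:
  assumes "\<And>x. x \<in> carrier M \<Longrightarrow> f x \<in> carrier N"
    "\<And>x y. x \<in> carrier M \<Longrightarrow> y \<in> carrier M \<Longrightarrow> f (x \<oplus>\<^bsub>M\<^esub> y) = f x \<oplus>\<^bsub>N\<^esub> f y"
    "\<And>a x. a \<in> carrier A \<Longrightarrow> x \<in> carrier M \<Longrightarrow> f (a \<odot>\<^bsub>M\<^esub> x) = a \<odot>\<^bsub>N\<^esub> f x"
    "f \<in> extensional (carrier M)"
  shows "f \<in> mod_hom A M N"
  using assms by (auto simp: mod_hom_def PiE_def)

lemma mod_hom_restrictI:
  assumes M: "left_module A M"
    and "\<And>x. x \<in> carrier M \<Longrightarrow> f x \<in> carrier N"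
    "\<And>x y. x \<in> carrier M \<Longrightarrow> y \<in> carrier M \<Longrightarrow> f (x \<oplus>\<^bsub>M\<^esub> y) = f x \<oplus>\<^bsub>N\<^esub> f y"
    "\<And>a x. a \<in> carrier A \<Longrightarrow> x \<in> carrier M \<Longrightarrow> f (a \<odot>\<^bsub>M\<^esub> x) = a \<odot>\<^bsub>N\<^esub> f x"
  shows "restrict f (carrier M) \<in> mod_hom A M N"
proof -
  interpret left_module A M by (rule M)
  show ?thesis using assms(2-) by (auto intro!: mod_homI simp: lsmult_closed)
qed

lemma mod_homD:
  assumes "f \<in> mod_hom A M N"
  shows "x \<in> carrier M \<Longrightarrow> f x \<in> carrier N"
    "x \<in> carrier M \<Longrightarrow> y \<in> carrier M \<Longrightarrow> f (x \<oplus>\<^bsub>M\<^esub> y) = f x \<oplus>\<^bsub>N\<^esub> f y"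
    "a \<in> carrier A \<Longrightarrow> x \<in> carrier M \<Longrightarrow> f (a \<odot>\<^bsub>M\<^esub> x) = a \<odot>\<^bsub>N\<^esub> f x"
    "f \<in> extensional (carrier M)"
  using assms by (auto simp: mod_hom_def PiE_def)

lemma mod_hom_eqI:
  assumes "f \<in> mod_hom A M N" "g \<in> mod_hom A M N" "\<And>x. x \<in> carrier M \<Longrightarrow> f x = g x"
  shows "f = g"
  using assms mod_homD(4) extensionalityI by metis

locale module_hom = M: left_module A M + N: left_module A N
  for A :: "('a, 'k) ring_scheme" and M :: "('a, 'm) module" and N :: "('a, 'n) module" +
  fixes f assumes hom: "f \<in> mod_hom A M N"
begin

lemmas closed = mod_homD(1)[OF hom] and add = mod_homD(2)[OF hom] and smult = mod_homD(3)[OF hom]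
  and ext = mod_homD(4)[OF hom]

lemma zero: "f \<zero>\<^bsub>M\<^esub> = \<zero>\<^bsub>N\<^esub>"
  by (metis M.M.r_zero M.M.zero_closed N.M.add.l_cancel_one add closed)

lemma neg: "x \<in> carrier M \<Longrightarrow> f (\<ominus>\<^bsub>M\<^esub> x) = \<ominus>\<^bsub>N\<^esub> f x"
  by (metis M.M.a_inv_closed M.M.l_neg N.M.minus_equality add closed zero)

lemma diff: "x \<in> carrier M \<Longrightarrow> y \<in> carrier M \<Longrightarrow> f (x \<ominus>\<^bsub>M\<^esub> y) = f x \<ominus>\<^bsub>N\<^esub> f y"
  by (simp add: a_minus_def add neg)

lemma finsum: "g \<in> S \<rightarrow> carrier M \<Longrightarrow> f (finsum M g S) = finsum N (\<lambda>i. f (g i)) S"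
proof (induction S rule: infinite_finite_induct)
  case (insert x S)
  then have "g \<in> S \<rightarrow> carrier M" "g x \<in> carrier M" "(\<lambda>i. f (g i)) \<in> S \<rightarrow> carrier N"
    "f (g x) \<in> carrier N" using closed by auto
  then show ?case using insert add by simp
qed (simp_all add: M.M.finsum_infinite N.M.finsum_infinite zero)

lemma sub_image: assumes H: "submodule H A M" shows "submodule (f ` H) A N"
  unfolding N.submodule_iff
proof (intro conjI ballI)
  show "f ` H \<subseteq> carrier N" using closed M.sub_carr[OF H] by auto
  show "\<zero>\<^bsub>N\<^esub> \<in> f ` H" using zero M.sub_zero[OF H] by (metis imageI)
  show "x \<oplus>\<^bsub>N\<^esub> y \<in> f ` H" if "x \<in> f ` H" "y \<in> f ` H" for x y
    using that add M.sub_carr[OF H] M.sub_add[OF H] by (smt (verit) imageE imageI)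
  show "a \<odot>\<^bsub>N\<^esub> x \<in> f ` H" if "a \<in> carrier A" "x \<in> f ` H" for a x
    using that smult M.sub_carr[OF H] M.sub_smult[OF H] by (smt (verit) imageE imageI)
qed

text \<open>Cut down to the carrier, because an extensional map takes the value
  \<open>undefined\<close> elsewhere and that value may lie in \<open>K\<close>.\<close>

definition pre :: "'n set \<Rightarrow> 'm set" where "pre K = {x \<in> carrier M. f x \<in> K}"

lemma sub_pre: assumes K: "submodule K A N" shows "submodule (pre K) A M"
  unfolding M.submodule_iff pre_def
  using closed add smult zero N.sub_zero[OF K] N.sub_add[OF K] N.sub_smult[OF K] M.lsmult_closed
  by auto

lemma sub_ker: "submodule (mod_ker M N f) A M"
  using sub_pre[OF N.submodule_zero] by (simp add: pre_def mod_ker_def)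

lemma image_pre: 
  assumes "f ` carrier M = carrier N" "K \<subseteq> carrier N" shows "f ` pre K = K"
proof (intro equalityI subsetI)
  fix y assume y: "y \<in> K"
  then have "y \<in> f ` carrier M" using assms by auto
  then show "y \<in> f ` pre K" using y by (auto simp: pre_def)
qed (auto simp: pre_def)

text \<open>Together with \<open>image_pre\<close> this is the correspondence theorem: elements with
  the same image differ by an element of the kernel, which \<open>H\<close> contains. Chains move
  along surjections by it in both directions.\<close>

lemma pre_image:
  assumes H: "submodule H A M" and k: "mod_ker M N f \<subseteq> H"
  shows "pre (f ` H) = H"
proof
  show "pre (f ` H) \<subseteq> H"
  proof
    fix x assume "x \<in> pre (f ` H)"
    then obtain h where x: "x \<in> carrier M" "h \<in> H" "f x = f h" by (auto simp: pre_def)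
    then have "x \<ominus>\<^bsub>M\<^esub> h \<in> H"
      using k diff M.sub_carr[OF H] closed[of x] N.diff_eq_zero by (auto simp: mod_ker_def)
    then show "x \<in> H" using x M.diff_mem_iff[OF H] by auto
  qed
qed (use M.sub_carr[OF H] in \<open>auto simp: pre_def\<close>)

lemma ker_pre: "submodule K A N \<Longrightarrow> mod_ker M N f \<subseteq> pre K"
  using N.sub_zero by (auto simp: mod_ker_def pre_def)

lemma inj_iff: "inj_on f (carrier M) \<longleftrightarrow> mod_ker M N f = {\<zero>\<^bsub>M\<^esub>}"
proof
  assume "inj_on f (carrier M)"
  then show "mod_ker M N f = {\<zero>\<^bsub>M\<^esub>}"
    using zero by (auto simp: mod_ker_def) (metis M.M.zero_closed inj_on_contraD)
next
  assume k: "mod_ker M N f = {\<zero>\<^bsub>M\<^esub>}"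
  show "inj_on f (carrier M)"
  proof
    fix x y assume "x \<in> carrier M" "y \<in> carrier M" "f x = f y"
    moreover from this have "x \<ominus>\<^bsub>M\<^esub> y \<in> mod_ker M N f"
      using diff closed N.diff_eq_zero by (auto simp: mod_ker_def)
    ultimately show "x = y" using k M.diff_eq_zero by auto
  qed
qed

lemma inverse:
  assumes "bij_betw f (carrier M) (carrier N)"
  shows "restrict (inv_into (carrier M) f) (carrier N) \<in> mod_hom A N M"
proof (rule mod_hom_restrictI[OF N.left_module_axioms])
  note i = bij_betw_inv_into_right[OF assms] bij_betw_inv_into_left[OF assms]
  show c: "inv_into (carrier M) f x \<in> carrier M" if "x \<in> carrier N" for x
    using that assms by (metis bij_betw_imp_surj_on inv_into_into)
  show "inv_into (carrier M) f (x \<oplus>\<^bsub>N\<^esub> y) = inv_into (carrier M) f x \<oplus>\<^bsub>M\<^esub> inv_into (carrier M) f y"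
    if "x \<in> carrier N" "y \<in> carrier N" for x y
    using that i(2)[of "inv_into (carrier M) f x \<oplus>\<^bsub>M\<^esub> inv_into (carrier M) f y"] c[of x] c[of y]
    by (simp add: i(1) add)
  show "inv_into (carrier M) f (a \<odot>\<^bsub>N\<^esub> x) = a \<odot>\<^bsub>M\<^esub> inv_into (carrier M) f x"
    if "a \<in> carrier A" "x \<in> carrier N" for a x
    using that i(2)[of "a \<odot>\<^bsub>M\<^esub> inv_into (carrier M) f x"] c[of x]
    by (simp add: i(1) smult M.lsmult_closed)
qed

end

lemma mod_hom_comp:
  assumes "left_module A M" "f \<in> mod_hom A M N" "g \<in> mod_hom A N K"
  shows "compose (carrier M) g f \<in> mod_hom A M K"
  unfolding compose_def
  by (rule mod_hom_restrictI[OF assms(1)]) (simp_all add: mod_homD[OF assms(2)] mod_homD[OF assms(3)])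

lemma mod_hom_id: "left_module A M \<Longrightarrow> restrict id (carrier M) \<in> mod_hom A M M"
  by (rule mod_hom_restrictI) auto

lemma mod_hom_sub:
  assumes "left_module A M" "submodule H A M" "f \<in> mod_hom A M N"
  shows "restrict f H \<in> mod_hom A (M\<lparr>carrier := H\<rparr>) N"
  using mod_hom_restrictI[OF left_module.left_module_sub[OF assms(1,2)], of f N]
    left_module.sub_carr[OF assms(1,2)] mod_homD[OF assms(3)] by simp

lemma mod_hom_carrier_mono:
  assumes "f \<in> mod_hom A M (N\<lparr>carrier := H\<rparr>)" "H \<subseteq> carrier N" shows "f \<in> mod_hom A M N"
  using assms by (auto simp: mod_hom_def PiE_def)

lemma mod_hom_carrier_restrict:
  assumes "f \<in> mod_hom A M N" "f ` carrier M \<subseteq> H" shows "f \<in> mod_hom A M (N\<lparr>carrier := H\<rparr>)"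
  using assms by (auto simp: mod_hom_def PiE_def)

section \<open>Quotient modules\<close>

context left_module
begin

lemma diff_self: "x \<in> carrier M \<Longrightarrow> x \<ominus>\<^bsub>M\<^esub> x = \<zero>\<^bsub>M\<^esub>"
  by (simp add: a_minus_def M.r_neg)

lemma mdiff_zero: "x \<in> carrier M \<Longrightarrow> x \<ominus>\<^bsub>M\<^esub> \<zero>\<^bsub>M\<^esub> = x"
  using mdiff_add[of x "\<zero>\<^bsub>M\<^esub>"] by simp

lemma mem_coset: "z \<in> N +>\<^bsub>M\<^esub> x \<longleftrightarrow> (\<exists>n\<in>N. z = n \<oplus>\<^bsub>M\<^esub> x)"
  by (auto simp: a_r_coset_def')

context
  fixes N assumes N: "submodule N A M"
begin

lemma mem_coset_iff: "x \<in> carrier M \<Longrightarrow> z \<in> N +>\<^bsub>M\<^esub> x \<longleftrightarrow> z \<in> carrier M \<and> z \<ominus>\<^bsub>M\<^esub> x \<in> N"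
  using sub_carr[OF N] mdiff_add[of z x] madd_diff[of _ x] by (force simp: mem_coset)

lemma coset_eq_iff:
  assumes "x \<in> carrier M" "y \<in> carrier M"
  shows "N +>\<^bsub>M\<^esub> x = N +>\<^bsub>M\<^esub> y \<longleftrightarrow> x \<ominus>\<^bsub>M\<^esub> y \<in> N"
proof
  assume "N +>\<^bsub>M\<^esub> x = N +>\<^bsub>M\<^esub> y"
  moreover have "x \<in> N +>\<^bsub>M\<^esub> x" using mem_coset_iff[of x x] assms sub_zero[OF N] diff_self by simp
  ultimately show "x \<ominus>\<^bsub>M\<^esub> y \<in> N" using mem_coset_iff assms by simp
next
  assume xy: "x \<ominus>\<^bsub>M\<^esub> y \<in> N"
  have eq: "z \<ominus>\<^bsub>M\<^esub> y = (z \<ominus>\<^bsub>M\<^esub> x) \<oplus>\<^bsub>M\<^esub> (x \<ominus>\<^bsub>M\<^esub> y)" if "z \<in> carrier M" for z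
    using assms that by (simp add: a_minus_def M.a_assoc M.r_neg1)
  have "z \<ominus>\<^bsub>M\<^esub> y \<in> N \<longleftrightarrow> z \<ominus>\<^bsub>M\<^esub> x \<in> N" if "z \<in> carrier M" for z
    using eq[OF that] that assms add_mem_iff[OF N xy, of "z \<ominus>\<^bsub>M\<^esub> x"] by simp
  then show "N +>\<^bsub>M\<^esub> x = N +>\<^bsub>M\<^esub> y"
    using assms by (intro Set.set_eqI) (simp add: mem_coset_iff cong: conj_cong)
qed

lemma coset_add:
  assumes "x \<in> carrier M" "y \<in> carrier M"
  shows "(N +>\<^bsub>M\<^esub> x) <+>\<^bsub>M\<^esub> (N +>\<^bsub>M\<^esub> y) = N +>\<^bsub>M\<^esub> (x \<oplus>\<^bsub>M\<^esub> y)"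
proof (intro Set.set_eqI iffI)
  fix z assume "z \<in> (N +>\<^bsub>M\<^esub> x) <+>\<^bsub>M\<^esub> (N +>\<^bsub>M\<^esub> y)"
  then obtain n n' where "n \<in> N" "n' \<in> N" "z = (n \<oplus>\<^bsub>M\<^esub> x) \<oplus>\<^bsub>M\<^esub> (n' \<oplus>\<^bsub>M\<^esub> y)"
    by (auto simp: mem_set_add mem_coset)
  then have "z = (n \<oplus>\<^bsub>M\<^esub> n') \<oplus>\<^bsub>M\<^esub> (x \<oplus>\<^bsub>M\<^esub> y)" "n \<oplus>\<^bsub>M\<^esub> n' \<in> N"
    using assms sub_carr[OF N] sub_add[OF N] by (auto simp: M.add.m_ac)
  then show "z \<in> N +>\<^bsub>M\<^esub> (x \<oplus>\<^bsub>M\<^esub> y)" by (auto simp: mem_coset)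
next
  fix z assume "z \<in> N +>\<^bsub>M\<^esub> (x \<oplus>\<^bsub>M\<^esub> y)"
  then obtain n where n: "n \<in> N" "z = n \<oplus>\<^bsub>M\<^esub> (x \<oplus>\<^bsub>M\<^esub> y)" by (auto simp: mem_coset)
  then have "z = (n \<oplus>\<^bsub>M\<^esub> x) \<oplus>\<^bsub>M\<^esub> (\<zero>\<^bsub>M\<^esub> \<oplus>\<^bsub>M\<^esub> y)"
    using assms sub_carr[OF N] by (simp add: M.add.m_ac)
  moreover have "n \<oplus>\<^bsub>M\<^esub> x \<in> N +>\<^bsub>M\<^esub> x" "\<zero>\<^bsub>M\<^esub> \<oplus>\<^bsub>M\<^esub> y \<in> N +>\<^bsub>M\<^esub> y"
    using n sub_zero[OF N] mem_coset by blast+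
  ultimately show "z \<in> (N +>\<^bsub>M\<^esub> x) <+>\<^bsub>M\<^esub> (N +>\<^bsub>M\<^esub> y)"
    unfolding mem_set_add by blast
qed

lemma coset_smult:
  assumes "a \<in> carrier A" "x \<in> carrier M"
  shows "(\<Union>y\<in>N +>\<^bsub>M\<^esub> x. N +>\<^bsub>M\<^esub> (a \<odot>\<^bsub>M\<^esub> y)) = N +>\<^bsub>M\<^esub> (a \<odot>\<^bsub>M\<^esub> x)"
proof -
  have "N +>\<^bsub>M\<^esub> (a \<odot>\<^bsub>M\<^esub> y) = N +>\<^bsub>M\<^esub> (a \<odot>\<^bsub>M\<^esub> x)" if "y \<in> N +>\<^bsub>M\<^esub> x" for y
    using that assms sub_smult[OF N, of a "y \<ominus>\<^bsub>M\<^esub> x"]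
    by (simp add: mem_coset_iff coset_eq_iff lsmult_closed smult_diff)
  moreover have "x \<in> N +>\<^bsub>M\<^esub> x"
    using mem_coset_iff[of x x] assms sub_zero[OF N] diff_self by simp
  ultimately show ?thesis by blast
qed

lemma coset_zero: "N +>\<^bsub>M\<^esub> \<zero>\<^bsub>M\<^esub> = N"
  using sub_carr[OF N] by (force simp: mem_coset)

lemma quot_carrier: "carrier (quot_module M N) = (\<lambda>x. N +>\<^bsub>M\<^esub> x) ` carrier M"
  by (auto simp: quot_module_def A_RCOSETS_def')

lemma quot_ops:
  "x \<in> carrier M \<Longrightarrow> y \<in> carrier M \<Longrightarrow> (N +>\<^bsub>M\<^esub> x) \<oplus>\<^bsub>quot_module M N\<^esub> (N +>\<^bsub>M\<^esub> y) = N +>\<^bsub>M\<^esub> (x \<oplus>\<^bsub>M\<^esub> y)"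
  "\<zero>\<^bsub>quot_module M N\<^esub> = N +>\<^bsub>M\<^esub> \<zero>\<^bsub>M\<^esub>"
  "a \<in> carrier A \<Longrightarrow> x \<in> carrier M \<Longrightarrow> a \<odot>\<^bsub>quot_module M N\<^esub> (N +>\<^bsub>M\<^esub> x) = N +>\<^bsub>M\<^esub> (a \<odot>\<^bsub>M\<^esub> x)"
  by (simp_all add: quot_module_def coset_add coset_zero coset_smult)

lemma left_module_quot: "left_module A (quot_module M N)"
proof -
  let ?c = "\<lambda>x. N +>\<^bsub>M\<^esub> x"
  have "abelian_group (quot_module M N)"
  proof (rule abelian_groupI)
    fix X assume "X \<in> carrier (quot_module M N)"
    then obtain x where x: "x \<in> carrier M" "X = ?c x" by (auto simp: quot_carrier)
    then show "\<exists>Y\<in>carrier (quot_module M N). Y \<oplus>\<^bsub>quot_module M N\<^esub> X = \<zero>\<^bsub>quot_module M N\<^esub>"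
      by (intro bexI[of _ "?c (\<ominus>\<^bsub>M\<^esub> x)"]) (auto simp: quot_ops quot_carrier M.l_neg)
  qed (auto simp: quot_carrier quot_ops M.add.m_ac)
  then show ?thesis
    unfolding left_module_def left_module_axioms_def
    by (auto simp: quot_carrier quot_ops A.ring_axioms lsmult_closed lsmult_l_distr lsmult_r_distr
        lsmult_assoc lsmult_one)
qed

definition quot_map where "quot_map = (\<lambda>x\<in>carrier M. N +>\<^bsub>M\<^esub> x)"

lemma quot_map: "quot_map \<in> mod_hom A M (quot_module M N)"
  unfolding quot_map_def
  by (rule mod_hom_restrictI[OF left_module_axioms]) (auto simp: quot_carrier quot_ops)

lemma quot_map_surj: "quot_map ` carrier M = carrier (quot_module M N)"
  by (auto simp: quot_map_def quot_carrier)

lemma quot_map_ker: "mod_ker M (quot_module M N) quot_map = N"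
  using sub_carr[OF N] by (auto simp: mod_ker_def quot_map_def quot_ops coset_eq_iff mdiff_zero)

lemma quot_hom: "module_hom A M (quot_module M N) quot_map"
  by (simp add: module_hom_def module_hom_axioms_def left_module_axioms left_module_quot quot_map)

end
end

lemma relpow_inf:
  fixes R S :: "('b \<times> 'b) set"
  shows "(x, y) \<in> (R \<inter> S) ^^ n \<Longrightarrow> (x, y) \<in> R ^^ n \<and> (x, y) \<in> S ^^ n"
  by (induction n arbitrary: y) auto

section \<open>Chains of submodules and length\<close>

text \<open>Covers in the weak sense: \<open>X = Y\<close> counts as a step. Annihilators and sums
  may collapse a step, and a chain of \<open>n\<close> weak steps still bounds every strict chain
  between its ends by \<open>n\<close>.\<close>

definition wcov :: "('a, 'k) ring_scheme \<Rightarrow> ('a, 'm) module \<Rightarrow> ('m set \<times> 'm set) set" where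
  "wcov A M = {(X, Y). submodule X A M \<and> submodule Y A M \<and> X \<subseteq> Y \<and>
     (\<forall>Z. submodule Z A M \<and> X \<subseteq> Z \<and> Z \<subseteq> Y \<longrightarrow> Z = X \<or> Z = Y)}"

definition strict :: "('a, 'k) ring_scheme \<Rightarrow> ('a, 'm) module \<Rightarrow> ('m set \<times> 'm set) set" where
  "strict A M = {(X, Y). submodule X A M \<and> submodule Y A M \<and> X \<subset> Y}"

text \<open>Finite length, expressed by a strictly increasing rank with values in the naturals. Both
  chain conditions follow at once, and the rank passes directly to submodules, quotients and
  extensions.\<close>

definition fin_len :: "('a, 'k) ring_scheme \<Rightarrow> ('a, 'm) module \<Rightarrow> bool" where
  "fin_len A M \<longleftrightarrow> (\<exists>\<mu> :: 'm set \<Rightarrow> nat. \<forall>X Y. (X, Y) \<in> strict A M \<longrightarrow> \<mu> X < \<mu> Y)"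

lemma wcovI:
  assumes "submodule X A M" "submodule Y A M" "X \<subseteq> Y"
    "\<And>Z. submodule Z A M \<Longrightarrow> X \<subseteq> Z \<Longrightarrow> Z \<subseteq> Y \<Longrightarrow> Z \<noteq> Y \<Longrightarrow> Z = X"
  shows "(X, Y) \<in> wcov A M"
  unfolding wcov_def using assms by blast

lemma wcovD:
  assumes "(X, Y) \<in> wcov A M"
  shows "submodule X A M" "submodule Y A M" "X \<subseteq> Y"
    "submodule Z A M \<Longrightarrow> X \<subseteq> Z \<Longrightarrow> Z \<subseteq> Y \<Longrightarrow> Z = X \<or> Z = Y"
  using assms unfolding wcov_def by blast+

lemma strictI: "submodule X A M \<Longrightarrow> submodule Y A M \<Longrightarrow> X \<subset> Y \<Longrightarrow> (X, Y) \<in> strict A M"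
  by (simp add: strict_def)

lemma wcov_chain_sub:
  assumes "(X, Y) \<in> wcov A M ^^ n" "submodule X A M" shows "submodule Y A M \<and> X \<subseteq> Y"
  using assms
proof (induction n arbitrary: Y)
  case (Suc n)
  then obtain Z where "(X, Z) \<in> wcov A M ^^ n" "(Z, Y) \<in> wcov A M" by auto
  then show ?case using Suc.IH[of Z] Suc.prems(2) by (auto simp: wcov_def)
qed auto

lemma strict_chain_sub:
  assumes "(X, Y) \<in> strict A M ^^ n" "submodule X A M" shows "submodule Y A M \<and> X \<subseteq> Y"
  using assms
proof (induction n arbitrary: Y)
  case (Suc n)
  then obtain Z where "(X, Z) \<in> strict A M ^^ n" "(Z, Y) \<in> strict A M" by auto
  then show ?case using Suc.IH[of Z] Suc.prems(2) by (auto simp: strict_def)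
qed auto

text \<open>The rank of every candidate is at most the rank of \<open>B\<close>, so a candidate of
  largest rank exists, and it is maximal.\<close>

lemma fin_max:
  assumes "fin_len A M" "P X" "\<And>X. P X \<Longrightarrow> submodule X A M \<and> X \<subseteq> B" "submodule B A M"
  obtains Y where "P Y" "\<And>Z. P Z \<Longrightarrow> Y \<subseteq> Z \<Longrightarrow> Z = Y"
proof -
  obtain \<mu> :: "'c set \<Rightarrow> nat" where \<mu>: "\<And>X Y. (X, Y) \<in> strict A M \<Longrightarrow> \<mu> X < \<mu> Y"
    using assms(1) by (auto simp: fin_len_def)
  have "\<mu> Z \<le> \<mu> B" if "P Z" for Z
    using assms(3)[OF that] assms(4) \<mu>[of Z B] by (cases "Z = B") (auto simp: strict_def psubset_eq)
  then obtain Y where Y: "P Y" "\<forall>Z. P Z \<longrightarrow> \<mu> Z \<le> \<mu> Y"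
    using ex_has_greatest_nat[of P X \<mu> "Suc (\<mu> B)"] assms(2) by (metis le_imp_less_Suc less_imp_le)
  have "Z = Y" if Z: "P Z" "Y \<subseteq> Z" for Z
  proof (rule ccontr)
    assume "Z \<noteq> Y"
    then have "(Y, Z) \<in> strict A M" using Z assms(3)[OF Y(1)] assms(3)[OF Z(1)] by (auto simp: strict_def)
    then show False using \<mu> Y(2) Z(1) leD by blast
  qed
  then show ?thesis using that Y by blast
qed

lemma fin_min:
  assumes "fin_len A M" "P X" "\<And>X. P X \<Longrightarrow> submodule X A M"
  obtains Y where "P Y" "\<And>Z. P Z \<Longrightarrow> Z \<subseteq> Y \<Longrightarrow> Z = Y"
proof -
  obtain \<mu> :: "'c set \<Rightarrow> nat" where \<mu>: "\<And>X Y. (X, Y) \<in> strict A M \<Longrightarrow> \<mu> X < \<mu> Y"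
    using assms(1) by (auto simp: fin_len_def)
  obtain Y where Y: "P Y" "\<forall>Z. P Z \<longrightarrow> \<mu> Y \<le> \<mu> Z"
    using ex_has_least_nat[of P X \<mu>] assms(2) by blast
  have "Z = Y" if Z: "P Z" "Z \<subseteq> Y" for Z
  proof (rule ccontr)
    assume "Z \<noteq> Y"
    then have "(Z, Y) \<in> strict A M" using Z assms(3)[OF Y(1)] assms(3)[OF Z(1)] by (auto simp: strict_def)
    then show False using \<mu> Y(2) Z(1) leD by blast
  qed
  then show ?thesis using that Y by blast
qed

context left_module
begin

text \<open>The modular law: \<open>y = x + n\<close> with \<open>x\<close> in \<open>X\<close> puts
  \<open>n\<close> into \<open>Y \<inter> N = X \<inter> N\<close>, hence \<open>y\<close> into
  \<open>X\<close>.\<close>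

lemma modular_eq:
  assumes X: "submodule X A M" and Y: "submodule Y A M" and N: "submodule N A M"
    and "X \<subseteq> Y" "X \<inter> N = Y \<inter> N" "Y \<subseteq> X <+>\<^bsub>M\<^esub> N"
  shows "X = Y"
proof
  show "Y \<subseteq> X"
  proof
    fix y assume y: "y \<in> Y"
    then obtain x n where xn: "x \<in> X" "n \<in> N" "y = x \<oplus>\<^bsub>M\<^esub> n" using assms(6) mem_set_add by (metis subsetD)
    have c: "x \<in> carrier M" "n \<in> carrier M" using xn sub_carr X N by auto
    have "n = y \<ominus>\<^bsub>M\<^esub> x" using c xn madd_diff[of n x] by (simp add: M.a_comm)
    moreover have "y \<ominus>\<^bsub>M\<^esub> x \<in> Y" using sub_diff[OF Y y] xn assms(4) by auto
    ultimately have "n \<in> Y \<inter> N" using xn by simp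
    then show "y \<in> X" using assms(5) xn sub_add[OF X] by auto
  qed
qed (rule assms)

text \<open>For \<open>X\<close> inside \<open>N\<close> the rank counts the steps of the chain at
  which the intersection of \<open>X\<close> with the members of the chain grows. There are
  \<open>n\<close> steps, which bounds it; the point is that it grows strictly with
  \<open>X\<close>.\<close>

lemma wcov_measure:
  assumes "(N0, N) \<in> wcov A M ^^ n" "submodule N0 A M"
  shows "\<exists>\<mu> :: 'm set \<Rightarrow> nat. (\<forall>X Y. (X, Y) \<in> strict A M \<longrightarrow> N0 \<subseteq> X \<longrightarrow> Y \<subseteq> N \<longrightarrow> \<mu> X < \<mu> Y) \<and> (\<forall>X. \<mu> X \<le> n)"
  using assms(1)
proof (induction n arbitrary: N)
  case 0
  then show ?case by (intro exI[of _ "\<lambda>_. 0"]) (auto simp: strict_def)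
next
  case (Suc n)
  then obtain N1 where 1: "(N0, N1) \<in> wcov A M ^^ n" "(N1, N) \<in> wcov A M" by auto
  from Suc.IH[OF 1(1)] obtain \<mu> :: "'m set \<Rightarrow> nat"
    where \<mu>: "\<And>X Y. (X, Y) \<in> strict A M \<Longrightarrow> N0 \<subseteq> X \<Longrightarrow> Y \<subseteq> N1 \<Longrightarrow> \<mu> X < \<mu> Y" "\<And>X. \<mu> X \<le> n" by blast
  have s: "submodule N1 A M" "submodule N A M" "N0 \<subseteq> N1" "N1 \<subseteq> N"
    using 1 wcov_chain_sub[OF 1(1) assms(2)] by (auto simp: wcov_def)
  let ?\<mu> = "\<lambda>X. \<mu> (X \<inter> N1) + (if X \<subseteq> N1 then 0 else 1)"
  have "?\<mu> X < ?\<mu> Y" if XY: "(X, Y) \<in> strict A M" "N0 \<subseteq> X" "Y \<subseteq> N" for X Y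
  proof (cases "X \<inter> N1 = Y \<inter> N1")
    case False
    then have "(X \<inter> N1, Y \<inter> N1) \<in> strict A M"
      using XY s submodule_Int by (auto simp: strict_def)
    then have "\<mu> (X \<inter> N1) < \<mu> (Y \<inter> N1)" using \<mu>(1) XY s by blast
    then show ?thesis using XY by (auto simp: strict_def)
  next
    case True
    have X: "submodule X A M" "submodule Y A M" "X \<subset> Y" using XY by (auto simp: strict_def)
    \<comment> \<open>The traces on \<open>N1\<close> are equal. If \<open>X\<close> were not inside
      \<open>N1\<close>, then \<open>X + N1\<close> would be all of \<open>N\<close> and the modular
      law would give \<open>X = Y\<close>. So \<open>X\<close> is inside \<open>N1\<close>,
      \<open>Y\<close> is not, and the extra unit makes the difference.\<close>
    have "X \<subseteq> N1"
    proof (rule ccontr)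
      assume "\<not> X \<subseteq> N1"
      moreover have "N1 \<subseteq> X <+>\<^bsub>M\<^esub> N1" "X \<subseteq> X <+>\<^bsub>M\<^esub> N1" "X <+>\<^bsub>M\<^esub> N1 \<subseteq> N"
        using set_add_upper[OF X(1) s(1)] set_add_least[OF s(2), of X N1] X XY s by auto
      moreover have "submodule (X <+>\<^bsub>M\<^esub> N1) A M" using submodule_set_add X s by auto
      ultimately have "X <+>\<^bsub>M\<^esub> N1 = N" using 1(2) unfolding wcov_def by blast
      then show False using modular_eq[OF X(1,2) s(1)] True X XY by auto
    qed
    moreover have "\<not> Y \<subseteq> N1" using True X calculation by auto
    ultimately show ?thesis using True by auto
  qed
  moreover have "?\<mu> X \<le> Suc n" for X using \<mu>(2)[of "X \<inter> N1"] by auto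
  ultimately show ?case by (intro exI[of _ ?\<mu>]) blast
qed

text \<open>Plays the role of the Jordan--Hoelder theorem: the rank of \<open>wcov_measure\<close>
  increases at each strict step and never exceeds \<open>n\<close>. All comparisons of lengths below
  reduce to it.\<close>

lemma strict_le_wcov:
  assumes "(X, Y) \<in> strict A M ^^ k" "(N0, N) \<in> wcov A M ^^ n" "N0 \<subseteq> X" "Y \<subseteq> N"
    "submodule X A M" "submodule N0 A M"
  shows "k \<le> n"
proof -
  obtain \<mu> :: "'m set \<Rightarrow> nat"
    where \<mu>: "\<And>X Y. (X, Y) \<in> strict A M \<Longrightarrow> N0 \<subseteq> X \<Longrightarrow> Y \<subseteq> N \<Longrightarrow> \<mu> X < \<mu> Y" "\<And>X. \<mu> X \<le> n"
    using wcov_measure[OF assms(2,6)] by blast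
  have "k \<le> \<mu> Y" using assms(1,4)
  proof (induction k arbitrary: Y)
    case (Suc k)
    then obtain Z where Z: "(X, Z) \<in> strict A M ^^ k" "(Z, Y) \<in> strict A M" by auto
    then have "Z \<subseteq> N" "N0 \<subseteq> Z"
      using Suc.prems(2) strict_chain_sub[OF Z(1) assms(5)] assms(3) by (auto simp: strict_def)
    then show ?case using Suc.IH[OF Z(1)] \<mu>(1)[OF Z(2)] Suc.prems(2) by auto
  qed simp
  then show ?thesis using \<mu>(2)[of Y] by simp
qed

text \<open>Among the submodules above \<open>X\<close> and properly below \<open>Y\<close> choose a
  maximal one, \<open>Z\<close>. It is covered by \<open>Y\<close>, and its smaller rank lets the
  induction continue.\<close>

lemma cover_chain:
  assumes "fin_len A M" "submodule X A M" "submodule Y A M" "X \<subseteq> Y"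
  obtains n where "(X, Y) \<in> (wcov A M \<inter> strict A M) ^^ n"
proof -
  obtain \<mu> :: "'m set \<Rightarrow> nat" where \<mu>: "\<And>X Y. (X, Y) \<in> strict A M \<Longrightarrow> \<mu> X < \<mu> Y"
    using assms(1) by (auto simp: fin_len_def)
  have "\<exists>n. (X, Y) \<in> (wcov A M \<inter> strict A M) ^^ n" using assms(3,4)
  proof (induction "\<mu> Y" arbitrary: Y rule: less_induct)
    case less
    show ?case
    proof (cases "X = Y")
      case True
      then show ?thesis by (intro exI[of _ 0]) auto
    next
      case False
      let ?P = "\<lambda>Z. submodule Z A M \<and> X \<subseteq> Z \<and> Z \<subset> Y"
      obtain Z where Z: "?P Z" "\<And>Z'. ?P Z' \<Longrightarrow> Z \<subseteq> Z' \<Longrightarrow> Z' = Z"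
        by (rule fin_max[of A M ?P X Y]) (use assms(1,2) less.prems False in auto)
      then have "(Z, Y) \<in> wcov A M"
        using less.prems by (intro wcovI) (blast, blast, blast, metis order_trans psubset_eq)
      then have zy: "(Z, Y) \<in> wcov A M \<inter> strict A M"
        using less.prems Z by (simp add: strict_def)
      then obtain n where "(X, Z) \<in> (wcov A M \<inter> strict A M) ^^ n"
        using less.hyps[of Z] \<mu>[of Z Y] Z by auto
      then have "(X, Y) \<in> (wcov A M \<inter> strict A M) ^^ Suc n" using zy by auto
      then show ?thesis by blast
    qed
  qed
  then show ?thesis using that by blast
qed

lemma max_sub_exists:
  assumes "fin_len A M" "submodule X A M" "X \<noteq> carrier M"
  obtains N where "maximal_submodule A M N" "X \<subseteq> N"
proof -
  let ?P = "\<lambda>Z. submodule Z A M \<and> X \<subseteq> Z \<and> Z \<noteq> carrier M"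
  obtain N where N: "?P N" "\<And>Z'. ?P Z' \<Longrightarrow> N \<subseteq> Z' \<Longrightarrow> Z' = N"
    by (rule fin_max[of A M ?P X "carrier M"]) (use assms submodule_carrier sub_carr in auto)
  then have "maximal_submodule A M N"
    unfolding maximal_submodule_def by blast
  then show ?thesis using that N by blast
qed

lemma min_sub_exists:
  assumes "fin_len A M" "submodule X A M" "X \<noteq> {\<zero>\<^bsub>M\<^esub>}"
  obtains S where "submodule S A M" "S \<subseteq> X" "S \<noteq> {\<zero>\<^bsub>M\<^esub>}"
    "\<And>Z. submodule Z A M \<Longrightarrow> Z \<subseteq> S \<Longrightarrow> Z = {\<zero>\<^bsub>M\<^esub>} \<or> Z = S"
proof -
  let ?P = "\<lambda>Z. submodule Z A M \<and> Z \<subseteq> X \<and> Z \<noteq> {\<zero>\<^bsub>M\<^esub>}"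
  obtain S where S: "?P S" "\<And>Z'. ?P Z' \<Longrightarrow> Z' \<subseteq> S \<Longrightarrow> Z' = S"
    by (rule fin_min[of A M ?P X]) (use assms in auto)
  show ?thesis by (rule that[of S]) (use S in blast)+
qed

lemma simple_iff: "simple_module A M \<longleftrightarrow> ({\<zero>\<^bsub>M\<^esub>}, carrier M) \<in> wcov A M \<inter> strict A M"
proof -
  have "{\<zero>\<^bsub>M\<^esub>} \<subseteq> Z \<and> Z \<subseteq> carrier M" if "submodule Z A M" for Z
    using that submodule_iff by auto
  then show ?thesis
    using submodule_zero submodule_carrier unfolding simple_module_def wcov_def strict_def
    by (auto simp del: subset_antisym; blast)
qed

end

context module_hom
begin

lemma pre_ker: "mod_ker M N f = pre {\<zero>\<^bsub>N\<^esub>}" by (auto simp: mod_ker_def pre_def)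

lemma pre_carrier: "pre (carrier N) = carrier M" by (auto simp: pre_def closed)

context
  assumes surj: "f ` carrier M = carrier N"
begin

lemma pre_mono_iff:
  "submodule X A N \<Longrightarrow> submodule Y A N \<Longrightarrow> pre X \<subseteq> pre Y \<longleftrightarrow> X \<subseteq> Y"
  using image_pre[OF surj, of X] image_pre[OF surj, of Y] N.submodule_iff[of X] N.submodule_iff[of Y]
    image_mono[of "pre X" "pre Y" f] by (auto simp: pre_def)

lemma pre_strict: 
  assumes "submodule X A N" "submodule Y A N"
  shows "(pre X, pre Y) \<in> strict A M \<longleftrightarrow> (X, Y) \<in> strict A N"
  using assms pre_mono_iff[of X Y] pre_mono_iff[of Y X] sub_pre by (simp add: strict_def less_le_not_le)

lemma pre_wcov:
  assumes "submodule X A N" "submodule Y A N"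
  shows "(pre X, pre Y) \<in> wcov A M \<longleftrightarrow> (X, Y) \<in> wcov A N"
proof
  assume "(pre X, pre Y) \<in> wcov A M"
  then have *: "pre X \<subseteq> pre Y" "\<And>Z. submodule Z A M \<Longrightarrow> pre X \<subseteq> Z \<Longrightarrow> Z \<subseteq> pre Y \<Longrightarrow> Z = pre X \<or> Z = pre Y"
    by (auto simp: wcov_def)
  have "Z = X \<or> Z = Y" if "submodule Z A N" "X \<subseteq> Z" "Z \<subseteq> Y" for Z
    using *(2)[OF sub_pre[OF that(1)]] that assms pre_mono_iff by (metis subset_antisym order_refl)
  then show "(X, Y) \<in> wcov A N" using assms *(1) pre_mono_iff by (auto simp: wcov_def)
next
  assume "(X, Y) \<in> wcov A N"
  then have *: "X \<subseteq> Y" "\<And>Z. submodule Z A N \<Longrightarrow> X \<subseteq> Z \<Longrightarrow> Z \<subseteq> Y \<Longrightarrow> Z = X \<or> Z = Y"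
    by (auto simp: wcov_def)
  have "Z = pre X \<or> Z = pre Y" if "submodule Z A M" "pre X \<subseteq> Z" "Z \<subseteq> pre Y" for Z
  proof -
    have "mod_ker M N f \<subseteq> Z" using ker_pre[OF assms(1)] that by auto
    then have "pre (f ` Z) = Z" using pre_image that by auto
    moreover have "X \<subseteq> f ` Z" "f ` Z \<subseteq> Y"
      using image_mono[OF that(2), of f] image_mono[OF that(3), of f]
        image_pre[OF surj] assms N.sub_carr by (metis subsetI)+
    ultimately show ?thesis using *(2)[OF sub_image[OF that(1)]] by auto
  qed
  then show "(pre X, pre Y) \<in> wcov A M"
    using assms * pre_mono_iff sub_pre by (auto simp: wcov_def)
qed

lemma simple_iff_ker: "simple_module A N \<longleftrightarrow> (mod_ker M N f, carrier M) \<in> wcov A M \<inter> strict A M"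
  unfolding N.simple_iff pre_ker
  using pre_wcov[OF N.submodule_zero N.submodule_carrier] pre_strict[OF N.submodule_zero N.submodule_carrier]
  by (simp add: pre_carrier)

lemma fin_surj: assumes "fin_len A M" shows "fin_len A N"
proof -
  obtain \<mu> :: "'m set \<Rightarrow> nat" where \<mu>: "\<And>X Y. (X, Y) \<in> strict A M \<Longrightarrow> \<mu> X < \<mu> Y"
    using assms(1) by (auto simp: fin_len_def)
  have "\<mu> (pre X) < \<mu> (pre Y)" if "(X, Y) \<in> strict A N" for X Y
    using \<mu>[of "pre X" "pre Y"] pre_strict[of X Y] that by (simp add: strict_def)
  then show ?thesis unfolding fin_len_def by (intro exI[of _ "\<lambda>X. \<mu> (pre X)"]) blast
qed

lemma strict_chain_pre:
  assumes "(X, Y) \<in> strict A N ^^ n" "submodule X A N"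
  shows "(pre X, pre Y) \<in> strict A M ^^ n"
  using assms
proof (induction n arbitrary: Y)
  case (Suc n)
  then obtain Z where "(X, Z) \<in> strict A N ^^ n" "(Z, Y) \<in> strict A N" by auto
  then show ?case using Suc pre_strict[of Z Y] by (auto simp: strict_def)
qed auto

lemma strict_chain_image:
  assumes "(X, Y) \<in> strict A M ^^ n" "submodule X A M" "mod_ker M N f \<subseteq> X"
  shows "(f ` X, f ` Y) \<in> strict A N ^^ n"
  using assms(1)
proof (induction n arbitrary: Y)
  case (Suc n)
  then obtain Z where Z: "(X, Z) \<in> strict A M ^^ n" "(Z, Y) \<in> strict A M" by auto
  then have "mod_ker M N f \<subseteq> Z" "mod_ker M N f \<subseteq> Y"
    using strict_chain_sub[OF Z(1) assms(2)] assms(3) by (auto simp: strict_def)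
  then have "pre (f ` Z) = Z" "pre (f ` Y) = Y" using Z pre_image by (auto simp: strict_def)
  then have "(f ` Z, f ` Y) \<in> strict A N"
    using Z(2) sub_image pre_strict[of "f ` Z" "f ` Y"] by (auto simp: strict_def)
  then show ?case using Suc.IH[OF Z(1)] by auto
qed auto

end
end

context left_module
begin

lemma simple_quot_iff:
  assumes X: "submodule X A M"
  shows "simple_module A (quot_module M X) \<longleftrightarrow> (X, carrier M) \<in> wcov A M \<inter> strict A M"
proof -
  interpret h: module_hom A M "quot_module M X" "quot_map X" by (rule quot_hom[OF X])
  show ?thesis using h.simple_iff_ker[OF quot_map_surj[OF X]] quot_map_ker[OF X] by simp
qed

lemma wcov_sub: "submodule H A M \<Longrightarrow> (X, Y) \<in> wcov A (M\<lparr>carrier := H\<rparr>) \<longleftrightarrow> (X, Y) \<in> wcov A M \<and> Y \<subseteq> H"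
  unfolding wcov_def by (simp add: submodule_sub_iff) (meson order_trans)

lemma strict_sub: "submodule H A M \<Longrightarrow> (X, Y) \<in> strict A (M\<lparr>carrier := H\<rparr>) \<longleftrightarrow> (X, Y) \<in> strict A M \<and> Y \<subseteq> H"
  unfolding strict_def by (auto simp: submodule_sub_iff)

lemma fin_sub: "submodule H A M \<Longrightarrow> fin_len A M \<Longrightarrow> fin_len A (M\<lparr>carrier := H\<rparr>)"
  unfolding fin_len_def using strict_sub by blast

lemma simple_quot_sub_iff:
  assumes X: "submodule X A M" and Y: "submodule Y A M" and XY: "X \<subseteq> Y"
  shows "simple_module A (quot_module (M\<lparr>carrier := Y\<rparr>) X) \<longleftrightarrow> (X, Y) \<in> wcov A M \<inter> strict A M"
proof -
  interpret Y: left_module A "M\<lparr>carrier := Y\<rparr>" by (rule left_module_sub[OF Y])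
  show ?thesis using Y.simple_quot_iff[of X] submodule_sub_iff[OF Y] X XY wcov_sub[OF Y] strict_sub[OF Y]
    by auto
qed

text \<open>Replaces the indexed series of the definition by a power of a relation, so that chains
  can be concatenated, cut and transported step by step.\<close>

lemma composition_series_iff:
  "(\<exists>N. composition_series A M n N) \<longleftrightarrow> ({\<zero>\<^bsub>M\<^esub>}, carrier M) \<in> (wcov A M \<inter> strict A M) ^^ n"
proof
  assume "\<exists>N. composition_series A M n N"
  then obtain N where N: "composition_series A M n N" by blast
  have "(N i, N (Suc i)) \<in> wcov A M \<inter> strict A M" if "i < n" for i
    using N that simple_quot_sub_iff[of "N i" "N (Suc i)"] unfolding composition_series_def by simp
  then show "({\<zero>\<^bsub>M\<^esub>}, carrier M) \<in> (wcov A M \<inter> strict A M) ^^ n"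
    using N unfolding relpow_fun_conv composition_series_def by blast
next
  assume "({\<zero>\<^bsub>M\<^esub>}, carrier M) \<in> (wcov A M \<inter> strict A M) ^^ n"
  then obtain N where N: "N 0 = {\<zero>\<^bsub>M\<^esub>}" "N n = carrier M"
    "\<And>i. i < n \<Longrightarrow> (N i, N (Suc i)) \<in> wcov A M \<inter> strict A M"
    unfolding relpow_fun_conv by blast
  have sub: "submodule (N i) A M" if "i \<le> n" for i
    using that N(2) N(3)[of i] submodule_carrier by (cases "i = n") (auto simp: strict_def)
  have "simple_module A (quot_module (M\<lparr>carrier := N (Suc i)\<rparr>) (N i))" "N i \<subseteq> N (Suc i)" if "i < n" for i
    using simple_quot_sub_iff[of "N i" "N (Suc i)"] sub N(3)[OF that] that by (auto simp: strict_def)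
  then show "\<exists>N. composition_series A M n N"
    using N(1,2) sub unfolding composition_series_def by blast
qed

lemma comp_length_chain:
  assumes "fin_len A M"
  shows "({\<zero>\<^bsub>M\<^esub>}, carrier M) \<in> (wcov A M \<inter> strict A M) ^^ comp_length A M"
proof -
  obtain n where "({\<zero>\<^bsub>M\<^esub>}, carrier M) \<in> (wcov A M \<inter> strict A M) ^^ n"
    using cover_chain[OF assms submodule_zero submodule_carrier] sub_zero submodule_carrier by blast
  then show ?thesis unfolding comp_length_def composition_series_iff by (rule LeastI)
qed

text \<open>Lower bounds for lengths are obtained by exhibiting strict chains: a shortest
  composition series is in particular a chain of weak covers from zero to the top, which no strict
  chain can exceed.\<close>

lemma strict_le_comp_length:
  assumes "fin_len A M" "(X, Y) \<in> strict A M ^^ k" "submodule X A M"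
  shows "k \<le> comp_length A M"
proof -
  have "({\<zero>\<^bsub>M\<^esub>}, carrier M) \<in> wcov A M ^^ comp_length A M"
    using relpow_inf[OF comp_length_chain[OF assms(1)]] by simp
  moreover have "submodule Y A M" using strict_chain_sub[OF assms(2,3)] by blast
  then have "Y \<subseteq> carrier M" using sub_carr by blast
  ultimately show ?thesis
    using strict_le_wcov[OF assms(2)] assms(3) sub_zero submodule_zero by simp
qed

end

text \<open>The rank is the rank of the image plus the rank of the trace on the kernel. If neither
  changes from \<open>X\<close> to \<open>Y\<close>, the modular law with the kernel gives
  \<open>X = Y\<close>.\<close>

lemma (in module_hom) fin_ext:
  assumes "fin_len A N" "fin_len A (M\<lparr>carrier := mod_ker M N f\<rparr>)"
  shows "fin_len A M"
proof -
  let ?K = "mod_ker M N f"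
  obtain \<mu> :: "'n set \<Rightarrow> nat" where \<mu>: "\<And>X Y. (X, Y) \<in> strict A N \<Longrightarrow> \<mu> X < \<mu> Y"
    using assms(1) by (auto simp: fin_len_def)
  obtain \<nu> :: "'m set \<Rightarrow> nat" where \<nu>: "\<And>X Y. (X, Y) \<in> strict A (M\<lparr>carrier := ?K\<rparr>) \<Longrightarrow> \<nu> X < \<nu> Y"
    using assms(2) by (auto simp: fin_len_def)
  let ?m = "\<lambda>X. \<mu> (f ` X) + \<nu> (X \<inter> ?K)"
  have "?m X < ?m Y" if XY: "(X, Y) \<in> strict A M" for X Y
  proof -
    have s: "submodule X A M" "submodule Y A M" "X \<subset> Y" using XY by (auto simp: strict_def)
    have 1: "f ` X = f ` Y \<or> (f ` X, f ` Y) \<in> strict A N"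
      using s sub_image by (auto simp: strict_def)
    have 2: "X \<inter> ?K = Y \<inter> ?K \<or> (X \<inter> ?K, Y \<inter> ?K) \<in> strict A (M\<lparr>carrier := ?K\<rparr>)"
      using s M.submodule_Int sub_ker M.strict_sub[OF sub_ker] by (auto simp: strict_def)
    have "\<not> (f ` X = f ` Y \<and> X \<inter> ?K = Y \<inter> ?K)"
    proof
      assume eq: "f ` X = f ` Y \<and> X \<inter> ?K = Y \<inter> ?K"
      have "Y \<subseteq> X <+>\<^bsub>M\<^esub> ?K"
      proof
        fix y assume y: "y \<in> Y"
        then obtain x where x: "x \<in> X" "f y = f x" using eq by (metis imageE imageI)
        have c: "x \<in> carrier M" "y \<in> carrier M" using s x y M.sub_carr by auto
        then have "y \<ominus>\<^bsub>M\<^esub> x \<in> ?K" using x diff closed N.diff_eq_zero by (auto simp: mod_ker_def)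
        moreover have "y = x \<oplus>\<^bsub>M\<^esub> (y \<ominus>\<^bsub>M\<^esub> x)"
          using c M.mdiff_add[of y x] by (simp add: M.M.a_comm)
        ultimately show "y \<in> X <+>\<^bsub>M\<^esub> ?K" using x unfolding M.mem_set_add by blast
      qed
      then show False using M.modular_eq[OF s(1,2) sub_ker] eq s by auto
    qed
    then show ?thesis using 1 2 \<mu> \<nu> by (smt (verit) add_less_le_mono add_le_less_mono order.strict_implies_order order_refl add_strict_mono)
  qed
  then show ?thesis unfolding fin_len_def by (intro exI[of _ ?m]) blast
qed

text \<open>Jointly injective maps embed \<open>M\<close> into a power of \<open>N\<close>. The
  induction cuts down to the kernel of the last map, so the power itself is never formed.\<close>

lemma fin_joint:
  fixes n :: nat
  assumes "left_module A M" "left_module A N" "fin_len A N"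
    and "\<And>i. i < n \<Longrightarrow> \<phi> i \<in> mod_hom A M N"
    and "\<And>x. x \<in> carrier M \<Longrightarrow> (\<And>i. i < n \<Longrightarrow> \<phi> i x = \<zero>\<^bsub>N\<^esub>) \<Longrightarrow> x = \<zero>\<^bsub>M\<^esub>"
  shows "fin_len A M"
  using assms
proof (induction n arbitrary: M \<phi>)
  case 0
  interpret left_module A M by fact
  have "carrier M = {\<zero>\<^bsub>M\<^esub>}" using 0 by auto
  then have "strict A M = {}" using sub_carr sub_zero by (fastforce simp: strict_def)
  then show ?case by (simp add: fin_len_def)
next
  case (Suc n)
  interpret h: module_hom A M N "\<phi> n"
    using Suc.prems by (simp add: module_hom_def module_hom_axioms_def)
  let ?K = "mod_ker M N (\<phi> n)"
  have "fin_len A (M\<lparr>carrier := ?K\<rparr>)"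
  proof (rule Suc.IH[where \<phi> = "\<lambda>i. restrict (\<phi> i) ?K"])
    show "restrict (\<phi> i) ?K \<in> mod_hom A (M\<lparr>carrier := ?K\<rparr>) N" if "i < n" for i
      using mod_hom_sub[OF Suc.prems(1) h.sub_ker Suc.prems(4)[of i]] that by simp
    fix x assume "x \<in> carrier (M\<lparr>carrier := ?K\<rparr>)" "\<And>i. i < n \<Longrightarrow> restrict (\<phi> i) ?K x = \<zero>\<^bsub>N\<^esub>"
    then have x: "x \<in> ?K" "x \<in> carrier M" "\<And>i. i < n \<Longrightarrow> \<phi> i x = \<zero>\<^bsub>N\<^esub>" by (auto simp: mod_ker_def)
    then have "\<phi> i x = \<zero>\<^bsub>N\<^esub>" if "i < Suc n" for i
      using that by (cases "i = n") (auto simp: mod_ker_def)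
    then show "x = \<zero>\<^bsub>M\<lparr>carrier := ?K\<rparr>\<^esub>" using Suc.prems(5) x by auto
  qed (use Suc.prems h.M.left_module_sub[OF h.sub_ker] in auto)
  then show ?case using h.fin_ext Suc.prems by blast
qed

section \<open>Finitely generated and projective modules\<close>

lemma module_homI: "left_module A M \<Longrightarrow> left_module A N \<Longrightarrow> f \<in> mod_hom A M N \<Longrightarrow> module_hom A M N f"
  by (simp add: module_hom_def module_hom_axioms_def)

context left_module
begin

lemma sub_subset: "submodule H A M \<Longrightarrow> H \<subseteq> carrier M"
  using sub_carr by blast

lemma span_sub: "S \<subseteq> carrier M \<Longrightarrow> submodule (submod_span A M S) A M"
  unfolding submod_span_def using submodule_carrier by (intro submodule_Inter) auto

lemma span_incl: "S \<subseteq> submod_span A M S"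
  unfolding submod_span_def by auto

lemma span_least: "submodule N A M \<Longrightarrow> S \<subseteq> N \<Longrightarrow> submod_span A M S \<subseteq> N"
  unfolding submod_span_def by auto

lemma span_mono: "S \<subseteq> T \<Longrightarrow> submod_span A M S \<subseteq> submod_span A M T"
  unfolding submod_span_def by auto

text \<open>A maximal finitely generated submodule already contains every element, since adjoining
  one more generator cannot enlarge it.\<close>

lemma fin_fg: assumes "fin_len A M" shows "fg_module A M"
proof -
  let ?P = "\<lambda>X. \<exists>S. finite S \<and> S \<subseteq> carrier M \<and> X = submod_span A M S"
  obtain Y where Y: "?P Y" "\<And>Z. ?P Z \<Longrightarrow> Y \<subseteq> Z \<Longrightarrow> Z = Y"
  proof (rule fin_max[of A M ?P "submod_span A M {}" "carrier M"])
    show "submodule X A M \<and> X \<subseteq> carrier M" if "?P X" for X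
      using that span_sub sub_carr by blast
  qed (use assms submodule_carrier in auto)
  then obtain S where S: "finite S" "S \<subseteq> carrier M" "Y = submod_span A M S" by auto
  have "x \<in> Y" if "x \<in> carrier M" for x
  proof -
    have "submod_span A M (insert x S) = Y"
      using Y(2)[of "submod_span A M (insert x S)"] S that span_mono[of S "insert x S"]
      by (metis finite_insert insert_subset subset_insertI)
    then show ?thesis using span_incl[of "insert x S"] by auto
  qed
  then have "Y = carrier M" using S sub_subset[OF span_sub] by blast
  then show ?thesis using S left_module_axioms unfolding fg_module_def by blast
qed

end

text \<open>The free module of rank \<open>n\<close>. Its cosets have type \<open>'a fgtype\<close>,
  so its quotients are legitimate test modules in the definitions of projective, injective and
  cogenerating modules.\<close>

definition fun_module :: "('a, 'k) ring_scheme \<Rightarrow> nat \<Rightarrow> ('a, nat \<Rightarrow> 'a) module" where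
  "fun_module A n = \<lparr>carrier = {..<n} \<rightarrow>\<^sub>E carrier A, mult = undefined, one = undefined,
     zero = (\<lambda>i\<in>{..<n}. \<zero>\<^bsub>A\<^esub>), add = (\<lambda>f g. \<lambda>i\<in>{..<n}. f i \<oplus>\<^bsub>A\<^esub> g i),
     smult = (\<lambda>a f. \<lambda>i\<in>{..<n}. a \<otimes>\<^bsub>A\<^esub> f i)\<rparr>"

lemma regular_simps [simp]:
  "carrier (regular_module A) = carrier A" "\<zero>\<^bsub>regular_module A\<^esub> = \<zero>\<^bsub>A\<^esub>"
  "x \<oplus>\<^bsub>regular_module A\<^esub> y = x \<oplus>\<^bsub>A\<^esub> y" "a \<odot>\<^bsub>regular_module A\<^esub> x = a \<otimes>\<^bsub>A\<^esub> x"
  by (simp_all add: regular_module_def)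

lemma (in ring) left_module_regular: "left_module R (regular_module R)"
proof -
  have "abelian_group (regular_module R)"
    by (rule abelian_groupI) (auto simp: add.m_ac intro!: bexI[of _ "\<ominus> _"] l_neg)
  then show ?thesis
    by (auto simp: left_module_def left_module_axioms_def ring_axioms l_distr r_distr m_assoc)
qed

lemma (in ring) left_module_fun: "left_module R (fun_module R n)"
proof -
  have "abelian_group (fun_module R n)"
  proof (rule abelian_groupI)
    fix x assume x: "x \<in> carrier (fun_module R n)"
    then show "\<exists>y\<in>carrier (fun_module R n). y \<oplus>\<^bsub>fun_module R n\<^esub> x = \<zero>\<^bsub>fun_module R n\<^esub>"
      by (intro bexI[of _ "\<lambda>i\<in>{..<n}. \<ominus> x i"]) (auto simp: fun_module_def l_neg restrict_def PiE_iff extensional_def)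
    have "x i \<in> carrier R" if "i < n" for i using x that by (auto simp: fun_module_def)
    moreover have "x i = undefined" if "\<not> i < n" for i
      using x that by (auto simp: fun_module_def PiE_def extensional_def)
    ultimately show "\<zero>\<^bsub>fun_module R n\<^esub> \<oplus>\<^bsub>fun_module R n\<^esub> x = x"
      by (auto simp: fun_module_def fun_eq_iff)
  qed (simp_all add: fun_module_def PiE_mem fun_eq_iff add.m_ac restrict_def PiE_iff extensional_def)
  moreover have "\<one> \<odot>\<^bsub>fun_module R n\<^esub> x = x" if x: "x \<in> carrier (fun_module R n)" for x
  proof -
    have "x i \<in> carrier R" if "i < n" for i using x that by (auto simp: fun_module_def)
    moreover have "x i = undefined" if "\<not> i < n" for i
      using x that by (auto simp: fun_module_def PiE_def extensional_def)
    ultimately show ?thesis by (auto simp: fun_module_def fun_eq_iff)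
  qed
  ultimately show ?thesis
    unfolding left_module_def left_module_axioms_def
    by (intro conjI allI impI ring_axioms) (auto simp: fun_module_def fun_eq_iff PiE_iff l_distr r_distr m_assoc)
qed

lemma (in ring) coord_hom:
  "i < n \<Longrightarrow> (\<lambda>v\<in>carrier (fun_module R n). v i) \<in> mod_hom R (fun_module R n) (regular_module R)"
  by (rule mod_hom_restrictI[OF left_module_fun]) (auto simp: fun_module_def)

lemma (in ring) fin_fun: assumes "fin_len R (regular_module R)" shows "fin_len R (fun_module R n)"
proof (rule fin_joint[OF left_module_fun left_module_regular assms coord_hom])
  fix x assume "x \<in> carrier (fun_module R n)"
    "\<And>i. i < n \<Longrightarrow> (\<lambda>v\<in>carrier (fun_module R n). v i) x = \<zero>\<^bsub>regular_module R\<^esub>"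
  then show "x = \<zero>\<^bsub>fun_module R n\<^esub>" 
    by (auto simp: fun_module_def fun_eq_iff PiE_def extensional_def)
qed auto

definition lin_comb :: "('a, 'k) ring_scheme \<Rightarrow> ('a, 'm) module \<Rightarrow> nat \<Rightarrow> (nat \<Rightarrow> 'm) \<Rightarrow> (nat \<Rightarrow> 'a) \<Rightarrow> 'm" where
  "lin_comb A M n x = (\<lambda>v\<in>carrier (fun_module A n). finsum M (\<lambda>i. v i \<odot>\<^bsub>M\<^esub> x i) {..<n})"

context left_module
begin

lemma lin_comb_hom:
  assumes "x \<in> {..<n} \<rightarrow> carrier M"
  shows "lin_comb A M n x \<in> mod_hom A (fun_module A n) M"
  unfolding lin_comb_def
proof (rule mod_hom_restrictI[OF A.left_module_fun])
  have vc: "v i \<in> carrier A" if "v \<in> carrier (fun_module A n)" "i < n" for v i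
    using that by (auto simp: fun_module_def)
  have xc: "x i \<in> carrier M" if "i < n" for i using that assms by auto
  have c: "(\<lambda>i. v i \<odot>\<^bsub>M\<^esub> x i) \<in> {..<n} \<rightarrow> carrier M" if "v \<in> carrier (fun_module A n)" for v
    using that assms lsmult_closed by (auto simp: fun_module_def)
  show "finsum M (\<lambda>i. v i \<odot>\<^bsub>M\<^esub> x i) {..<n} \<in> carrier M" if "v \<in> carrier (fun_module A n)" for v
    using c[OF that] by (rule M.finsum_closed)
  show "finsum M (\<lambda>i. (v \<oplus>\<^bsub>fun_module A n\<^esub> w) i \<odot>\<^bsub>M\<^esub> x i) {..<n} =
      finsum M (\<lambda>i. v i \<odot>\<^bsub>M\<^esub> x i) {..<n} \<oplus>\<^bsub>M\<^esub> finsum M (\<lambda>i. w i \<odot>\<^bsub>M\<^esub> x i) {..<n}"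
    if v: "v \<in> carrier (fun_module A n)" "w \<in> carrier (fun_module A n)" for v w
    unfolding M.finsum_addf[OF c[OF v(1)] c[OF v(2)], symmetric]
    using vc[OF v(1)] vc[OF v(2)] xc lsmult_l_distr lsmult_closed
    by (intro M.finsum_cong') (auto simp: fun_module_def Pi_iff)
  show "finsum M (\<lambda>i. (a \<odot>\<^bsub>fun_module A n\<^esub> v) i \<odot>\<^bsub>M\<^esub> x i) {..<n} =
      a \<odot>\<^bsub>M\<^esub> finsum M (\<lambda>i. v i \<odot>\<^bsub>M\<^esub> x i) {..<n}"
    if v: "a \<in> carrier A" "v \<in> carrier (fun_module A n)" for a v
    unfolding finsum_smult[OF v(1) c[OF v(2)]]
    using v(1) vc[OF v(2)] xc lsmult_assoc lsmult_closed
    by (intro M.finsum_cong') (auto simp: fun_module_def Pi_iff)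
qed

lemma lin_comb_gen:
  assumes x: "x \<in> {..<n} \<rightarrow> carrier M" and j: "j < n"
  shows "x j \<in> lin_comb A M n x ` carrier (fun_module A n)"
proof
  let ?v = "\<lambda>i\<in>{..<n}. if j = i then \<one>\<^bsub>A\<^esub> else \<zero>\<^bsub>A\<^esub>"
  show v: "?v \<in> carrier (fun_module A n)" by (auto simp: fun_module_def)
  have "finsum M (\<lambda>i. ?v i \<odot>\<^bsub>M\<^esub> x i) {..<n} = finsum M (\<lambda>i. if j = i then x i else \<zero>\<^bsub>M\<^esub>) {..<n}"
    using x by (intro M.finsum_cong') (auto simp: lsmult_one smult_l_zero Pi_iff)
  also have "\<dots> = x j" using x j by (intro M.finsum_singleton) auto
  finally show "x j = lin_comb A M n x ?v" using v by (simp add: lin_comb_def)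
qed

lemma fg_iff:
  "fg_module A M \<longleftrightarrow> (\<exists>n x. x \<in> {..<n} \<rightarrow> carrier M \<and>
     lin_comb A M n x ` carrier (fun_module A n) = carrier M)"
proof
  assume "fg_module A M"
  then obtain S where S: "finite S" "S \<subseteq> carrier M" "submod_span A M S = carrier M"
    by (auto simp: fg_module_def)
  obtain x where x: "bij_betw x {..<card S} S"
    using ex_bij_betw_nat_finite[OF S(1)] by (metis lessThan_atLeast0)
  then have c: "x \<in> {..<card S} \<rightarrow> carrier M" using S(2) by (auto simp: bij_betw_def)
  interpret h: module_hom A "fun_module A (card S)" M "lin_comb A M (card S) x"
    using lin_comb_hom[OF c] A.left_module_fun left_module_axioms
    by (simp add: module_hom_def module_hom_axioms_def)
  have "S \<subseteq> lin_comb A M (card S) x ` carrier (fun_module A (card S))"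
  proof
    fix y assume "y \<in> S"
    then obtain j where "j < card S" "y = x j" using bij_betw_imp_surj_on[OF x] by auto
    then show "y \<in> lin_comb A M (card S) x ` carrier (fun_module A (card S))"
      using lin_comb_gen[OF c] by simp
  qed
  then have "carrier M \<subseteq> lin_comb A M (card S) x ` carrier (fun_module A (card S))"
    using span_least[OF h.sub_image[OF h.M.submodule_carrier], of S] S(3) by simp
  then have "lin_comb A M (card S) x ` carrier (fun_module A (card S)) = carrier M"
    using h.closed by auto
  then show "\<exists>n x. x \<in> {..<n} \<rightarrow> carrier M \<and> lin_comb A M n x ` carrier (fun_module A n) = carrier M"
    using c by blast
next
  assume "\<exists>n x. x \<in> {..<n} \<rightarrow> carrier M \<and> lin_comb A M n x ` carrier (fun_module A n) = carrier M"
  then obtain n x where x: "x \<in> {..<n} \<rightarrow> carrier M"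
    "carrier M = lin_comb A M n x ` carrier (fun_module A n)" by blast
  let ?S = "x ` {..<n}"
  have S: "?S \<subseteq> carrier M" using x by auto
  have "lin_comb A M n x v \<in> submod_span A M ?S" if v: "v \<in> carrier (fun_module A n)" for v
  proof -
    have "v i \<odot>\<^bsub>M\<^esub> x i \<in> submod_span A M ?S" if "i < n" for i
      using that v span_incl[of ?S] sub_smult[OF span_sub[OF S]] by (auto simp: fun_module_def)
    then have "finsum M (\<lambda>i. v i \<odot>\<^bsub>M\<^esub> x i) {..<n} \<in> submod_span A M ?S"
      by (intro sub_finsum[OF span_sub[OF S]]) auto
    then show ?thesis using v by (simp add: lin_comb_def)
  qed
  then have "carrier M \<subseteq> submod_span A M ?S" unfolding x(2) by (rule image_subsetI)
  then have "submod_span A M ?S = carrier M" using sub_subset[OF span_sub[OF S]] by blast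
  then show "fg_module A M" using S left_module_axioms unfolding fg_module_def
    by (intro conjI exI[of _ ?S]) simp_all
qed

end

lemma (in left_module) lin_comb_image:
  assumes x: "x \<in> {..<n} \<rightarrow> carrier M"
  shows "lin_comb A M n x ` carrier (fun_module A n) =
    {finsum M (\<lambda>i. v i \<odot>\<^bsub>M\<^esub> x i) {..<n} | v. v \<in> {..<n} \<rightarrow> carrier A}"
proof
  show "lin_comb A M n x ` carrier (fun_module A n) \<subseteq> {finsum M (\<lambda>i. v i \<odot>\<^bsub>M\<^esub> x i) {..<n} | v. v \<in> {..<n} \<rightarrow> carrier A}"
    by (auto simp: lin_comb_def fun_module_def)
  show "{finsum M (\<lambda>i. v i \<odot>\<^bsub>M\<^esub> x i) {..<n} | v. v \<in> {..<n} \<rightarrow> carrier A} \<subseteq> lin_comb A M n x ` carrier (fun_module A n)"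
  proof
    fix y assume "y \<in> {finsum M (\<lambda>i. v i \<odot>\<^bsub>M\<^esub> x i) {..<n} | v. v \<in> {..<n} \<rightarrow> carrier A}"
    then obtain v where v: "v \<in> {..<n} \<rightarrow> carrier A" "y = finsum M (\<lambda>i. v i \<odot>\<^bsub>M\<^esub> x i) {..<n}" by blast
    have r: "restrict v {..<n} \<in> carrier (fun_module A n)" using v(1) by (auto simp: fun_module_def)
    have "y = finsum M (\<lambda>i. restrict v {..<n} i \<odot>\<^bsub>M\<^esub> x i) {..<n}"
      unfolding v(2) using v(1) x lsmult_closed by (intro M.finsum_cong') (auto simp: Pi_iff)
    then show "y \<in> lin_comb A M n x ` carrier (fun_module A n)"
      using r by (intro image_eqI[OF _ r]) (simp add: lin_comb_def)
  qed
qed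

lemma (in left_module) submodule_combinations:
  assumes x: "x \<in> {..<n :: nat} \<rightarrow> carrier M"
  shows "submodule {finsum M (\<lambda>i. v i \<odot>\<^bsub>M\<^esub> x i) {..<n} | v. v \<in> {..<n} \<rightarrow> carrier A} A M"
  unfolding lin_comb_image[OF x, symmetric]
  using module_hom.sub_image[OF module_homI[OF A.left_module_fun left_module_axioms lin_comb_hom[OF x]]
      left_module.submodule_carrier[OF A.left_module_fun]] by simp

lemma (in module_hom) lin_comb:
  assumes "x \<in> {..<n} \<rightarrow> carrier M" "v \<in> carrier (fun_module A n)"
  shows "f (lin_comb A M n x v) = lin_comb A N n (\<lambda>i. f (x i)) v"
proof -
  have vc: "v i \<in> carrier A" "x i \<in> carrier M" if "i < n" for i
    using that assms by (auto simp: fun_module_def)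
  have "f (finsum M (\<lambda>i. v i \<odot>\<^bsub>M\<^esub> x i) {..<n}) = finsum N (\<lambda>i. f (v i \<odot>\<^bsub>M\<^esub> x i)) {..<n}"
    using vc M.lsmult_closed by (intro finsum) auto
  also have "\<dots> = finsum N (\<lambda>i. v i \<odot>\<^bsub>N\<^esub> f (x i)) {..<n}"
    using vc N.lsmult_closed smult closed by (intro N.M.finsum_cong') auto
  finally show ?thesis using assms by (simp add: lin_comb_def)
qed

lemma (in module_hom) fg_surj:
  assumes "fg_module A M" "f ` carrier M = carrier N" shows "fg_module A N"
proof -
  obtain n x where x: "x \<in> {..<n} \<rightarrow> carrier M"
    "lin_comb A M n x ` carrier (fun_module A n) = carrier M" using assms(1) M.fg_iff by blast
  have "lin_comb A N n (\<lambda>i. f (x i)) ` carrier (fun_module A n) = f ` carrier M"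
    unfolding x(2)[symmetric] image_image by (rule image_cong[OF refl]) (use lin_comb[OF x(1)] in simp)
  then show ?thesis using assms(2) x(1) closed by (subst N.fg_iff) (intro exI[of _ n] exI[of _ "\<lambda>i. f (x i)"], auto)
qed

lemma fg_left_module: "fg_module A M \<Longrightarrow> left_module A M" by (simp add: fg_module_def)

lemma fg_fin:
  assumes "fg_module A M" "fin_len A (regular_module A)" shows "fin_len A M"
proof -
  interpret left_module A M using assms(1) by (rule fg_left_module)
  obtain n x where x: "x \<in> {..<n} \<rightarrow> carrier M"
    "lin_comb A M n x ` carrier (fun_module A n) = carrier M" using assms(1) fg_iff by blast
  interpret h: module_hom A "fun_module A n" M "lin_comb A M n x"
    using lin_comb_hom[OF x(1)] A.left_module_fun left_module_axioms
    by (simp add: module_hom_def module_hom_axioms_def)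
  show ?thesis using h.fin_surj[OF x(2)] A.fin_fun assms(2) by blast
qed

lemma (in module_hom) first_iso:
  assumes "f ` carrier M = carrier N"
  obtains k where "k \<in> mod_hom A (quot_module M (mod_ker M N f)) N"
    "bij_betw k (carrier (quot_module M (mod_ker M N f))) (carrier N)"
    "\<And>x. x \<in> carrier M \<Longrightarrow> k (mod_ker M N f +>\<^bsub>M\<^esub> x) = f x"
proof -
  let ?K = "mod_ker M N f" and ?Q = "quot_module M (mod_ker M N f)"
  have K: "submodule ?K A M" by (rule sub_ker)
  interpret Q: left_module A ?Q by (rule M.left_module_quot[OF K])
  define k where "k = (\<lambda>X\<in>carrier ?Q. f (SOME x. x \<in> carrier M \<and> X = ?K +>\<^bsub>M\<^esub> x))"
  have kx: "k (?K +>\<^bsub>M\<^esub> x) = f x" if x: "x \<in> carrier M" for x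
  proof -
    let ?y = "SOME y. y \<in> carrier M \<and> ?K +>\<^bsub>M\<^esub> x = ?K +>\<^bsub>M\<^esub> y"
    have y: "?y \<in> carrier M \<and> ?K +>\<^bsub>M\<^esub> x = ?K +>\<^bsub>M\<^esub> ?y"
      by (rule someI[of _ x]) (use x in simp)
    then have "x \<ominus>\<^bsub>M\<^esub> ?y \<in> ?K" using M.coset_eq_iff[OF K] x by blast
    then have "f x = f ?y" using y x diff closed N.diff_eq_zero by (auto simp: mod_ker_def)
    then show ?thesis using x by (auto simp: k_def M.quot_carrier[OF K])
  qed
  have "k \<in> mod_hom A ?Q N"
  proof (rule mod_homI)
    show "k \<in> extensional (carrier ?Q)" by (simp add: k_def)
  qed (auto simp: M.quot_carrier[OF K] M.quot_ops[OF K] kx closed add smult M.lsmult_closed)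
  moreover have "bij_betw k (carrier ?Q) (carrier N)"
  proof (rule bij_betw_imageI)
    show "k ` carrier ?Q = carrier N"
      using assms by (auto simp: M.quot_carrier[OF K] image_image kx)
    show "inj_on k (carrier ?Q)"
    proof (rule inj_onI, unfold M.quot_carrier[OF K], elim imageE)
      fix X Y x y assume xy: "k X = k Y" "X = ?K +>\<^bsub>M\<^esub> x" "x \<in> carrier M" "Y = ?K +>\<^bsub>M\<^esub> y" "y \<in> carrier M"
      then have "f x = f y" using kx by simp
      then have "x \<ominus>\<^bsub>M\<^esub> y \<in> ?K" using xy diff N.diff_eq_zero closed by (auto simp: mod_ker_def)
      then show "X = Y" using M.coset_eq_iff[OF K] xy by simp
    qed
  qed
  ultimately show ?thesis using that kx by blast
qed

text \<open>The definitions of \<open>projective\<close>, \<open>injective\<close> and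
  \<open>cogenerator\<close> only test against modules with elements of type
  \<open>'a fgtype\<close>. This copy, a quotient of a free module, brings every finitely generated
  module within their reach; what is found there is carried back along \<open>k\<close>.\<close>

lemma fg_copy:
  assumes "fg_module A M"
  obtains X :: "('a, 'a fgtype) module" and k
  where "fg_module A X" "k \<in> mod_hom A X M" "bij_betw k (carrier X) (carrier M)"
proof -
  interpret left_module A M using assms by (rule fg_left_module)
  obtain n x where x: "x \<in> {..<n} \<rightarrow> carrier M"
    "lin_comb A M n x ` carrier (fun_module A n) = carrier M" using assms(1) fg_iff by blast
  interpret h: module_hom A "fun_module A n" M "lin_comb A M n x"
    using lin_comb_hom[OF x(1)] A.left_module_fun left_module_axioms
    by (simp add: module_hom_def module_hom_axioms_def)
  let ?X = "quot_module (fun_module A n) (mod_ker (fun_module A n) M (lin_comb A M n x))"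
  obtain k where k: "k \<in> mod_hom A ?X M" "bij_betw k (carrier ?X) (carrier M)"
    using h.first_iso[OF x(2)] by blast
  have X: "left_module A ?X" by (rule h.M.left_module_quot[OF h.sub_ker])
  interpret k: module_hom A ?X M k
    using k X left_module_axioms by (simp add: module_hom_def module_hom_axioms_def)
  interpret i: module_hom A M ?X "restrict (inv_into (carrier ?X) k) (carrier M)"
    using k.inverse[OF k(2)] X left_module_axioms by (simp add: module_hom_def module_hom_axioms_def)
  have "restrict (inv_into (carrier ?X) k) (carrier M) ` carrier M = carrier ?X"
    using bij_betw_inv_into[OF k(2)] by (simp add: bij_betw_def)
  then have "fg_module A ?X" using i.fg_surj assms by blast
  then show ?thesis using that k by blast
qed

lemma (in ring) lin_comb_unit:
  assumes v: "v \<in> carrier (fun_module R n)"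
  shows "lin_comb R (fun_module R n) n (\<lambda>i. \<lambda>j\<in>{..<n}. if j = i then \<one> else \<zero>) v = v"
proof
  let ?F = "fun_module R n" and ?x = "\<lambda>i. \<lambda>j\<in>{..<n}. if j = i then \<one> else \<zero>"
  interpret F: left_module R ?F by (rule left_module_fun)
  have x: "?x \<in> {..<n} \<rightarrow> carrier ?F" by (auto simp: fun_module_def)
  interpret h: module_hom R ?F ?F "lin_comb R ?F n ?x"
    by (rule module_homI) (use F.lin_comb_hom[OF x] left_module_fun in auto)
  fix j
  have vc: "\<And>i. i < n \<Longrightarrow> v i \<in> carrier R" using v by (auto simp: fun_module_def)
  show "lin_comb R ?F n ?x v j = v j"
  proof (cases "j < n")
    case True
    interpret c: module_hom R ?F "regular_module R" "\<lambda>v\<in>carrier ?F. v j"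
      by (rule module_homI) (use coord_hom[OF True] left_module_fun left_module_regular in auto)
    have t: "(\<lambda>i. v i \<odot>\<^bsub>?F\<^esub> ?x i) \<in> {..<n} \<rightarrow> carrier ?F" using x vc F.lsmult_closed by auto
    have "lin_comb R ?F n ?x v j = finsum (regular_module R) (\<lambda>i. (\<lambda>v\<in>carrier ?F. v j) (v i \<odot>\<^bsub>?F\<^esub> ?x i)) {..<n}"
      using c.finsum[OF t] h.closed[OF v] v F.M.finsum_closed[OF t] by (simp add: lin_comb_def)
    also have "\<dots> = finsum (regular_module R) (\<lambda>i. if j = i then v i else \<zero>\<^bsub>regular_module R\<^esub>) {..<n}"
      using t vc True by (intro c.N.M.finsum_cong') (auto simp: fun_module_def Pi_iff)
    also have "\<dots> = v j" using vc True by (intro c.N.M.finsum_singleton) auto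
    finally show ?thesis .
  next
    case False
    then show ?thesis using h.closed[OF v] v by (auto simp: fun_module_def PiE_def extensional_def)
  qed
qed

lemma (in ring) fg_fun: "fg_module R (fun_module R n)"
proof -
  let ?x = "\<lambda>i. \<lambda>j\<in>{..<n}. if j = i then \<one> else \<zero>"
  interpret F: left_module R "fun_module R n" by (rule left_module_fun)
  have "?x \<in> {..<n} \<rightarrow> carrier (fun_module R n)" by (auto simp: fun_module_def)
  moreover have "lin_comb R (fun_module R n) n ?x ` carrier (fun_module R n) = carrier (fun_module R n)"
    using lin_comb_unit by simp
  ultimately show ?thesis using F.fg_iff by blast
qed

text \<open>The dual basis criterion for projectivity. It mentions no test modules, so it can be
  used at every element type and transported along isomorphisms.\<close>

definition dual_basis ::
    "('a, 'k) ring_scheme \<Rightarrow> ('a, 'm) module \<Rightarrow> nat \<Rightarrow> (nat \<Rightarrow> 'm) \<Rightarrow> (nat \<Rightarrow> 'm \<Rightarrow> 'a) \<Rightarrow> bool" where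
  "dual_basis A P n x h \<longleftrightarrow> x \<in> {..<n} \<rightarrow> carrier P \<and>
     (\<forall>i<n. h i \<in> mod_hom A P (regular_module A)) \<and>
     (\<forall>y\<in>carrier P. y = finsum P (\<lambda>i. h i y \<odot>\<^bsub>P\<^esub> x i) {..<n})"

text \<open>With \<open>z i\<close> a preimage of \<open>f (x i)\<close> under \<open>g\<close>, the
  lift sends \<open>y\<close> to the sum of the \<open>h i y\<close> times \<open>z i\<close>. The
  element types of \<open>X\<close> and \<open>Y\<close> are arbitrary here, in contrast to the
  definition of \<open>projective\<close>.\<close>

lemma dual_basis_lift:
  assumes P: "left_module A P" and X: "left_module A X" and Y: "left_module A Y"
    and db: "dual_basis A P n x h"
    and g: "g \<in> mod_hom A X Y" "g ` carrier X = carrier Y" and f: "f \<in> mod_hom A P Y"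
  obtains l where "l \<in> mod_hom A P X" "\<And>y. y \<in> carrier P \<Longrightarrow> g (l y) = f y"
proof -
  interpret P: left_module A P by (rule P)
  interpret g: module_hom A X Y g by (rule module_homI) fact+
  interpret f: module_hom A P Y f by (rule module_homI) fact+
  note d = db[unfolded dual_basis_def]
  have "\<forall>i\<in>{..<n}. \<exists>z\<in>carrier X. g z = f (x i)"
    using d g(2) f.closed by (metis (no_types, lifting) PiE imageE funcset_mem)
  then obtain z where z: "\<And>i. i < n \<Longrightarrow> z i \<in> carrier X" "\<And>i. i < n \<Longrightarrow> g (z i) = f (x i)"
    by (metis lessThan_iff)
  have hc: "h i y \<in> carrier A" if "i < n" "y \<in> carrier P" for i y
    using d that mod_homD(1) by fastforce
  have xc: "x i \<in> carrier P" if "i < n" for i using d that by auto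
  have zc: "(\<lambda>i. h i y \<odot>\<^bsub>X\<^esub> z i) \<in> {..<n} \<rightarrow> carrier X" if "y \<in> carrier P" for y
    using that hc z g.M.lsmult_closed by auto
  have "restrict (\<lambda>y. finsum X (\<lambda>i. h i y \<odot>\<^bsub>X\<^esub> z i) {..<n}) (carrier P) \<in> mod_hom A P X"
  proof (rule mod_hom_restrictI[OF P])
    show "finsum X (\<lambda>i. h i y \<odot>\<^bsub>X\<^esub> z i) {..<n} \<in> carrier X" if "y \<in> carrier P" for y
      using zc[OF that] by (rule g.M.M.finsum_closed)
    show "finsum X (\<lambda>i. h i (y \<oplus>\<^bsub>P\<^esub> w) \<odot>\<^bsub>X\<^esub> z i) {..<n} =
       finsum X (\<lambda>i. h i y \<odot>\<^bsub>X\<^esub> z i) {..<n} \<oplus>\<^bsub>X\<^esub> finsum X (\<lambda>i. h i w \<odot>\<^bsub>X\<^esub> z i) {..<n}"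
      if y: "y \<in> carrier P" "w \<in> carrier P" for y w
      unfolding g.M.M.finsum_addf[OF zc[OF y(1)] zc[OF y(2)], symmetric]
    proof (rule g.M.M.finsum_cong'[OF refl])
      show "h i (y \<oplus>\<^bsub>P\<^esub> w) \<odot>\<^bsub>X\<^esub> z i = h i y \<odot>\<^bsub>X\<^esub> z i \<oplus>\<^bsub>X\<^esub> h i w \<odot>\<^bsub>X\<^esub> z i" if "i \<in> {..<n}" for i
        using that y z hc mod_homD(2)[of "h i" A P "regular_module A" y w] d g.M.lsmult_l_distr by simp
    qed (use y z hc g.M.lsmult_closed in auto)
    show "finsum X (\<lambda>i. h i (a \<odot>\<^bsub>P\<^esub> y) \<odot>\<^bsub>X\<^esub> z i) {..<n} = a \<odot>\<^bsub>X\<^esub> finsum X (\<lambda>i. h i y \<odot>\<^bsub>X\<^esub> z i) {..<n}"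
      if y: "a \<in> carrier A" "y \<in> carrier P" for a y
      unfolding g.M.finsum_smult[OF y(1) zc[OF y(2)]]
    proof (rule g.M.M.finsum_cong'[OF refl])
      show "h i (a \<odot>\<^bsub>P\<^esub> y) \<odot>\<^bsub>X\<^esub> z i = a \<odot>\<^bsub>X\<^esub> (h i y \<odot>\<^bsub>X\<^esub> z i)" if "i \<in> {..<n}" for i
        using that y z hc mod_homD(3)[of "h i" A P "regular_module A" a y] d g.M.lsmult_assoc by simp
    qed (use y z hc g.M.lsmult_closed in auto)
  qed
  moreover have "g (restrict (\<lambda>y. finsum X (\<lambda>i. h i y \<odot>\<^bsub>X\<^esub> z i) {..<n}) (carrier P) y) = f y"
    if y: "y \<in> carrier P" for y
  proof -
    have "g (finsum X (\<lambda>i. h i y \<odot>\<^bsub>X\<^esub> z i) {..<n}) = finsum Y (\<lambda>i. g (h i y \<odot>\<^bsub>X\<^esub> z i)) {..<n}"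
      using g.finsum[OF zc[OF y]] .
    also have "\<dots> = finsum Y (\<lambda>i. f (h i y \<odot>\<^bsub>P\<^esub> x i)) {..<n}"
      using y z hc xc g.smult f.smult f.closed g.N.lsmult_closed
      by (intro g.N.M.finsum_cong') (auto simp: P.lsmult_closed)
    also have "\<dots> = f (finsum P (\<lambda>i. h i y \<odot>\<^bsub>P\<^esub> x i) {..<n})"
      using y hc xc P.lsmult_closed by (intro f.finsum[symmetric]) auto
    also have "\<dots> = f y" using d y by simp
    finally show ?thesis using y by simp
  qed
  ultimately show ?thesis using that by blast
qed

text \<open>A splitting of a surjection from a free module onto \<open>P\<close> has coordinates,
  and these are the functionals \<open>h i\<close>. The lifting property is applied to copies of the
  free module and of \<open>P\<close> that have the test type.\<close>

lemma projective_dual_basis: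
  assumes "projective A P" obtains n x h where "dual_basis A P n x h"
proof -
  have fg: "fg_module A P" using assms by (simp add: projective_def)
  interpret P: left_module A P by (rule fg_left_module[OF fg])
  obtain n x where x: "x \<in> {..<n} \<rightarrow> carrier P"
    "lin_comb A P n x ` carrier (fun_module A n) = carrier P" using fg P.fg_iff by blast
  let ?F = "fun_module A n" let ?p = "lin_comb A P n x"
  have F: "left_module A ?F" by (rule P.A.left_module_fun)
  have "fg_module A ?F" by (rule P.A.fg_fun)
  then obtain X :: "('a, 'a fgtype) module" and k
    where X: "fg_module A X" "k \<in> mod_hom A X ?F" "bij_betw k (carrier X) (carrier ?F)"
    by (rule fg_copy)
  obtain Y :: "('a, 'a fgtype) module" and l
    where Y: "fg_module A Y" "l \<in> mod_hom A Y P" "bij_betw l (carrier Y) (carrier P)"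
    using fg by (rule fg_copy)
  let ?l = "restrict (inv_into (carrier Y) l) (carrier P)"
  have l: "?l \<in> mod_hom A P Y"
    using module_hom.inverse[OF module_homI[OF fg_left_module[OF Y(1)] P.left_module_axioms Y(2)] Y(3)] .
  have pk: "compose (carrier X) ?p k \<in> mod_hom A X P"
    using mod_hom_comp X P.lin_comb_hom[OF x(1)] fg_left_module by blast
  \<comment> \<open>The surjection \<open>?p\<close> read between the copies \<open>X\<close> of the
    free module and \<open>Y\<close> of \<open>P\<close>. Lifting \<open>?l\<close> through it
    splits \<open>?p\<close> up to the isomorphism \<open>k\<close>.\<close>
  let ?g = "compose (carrier X) ?l (compose (carrier X) ?p k)"
  have g: "?g \<in> mod_hom A X Y" using mod_hom_comp pk l X fg_left_module by blast
  have "?g ` carrier X = ?l ` ?p ` k ` carrier X" by (auto simp: compose_def image_image)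
  also have "\<dots> = carrier Y"
    using X(3) x(2) bij_betw_inv_into[OF Y(3)] by (simp add: bij_betw_def)
  finally have "?g ` carrier X = carrier Y" .
  then obtain h where h: "h \<in> mod_hom A P X" "compose (carrier P) ?g h = ?l"
    using assms X Y g l unfolding projective_def by blast
  have eq: "?p (k (h y)) = y" if y: "y \<in> carrier P" for y
  proof -
    have c: "h y \<in> carrier X" "k (h y) \<in> carrier ?F" using mod_homD(1)[OF h(1) y] mod_homD(1)[OF X(2)] by auto
    then have pc: "?p (k (h y)) \<in> carrier P" using x(2) by blast
    have "?g (h y) = ?l y" using fun_cong[OF h(2), of y] y by (simp add: compose_def)
    then have "inv_into (carrier Y) l (?p (k (h y))) = inv_into (carrier Y) l y"
      using c pc y by (simp add: compose_def)
    then show ?thesis using bij_betw_inv_into_right[OF Y(3)] pc y by metis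
  qed
  have kh: "compose (carrier P) k h \<in> mod_hom A P ?F"
    using mod_hom_comp[OF P.left_module_axioms h(1) X(2)] .
  have "compose (carrier P) (\<lambda>v\<in>carrier ?F. v i) (compose (carrier P) k h) \<in> mod_hom A P (regular_module A)"
    if "i < n" for i
    using mod_hom_comp[OF P.left_module_axioms kh P.A.coord_hom[OF that]] .
  moreover have "y = finsum P (\<lambda>i. compose (carrier P) (\<lambda>v\<in>carrier ?F. v i) (compose (carrier P) k h) y \<odot>\<^bsub>P\<^esub> x i) {..<n}"
    if y: "y \<in> carrier P" for y
  proof -
    have "k (h y) \<in> carrier ?F" using mod_homD(1)[OF h(1) y] mod_homD(1)[OF X(2)] by auto
    then show ?thesis using eq[OF y] y by (simp add: compose_def lin_comb_def)
  qed
  ultimately have "dual_basis A P n x (\<lambda>i. compose (carrier P) (\<lambda>v\<in>carrier ?F. v i) (compose (carrier P) k h))"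
    using x(1) by (simp add: dual_basis_def)
  then show ?thesis using that by blast
qed

lemma dual_basis_projective:
  assumes P: "left_module A P" and db: "dual_basis A P n x h" shows "projective A P"
proof -
  interpret P: left_module A P by (rule P)
  note d = db[unfolded dual_basis_def]
  have "y \<in> lin_comb A P n x ` carrier (fun_module A n)" if y: "y \<in> carrier P" for y
  proof
    show v: "(\<lambda>i\<in>{..<n}. h i y) \<in> carrier (fun_module A n)"
      using d mod_homD(1)[OF _ y, of _ A "regular_module A"] by (auto simp: fun_module_def)
    have "finsum P (\<lambda>i. (\<lambda>i\<in>{..<n}. h i y) i \<odot>\<^bsub>P\<^esub> x i) {..<n} = finsum P (\<lambda>i. h i y \<odot>\<^bsub>P\<^esub> x i) {..<n}"
      using d mod_homD(1)[OF _ y, of _ A "regular_module A"] P.lsmult_closed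
      by (intro P.M.finsum_cong') (auto simp: Pi_iff)
    then show "y = lin_comb A P n x (\<lambda>i\<in>{..<n}. h i y)"
      using d y v by (simp add: lin_comb_def)
  qed
  moreover have "lin_comb A P n x ` carrier (fun_module A n) \<subseteq> carrier P"
    using mod_homD(1)[OF P.lin_comb_hom] d by blast
  ultimately have "lin_comb A P n x ` carrier (fun_module A n) = carrier P" by auto
  then have fg: "fg_module A P" using d P.fg_iff by blast
  have "\<exists>l\<in>mod_hom A P X. compose (carrier P) g l = f"
    if *: "fg_module A X" "fg_module A Y" "g \<in> mod_hom A X Y" "g ` carrier X = carrier Y" "f \<in> mod_hom A P Y"
    for X Y :: "('a, 'a fgtype) module" and g f
  proof -
    obtain l where l: "l \<in> mod_hom A P X" "\<And>y. y \<in> carrier P \<Longrightarrow> g (l y) = f y"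
      using dual_basis_lift[OF P fg_left_module[OF *(1)] fg_left_module[OF *(2)] db *(3-5)] by blast
    moreover have "compose (carrier P) g l = f"
      using l mod_homD(4)[OF *(5)] by (intro extensionalityI[of _ "carrier P"]) (auto simp: compose_eq)
    ultimately show ?thesis by blast
  qed
  note lift = this
  show ?thesis
    unfolding projective_def
  proof (intro conjI allI impI)
    fix X Y :: "('a, 'a fgtype) module" and g f
    assume H: "fg_module A X \<and> fg_module A Y \<and> g \<in> mod_hom A X Y \<and> g ` carrier X = carrier Y \<and> f \<in> mod_hom A P Y"
    show "\<exists>h\<in>mod_hom A P X. compose (carrier P) g h = f" using lift[of X Y g f] H by blast
  qed (rule fg)
qed

lemma (in module_hom) dual_basis_iso:
  assumes b: "bij_betw f (carrier M) (carrier N)" and db: "dual_basis A M n x h"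
  shows "dual_basis A N n (\<lambda>i. f (x i)) (\<lambda>i. compose (carrier N) (h i) (restrict (inv_into (carrier M) f) (carrier N)))"
proof -
  let ?i = "restrict (inv_into (carrier M) f) (carrier N)"
  note d = db[unfolded dual_basis_def]
  have i: "?i \<in> mod_hom A N M" by (rule inverse[OF b])
  have "y = finsum N (\<lambda>j. compose (carrier N) (h j) ?i y \<odot>\<^bsub>N\<^esub> f (x j)) {..<n}" if y: "y \<in> carrier N" for y
  proof -
    have c: "?i y \<in> carrier M" using mod_homD(1)[OF i y] .
    have hc: "h j (?i y) \<in> carrier A" "x j \<in> carrier M" if "j < n" for j
      using d c that mod_homD(1)[of "h j" A M "regular_module A"] by auto
    have "y = f (?i y)" using y bij_betw_inv_into_right[OF b y] by simp
    also have "\<dots> = f (finsum M (\<lambda>j. h j (?i y) \<odot>\<^bsub>M\<^esub> x j) {..<n})" using d c by auto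
    also have "\<dots> = finsum N (\<lambda>j. f (h j (?i y) \<odot>\<^bsub>M\<^esub> x j)) {..<n}"
      using hc M.lsmult_closed by (intro finsum) auto
    also have "\<dots> = finsum N (\<lambda>j. compose (carrier N) (h j) ?i y \<odot>\<^bsub>N\<^esub> f (x j)) {..<n}"
      using hc N.lsmult_closed y smult closed by (intro N.M.finsum_cong') (auto simp: compose_def)
    finally show ?thesis .
  qed
  then show ?thesis
    using d mod_hom_comp[OF N.left_module_axioms i] closed
    unfolding dual_basis_def by (intro conjI ballI allI impI) (blast | auto simp: Pi_iff)+
qed

section \<open>Injective modules and cogenerators\<close>

text \<open>Frees the extension property from the test type: the inclusion of \<open>X\<close> into
  \<open>Y\<close> is read between copies of both modules, where it is still injective.\<close>

lemma injective_extend: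
  assumes E: "injective A E" and Y: "fg_module A Y" and X: "submodule X A Y"
    and fgX: "fg_module A (Y\<lparr>carrier := X\<rparr>)" and f: "f \<in> mod_hom A (Y\<lparr>carrier := X\<rparr>) E"
  obtains h where "h \<in> mod_hom A Y E" "\<And>x. x \<in> X \<Longrightarrow> h x = f x"
proof -
  interpret Y: left_module A Y by (rule fg_left_module[OF Y])
  obtain Y' :: "('a, 'a fgtype) module" and k
    where Y': "fg_module A Y'" "k \<in> mod_hom A Y' Y" "bij_betw k (carrier Y') (carrier Y)"
    using Y by (rule fg_copy)
  obtain X' :: "('a, 'a fgtype) module" and l
    where X': "fg_module A X'" "l \<in> mod_hom A X' (Y\<lparr>carrier := X\<rparr>)"
      "bij_betw l (carrier X') (carrier (Y\<lparr>carrier := X\<rparr>))"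
    using fgX by (rule fg_copy)
  let ?k = "restrict (inv_into (carrier Y') k) (carrier Y)"
  have k: "?k \<in> mod_hom A Y Y'"
    using module_hom.inverse[OF module_homI[OF fg_left_module[OF Y'(1)] Y.left_module_axioms Y'(2)] Y'(3)] .
  have l: "l \<in> mod_hom A X' Y" using mod_hom_carrier_mono[OF X'(2)] Y.sub_subset[OF X] by blast
  have lX: "l ` carrier X' = X" "inj_on l (carrier X')" using X'(3) by (auto simp: bij_betw_def)
  let ?g = "compose (carrier X') ?k l"
  have g: "?g \<in> mod_hom A X' Y'" using mod_hom_comp[OF fg_left_module[OF X'(1)] l k] .
  have bk: "bij_betw (inv_into (carrier Y') k) (carrier Y) (carrier Y')" by (rule bij_betw_inv_into[OF Y'(3)])
  have "inj_on ?g (carrier X')"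
  proof (rule inj_onI)
    fix x y assume xy: "x \<in> carrier X'" "y \<in> carrier X'" "?g x = ?g y"
    have "l x \<in> carrier Y" "l y \<in> carrier Y" using xy mod_homD(1)[OF l] by auto
    then have "l x = l y" using xy bk by (auto simp: compose_def bij_betw_def inj_on_def)
    then show "x = y" using xy lX by (auto simp: inj_on_def)
  qed
  moreover have "compose (carrier X') f l \<in> mod_hom A X' E"
    using mod_hom_comp[OF fg_left_module[OF X'(1)] X'(2) f] .
  ultimately obtain h where h: "h \<in> mod_hom A Y' E" "compose (carrier X') h ?g = compose (carrier X') f l"
    using E X'(1) Y'(1) g unfolding injective_def by blast
  have "compose (carrier Y) h ?k \<in> mod_hom A Y E" using mod_hom_comp[OF Y.left_module_axioms k h(1)] .
  moreover have "compose (carrier Y) h ?k x = f x" if x: "x \<in> X" for x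
  proof -
    obtain x' where x': "x' \<in> carrier X'" "x = l x'" using x lX by auto
    have "x \<in> carrier Y" using Y.sub_carr[OF X x] .
    then show ?thesis using fun_cong[OF h(2), of x'] x' by (simp add: compose_def)
  qed
  ultimately show ?thesis using that by blast
qed

text \<open>The property in the definition, applied to the nonzero class of \<open>v\<close> in a
  copy of \<open>V / X\<close>.\<close>

lemma cogenerator_separates:
  assumes E: "cogenerator A E" and V: "fg_module A V" and X: "submodule X A V"
    and v: "v \<in> carrier V" "v \<notin> X"
  obtains f where "f \<in> mod_hom A V E" "\<And>x. x \<in> X \<Longrightarrow> f x = \<zero>\<^bsub>E\<^esub>" "f v \<noteq> \<zero>\<^bsub>E\<^esub>"
proof -
  interpret V: left_module A V by (rule fg_left_module[OF V])
  interpret q: module_hom A V "quot_module V X" "V.quot_map X" by (rule V.quot_hom[OF X])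
  have "fg_module A (quot_module V X)" by (rule q.fg_surj[OF V V.quot_map_surj[OF X]])
  then obtain Y :: "('a, 'a fgtype) module" and k
    where Y: "fg_module A Y" "k \<in> mod_hom A Y (quot_module V X)" "bij_betw k (carrier Y) (carrier (quot_module V X))"
    by (rule fg_copy)
  interpret Ym: left_module A Y by (rule fg_left_module[OF Y(1)])
  interpret k: module_hom A Y "quot_module V X" k
    by (rule module_homI) (use Y q.N.left_module_axioms Ym.left_module_axioms in auto)
  let ?k = "restrict (inv_into (carrier Y) k) (carrier (quot_module V X))"
  interpret ik: module_hom A "quot_module V X" Y ?k
    by (rule module_homI) (use k.inverse[OF Y(3)] q.N.left_module_axioms Ym.left_module_axioms in auto)
  interpret Em: left_module A E using E by (simp add: cogenerator_def fg_left_module)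
  have c: "V.quot_map X v \<in> carrier (quot_module V X)" using q.closed v by auto
  have "V.quot_map X v \<noteq> \<zero>\<^bsub>quot_module V X\<^esub>"
    using V.quot_map_ker[OF X] v by (auto simp: mod_ker_def)
  then have "?k (V.quot_map X v) \<noteq> \<zero>\<^bsub>Y\<^esub>"
    using c bij_betw_inv_into_right[OF Y(3) c] k.zero by auto
  then obtain f where f: "f \<in> mod_hom A Y E" "f (?k (V.quot_map X v)) \<noteq> \<zero>\<^bsub>E\<^esub>"
    using E Y(1) ik.closed[OF c] unfolding cogenerator_def by blast
  interpret f: module_hom A Y E f
    by (rule module_homI) (use f Em.left_module_axioms Ym.left_module_axioms in auto)
  have "compose (carrier V) (compose (carrier (quot_module V X)) f ?k) (V.quot_map X) \<in> mod_hom A V E"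
    using mod_hom_comp[OF V.left_module_axioms q.hom mod_hom_comp[OF q.N.left_module_axioms ik.hom f(1)]] .
  moreover have "compose (carrier V) (compose (carrier (quot_module V X)) f ?k) (V.quot_map X) x = \<zero>\<^bsub>E\<^esub>" if "x \<in> X" for x
  proof -
    have "x \<in> mod_ker V (quot_module V X) (V.quot_map X)" using that V.quot_map_ker[OF X] by simp
    then have "x \<in> carrier V" "V.quot_map X x = \<zero>\<^bsub>quot_module V X\<^esub>" by (auto simp: mod_ker_def)
    then show ?thesis using ik.zero f.zero q.N.M.zero_closed by (simp add: compose_def)
  qed
  moreover have "compose (carrier V) (compose (carrier (quot_module V X)) f ?k) (V.quot_map X) v \<noteq> \<zero>\<^bsub>E\<^esub>"
    using f(2) c v by (simp add: compose_def)
  ultimately show ?thesis using that by blast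
qed

section \<open>The Jacobson radical\<close>

lemma (in left_module) maximal_iff:
  "maximal_submodule A M N \<longleftrightarrow> (N, carrier M) \<in> wcov A M \<inter> strict A M"
proof -
  have "L \<subseteq> carrier M" if "submodule L A M" for L using that sub_subset by blast
  then show ?thesis
    unfolding maximal_submodule_def wcov_def strict_def using submodule_carrier by (simp add: psubset_eq) blast
qed

lemma (in left_module) maximal_gen:
  assumes "maximal_submodule A M N" "x \<in> carrier M" "x \<notin> N" "y \<in> carrier M"
  obtains n a where "n \<in> N" "a \<in> carrier A" "y = n \<oplus>\<^bsub>M\<^esub> a \<odot>\<^bsub>M\<^esub> x"
proof -
  have N: "submodule N A M" and max: "\<And>L. submodule L A M \<Longrightarrow> N \<subseteq> L \<Longrightarrow> L = N \<or> L = carrier M"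
    using assms(1) unfolding maximal_submodule_def by blast+
  have "N <+>\<^bsub>M\<^esub> cyc x = carrier M"
    by (rule cover_gen[OF N submodule_carrier]) (use assms max sub_subset[OF N] in auto)
  then have "y \<in> N <+>\<^bsub>M\<^esub> cyc x" using assms by simp
  then obtain n w where "n \<in> N" "w \<in> cyc x" "y = n \<oplus>\<^bsub>M\<^esub> w" unfolding mem_set_add by blast
  moreover from this obtain a where "a \<in> carrier A" "w = a \<odot>\<^bsub>M\<^esub> x" unfolding mem_cyc by blast
  ultimately show ?thesis using that by blast
qed

lemma (in left_module) orbit_hom:
  assumes "x \<in> carrier M" shows "(\<lambda>a\<in>carrier A. a \<odot>\<^bsub>M\<^esub> x) \<in> mod_hom A (regular_module A) M"
  using mod_hom_restrictI[OF A.left_module_regular, of "\<lambda>a. a \<odot>\<^bsub>M\<^esub> x" M] assms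
    lsmult_closed lsmult_l_distr lsmult_assoc by simp

lemma (in left_module) orbit_module_hom:
  assumes "x \<in> carrier M" shows "module_hom A (regular_module A) M (\<lambda>a\<in>carrier A. a \<odot>\<^bsub>M\<^esub> x)"
  by (rule module_homI[OF A.left_module_regular left_module_axioms orbit_hom[OF assms]])

text \<open>Since \<open>x\<close> lies outside \<open>N\<close>, it generates \<open>M / N\<close>,
  so \<open>a \<mapsto> a x\<close> identifies the quotient of \<open>A\<close> by this left ideal
  with the simple module \<open>M / N\<close>. This links the radical of \<open>A\<close> to the
  maximal submodules of arbitrary modules.\<close>

lemma (in left_module) orbit_maximal:
  assumes N: "maximal_submodule A M N" and x: "x \<in> carrier M" "x \<notin> N"
  shows "maximal_submodule A (regular_module A) {a \<in> carrier A. a \<odot>\<^bsub>M\<^esub> x \<in> N}"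
proof -
  interpret R: left_module A "regular_module A" by (rule A.left_module_regular)
  interpret h: module_hom A "regular_module A" M "\<lambda>a\<in>carrier A. a \<odot>\<^bsub>M\<^esub> x"
    by (rule orbit_module_hom[OF x(1)])
  let ?L = "{a \<in> carrier A. a \<odot>\<^bsub>M\<^esub> x \<in> N}"
  have NS: "submodule N A M" using N by (simp add: maximal_submodule_def)
  have "h.pre N = ?L" by (auto simp: h.pre_def)
  then have L: "submodule ?L A (regular_module A)" using h.sub_pre[OF NS] by simp
  have one: "L' = carrier A" if "submodule L' A (regular_module A)" "\<one>\<^bsub>A\<^esub> \<in> L'" for L'
    using R.sub_subset[OF that(1)] R.sub_smult[OF that(1) _ that(2)] by auto
  have "L' = carrier A" if L': "submodule L' A (regular_module A)" "?L \<subseteq> L'" "L' \<noteq> ?L" for L'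
  proof -
    obtain a where a: "a \<in> L'" "a \<notin> ?L" using L' by blast
    have ac: "a \<in> carrier A" using R.sub_carr[OF L'(1) a(1)] by simp
    then have "a \<odot>\<^bsub>M\<^esub> x \<notin> N" "a \<odot>\<^bsub>M\<^esub> x \<in> carrier M" using a x lsmult_closed by auto
    \<comment> \<open>From \<open>x = n + b a x\<close> it follows that \<open>1 - b a\<close> lies
      in the left ideal itself, hence in \<open>L'\<close>, which also contains \<open>b a\<close>;
      so \<open>1 \<in> L'\<close>.\<close>
    then obtain n b where nb: "n \<in> N" "b \<in> carrier A" "x = n \<oplus>\<^bsub>M\<^esub> b \<odot>\<^bsub>M\<^esub> (a \<odot>\<^bsub>M\<^esub> x)"
      using maximal_gen[OF N, of "a \<odot>\<^bsub>M\<^esub> x" x] x(1) by blast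
    have nc: "n \<in> carrier M" using sub_carr[OF NS nb(1)] .
    have ba: "b \<otimes>\<^bsub>A\<^esub> a \<in> L'" using R.sub_smult[OF L'(1) nb(2) a(1)] by simp
    have "(\<one>\<^bsub>A\<^esub> \<ominus>\<^bsub>A\<^esub> b \<otimes>\<^bsub>A\<^esub> a) \<odot>\<^bsub>M\<^esub> x = x \<ominus>\<^bsub>M\<^esub> b \<odot>\<^bsub>M\<^esub> (a \<odot>\<^bsub>M\<^esub> x)"
      using x nb ac by (simp add: diff_smult lsmult_one lsmult_assoc)
    also have "\<dots> = n" using nb(3) madd_diff[OF nc, of "b \<odot>\<^bsub>M\<^esub> (a \<odot>\<^bsub>M\<^esub> x)"] lsmult_closed nb ac x by simp
    finally have "\<one>\<^bsub>A\<^esub> \<ominus>\<^bsub>A\<^esub> b \<otimes>\<^bsub>A\<^esub> a \<in> ?L" using nb(1,2) ac by simp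
    then have "\<one>\<^bsub>A\<^esub> \<ominus>\<^bsub>A\<^esub> b \<otimes>\<^bsub>A\<^esub> a \<in> L'" using L' by blast
    then have "(\<one>\<^bsub>A\<^esub> \<ominus>\<^bsub>A\<^esub> b \<otimes>\<^bsub>A\<^esub> a) \<oplus>\<^bsub>A\<^esub> b \<otimes>\<^bsub>A\<^esub> a \<in> L'" using R.sub_add[OF L'(1) _ ba] by simp
    moreover have "(\<one>\<^bsub>A\<^esub> \<ominus>\<^bsub>A\<^esub> b \<otimes>\<^bsub>A\<^esub> a) \<oplus>\<^bsub>A\<^esub> b \<otimes>\<^bsub>A\<^esub> a = \<one>\<^bsub>A\<^esub>"
      using nb ac by (simp add: a_minus_def A.a_assoc A.l_neg)
    ultimately show ?thesis using one[OF L'(1)] by simp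
  qed
  moreover have "?L \<noteq> carrier A" using x lsmult_one by (metis (no_types, lifting) A.one_closed mem_Collect_eq)
  ultimately show ?thesis unfolding maximal_submodule_def using L by auto
qed

text \<open>For \<open>x\<close> outside \<open>N\<close> the radical lies in the maximal left ideal
  of \<open>orbit_maximal\<close>, which means \<open>j x \<in> N\<close>.\<close>

lemma (in left_module) radical_smult:
  assumes N: "maximal_submodule A M N" and x: "x \<in> carrier M" and j: "j \<in> jacobson_radical A"
  shows "j \<odot>\<^bsub>M\<^esub> x \<in> N"
proof (cases "x \<in> N")
  case True
  have "submodule N A M" "j \<in> carrier A" using N j by (auto simp: maximal_submodule_def jacobson_radical_def rad_def)
  then show ?thesis using True sub_smult by blast
next
  case False
  then show ?thesis using orbit_maximal[OF N x False] j unfolding jacobson_radical_def rad_def by blast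
qed

lemma (in left_module) submodule_rad: "submodule (rad A M) A M"
proof -
  have eq: "rad A M = \<Inter>(insert (carrier M) {N. maximal_submodule A M N})" by (simp add: rad_def)
  show ?thesis unfolding eq
    by (rule submodule_Inter) (use submodule_carrier in \<open>auto simp: maximal_submodule_def\<close>)
qed

lemma (in left_module) radical_smult_rad:
  assumes "x \<in> carrier M" "j \<in> jacobson_radical A" shows "j \<odot>\<^bsub>M\<^esub> x \<in> rad A M"
proof -
  have "j \<in> carrier A" using assms(2) by (auto simp: jacobson_radical_def rad_def)
  then show ?thesis using assms radical_smult lsmult_closed unfolding rad_def by auto
qed

context ring
begin

lemma jacobson_carr: "j \<in> jacobson_radical R \<Longrightarrow> j \<in> carrier R"
  by (auto simp: jacobson_radical_def rad_def)

lemma left_ideal_iff: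
  "submodule H R (regular_module R) \<longleftrightarrow> H \<subseteq> carrier R \<and> \<zero> \<in> H \<and> (\<forall>x\<in>H. \<forall>y\<in>H. x \<oplus> y \<in> H) \<and>
     (\<forall>a\<in>carrier R. \<forall>x\<in>H. a \<otimes> x \<in> H)"
  using left_module.submodule_iff[OF left_module_regular] by simp

lemma ideal_iff:
  "ideal H R \<longleftrightarrow> submodule H R (regular_module R) \<and> (\<forall>x\<in>H. \<forall>a\<in>carrier R. x \<otimes> a \<in> H)"
proof
  assume "ideal H R"
  then interpret ideal H R .
  show "submodule H R (regular_module R) \<and> (\<forall>x\<in>H. \<forall>a\<in>carrier R. x \<otimes> a \<in> H)"
    unfolding left_ideal_iff using Icarr I_l_closed I_r_closed by auto
next
  assume H: "submodule H R (regular_module R) \<and> (\<forall>x\<in>H. \<forall>a\<in>carrier R. x \<otimes> a \<in> H)"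
  then have Hl: "H \<subseteq> carrier R" "\<zero> \<in> H" "\<And>x y. x \<in> H \<Longrightarrow> y \<in> H \<Longrightarrow> x \<oplus> y \<in> H"
    "\<And>a x. a \<in> carrier R \<Longrightarrow> x \<in> H \<Longrightarrow> a \<otimes> x \<in> H"
    unfolding left_ideal_iff by blast+
  have "\<ominus> x \<in> H" if "x \<in> H" for x using Hl(4)[of "\<ominus> \<one>" x] that Hl(1) l_minus[of \<one> x] by auto
  then have "subgroup H (add_monoid R)" using Hl by (intro add.subgroupI) auto
  then show "ideal H R" using H left_ideal_iff by (intro idealI ring_axioms) auto
qed

text \<open>The radical is an intersection of left ideals. That it absorbs factors on the right is
  \<open>J x \<subseteq> rad M\<close> for the regular module.\<close>

lemma jacobson_ideal: "ideal (jacobson_radical R) R"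
proof -
  interpret M: left_module R "regular_module R" by (rule left_module_regular)
  show ?thesis
    unfolding ideal_iff using M.submodule_rad M.radical_smult_rad by (simp add: jacobson_radical_def)
qed

lemma ideal_power_ideal: "ideal I R \<Longrightarrow> ideal (ideal_power R I n) R"
  by (induction n) (auto simp: oneideal ideal_prod_is_ideal)

text \<open>Powers are built by factors on the left. Moving one factor to the right puts a product
  of an element of \<open>I^n\<close> with one of \<open>I\<close>, in this order, into
  \<open>I^(n+1)\<close>.\<close>

lemma ideal_power_commute: "ideal I R \<Longrightarrow> ideal_power R I (Suc n) = ideal_prod R (ideal_power R I n) I"
proof (induction n)
  case 0
  have "ideal_prod R (carrier R) I = I"
  proof
    show "ideal_prod R (carrier R) I \<subseteq> I" using ideal_prod_inter[OF oneideal 0] by auto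
    show "I \<subseteq> ideal_prod R (carrier R) I"
      using ideal_prod.prod[of \<one> "carrier R" _ I R] ideal.Icarr[OF 0] by force
  qed
  then show ?case using 0 ideal_prod_one by simp
next
  case (Suc n)
  then show ?case using ideal_prod_assoc[OF Suc.prems ideal_power_ideal[OF Suc.prems] Suc.prems, of n] by simp
qed

lemma ideal_power_prod:
  assumes "ideal I R" "a \<in> ideal_power R I n" "b \<in> I" shows "a \<otimes> b \<in> ideal_power R I (Suc n)"
  unfolding ideal_power_commute[OF assms(1)] using assms by (intro ideal_prod.prod)

lemma elem_power:
  assumes "ideal I R" "x \<in> I" shows "x [^] n \<in> ideal_power R I n"
proof (induction n)
  case (Suc n)
  then show ?case unfolding ideal_power_commute[OF assms(1)] nat_pow_Suc using assms by (intro ideal_prod.prod)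
qed simp

text \<open>Take the smallest power. If it is nonzero it has a maximal submodule \<open>K\<close>,
  and \<open>J\<close> times the power lies in \<open>K\<close>, so the next power is strictly
  smaller.\<close>

lemma jacobson_nilpotent:
  assumes "fin_len R (regular_module R)"
  obtains n where "ideal_power R (jacobson_radical R) n = {\<zero>}"
proof -
  interpret M: left_module R "regular_module R" by (rule left_module_regular)
  let ?J = "jacobson_radical R" let ?p = "ideal_power R (jacobson_radical R)"
  have sub: "submodule (?p n) R (regular_module R)" for n
    using ideal_power_ideal[OF jacobson_ideal] ideal_iff by blast
  obtain Y where Y: "\<exists>n. Y = ?p n" "\<And>Z. \<exists>n. Z = ?p n \<Longrightarrow> Z \<subseteq> Y \<Longrightarrow> Z = Y"
    by (rule fin_min[OF assms, of "\<lambda>Z. \<exists>n. Z = ?p n" "?p 0"]) (use sub in blast)+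
  then obtain n where n: "Y = ?p n" by blast
  have "?p n = {\<zero>}"
  proof (rule ccontr)
    assume ne: "?p n \<noteq> {\<zero>}"
    let ?N = "(regular_module R)\<lparr>carrier := ?p n\<rparr>"
    interpret N: left_module R ?N by (rule M.left_module_sub[OF sub])
    obtain K where K: "maximal_submodule R ?N K"
      using N.max_sub_exists[OF M.fin_sub[OF sub assms] N.submodule_zero] ne by auto
    then have K': "submodule K R ?N" "K \<noteq> ?p n" by (auto simp: maximal_submodule_def)
    have "?p (Suc n) \<subseteq> K"
    proof
      fix x assume "x \<in> ?p (Suc n)"
      then have "x \<in> ideal_prod R ?J (?p n)" by simp
      then show "x \<in> K"
      proof induction
        case (prod j x)
        then show ?case using N.radical_smult[OF K, of x j] by simp
      next
        case (sum a b)
        then show ?case using N.sub_add[OF K'(1), of a b] by simp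
      qed
    qed
    moreover have "K \<subseteq> ?p n" using N.sub_subset[OF K'(1)] by simp
    ultimately have "?p (Suc n) = ?p n" using Y(2)[of "?p (Suc n)"] n by blast
    then show False using \<open>?p (Suc n) \<subseteq> K\<close> \<open>K \<subseteq> ?p n\<close> K'(2) by auto
  qed
  then show ?thesis using that by blast
qed

text \<open>Serves the left-right symmetry of the radical. If \<open>x\<close> avoids a maximal left
  ideal \<open>N\<close>, then \<open>1 = z + a x\<close> with \<open>z \<in> N\<close>, and modulo
  \<open>N\<close> every power of \<open>a x\<close> is congruent to 1; nilpotency of
  \<open>a x\<close> gives \<open>1 \<in> N\<close>.\<close>

lemma nil_ideal_jacobson:
  assumes K: "ideal K R" and nil: "\<And>x. x \<in> K \<Longrightarrow> \<exists>n::nat. x [^] n = \<zero>"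
  shows "K \<subseteq> jacobson_radical R"
proof
  interpret M: left_module R "regular_module R" by (rule left_module_regular)
  fix x assume x: "x \<in> K"
  have xc: "x \<in> carrier R" using ideal.Icarr[OF K x] .
  have "x \<in> N" if N: "maximal_submodule R (regular_module R) N" for N
  proof (rule ccontr)
    assume "x \<notin> N"
    then obtain z a where za: "z \<in> N" "a \<in> carrier R" "\<one> = z \<oplus> a \<otimes> x"
      using M.maximal_gen[OF N, of x \<one>] xc by auto
    have Ns: "submodule N R (regular_module R)" "N \<noteq> carrier R" using N by (auto simp: maximal_submodule_def)
    note Nl = Ns(1)[unfolded left_ideal_iff]
    let ?y = "a \<otimes> x"
    have yc: "?y \<in> carrier R" using za xc by simp
    have zc: "z \<in> carrier R" using za Nl by auto
    have "\<exists>w\<in>N. \<one> = w \<oplus> ?y [^] n" for n :: nat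
    proof (induction n)
      case 0
      then show ?case using Nl by (intro bexI[of _ \<zero>]) auto
    next
      case (Suc n)
      then obtain w where w: "w \<in> N" "\<one> = w \<oplus> ?y [^] n" by blast
      have wc: "w \<in> carrier R" using w Nl by auto
      have "?y [^] n = ?y [^] n \<otimes> (z \<oplus> ?y)" unfolding za(3)[symmetric] using yc by simp
      also have "\<dots> = ?y [^] n \<otimes> z \<oplus> ?y [^] Suc n" using yc zc by (simp add: r_distr)
      finally have "\<one> = w \<oplus> (?y [^] n \<otimes> z \<oplus> ?y [^] Suc n)" using w(2) by simp
      then have "\<one> = (w \<oplus> ?y [^] n \<otimes> z) \<oplus> ?y [^] Suc n" using wc zc yc by (simp add: a_assoc)
      moreover have "w \<oplus> ?y [^] n \<otimes> z \<in> N" using Nl w za yc by auto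
      ultimately show ?case by blast
    qed
    moreover have "?y \<in> K" using ideal.I_l_closed[OF K x za(2)] .
    then obtain n :: nat where "?y [^] n = \<zero>" using nil by blast
    ultimately obtain w where "w \<in> N" "\<one> = w \<oplus> \<zero>" by metis
    then have "\<one> \<in> N" using Nl by auto
    then have "N = carrier R" using Nl by auto (metis r_one)
    then show False using Ns by blast
  qed
  then show "x \<in> jacobson_radical R" using xc by (auto simp: jacobson_radical_def rad_def)
qed

text \<open>If \<open>x\<close> avoids a maximal left ideal, then \<open>x = x z + x (a x)\<close>
  with \<open>z\<close> in that ideal, and \<open>x (a x)\<close> is a product of two elements of
  \<open>L\<close>, hence in the radical. Used for \<open>L\<close> the image of a map from a module
  to the ring.\<close>

lemma sq_jacobson:
  assumes L: "submodule L R (regular_module R)" and sq: "\<And>x y. x \<in> L \<Longrightarrow> y \<in> L \<Longrightarrow> x \<otimes> y \<in> jacobson_radical R"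
  shows "L \<subseteq> jacobson_radical R"
proof
  interpret M: left_module R "regular_module R" by (rule left_module_regular)
  fix x assume x: "x \<in> L"
  note Ll = L[unfolded left_ideal_iff]
  have xc: "x \<in> carrier R" using x Ll by auto
  have "x \<in> N" if N: "maximal_submodule R (regular_module R) N" for N
  proof (rule ccontr)
    assume xN: "x \<notin> N"
    then obtain z a where za: "z \<in> N" "a \<in> carrier R" "\<one> = z \<oplus> a \<otimes> x"
      using M.maximal_gen[OF N, of x \<one>] xc by auto
    have Ns: "submodule N R (regular_module R)" using N by (auto simp: maximal_submodule_def)
    note Nl = Ns[unfolded left_ideal_iff]
    have zc: "z \<in> carrier R" using za Nl by auto
    have "x = x \<otimes> (z \<oplus> a \<otimes> x)" unfolding za(3)[symmetric] using xc by simp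
    also have "\<dots> = x \<otimes> z \<oplus> x \<otimes> (a \<otimes> x)" using za xc zc by (simp add: r_distr)
    finally have "x = x \<otimes> z \<oplus> x \<otimes> (a \<otimes> x)" .
    moreover have "x \<otimes> (a \<otimes> x) \<in> jacobson_radical R" using sq x Ll za by blast
    then have "x \<otimes> (a \<otimes> x) \<in> N" using N by (auto simp: jacobson_radical_def rad_def)
    ultimately show False using Nl za xc xN by metis
  qed
  then show "x \<in> jacobson_radical R" using xc by (auto simp: jacobson_radical_def rad_def)
qed

end

section \<open>The radical and its powers in the opposite ring\<close>

lemma opp_simps [simp]:
  "carrier (opp A) = carrier A" "\<zero>\<^bsub>opp A\<^esub> = \<zero>\<^bsub>A\<^esub>" "\<one>\<^bsub>opp A\<^esub> = \<one>\<^bsub>A\<^esub>"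
  "x \<oplus>\<^bsub>opp A\<^esub> y = x \<oplus>\<^bsub>A\<^esub> y" "x \<otimes>\<^bsub>opp A\<^esub> y = y \<otimes>\<^bsub>A\<^esub> x" "add (opp A) = add A"
  by (simp_all add: opp_def)

lemma (in ring) ring_opp: "ring (opp R)"
proof -
  have "abelian_group (opp R)"
    by (rule abelian_groupI) (auto simp: add.m_ac intro!: bexI[of _ "\<ominus> _"] l_neg)
  moreover have "monoid (opp R)" by (rule monoidI) (auto simp: m_assoc)
  ultimately show ?thesis by (intro ringI) (auto simp: abelian_group_def l_distr r_distr m_assoc
     intro: abelian_group.axioms monoid.m_assoc)
qed

lemma (in ring) ideal_opp: assumes "ideal K R" shows "ideal K (opp R)"
proof -
  interpret B: ring "opp R" by (rule ring_opp)
  interpret K: ideal K R by fact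
  show ?thesis unfolding B.ideal_iff B.left_ideal_iff using K.I_l_closed K.I_r_closed K.Icarr by auto
qed

lemma (in ring) pow_opp: assumes "x \<in> carrier R" shows "x [^]\<^bsub>opp R\<^esub> (n::nat) = x [^] n"
proof (induction n)
  case 0
  then show ?case by (simp add: nat_pow_def)
next
  case (Suc n)
  interpret B: ring "opp R" by (rule ring_opp)
  show ?case using Suc B.nat_pow_Suc[of x n] nat_pow_Suc2[OF assms, of n] by simp
qed

text \<open>The radical is a two-sided nilpotent ideal, a property independent of the side, and
  \<open>nil_ideal_jacobson\<close> applies in the opposite ring.\<close>

lemma (in ring) jacobson_opp_sub:
  assumes "fin_len R (regular_module R)" shows "jacobson_radical R \<subseteq> jacobson_radical (opp R)"
proof -
  interpret B: ring "opp R" by (rule ring_opp)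
  obtain n where n: "ideal_power R (jacobson_radical R) n = {\<zero>}" using jacobson_nilpotent[OF assms] .
  show ?thesis
  proof (rule B.nil_ideal_jacobson[OF ideal_opp[OF jacobson_ideal]])
    fix x assume x: "x \<in> jacobson_radical R"
    then have "x [^] n = \<zero>" using elem_power[OF jacobson_ideal x, of n] n by simp
    then show "\<exists>n::nat. x [^]\<^bsub>opp R\<^esub> n = \<zero>\<^bsub>opp R\<^esub>" using pow_opp[OF jacobson_carr[OF x]] by auto
  qed
qed

lemma (in ring) jacobson_opp:
  assumes "fin_len R (regular_module R)" "fin_len (opp R) (regular_module (opp R))"
  shows "jacobson_radical (opp R) = jacobson_radical R"
  using jacobson_opp_sub[OF assms(1)] ring.jacobson_opp_sub[OF ring_opp assms(2)] by (simp add: opp_opp)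

text \<open>Products of ideals are reversed in the opposite ring, and a power does not change when
  its factors are reversed.\<close>

lemma (in ring) ideal_power_opp:
  assumes "ideal I R" shows "ideal_power (opp R) I n = ideal_power R I n"
proof (induction n)
  case (Suc n)
  have "x \<in> ideal_prod (opp R) X Y \<longleftrightarrow> x \<in> ideal_prod R Y X" for x X Y
  proof
    show "x \<in> ideal_prod R Y X" if "x \<in> ideal_prod (opp R) X Y"
      using that by induction (auto intro: ideal_prod.intros)
    show "x \<in> ideal_prod (opp R) X Y" if "x \<in> ideal_prod R Y X"
      using that
    proof induction
      case (prod i j)
      then show ?case using ideal_prod.prod[of j X i Y "opp R"] by simp
    next
      case (sum a b)
      then show ?case using ideal_prod.sum[of a "opp R" X Y b] by simp
    qed
  qed
  then show ?case using Suc ideal_power_commute[OF assms, of n] by auto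
qed simp

section \<open>Local modules\<close>

text \<open>A module with such an \<open>N\<close> is local, and \<open>N\<close> is its radical
  (\<open>largest_rad\<close>). Any single element outside \<open>N\<close> generates the module
  (\<open>largest_gen\<close>).\<close>

definition largest_proper :: "('a, 'k) ring_scheme \<Rightarrow> ('a, 'm) module \<Rightarrow> 'm set \<Rightarrow> bool" where
  "largest_proper A M N \<longleftrightarrow> submodule N A M \<and> N \<noteq> carrier M \<and>
     (\<forall>L. submodule L A M \<longrightarrow> L \<noteq> carrier M \<longrightarrow> L \<subseteq> N)"

context left_module
begin

lemma largest_maximal: "largest_proper A M N \<Longrightarrow> maximal_submodule A M N"
  unfolding largest_proper_def maximal_submodule_def by blast

lemma largest_rad: "largest_proper A M N \<Longrightarrow> rad A M = N"
proof -
  assume N: "largest_proper A M N"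
  then have "L = N" if "maximal_submodule A M L" for L
    using that unfolding largest_proper_def maximal_submodule_def by blast
  then have "{L. maximal_submodule A M L} = {N}" using largest_maximal[OF N] by blast
  then show ?thesis using N sub_subset unfolding rad_def largest_proper_def by auto
qed

lemma largest_gen:
  assumes "largest_proper A M N" "submodule L A M" "x \<in> L" "x \<notin> N" shows "L = carrier M"
  using assms unfolding largest_proper_def by blast

text \<open>By finite length a proper submodule lies in a maximal one, and every maximal one
  contains the radical, hence equals it.\<close>

lemma simple_top_largest:
  assumes "fin_len A M" "maximal_submodule A M (rad A M)" shows "largest_proper A M (rad A M)"
proof -
  have "L \<subseteq> rad A M" if L: "submodule L A M" "L \<noteq> carrier M" for L
  proof -
    obtain K where K: "maximal_submodule A M K" "L \<subseteq> K" using max_sub_exists[OF assms(1) L] by blast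
    then have "rad A M \<subseteq> K" by (auto simp: rad_def)
    then have "K = rad A M" using K(1) assms(2) unfolding maximal_submodule_def by blast
    then show ?thesis using K by simp
  qed
  then show ?thesis using assms(2) unfolding largest_proper_def maximal_submodule_def by blast
qed

text \<open>A left ideal \<open>Y\<close> minimal with \<open>Y p = M\<close>
  meets the annihilator of \<open>p\<close> modulo \<open>N\<close> inside every maximal left ideal.\<close>

lemma local_rad_eq:
  assumes fin: "fin_len A (regular_module A)" and N: "largest_proper A M N"
    and p: "p \<in> carrier M" "p \<notin> N" and n: "n \<in> N"
  obtains j where "j \<in> jacobson_radical A" "n = j \<odot>\<^bsub>M\<^esub> p"
proof -
  interpret R: left_module A "regular_module A" by (rule A.left_module_regular)
  interpret h: module_hom A "regular_module A" M "\<lambda>a\<in>carrier A. a \<odot>\<^bsub>M\<^esub> p"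
    by (rule orbit_module_hom[OF p(1)])
  let ?h = "\<lambda>a\<in>carrier A. a \<odot>\<^bsub>M\<^esub> p"
  have NS: "submodule N A M" using N by (simp add: largest_proper_def)
  let ?P = "\<lambda>Y. submodule Y A (regular_module A) \<and> ?h ` Y = carrier M"
  have "?h ` carrier A = carrier M"
  proof (rule largest_gen[OF N])
    show "submodule (?h ` carrier A) A M" using h.sub_image[OF R.submodule_carrier] by simp
    show "p \<in> ?h ` carrier A" using lsmult_one[OF p(1)] by (intro image_eqI[of _ _ "\<one>\<^bsub>A\<^esub>"]) auto
  qed (rule p(2))
  then have "?P (carrier A)" using R.submodule_carrier by simp
  then obtain Y where Y: "?P Y" "\<And>Z. ?P Z \<Longrightarrow> Z \<subseteq> Y \<Longrightarrow> Z = Y"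
    by (rule fin_min[OF fin, of ?P "carrier A"]) simp_all
  have "n \<in> carrier M" using n NS sub_carr by blast
  then obtain y where y: "y \<in> Y" "n = ?h y" using Y(1) by blast
  have yc: "y \<in> carrier A" using R.sub_carr[of Y y] Y y by simp
  have "y \<in> L" if L: "maximal_submodule A (regular_module A) L" for L
  proof (rule ccontr)
    assume "y \<notin> L"
    have LS: "submodule L A (regular_module A)" using L by (simp add: maximal_submodule_def)
    have YL: "submodule (Y \<inter> L) A (regular_module A)" using R.submodule_Int Y LS by blast
    \<comment> \<open>Some \<open>q\<close> in \<open>Y\<close> has \<open>q p = p\<close>; write
      \<open>q = l + a y\<close> with \<open>l \<in> L\<close>. As \<open>a y p = a n\<close> lies
      in \<open>N\<close>, the vector \<open>l p\<close> lies outside \<open>N\<close> and generates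
      \<open>M\<close>, and \<open>l\<close> is in \<open>Y \<inter> L\<close>. By minimality of
      \<open>Y\<close> then \<open>Y \<subseteq> L\<close>.\<close>
    have "?h ` (Y \<inter> L) = carrier M"
    proof -
      obtain q where q: "q \<in> Y" "?h q = p" using Y(1) p(1) by (metis (no_types, lifting) imageE)
      have qc: "q \<in> carrier A" using R.sub_carr[of Y q] Y q by simp
      obtain l a where la: "l \<in> L" "a \<in> carrier A" "q = l \<oplus>\<^bsub>A\<^esub> a \<otimes>\<^bsub>A\<^esub> y"
        using R.maximal_gen[OF L, of y q] yc qc \<open>y \<notin> L\<close> by auto
      have lc: "l \<in> carrier A" using R.sub_carr[OF LS la(1)] by simp
      have ay: "a \<otimes>\<^bsub>A\<^esub> y \<in> Y" using R.sub_smult[of Y a y] Y la y by simp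
      have "l = q \<ominus>\<^bsub>regular_module A\<^esub> a \<otimes>\<^bsub>A\<^esub> y" using R.madd_diff[of l "a \<otimes>\<^bsub>A\<^esub> y"] la lc yc by simp
      then have "l \<in> Y" using R.sub_diff[of Y q "a \<otimes>\<^bsub>A\<^esub> y"] Y q ay by simp
      moreover have "?h l \<notin> N"
      proof
        assume "?h l \<in> N"
        moreover have "?h (a \<otimes>\<^bsub>A\<^esub> y) \<in> N" using h.smult[of a y] sub_smult[OF NS la(2) n] y la(2) yc by simp
        ultimately have "?h l \<oplus>\<^bsub>M\<^esub> ?h (a \<otimes>\<^bsub>A\<^esub> y) \<in> N" using sub_add[OF NS] by blast
        moreover have "p = ?h l \<oplus>\<^bsub>M\<^esub> ?h (a \<otimes>\<^bsub>A\<^esub> y)" using h.add[of l "a \<otimes>\<^bsub>A\<^esub> y"] q(2) la lc yc by simp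
        ultimately show False using p(2) by simp
      qed
      ultimately show ?thesis using largest_gen[OF N h.sub_image[OF YL], of "?h l"] la(1) by blast
    qed
    then have "Y \<inter> L = Y" using Y(2)[of "Y \<inter> L"] YL by blast
    then show False using y(1) \<open>y \<notin> L\<close> by blast
  qed
  then have "y \<in> jacobson_radical A" using yc by (auto simp: jacobson_radical_def rad_def)
  then show ?thesis using that y yc by simp
qed

end

section \<open>Endomorphisms of modules of finite length\<close>

lemma (in left_module) surj_endo_inj:
  assumes fin: "fin_len A M" and f: "f \<in> mod_hom A M M" and surj: "f ` carrier M = carrier M"
  shows "inj_on f (carrier M)"
proof (rule ccontr)
  interpret f: module_hom A M M f by (rule module_homI[OF left_module_axioms left_module_axioms f])
  assume "\<not> inj_on f (carrier M)"
  then have ne: "mod_ker M M f \<noteq> {\<zero>\<^bsub>M\<^esub>}" using f.inj_iff by blast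
  let ?n = "comp_length A M"
  have "({\<zero>\<^bsub>M\<^esub>}, carrier M) \<in> strict A M ^^ ?n"
    using relpow_inf[OF comp_length_chain[OF fin]] by simp
  \<comment> \<open>The preimage of a longest chain is a chain of the same length that starts at the
    kernel. Below a nonzero kernel one more step fits, which exceeds the length.\<close>
  then have "(mod_ker M M f, carrier M) \<in> strict A M ^^ ?n"
    using f.strict_chain_pre[OF surj _ submodule_zero, of "carrier M" ?n] by (simp add: f.pre_ker f.pre_carrier)
  moreover have "({\<zero>\<^bsub>M\<^esub>}, mod_ker M M f) \<in> strict A M"
    using ne sub_zero[OF f.sub_ker] submodule_zero f.sub_ker by (auto simp: strict_def)
  ultimately have "({\<zero>\<^bsub>M\<^esub>}, carrier M) \<in> strict A M ^^ Suc ?n" by (rule relpow_Suc_I2[rotated])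
  then show False using strict_le_comp_length[OF fin _ submodule_zero] by fastforce
qed

lemma (in left_module) iter_hom:
  assumes f: "f \<in> mod_hom A M M"
  shows "restrict (f ^^ n) (carrier M) \<in> mod_hom A M M"
proof (rule mod_hom_restrictI[OF left_module_axioms])
  show c: "(f ^^ n) x \<in> carrier M" if "x \<in> carrier M" for x
    using that by (induction n) (auto simp: mod_homD(1)[OF f])
  show "(f ^^ n) (x \<oplus>\<^bsub>M\<^esub> y) = (f ^^ n) x \<oplus>\<^bsub>M\<^esub> (f ^^ n) y" if "x \<in> carrier M" "y \<in> carrier M" for x y
  proof (induction n)
    case (Suc n)
    have "(f ^^ n) z \<in> carrier M" if "z \<in> carrier M" for z
      using that by (induction n) (auto simp: mod_homD(1)[OF f])
    then show ?case using Suc that mod_homD(2)[OF f] by simp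
  qed simp
  show "(f ^^ n) (a \<odot>\<^bsub>M\<^esub> x) = a \<odot>\<^bsub>M\<^esub> (f ^^ n) x" if "a \<in> carrier A" "x \<in> carrier M" for a x
  proof (induction n)
    case (Suc n)
    have "(f ^^ n) z \<in> carrier M" if "z \<in> carrier M" for z
      using that by (induction n) (auto simp: mod_homD(1)[OF f])
    then show ?case using Suc that mod_homD(3)[OF f] by simp
  qed simp
qed

text \<open>Fitting's lemma: once the kernels and images of the iterates are stable, the module is
  the direct sum of the two, so one of them vanishes. A zero image means nilpotency, a zero kernel
  bijectivity.\<close>

lemma (in left_module) fitting:
  assumes fin: "fin_len A M" and ind: "indecomposable A M" and f: "f \<in> mod_hom A M M"
  shows "(\<exists>n. \<forall>x\<in>carrier M. (f ^^ n) x = \<zero>\<^bsub>M\<^esub>) \<or> bij_betw f (carrier M) (carrier M)"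
proof -
  define K where "K = (\<lambda>n. {x \<in> carrier M. (f ^^ n) x = \<zero>\<^bsub>M\<^esub>})"
  define I where "I = (\<lambda>n. (f ^^ n) ` carrier M)"
  have hom: "module_hom A M M (restrict (f ^^ n) (carrier M))" for n
    by (rule module_homI[OF left_module_axioms left_module_axioms iter_hom[OF f]])
  interpret f: module_hom A M M f by (rule module_homI[OF left_module_axioms left_module_axioms f])
  have K: "submodule (K n) A M" for n
    using module_hom.sub_ker[OF hom[of n]] by (simp add: K_def mod_ker_def cong: conj_cong)
  have I: "submodule (I n) A M" for n
    using module_hom.sub_image[OF hom[of n] submodule_carrier] by (simp add: I_def)
  have fc: "(f ^^ n) x \<in> carrier M" if "x \<in> carrier M" for n x
    using sub_carr[OF I[of n]] that by (auto simp: I_def)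
  have Kmono: "K n \<subseteq> K (n + k)" for n k
  proof (induction k)
    case (Suc k)
    have "K m \<subseteq> K (Suc m)" for m by (auto simp: K_def f.zero)
    then show ?case using Suc by fastforce
  qed simp
  have Imono: "I (n + k) \<subseteq> I n" for n k
    using fc by (auto simp: I_def funpow_add)
  obtain Y where Y: "\<exists>n. Y = K n" "\<And>Z. \<exists>n. Z = K n \<Longrightarrow> Y \<subseteq> Z \<Longrightarrow> Z = Y"
    by (rule fin_max[OF fin, of "\<lambda>Z. \<exists>n. Z = K n" "K 0" "carrier M"]) (use K sub_subset submodule_carrier in blast)+
  obtain Z where Z: "\<exists>n. Z = I n" "\<And>Z'. \<exists>n. Z' = I n \<Longrightarrow> Z' \<subseteq> Z \<Longrightarrow> Z' = Z"
    by (rule fin_min[OF fin, of "\<lambda>Z. \<exists>n. Z = I n" "I 0"]) (use I in blast)+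
  obtain k i where ki: "Y = K k" "Z = I i" using Y(1) Z(1) by blast
  \<comment> \<open>Large enough both for the kernels, stable from \<open>k\<close> on, and for the
    images, stable from \<open>i\<close> on.\<close>
  define n where "n = k + i"
  have Kn: "K (n + m) = K n" for m
    using Y(2)[of "K (k + (i + m))"] Y(2)[of "K (k + i)"] Kmono[of k] ki by (auto simp: n_def add.assoc)
  have In: "I (n + m) = I n" for m
    using Z(2)[of "I (i + (k + m))"] Z(2)[of "I (i + k)"] Imono[of i] ki by (auto simp: n_def add.assoc add.commute add.left_commute)
  have "K n \<inter> I n = {\<zero>\<^bsub>M\<^esub>}"
  proof -
    have "x = \<zero>\<^bsub>M\<^esub>" if "x \<in> K n" "x \<in> I n" for x
    proof -
      obtain y where y: "y \<in> carrier M" "x = (f ^^ n) y" using \<open>x \<in> I n\<close> by (auto simp: I_def)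
      then have "y \<in> K (n + n)" using \<open>x \<in> K n\<close> by (auto simp: K_def funpow_add)
      then show ?thesis using Kn y by (auto simp: K_def)
    qed
    then show ?thesis using sub_zero[OF K] sub_zero[OF I] by blast
  qed
  moreover have "K n <+>\<^bsub>M\<^esub> I n = carrier M"
  proof
    show "K n <+>\<^bsub>M\<^esub> I n \<subseteq> carrier M" using submodule_set_add[OF K I] sub_subset by blast
    show "carrier M \<subseteq> K n <+>\<^bsub>M\<^esub> I n"
    proof
      fix x assume x: "x \<in> carrier M"
      have "(f ^^ n) x \<in> I (n + n)" using x In[of n] by (auto simp: I_def)
      then obtain y where y: "y \<in> carrier M" "(f ^^ n) x = (f ^^ n) ((f ^^ n) y)"
        by (auto simp: I_def funpow_add)
      let ?y = "(f ^^ n) y"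
      have yc: "?y \<in> carrier M" "?y \<in> I n" using y fc by (auto simp: I_def)
      have "(f ^^ n) (x \<ominus>\<^bsub>M\<^esub> ?y) = (f ^^ n) x \<ominus>\<^bsub>M\<^esub> (f ^^ n) ?y"
        using module_hom.diff[OF hom[of n] x yc(1)] x yc(1) by simp
      then have "x \<ominus>\<^bsub>M\<^esub> ?y \<in> K n" using y(2) x yc diff_self[OF fc] by (simp add: K_def)
      then show "x \<in> K n <+>\<^bsub>M\<^esub> I n" using yc(2) mdiff_add[OF x yc(1)] unfolding mem_set_add by metis
    qed
  qed
  ultimately have "K n = {\<zero>\<^bsub>M\<^esub>} \<or> I n = {\<zero>\<^bsub>M\<^esub>}"
    using ind K[of n] I[of n] unfolding indecomposable_def by blast
  then show ?thesis
  proof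
    assume "I n = {\<zero>\<^bsub>M\<^esub>}"
    then show ?thesis unfolding I_def by blast
  next
    assume K0: "K n = {\<zero>\<^bsub>M\<^esub>}"
    then have "I n = carrier M"
      using \<open>K n <+>\<^bsub>M\<^esub> I n = carrier M\<close> sub_carr[OF I[of n]] by (force simp: set_add_def')
    then have "I 1 = carrier M"
    proof (cases n)
      case 0
      then have "I (0 + 1) = I 0" using In[of 1] by simp
      then show ?thesis by (simp add: I_def)
    next
      case (Suc m)
      then show ?thesis using Imono[of 1 m] \<open>I n = carrier M\<close> sub_carr[OF I[of 1]] by auto
    qed
    moreover have "K 1 = {\<zero>\<^bsub>M\<^esub>}"
    proof -
      have "K 1 \<subseteq> {\<zero>\<^bsub>M\<^esub>}" using Kmono[of 1 n] Kn[of 1] K0 by (simp add: add.commute)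
      then show ?thesis using sub_zero[OF K[of 1]] by auto
    qed
    ultimately have "f ` carrier M = carrier M" "mod_ker M M f = {\<zero>\<^bsub>M\<^esub>}"
      by (auto simp: I_def K_def mod_ker_def)
    then show ?thesis using f.inj_iff by (simp add: bij_betw_def)
  qed
qed

text \<open>Suppose a proper \<open>L\<close> contains some \<open>l\<close> outside the maximal
  \<open>N\<close>. Projectivity lifts \<open>P \<rightarrow> P / N\<close> through
  \<open>a \<mapsto> a l\<close>, which yields an endomorphism with image in \<open>L\<close> that
  is the identity modulo \<open>N\<close>. It is not nilpotent, so it is bijective by Fitting's
  lemma, and \<open>L = P\<close>.\<close>

lemma projective_local:
  assumes fin: "fin_len A (regular_module A)" and P: "projective A P" and ind: "indecomposable A P"
  obtains N where "largest_proper A P N"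
proof -
  have fg: "fg_module A P" using P by (simp add: projective_def)
  interpret P: left_module A P by (rule fg_left_module[OF fg])
  have finP: "fin_len A P" by (rule fg_fin[OF fg fin])
  obtain N where N: "maximal_submodule A P N"
    using P.max_sub_exists[OF finP P.submodule_zero] ind unfolding indecomposable_def by metis
  have NS: "submodule N A P" "N \<noteq> carrier P" using N by (auto simp: maximal_submodule_def)
  interpret q: module_hom A P "quot_module P N" "P.quot_map N" by (rule P.quot_hom[OF NS(1)])
  obtain n x h where db: "dual_basis A P n x h" using projective_dual_basis[OF P] .
  have "L \<subseteq> N" if L: "submodule L A P" "L \<noteq> carrier P" for L
  proof (rule ccontr)
    assume "\<not> L \<subseteq> N"
    then obtain l where l: "l \<in> L" "l \<notin> N" by blast
    have lc: "l \<in> carrier P" using P.sub_carr[OF L(1) l(1)] .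
    have g: "compose (carrier (regular_module A)) (P.quot_map N) (\<lambda>a\<in>carrier A. a \<odot>\<^bsub>P\<^esub> l)
        \<in> mod_hom A (regular_module A) (quot_module P N)" (is "?g \<in> _")
      by (rule mod_hom_comp[OF P.A.left_module_regular P.orbit_hom[OF lc] q.hom])
    have "?g ` carrier (regular_module A) = carrier (quot_module P N)"
    proof
      show "?g ` carrier (regular_module A) \<subseteq> carrier (quot_module P N)" using mod_homD(1)[OF g] by blast
      show "carrier (quot_module P N) \<subseteq> ?g ` carrier (regular_module A)"
      proof
        fix X assume "X \<in> carrier (quot_module P N)"
        then obtain y where y: "y \<in> carrier P" "X = P.quot_map N y"
          using P.quot_map_surj[OF NS(1)] by (metis imageE)
        obtain m a where ma: "m \<in> N" "a \<in> carrier A" "y = m \<oplus>\<^bsub>P\<^esub> a \<odot>\<^bsub>P\<^esub> l"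
          using P.maximal_gen[OF N lc l(2) y(1)] by blast
        have "m \<in> mod_ker P (quot_module P N) (P.quot_map N)"
          using ma(1) P.quot_map_ker[OF NS(1)] by simp
        then have mc: "m \<in> carrier P" "P.quot_map N m = \<zero>\<^bsub>quot_module P N\<^esub>" by (auto simp: mod_ker_def)
        have "X = P.quot_map N (a \<odot>\<^bsub>P\<^esub> l)"
          using y ma q.add[OF mc(1), of "a \<odot>\<^bsub>P\<^esub> l"] mc(2) P.lsmult_closed[OF ma(2) lc] q.closed by simp
        then show "X \<in> ?g ` carrier (regular_module A)" using ma(2) by (auto simp: compose_def)
      qed
    qed
    then obtain k where k: "k \<in> mod_hom A P (regular_module A)"
      "\<And>y. y \<in> carrier P \<Longrightarrow> ?g (k y) = P.quot_map N y"
      using dual_basis_lift[OF P.left_module_axioms P.A.left_module_regular q.N.left_module_axioms db g _ q.hom] by blast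
    let ?\<phi> = "compose (carrier P) (\<lambda>a\<in>carrier A. a \<odot>\<^bsub>P\<^esub> l) k"
    have \<phi>: "?\<phi> \<in> mod_hom A P P" by (rule mod_hom_comp[OF P.left_module_axioms k(1) P.orbit_hom[OF lc]])
    have \<phi>N: "y \<ominus>\<^bsub>P\<^esub> ?\<phi> y \<in> N" if y: "y \<in> carrier P" for y
    proof -
      have kc: "k y \<in> carrier A" using mod_homD(1)[OF k(1) y] by simp
      then have "P.quot_map N (?\<phi> y) = P.quot_map N y" using k(2)[OF y] y by (simp add: compose_def)
      then show ?thesis using P.coset_eq_iff[OF NS(1) y mod_homD(1)[OF \<phi> y]] mod_homD(1)[OF \<phi> y] y
        by (simp add: P.quot_map_def[OF NS(1)])
    qed
    obtain p where p: "p \<in> carrier P" "p \<notin> N" using NS P.sub_subset by blast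
    have pow: "(?\<phi> ^^ m) p \<in> carrier P \<and> (?\<phi> ^^ m) p \<notin> N" for m
    proof (induction m)
      case (Suc m)
      let ?y = "(?\<phi> ^^ m) p"
      have c: "?\<phi> ?y \<in> carrier P" using mod_homD(1)[OF \<phi>] Suc by blast
      have "?\<phi> ?y \<notin> N"
      proof
        assume "?\<phi> ?y \<in> N"
        then have "?y \<in> N" using \<phi>N[of ?y] P.diff_mem_iff[OF NS(1)] Suc by blast
        then show False using Suc by blast
      qed
      then show ?case using c by (simp only: funpow.simps o_apply) blast
    qed (use p in simp)
    then have "\<not> (\<exists>m. \<forall>x\<in>carrier P. (?\<phi> ^^ m) x = \<zero>\<^bsub>P\<^esub>)" using p P.sub_zero[OF NS(1)] by metis
    then have "bij_betw ?\<phi> (carrier P) (carrier P)" using P.fitting[OF finP ind \<phi>] by blast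
    moreover have "?\<phi> ` carrier P \<subseteq> L"
      using mod_homD(1)[OF k(1)] P.sub_smult[OF L(1) _ l(1)] by (auto simp: compose_def)
    ultimately show False using L P.sub_subset[OF L(1)] by (auto simp: bij_betw_def)
  qed
  then have "largest_proper A P N" using NS unfolding largest_proper_def by blast
  then show ?thesis using that by blast
qed

text \<open>Consider the endomorphisms \<open>y \<mapsto> (h y) p\<close> of \<open>P\<close>. If
  all of them have image in \<open>N\<close>, then products of two elements of \<open>h(P)\<close>
  lie in \<open>J\<close>, so \<open>h(P) \<subseteq> J\<close> by \<open>sq_jacobson\<close>.
  Otherwise one of them is onto, hence invertible, and \<open>b\<close> is the value of
  \<open>h'\<close> at the preimage of \<open>p\<close>.\<close>

lemma local_hom_gen:
  assumes fin: "fin_len A (regular_module A)" and P: "left_module A P" and finP: "fin_len A P"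
    and N: "largest_proper A P N"
    and h: "h \<in> mod_hom A P (regular_module A)" and h': "h' \<in> mod_hom A P (regular_module A)"
    and nJ: "\<not> h ` carrier P \<subseteq> jacobson_radical A"
  obtains b where "b \<in> carrier A" "\<And>x. x \<in> carrier P \<Longrightarrow> h' x = h x \<otimes>\<^bsub>A\<^esub> b"
proof -
  interpret P: left_module A P by (rule P)
  interpret h: module_hom A P "regular_module A" h by (rule module_homI[OF P P.A.left_module_regular h])
  interpret h': module_hom A P "regular_module A" h' by (rule module_homI[OF P P.A.left_module_regular h'])
  have hc: "h x \<in> carrier A" if "x \<in> carrier P" for x using h.closed that by simp
  have NS: "submodule N A P" "N \<noteq> carrier P" using N by (auto simp: largest_proper_def)
  have "\<exists>p\<in>carrier P. \<exists>x\<in>carrier P. h x \<odot>\<^bsub>P\<^esub> p \<notin> N"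
  proof (rule ccontr)
    assume *: "\<not> ?thesis"
    obtain p0 where p0: "p0 \<in> carrier P" "p0 \<notin> N" using NS P.sub_subset by blast
    have "h ` carrier P \<subseteq> jacobson_radical A"
    proof (rule P.A.sq_jacobson)
      show "submodule (h ` carrier P) A (regular_module A)" by (rule h.sub_image[OF P.submodule_carrier])
      fix a b assume "a \<in> h ` carrier P" "b \<in> h ` carrier P"
      then obtain x y where xy: "x \<in> carrier P" "y \<in> carrier P" "a = h x" "b = h y" by blast
      \<comment> \<open>The product \<open>a b\<close> is \<open>h\<close> applied to
        \<open>(h x) y\<close>, an element of \<open>N = J p0\<close>; so it equals
        \<open>j (h p0)\<close>.\<close>
      then have "h x \<odot>\<^bsub>P\<^esub> y \<in> N" using * by blast
      then obtain j where j: "j \<in> jacobson_radical A" "h x \<odot>\<^bsub>P\<^esub> y = j \<odot>\<^bsub>P\<^esub> p0"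
        using P.local_rad_eq[OF fin N p0] by blast
      have "a \<otimes>\<^bsub>A\<^esub> b = h (h x \<odot>\<^bsub>P\<^esub> y)" using h.smult[OF hc[OF xy(1)] xy(2)] xy by simp
      also have "\<dots> = j \<otimes>\<^bsub>A\<^esub> h p0" using h.smult[OF P.A.jacobson_carr[OF j(1)] p0(1)] j(2) by simp
      also have "\<dots> \<in> jacobson_radical A"
        using ideal.I_r_closed[OF P.A.jacobson_ideal j(1) hc[OF p0(1)]] .
      finally show "a \<otimes>\<^bsub>A\<^esub> b \<in> jacobson_radical A" .
    qed
    then show False using nJ by blast
  qed
  then obtain p x where px: "p \<in> carrier P" "x \<in> carrier P" "h x \<odot>\<^bsub>P\<^esub> p \<notin> N" by blast
  let ?\<phi> = "compose (carrier P) (\<lambda>a\<in>carrier A. a \<odot>\<^bsub>P\<^esub> p) h"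
  have \<phi>: "?\<phi> \<in> mod_hom A P P" by (rule mod_hom_comp[OF P h P.orbit_hom[OF px(1)]])
  interpret \<phi>: module_hom A P P ?\<phi> by (rule module_homI[OF P P \<phi>])
  have \<phi>x: "?\<phi> y = h y \<odot>\<^bsub>P\<^esub> p" if "y \<in> carrier P" for y using that hc by (simp add: compose_def)
  have surj: "?\<phi> ` carrier P = carrier P"
    using P.largest_gen[OF N \<phi>.sub_image[OF P.submodule_carrier], of "?\<phi> x"] px \<phi>x by auto
  then have bij: "bij_betw ?\<phi> (carrier P) (carrier P)"
    using P.surj_endo_inj[OF finP \<phi>] by (simp add: bij_betw_def)
  let ?\<psi> = "restrict (inv_into (carrier P) ?\<phi>) (carrier P)"
  interpret \<psi>: module_hom A P P ?\<psi> by (rule module_homI[OF P P \<phi>.inverse[OF bij]])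
  have "h' y = h y \<otimes>\<^bsub>A\<^esub> h' (?\<psi> p)" if y: "y \<in> carrier P" for y
  proof -
    have "y = ?\<psi> (?\<phi> y)" using bij_betw_inv_into_left[OF bij y] \<phi>.closed[OF y] by simp
    also have "\<dots> = h y \<odot>\<^bsub>P\<^esub> ?\<psi> p" using \<phi>x[OF y] \<psi>.smult[OF hc[OF y] px(1)] by simp
    finally have "h' y = h' (h y \<odot>\<^bsub>P\<^esub> ?\<psi> p)" by simp
    then show ?thesis using h'.smult[OF hc[OF y] \<psi>.closed[OF px(1)]] by simp
  qed
  moreover have "h' (?\<psi> p) \<in> carrier A" using h'.closed[OF \<psi>.closed[OF px(1)]] by simp
  ultimately show ?thesis using that by blast
qed

section \<open>Primitive idempotents\<close>

context ring
begin

lemma mem_r_coset: "x \<in> H #> a \<longleftrightarrow> (\<exists>h\<in>H. x = h \<otimes> a)" by (auto simp: r_coset_def)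

lemma mem_l_coset: "x \<in> a <# H \<longleftrightarrow> (\<exists>h\<in>H. x = a \<otimes> h)" by (auto simp: l_coset_def)

lemma sub_r_coset:
  assumes I: "submodule I R (regular_module R)" and e: "e \<in> carrier R"
  shows "submodule (I #> e) R (regular_module R)"
proof -
  interpret M: left_module R "regular_module R" by (rule left_module_regular)
  interpret h: module_hom R "regular_module R" "regular_module R" "\<lambda>a\<in>carrier R. a \<odot>\<^bsub>regular_module R\<^esub> e"
    by (rule M.orbit_module_hom) (use e in simp)
  have "(\<lambda>a\<in>carrier R. a \<odot>\<^bsub>regular_module R\<^esub> e) ` I = I #> e"
    using M.sub_carr[OF I] by (force simp: mem_r_coset)
  then show ?thesis using h.sub_image[OF I] by simp
qed

lemma idem_r_coset: "e \<in> carrier R \<Longrightarrow> e \<otimes> e = e \<Longrightarrow> x \<in> carrier R #> e \<longleftrightarrow> x \<in> carrier R \<and> x \<otimes> e = x"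
  unfolding mem_r_coset by (metis m_assoc m_closed)

text \<open>\<open>A e\<close> is projective, with \<open>e\<close> and the inclusion into
  \<open>A\<close> as dual basis, and a decomposition of it writes \<open>e\<close> as a sum of two
  orthogonal idempotents. So \<open>projective_local\<close> applies, and
  \<open>local_rad_eq\<close> for the generator \<open>e\<close> identifies the largest proper
  submodule as \<open>J e\<close>.\<close>

lemma primitive_local:
  assumes fin: "fin_len R (regular_module R)" and e: "primitive_idempotent R e"
  shows "largest_proper R ((regular_module R)\<lparr>carrier := carrier R #> e\<rparr>) (jacobson_radical R #> e)"
proof -
  have ee: "e \<in> carrier R" "e \<otimes> e = e" "e \<noteq> \<zero>" using e by (auto simp: primitive_idempotent_def)
  interpret M: left_module R "regular_module R" by (rule left_module_regular)
  let ?P = "(regular_module R)\<lparr>carrier := carrier R #> e\<rparr>"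
  have Ps: "submodule (carrier R #> e) R (regular_module R)"
    using sub_r_coset[OF M.submodule_carrier ee(1)] by simp
  interpret P: left_module R ?P by (rule M.left_module_sub[OF Ps])
  have eP: "e \<in> carrier R #> e" using ee idem_r_coset by simp
  have xP: "x \<in> carrier R \<and> x \<otimes> e = x" if "x \<in> carrier R #> e" for x
    using that idem_r_coset[OF ee(1,2)] by simp
  have "dual_basis R ?P 1 (\<lambda>_. e) (\<lambda>_. restrict id (carrier R #> e))"
    unfolding dual_basis_def
  proof (intro conjI ballI allI impI)
    show "restrict id (carrier R #> e) \<in> mod_hom R ?P (regular_module R)"
      by (intro mod_homI) (use xP P.sub_add[OF P.submodule_carrier] P.sub_smult[OF P.submodule_carrier] in auto)
    show "y = finsum ?P (\<lambda>i. restrict id (carrier R #> e) y \<odot>\<^bsub>?P\<^esub> e) {..<1::nat}" if "y \<in> carrier ?P" for y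
    proof -
      have eq: "{..<1} = {0::nat}" by auto
      show ?thesis unfolding eq using that xP by simp
    qed
  qed (use eP in auto)
  then have proj: "projective R ?P" by (rule dual_basis_projective[OF P.left_module_axioms])
  have "X = {\<zero>} \<or> Y = {\<zero>}"
    if XY: "submodule X R ?P" "submodule Y R ?P" "X \<inter> Y = {\<zero>}" "X <+>\<^bsub>?P\<^esub> Y = carrier R #> e" for X Y
  proof -
    \<comment> \<open>These components of \<open>e\<close> are orthogonal idempotents:
      \<open>x y\<close> and \<open>y x\<close> lie in both summands, hence vanish.\<close>
    obtain x y where xy: "x \<in> X" "y \<in> Y" "e = x \<oplus> y" using eP XY(4) P.mem_set_add[of e X Y] by auto
    have xc: "x \<in> carrier R #> e" "y \<in> carrier R #> e"
      using xy P.sub_carr[OF XY(1)] P.sub_carr[OF XY(2)] by auto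
    then have c: "x \<in> carrier R" "y \<in> carrier R" "x \<otimes> e = x" "y \<otimes> e = y" using xP by auto
    have smX: "a \<otimes> z \<in> X" if "z \<in> X" "a \<in> carrier R" for a z
      using P.sub_smult[OF XY(1) that(2,1)] by simp
    have smY: "a \<otimes> z \<in> Y" if "z \<in> Y" "a \<in> carrier R" for a z
      using P.sub_smult[OF XY(2) that(2,1)] by simp
    have "x = x \<otimes> (x \<oplus> y)" "y = y \<otimes> (x \<oplus> y)" using c xy(3) by simp_all
    then have eq: "x = x \<otimes> y \<oplus> x \<otimes> x" "y = y \<otimes> x \<oplus> y \<otimes> y"
      using c(1,2) by (simp_all add: r_distr a_comm)
    have "x \<otimes> y \<in> Y" "y \<otimes> x \<in> X" "x \<otimes> x \<in> X" "y \<otimes> y \<in> Y" using smX smY xy c by auto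
    moreover have "x \<otimes> y \<in> X"
      using P.add_mem_iff[OF XY(1) \<open>x \<otimes> x \<in> X\<close>, of "x \<otimes> y"] eq(1) xy(1) P.sub_carr[OF XY(2) \<open>x \<otimes> y \<in> Y\<close>] by simp
    moreover have "y \<otimes> x \<in> Y"
      using P.add_mem_iff[OF XY(2) \<open>y \<otimes> y \<in> Y\<close>, of "y \<otimes> x"] eq(2) xy(2) P.sub_carr[OF XY(1) \<open>y \<otimes> x \<in> X\<close>] by simp
    ultimately have o: "x \<otimes> y = \<zero>" "y \<otimes> x = \<zero>" using XY(3) by blast+
    then have "x \<otimes> x = x" "y \<otimes> y = y" using eq c by simp_all
    then have "x = \<zero> \<or> y = \<zero>" using e c o xy(3) unfolding primitive_idempotent_def by blast
    then show ?thesis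
    proof
      assume "x = \<zero>"
      then have "e \<in> Y" using xy c by simp
      then have "carrier R #> e \<subseteq> Y" using smY by (auto simp: mem_r_coset)
      then show ?thesis using XY(3) P.sub_subset[OF XY(1)] by auto
    next
      assume "y = \<zero>"
      then have "e \<in> X" using xy c by simp
      then have "carrier R #> e \<subseteq> X" using smX by (auto simp: mem_r_coset)
      then show ?thesis using XY(3) P.sub_subset[OF XY(2)] by auto
    qed
  qed
  then have "indecomposable R ?P"
    unfolding indecomposable_def using eP ee(3) by auto
  then obtain N where N: "largest_proper R ?P N" using projective_local[OF fin proj] by blast
  have NS: "submodule N R ?P" "N \<noteq> carrier R #> e" using N by (auto simp: largest_proper_def)
  have eN: "e \<notin> N"
  proof
    assume "e \<in> N"
    then have "carrier R #> e \<subseteq> N" using P.sub_smult[OF NS(1) _ \<open>e \<in> N\<close>] by (auto simp: mem_r_coset)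
    then show False using NS P.sub_subset[OF NS(1)] by simp
  qed
  have "N = jacobson_radical R #> e"
  proof
    show "N \<subseteq> jacobson_radical R #> e"
    proof
      fix n assume "n \<in> N"
      then obtain j where "j \<in> jacobson_radical R" "n = j \<odot>\<^bsub>?P\<^esub> e"
        using P.local_rad_eq[OF fin N _ eN] eP by auto
      then show "n \<in> jacobson_radical R #> e" unfolding mem_r_coset by auto
    qed
    show "jacobson_radical R #> e \<subseteq> N"
      using P.radical_smult[OF P.largest_maximal[OF N], of e] eP by (auto simp: mem_r_coset)
  qed
  then show ?thesis using N by simp
qed

lemma left_factor_simple:
  assumes fin: "fin_len R (regular_module R)" and e: "primitive_idempotent R e"
  shows "simple_module R (left_factor R e (jacobson_radical R))"
proof -
  have ee: "e \<in> carrier R" using e by (auto simp: primitive_idempotent_def)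
  interpret M: left_module R "regular_module R" by (rule left_module_regular)
  have Ps: "submodule (carrier R #> e) R (regular_module R)"
    using sub_r_coset[OF M.submodule_carrier ee] by simp
  interpret P: left_module R "(regular_module R)\<lparr>carrier := carrier R #> e\<rparr>" by (rule M.left_module_sub[OF Ps])
  note l = primitive_local[OF assms]
  show ?thesis unfolding left_factor_def
    using P.simple_quot_iff[of "jacobson_radical R #> e"] P.maximal_iff P.largest_maximal[OF l] l
    by (auto simp: largest_proper_def)
qed

text \<open>The class of \<open>e\<close>, nonzero because \<open>e\<close> generates
  \<open>A e\<close> and \<open>J e\<close> is proper. Isomorphisms carry it to a nonzero vector
  fixed by \<open>e\<close>.\<close>

lemma left_factor_idem:
  assumes fin: "fin_len R (regular_module R)" and e: "primitive_idempotent R e"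
  obtains x where "x \<in> carrier (left_factor R e (jacobson_radical R))"
    "x \<noteq> \<zero>\<^bsub>left_factor R e (jacobson_radical R)\<^esub>" "e \<odot>\<^bsub>left_factor R e (jacobson_radical R)\<^esub> x = x"
proof -
  have ee: "e \<in> carrier R" "e \<otimes> e = e" using e by (auto simp: primitive_idempotent_def)
  interpret M: left_module R "regular_module R" by (rule left_module_regular)
  let ?P = "(regular_module R)\<lparr>carrier := carrier R #> e\<rparr>"
  have Ps: "submodule (carrier R #> e) R (regular_module R)"
    using sub_r_coset[OF M.submodule_carrier ee(1)] by simp
  interpret P: left_module R ?P by (rule M.left_module_sub[OF Ps])
  note l = primitive_local[OF assms]
  have K: "submodule (jacobson_radical R #> e) R ?P" "jacobson_radical R #> e \<noteq> carrier R #> e"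
    using l by (auto simp: largest_proper_def)
  have eP: "e \<in> carrier ?P" using ee idem_r_coset by simp
  have "e \<notin> jacobson_radical R #> e"
  proof
    assume "e \<in> jacobson_radical R #> e"
    then have "carrier R #> e \<subseteq> jacobson_radical R #> e"
      using P.sub_smult[OF K(1), of _ e] by (auto simp: mem_r_coset[of _ "carrier R"])
    then show False using K P.sub_subset[OF K(1)] by auto
  qed
  interpret q: module_hom R ?P "quot_module ?P (jacobson_radical R #> e)" "P.quot_map (jacobson_radical R #> e)"
    by (rule P.quot_hom[OF K(1)])
  let ?x = "P.quot_map (jacobson_radical R #> e) e"
  have "?x \<in> carrier (quot_module ?P (jacobson_radical R #> e))" using q.closed eP by simp
  moreover have "?x \<noteq> \<zero>\<^bsub>quot_module ?P (jacobson_radical R #> e)\<^esub>"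
    using P.quot_map_ker[OF K(1)] eP \<open>e \<notin> jacobson_radical R #> e\<close> unfolding mod_ker_def by blast
  moreover have "e \<odot>\<^bsub>quot_module ?P (jacobson_radical R #> e)\<^esub> ?x = ?x"
    using q.smult[OF ee(1) eP] ee(2) by simp
  ultimately show ?thesis using that[of ?x] unfolding left_factor_def by simp
qed

end

lemma (in ring) left_module_left_factor:
  assumes fl: "fin_len R (regular_module R)" and e: "primitive_idempotent R e"
  shows "left_module R (left_factor R e (jacobson_radical R))"
proof -
  have ec: "e \<in> carrier R" using e by (simp add: primitive_idempotent_def)
  interpret M: left_module R "regular_module R" by (rule left_module_regular)
  have s1: "submodule (carrier R #> e) R (regular_module R)" using sub_r_coset[OF M.submodule_carrier] ec by simp
  interpret Q: left_module R "(regular_module R)\<lparr>carrier := carrier R #> e\<rparr>" by (rule M.left_module_sub[OF s1])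
  have "submodule (jacobson_radical R #> e) R ((regular_module R)\<lparr>carrier := carrier R #> e\<rparr>)"
    using primitive_local[OF fl e] by (simp add: largest_proper_def)
  then show ?thesis unfolding left_factor_def by (rule Q.left_module_quot)
qed

lemma mod_iso_simple:
  assumes M: "left_module A M" and N: "left_module A N" and iso: "mod_iso A M N" and s: "simple_module A N"
  shows "simple_module A M"
proof -
  obtain f where f: "f \<in> mod_hom A M N" "bij_betw f (carrier M) (carrier N)" using iso by (auto simp: mod_iso_def)
  interpret f: module_hom A M N f by (rule module_homI[OF M N f(1)])
  have "mod_ker M N f = {\<zero>\<^bsub>M\<^esub>}" using f(2) f.inj_iff by (simp add: bij_betw_def)
  then show ?thesis
    using f.simple_iff_ker s f(2) f.M.simple_iff by (simp add: bij_betw_def)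
qed

section \<open>Projective covers and the transpose\<close>

text \<open>Preimages of maximal submodules under a surjection are maximal.\<close>

lemma (in module_hom) surj_rad:
  assumes surj: "f ` carrier M = carrier N" and x: "x \<in> rad A M" shows "f x \<in> rad A N"
proof -
  have xc: "x \<in> carrier M" using x by (simp add: rad_def)
  have "f x \<in> K" if K: "maximal_submodule A N K" for K
  proof -
    have KS: "submodule K A N" using K by (simp add: maximal_submodule_def)
    have "maximal_submodule A M (pre K)"
      using K pre_wcov[OF surj KS N.submodule_carrier] pre_strict[OF surj KS N.submodule_carrier]
      unfolding M.maximal_iff N.maximal_iff pre_carrier by simp
    then have "x \<in> pre K" using x by (auto simp: rad_def)
    then show ?thesis by (simp add: pre_def)
  qed
  then show ?thesis using closed[OF xc] by (auto simp: rad_def)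
qed

lemma (in left_module) superfluous_rad:
  assumes fin: "fin_len A M" and K: "submodule K A M" "K \<subseteq> rad A M" shows "superfluous A M K"
  unfolding superfluous_def
proof (intro conjI allI impI)
  fix L assume L: "submodule L A M \<and> K <+>\<^bsub>M\<^esub> L = carrier M"
  show "L = carrier M"
  proof (rule ccontr)
    assume "L \<noteq> carrier M"
    then obtain N where N: "maximal_submodule A M N" "L \<subseteq> N" using max_sub_exists[OF fin] L by blast
    have NS: "submodule N A M" "N \<noteq> carrier M" using N by (auto simp: maximal_submodule_def)
    have "K \<subseteq> N" using K N by (auto simp: rad_def)
    then have "carrier M \<subseteq> N" using set_add_least[OF NS(1) \<open>K \<subseteq> N\<close> N(2)] L by simp
    then show False using NS sub_subset by blast
  qed
qed (rule K)

lemma (in module_hom) cover_inj: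
  assumes fin: "fin_len A M" and surj: "f ` carrier M = carrier N"
    and db: "dual_basis A N n x h" and ker: "mod_ker M N f \<subseteq> rad A M"
  shows "inj_on f (carrier M)"
proof -
  obtain \<sigma> where \<sigma>: "\<sigma> \<in> mod_hom A N M" "\<And>y. y \<in> carrier N \<Longrightarrow> f (\<sigma> y) = restrict id (carrier N) y"
    using dual_basis_lift[OF N.left_module_axioms M.left_module_axioms N.left_module_axioms db hom surj
        mod_hom_id[OF N.left_module_axioms]] by blast
  interpret \<sigma>: module_hom A N M \<sigma> by (rule module_homI[OF N.left_module_axioms M.left_module_axioms \<sigma>(1)])
  have im: "submodule (\<sigma> ` carrier N) A M" by (rule \<sigma>.sub_image[OF N.submodule_carrier])
  have "carrier M \<subseteq> mod_ker M N f <+>\<^bsub>M\<^esub> \<sigma> ` carrier N"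
  proof
    fix y assume y: "y \<in> carrier M"
    have c: "f y \<in> carrier N" "\<sigma> (f y) \<in> carrier M" using y closed \<sigma>.closed by auto
    have "f (y \<ominus>\<^bsub>M\<^esub> \<sigma> (f y)) = \<zero>\<^bsub>N\<^esub>" using diff[OF y c(2)] \<sigma>(2)[OF c(1)] c N.diff_self by simp
    then have "y \<ominus>\<^bsub>M\<^esub> \<sigma> (f y) \<in> mod_ker M N f" using y c by (simp add: mod_ker_def)
    moreover have "y = (y \<ominus>\<^bsub>M\<^esub> \<sigma> (f y)) \<oplus>\<^bsub>M\<^esub> \<sigma> (f y)" using M.mdiff_add[OF y c(2)] by simp
    ultimately show "y \<in> mod_ker M N f <+>\<^bsub>M\<^esub> \<sigma> ` carrier N" using c(1) unfolding M.mem_set_add by blast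
  qed
  moreover have "mod_ker M N f <+>\<^bsub>M\<^esub> \<sigma> ` carrier N \<subseteq> carrier M"
    by (rule M.sub_subset[OF M.submodule_set_add[OF sub_ker im]])
  ultimately have "\<sigma> ` carrier N = carrier M"
    using M.superfluous_rad[OF fin sub_ker ker] im unfolding superfluous_def by blast
  then have "mod_ker M N f = {\<zero>\<^bsub>M\<^esub>}"
  proof -
    have "y = \<zero>\<^bsub>M\<^esub>" if "y \<in> mod_ker M N f" for y
    proof -
      have "y \<in> \<sigma> ` carrier N" using that \<open>\<sigma> ` carrier N = carrier M\<close> by (simp add: mod_ker_def)
      then obtain z where z: "z \<in> carrier N" "y = \<sigma> z" by blast
      then have "z = \<zero>\<^bsub>N\<^esub>" using \<sigma>(2)[of z] that by (simp add: mod_ker_def)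
      then show ?thesis using z \<sigma>.zero by simp
    qed
    then show ?thesis using zero by (auto simp: mod_ker_def)
  qed
  then show ?thesis using inj_iff by blast
qed

section \<open>Duals into the ring, and direct sums of modules \<open>A e\<close>\<close>

lemma ring_dual_simps [simp]:
  "carrier (ring_dual A M) = mod_hom A M (regular_module A)"
  "\<zero>\<^bsub>ring_dual A M\<^esub> = (\<lambda>x\<in>carrier M. \<zero>\<^bsub>A\<^esub>)"
  "f \<oplus>\<^bsub>ring_dual A M\<^esub> g = (\<lambda>x\<in>carrier M. f x \<oplus>\<^bsub>A\<^esub> g x)"
  "a \<odot>\<^bsub>ring_dual A M\<^esub> f = (\<lambda>x\<in>carrier M. f x \<otimes>\<^bsub>A\<^esub> a)"
  by (simp_all add: ring_dual_def)

lemma (in left_module) left_module_ring_dual: "left_module (opp A) (ring_dual A M)"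
proof -
  let ?D = "ring_dual A M" let ?H = "mod_hom A M (regular_module A)"
  have c: "f x \<in> carrier A" if "f \<in> ?H" "x \<in> carrier M" for f x using mod_homD(1)[OF that] by simp
  have e: "f = g" if "f \<in> ?H" "g \<in> ?H" "\<And>x. x \<in> carrier M \<Longrightarrow> f x = g x" for f g
    using that by (rule mod_hom_eqI)
  note d = mod_homD(2,3)[of _ A M "regular_module A", simplified]
  have z: "(\<lambda>x\<in>carrier M. \<zero>\<^bsub>A\<^esub>) \<in> ?H" by (rule mod_hom_restrictI[OF left_module_axioms]) auto
  have ad: "(\<lambda>x\<in>carrier M. f x \<oplus>\<^bsub>A\<^esub> g x) \<in> ?H" if "f \<in> ?H" "g \<in> ?H" for f g
    by (rule mod_hom_restrictI[OF left_module_axioms])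
      (use that c in \<open>auto simp: d A.r_distr A.add.m_ac\<close>)
  have sm: "(\<lambda>x\<in>carrier M. f x \<otimes>\<^bsub>A\<^esub> a) \<in> ?H" if "f \<in> ?H" "a \<in> carrier A" for f a
    by (rule mod_hom_restrictI[OF left_module_axioms])
      (use that c in \<open>auto simp: d A.l_distr A.m_assoc\<close>)
  have "abelian_group ?D"
  proof (rule abelian_groupI)
    fix f assume f: "f \<in> carrier ?D"
    then show "\<exists>g\<in>carrier ?D. g \<oplus>\<^bsub>?D\<^esub> f = \<zero>\<^bsub>?D\<^esub>"
      using sm[of f "\<ominus>\<^bsub>A\<^esub> \<one>\<^bsub>A\<^esub>"] c
      by (intro bexI[of _ "\<lambda>x\<in>carrier M. f x \<otimes>\<^bsub>A\<^esub> (\<ominus>\<^bsub>A\<^esub> \<one>\<^bsub>A\<^esub>)"])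
        (auto simp: fun_eq_iff A.r_minus A.l_neg)
    show "\<zero>\<^bsub>?D\<^esub> \<oplus>\<^bsub>?D\<^esub> f = f" using f z c ad[OF z, of f] by (intro e) auto
  next
    fix f g assume "f \<in> carrier ?D" "g \<in> carrier ?D"
    then show "f \<oplus>\<^bsub>?D\<^esub> g = g \<oplus>\<^bsub>?D\<^esub> f" using c by (auto simp: fun_eq_iff A.a_comm)
  next
    fix f g h assume "f \<in> carrier ?D" "g \<in> carrier ?D" "h \<in> carrier ?D"
    then show "f \<oplus>\<^bsub>?D\<^esub> g \<oplus>\<^bsub>?D\<^esub> h = f \<oplus>\<^bsub>?D\<^esub> (g \<oplus>\<^bsub>?D\<^esub> h)" using c by (auto simp: fun_eq_iff A.a_assoc)
  qed (use z ad in auto)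
  moreover have "\<one>\<^bsub>opp A\<^esub> \<odot>\<^bsub>?D\<^esub> f = f" if f: "f \<in> carrier ?D" for f
    using f sm[of f "\<one>\<^bsub>A\<^esub>"] c by (intro e) auto
  ultimately show ?thesis
    unfolding left_module_def left_module_axioms_def
    using A.ring_opp sm c by (auto simp: fun_eq_iff A.l_distr A.r_distr A.m_assoc)
qed

text \<open>The direct sum of the left modules \<open>A (e i)\<close>, realised inside the free
  module of rank \<open>s\<close>: for idempotent \<open>e i\<close>, membership of \<open>x\<close>
  in \<open>A (e i)\<close> means \<open>x (e i) = x\<close>.\<close>

definition idem_sum :: "('a, 'k) ring_scheme \<Rightarrow> nat \<Rightarrow> (nat \<Rightarrow> 'a) \<Rightarrow> (nat \<Rightarrow> 'a) set" where
  "idem_sum A s e = {v \<in> carrier (fun_module A s). \<forall>i<s. v i \<otimes>\<^bsub>A\<^esub> e i = v i}"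

definition idem_gen :: "('a, 'k) ring_scheme \<Rightarrow> nat \<Rightarrow> (nat \<Rightarrow> 'a) \<Rightarrow> nat \<Rightarrow> nat \<Rightarrow> 'a" where
  "idem_gen A s e j = (\<lambda>i\<in>{..<s}. if i = j then e j else \<zero>\<^bsub>A\<^esub>)"

locale idempotents = ring A for A :: "('a, 'k) ring_scheme" (structure) +
  fixes s :: nat and e :: "nat \<Rightarrow> 'a"
  assumes idem: "i < s \<Longrightarrow> e i \<in> carrier A" "i < s \<Longrightarrow> e i \<otimes> e i = e i"
begin

abbreviation "F \<equiv> fun_module A s"
abbreviation "D \<equiv> F\<lparr>carrier := idem_sum A s e\<rparr>"
abbreviation "gen \<equiv> idem_gen A s e"

lemma F_nth: "v \<in> carrier F \<Longrightarrow> i < s \<Longrightarrow> v i \<in> carrier A"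
  by (auto simp: fun_module_def)

lemma F_ops:
  "i < s \<Longrightarrow> (v \<oplus>\<^bsub>F\<^esub> w) i = v i \<oplus> w i" "i < s \<Longrightarrow> (a \<odot>\<^bsub>F\<^esub> v) i = a \<otimes> v i" "i < s \<Longrightarrow> \<zero>\<^bsub>F\<^esub> i = \<zero>"
  by (auto simp: fun_module_def)

lemma D_sub: "submodule (idem_sum A s e) A F"
  unfolding left_module.submodule_iff[OF left_module_fun]
proof (intro conjI ballI)
  interpret F: left_module A F by (rule left_module_fun)
  show "idem_sum A s e \<subseteq> carrier F" by (auto simp: idem_sum_def)
  show "\<zero>\<^bsub>F\<^esub> \<in> idem_sum A s e" using idem F.M.zero_closed by (auto simp: idem_sum_def F_ops)
  show "v \<oplus>\<^bsub>F\<^esub> w \<in> idem_sum A s e" if "v \<in> idem_sum A s e" "w \<in> idem_sum A s e" for v w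
    using that idem F_nth by (auto simp: idem_sum_def F_ops l_distr)
  show "a \<odot>\<^bsub>F\<^esub> v \<in> idem_sum A s e" if "a \<in> carrier A" "v \<in> idem_sum A s e" for a v
    using that idem F_nth F.lsmult_closed by (auto simp: idem_sum_def F_ops m_assoc)
qed

lemma D_left_module: "left_module A D"
  by (rule left_module.left_module_sub[OF left_module_fun D_sub])

lemma D_nth: "v \<in> idem_sum A s e \<Longrightarrow> i < s \<Longrightarrow> v i \<in> carrier A \<and> v i \<otimes> e i = v i"
  using F_nth by (auto simp: idem_sum_def)

lemma gen_D: "j < s \<Longrightarrow> gen j \<in> idem_sum A s e"
  using idem by (auto simp: idem_sum_def idem_gen_def fun_module_def)

lemma lin_comb_gen_sum:
  assumes v: "v \<in> idem_sum A s e"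
  shows "v = finsum D (\<lambda>i. v i \<odot>\<^bsub>F\<^esub> gen i) {..<s}"
proof -
  interpret F: left_module A F by (rule left_module_fun)
  let ?x = "\<lambda>i. \<lambda>j\<in>{..<s}. if j = i then \<one> else \<zero>"
  have vF: "v \<in> carrier F" using v by (simp add: idem_sum_def)
  have x: "?x i \<in> carrier F" for i by (auto simp: fun_module_def)
  have "v = finsum F (\<lambda>i. v i \<odot>\<^bsub>F\<^esub> ?x i) {..<s}"
    using lin_comb_unit[OF vF] vF by (simp add: lin_comb_def)
  also have "\<dots> = finsum F (\<lambda>i. v i \<odot>\<^bsub>F\<^esub> gen i) {..<s}"
  proof (rule F.M.finsum_cong'[OF refl])
    show "(\<lambda>i. v i \<odot>\<^bsub>F\<^esub> gen i) \<in> {..<s} \<rightarrow> carrier F"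
      using D_nth[OF v] gen_D F.lsmult_closed by (auto simp: idem_sum_def)
    show "v i \<odot>\<^bsub>F\<^esub> ?x i = v i \<odot>\<^bsub>F\<^esub> gen i" if "i \<in> {..<s}" for i
      using that D_nth[OF v] idem by (auto simp: fun_module_def idem_gen_def fun_eq_iff)
  qed
  also have "\<dots> = finsum D (\<lambda>i. v i \<odot>\<^bsub>F\<^esub> gen i) {..<s}"
    using D_nth[OF v] gen_D F.sub_smult[OF D_sub] by (intro F.finsum_sub[OF D_sub, symmetric]) auto
  finally show ?thesis .
qed

lemma D_dual_basis:
  "dual_basis A D s gen (\<lambda>i. restrict (\<lambda>v\<in>carrier F. v i) (idem_sum A s e))"
  unfolding dual_basis_def
proof (intro conjI ballI allI impI)
  show "gen \<in> {..<s} \<rightarrow> carrier D" using gen_D by auto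
  show "restrict (\<lambda>v\<in>carrier F. v i) (idem_sum A s e) \<in> mod_hom A D (regular_module A)" if "i < s" for i
    by (rule mod_hom_sub[OF left_module_fun D_sub coord_hom[OF that]])
  fix y assume y: "y \<in> carrier D"
  then have y': "y \<in> idem_sum A s e" "y \<in> carrier F" by (auto simp: idem_sum_def)
  then show "y = finsum D (\<lambda>i. restrict (\<lambda>v\<in>carrier F. v i) (idem_sum A s e) y \<odot>\<^bsub>D\<^esub> gen i) {..<s}"
    using lin_comb_gen_sum[OF y'(1)] by simp
qed

text \<open>The map out of the direct sum of the \<open>A (e i)\<close> that sends
  \<open>gen i\<close> to \<open>q i\<close>, provided that \<open>e i\<close> fixes
  \<open>q i\<close> (\<open>ext_gen\<close>).\<close>

definition ext :: "('a, 'm) module \<Rightarrow> (nat \<Rightarrow> 'm) \<Rightarrow> (nat \<Rightarrow> 'a) \<Rightarrow> 'm" where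
  "ext M q = restrict (lin_comb A M s q) (idem_sum A s e)"

lemma ext_hom:
  assumes M: "left_module A M" and q: "\<And>i. i < s \<Longrightarrow> q i \<in> carrier M"
  shows "ext M q \<in> mod_hom A D M"
  unfolding ext_def
  by (rule mod_hom_sub[OF left_module_fun D_sub left_module.lin_comb_hom[OF M]]) (use q in auto)

lemma ext_apply:
  assumes "v \<in> idem_sum A s e" shows "ext M q v = finsum M (\<lambda>i. v i \<odot>\<^bsub>M\<^esub> q i) {..<s}"
  using assms by (simp add: ext_def lin_comb_def idem_sum_def)

lemma ext_gen:
  assumes M: "left_module A M" and q: "\<And>i. i < s \<Longrightarrow> q i \<in> carrier M" "\<And>i. i < s \<Longrightarrow> e i \<odot>\<^bsub>M\<^esub> q i = q i"
    and j: "j < s"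
  shows "ext M q (gen j) = q j"
proof -
  interpret M: left_module A M by (rule M)
  have "ext M q (gen j) = finsum M (\<lambda>i. gen j i \<odot>\<^bsub>M\<^esub> q i) {..<s}" by (rule ext_apply[OF gen_D[OF j]])
  also have "\<dots> = finsum M (\<lambda>i. if j = i then q i else \<zero>\<^bsub>M\<^esub>) {..<s}"
    using q by (intro M.M.finsum_cong') (auto simp: idem_gen_def M.smult_l_zero)
  also have "\<dots> = q j" using q j by (intro M.M.finsum_singleton) auto
  finally show ?thesis .
qed

text \<open>The coefficient \<open>v i\<close> may be replaced by \<open>v i \<otimes> e i\<close>,
  because \<open>e i\<close> fixes \<open>q i\<close>. Hence the image of \<open>ext\<close> is the
  full span of the \<open>q i\<close>.\<close>

lemma ext_all:
  assumes M: "left_module A M" and q: "\<And>i. i < s \<Longrightarrow> q i \<in> carrier M" "\<And>i. i < s \<Longrightarrow> e i \<odot>\<^bsub>M\<^esub> q i = q i"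
    and v: "\<And>i. i < s \<Longrightarrow> v i \<in> carrier A"
  obtains w where "w \<in> idem_sum A s e" "ext M q w = finsum M (\<lambda>i. v i \<odot>\<^bsub>M\<^esub> q i) {..<s}"
proof -
  interpret M: left_module A M by (rule M)
  let ?w = "\<lambda>i\<in>{..<s}. v i \<otimes> e i"
  have w: "?w \<in> idem_sum A s e" using v idem by (auto simp: idem_sum_def fun_module_def m_assoc)
  have "ext M q ?w = finsum M (\<lambda>i. v i \<odot>\<^bsub>M\<^esub> q i) {..<s}"
    unfolding ext_apply[OF w] using v q idem M.lsmult_assoc M.lsmult_closed
    by (intro M.M.finsum_cong') auto
  then show ?thesis using that w by blast
qed

end

section \<open>A lower bound for the length of the transpose\<close>

text \<open>The setting of the estimate, with \<open>P\<close> in the role of \<open>Q\<close>.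
  \<open>X\<close> is the target of a surjection \<open>g0\<close> with prescribed kernel instead of
  a literal quotient, because in the second application it is \<open>D(rad I)\<close> and
  \<open>g0\<close> is restriction of functionals. The exponent \<open>c i\<close> records how deep
  \<open>u i\<close> lies in \<open>P\<close>.\<close>

locale transpose_bound = idempotents A s e
  for A :: "('a, 'k) ring_scheme" (structure) and s e +
  fixes P :: "('a, 'p) module" and N :: "'p set" and X :: "('a, 'x) module" and g0 :: "'p \<Rightarrow> 'x"
    and u :: "nat \<Rightarrow> 'p" and c :: "nat \<Rightarrow> nat"
  assumes fin_left: "fin_len A (regular_module A)"
    and fin_right: "fin_len (opp A) (regular_module (opp A))"
    and proj: "projective A P" and X: "left_module A X"
    and local: "largest_proper A P N"
    and prim: "i < s \<Longrightarrow> primitive_idempotent A (e i)"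
    and u: "i < s \<Longrightarrow> u i \<in> carrier P" "i < s \<Longrightarrow> e i \<odot>\<^bsub>P\<^esub> u i = u i" "i < s \<Longrightarrow> u i \<noteq> \<zero>\<^bsub>P\<^esub>"
    and u_rad: "i < s \<Longrightarrow> u i \<in> ideal_times_module A (ideal_power A (jacobson_radical A) (c i)) P"
    and indep: "\<lbrakk>v \<in> {..<s} \<rightarrow> carrier A; finsum P (\<lambda>i. v i \<odot>\<^bsub>P\<^esub> u i) {..<s} = \<zero>\<^bsub>P\<^esub>; i < s\<rbrakk>
      \<Longrightarrow> v i \<odot>\<^bsub>P\<^esub> u i = \<zero>\<^bsub>P\<^esub>"
    and g0: "g0 \<in> mod_hom A P X" "g0 ` carrier P = carrier X"
    and ker: "mod_ker P X g0 = {finsum P (\<lambda>i. v i \<odot>\<^bsub>P\<^esub> u i) {..<s} | v. v \<in> {..<s} \<rightarrow> carrier A}"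
    and ker_N: "mod_ker P X g0 \<subseteq> N"
begin

lemma fgP: "fg_module A P" using proj by (simp add: projective_def)

sublocale P: left_module A P by (rule fg_left_module[OF fgP])
sublocale g0: module_hom A P X g0 by (rule module_homI[OF P.left_module_axioms X g0(1)])

lemma finP: "fin_len A P" by (rule fg_fin[OF fgP fin_left])

lemma fgD: "fg_module A D"
  using dual_basis_projective[OF D_left_module D_dual_basis] by (simp add: projective_def)

lemma finD: "fin_len A D" by (rule fg_fin[OF fgD fin_left])

lemma radP: "rad A P = N" by (rule P.largest_rad[OF local])

text \<open>By \<open>indep\<close> each \<open>v i\<close> kills \<open>u i\<close>. The elements
  of \<open>A (e i)\<close> that do so form a proper submodule, as \<open>e i\<close> itself fixes
  the nonzero \<open>u i\<close>; so \<open>v i \<in> J (e i)\<close>. This is why \<open>D\<close>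
  is a projective cover of the span of the \<open>u i\<close>.\<close>

lemma kernel_rad:
  assumes v: "v \<in> idem_sum A s e" and 0: "ext P u v = \<zero>\<^bsub>P\<^esub>"
  shows "v \<in> rad A D"
proof -
  interpret D: left_module A D by (rule D_left_module)
  interpret M: left_module A "regular_module A" by (rule left_module_regular)
  have vc: "v \<in> {..<s} \<rightarrow> carrier A" using D_nth[OF v] by auto
  have "v i \<odot>\<^bsub>D\<^esub> gen i \<in> rad A D" if i: "i < s" for i
  proof -
    let ?P = "(regular_module A)\<lparr>carrier := carrier A #> e i\<rparr>"
    have Ps: "submodule (carrier A #> e i) A (regular_module A)"
      using sub_r_coset[OF M.submodule_carrier] idem(1)[OF i] by simp
    interpret Q: left_module A ?P by (rule M.left_module_sub[OF Ps])
    interpret o: module_hom A "regular_module A" P "\<lambda>a\<in>carrier A. a \<odot>\<^bsub>P\<^esub> u i"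
      by (rule P.orbit_module_hom[OF u(1)[OF i]])
    note lp = primitive_local[OF fin_left prim[OF i]]
    let ?L = "o.pre {\<zero>\<^bsub>P\<^esub>} \<inter> (carrier A #> e i)"
    have "submodule ?L A ?P"
      using M.submodule_Int[OF o.sub_pre[OF P.submodule_zero] Ps] M.submodule_sub_iff[OF Ps] by simp
    moreover have "?L \<noteq> carrier ?P"
    proof
      assume "?L = carrier ?P"
      moreover have "e i \<in> carrier ?P" using idem_r_coset[OF idem(1,2)[OF i]] idem[OF i] by simp
      ultimately have "e i \<in> o.pre {\<zero>\<^bsub>P\<^esub>}" by auto
      then show False using u(2,3)[OF i] idem(1)[OF i] by (auto simp: o.pre_def)
    qed
    ultimately have "?L \<subseteq> jacobson_radical A #> e i" using lp unfolding largest_proper_def by blast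
    moreover have "v i \<odot>\<^bsub>P\<^esub> u i = \<zero>\<^bsub>P\<^esub>"
      using indep[OF vc _ i] 0 ext_apply[OF v, of P u] by simp
    then have "v i \<in> ?L"
      using D_nth[OF v i] idem_r_coset[OF idem(1,2)[OF i]] by (auto simp: o.pre_def)
    ultimately have "v i \<in> jacobson_radical A #> e i" by blast
    then obtain j where j: "j \<in> jacobson_radical A" "v i = j \<otimes> e i" unfolding mem_r_coset by blast
    have gi: "gen i \<in> carrier D" using gen_D[OF i] by simp
    have "e i \<odot>\<^bsub>D\<^esub> gen i = gen i" using idem[OF i] by (auto simp: fun_module_def idem_gen_def fun_eq_iff)
    then have "v i \<odot>\<^bsub>D\<^esub> gen i = j \<odot>\<^bsub>D\<^esub> gen i"
      using D.lsmult_assoc[OF jacobson_carr[OF j(1)] idem(1)[OF i] gi] j(2) by simp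
    then show ?thesis using D.radical_smult_rad[OF gi j(1)] by simp
  qed
  then have "finsum D (\<lambda>i. v i \<odot>\<^bsub>D\<^esub> gen i) {..<s} \<in> rad A D"
    by (intro D.sub_finsum[OF D.submodule_rad]) auto
  then show ?thesis using lin_comb_gen_sum[OF v] by simp
qed

lemma ext_u_image: "ext P u ` idem_sum A s e = mod_ker P X g0"
proof
  show "ext P u ` idem_sum A s e \<subseteq> mod_ker P X g0"
    unfolding ker using ext_apply D_nth by fastforce
  show "mod_ker P X g0 \<subseteq> ext P u ` idem_sum A s e"
  proof
    fix y assume "y \<in> mod_ker P X g0"
    then obtain v where v: "v \<in> {..<s} \<rightarrow> carrier A" "y = finsum P (\<lambda>i. v i \<odot>\<^bsub>P\<^esub> u i) {..<s}"
      unfolding ker by blast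
    obtain w where "w \<in> idem_sum A s e" "ext P u w = y"
      using ext_all[OF P.left_module_axioms u(1,2), of v] v by blast
    then show "y \<in> ext P u ` idem_sum A s e" by blast
  qed
qed

text \<open>Makes the choice in \<open>Tr\<close> meaningful: the sequence from \<open>D\<close>
  over \<open>P\<close> to \<open>X\<close>, copied to modules of the type over which the choice
  ranges, is a minimal projective presentation.\<close>

lemma presentation_exists:
  obtains P1 P0 :: "('a, 'a fgtype) module" and f g where "min_proj_presentation A P1 P0 f g X"
proof -
  interpret D: left_module A D by (rule D_left_module)
  interpret eu: module_hom A D P "ext P u"
    by (rule module_homI[OF D_left_module P.left_module_axioms ext_hom[OF P.left_module_axioms u(1)]])
  obtain P0 :: "('a, 'a fgtype) module" and k0
    where P0: "fg_module A P0" "k0 \<in> mod_hom A P0 P" "bij_betw k0 (carrier P0) (carrier P)"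
    using fgP by (rule fg_copy)
  obtain P1 :: "('a, 'a fgtype) module" and k1
    where P1: "fg_module A P1" "k1 \<in> mod_hom A P1 D" "bij_betw k1 (carrier P1) (carrier D)"
    using fgD by (rule fg_copy)
  interpret k0: module_hom A P0 P k0 by (rule module_homI[OF fg_left_module[OF P0(1)] P.left_module_axioms P0(2)])
  interpret k1: module_hom A P1 D k1 by (rule module_homI[OF fg_left_module[OF P1(1)] D_left_module P1(2)])
  let ?i0 = "restrict (inv_into (carrier P0) k0) (carrier P)"
  let ?i1 = "restrict (inv_into (carrier P1) k1) (carrier D)"
  interpret i0: module_hom A P P0 ?i0
    by (rule module_homI[OF P.left_module_axioms k0.M.left_module_axioms k0.inverse[OF P0(3)]])
  interpret i1: module_hom A D P1 ?i1
    by (rule module_homI[OF D_left_module k1.M.left_module_axioms k1.inverse[OF P1(3)]])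
  have b0: "bij_betw ?i0 (carrier P) (carrier P0)"
    using bij_betw_inv_into[OF P0(3)] by (subst bij_betw_cong[of _ _ "inv_into (carrier P0) k0"]) auto
  have b1: "bij_betw ?i1 (carrier D) (carrier P1)"
    using bij_betw_inv_into[OF P1(3)] by (subst bij_betw_cong[of _ _ "inv_into (carrier P1) k1"]) auto
  have ik0: "?i0 (k0 x) = x" if "x \<in> carrier P0" for x
    using bij_betw_inv_into_left[OF P0(3) that] k0.closed[OF that] by simp
  have ik1: "?i1 (k1 x) = x" if "x \<in> carrier P1" for x
    using bij_betw_inv_into_left[OF P1(3) that] k1.closed[OF that] by simp
  obtain n x h where db: "dual_basis A P n x h" using projective_dual_basis[OF proj] .
  have pr0: "projective A P0"
    using dual_basis_projective[OF k0.M.left_module_axioms i0.dual_basis_iso[OF b0 db]] .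
  have pr1: "projective A P1"
    using dual_basis_projective[OF k1.M.left_module_axioms i1.dual_basis_iso[OF b1 D_dual_basis]] .
  let ?g = "compose (carrier P0) g0 k0"
  let ?f = "compose (carrier P1) ?i0 (compose (carrier P1) (ext P u) k1)"
  have g: "?g \<in> mod_hom A P0 X" by (rule mod_hom_comp[OF k0.M.left_module_axioms P0(2) g0(1)])
  have f: "?f \<in> mod_hom A P1 P0"
    by (rule mod_hom_comp[OF k1.M.left_module_axioms mod_hom_comp[OF k1.M.left_module_axioms P1(2) eu.hom] i0.hom])
  interpret g: module_hom A P0 X ?g by (rule module_homI[OF k0.M.left_module_axioms X g])
  interpret f: module_hom A P1 P0 ?f by (rule module_homI[OF k1.M.left_module_axioms k0.M.left_module_axioms f])
  have fin0: "fin_len A P0" "fin_len A P1" using fg_fin P0(1) P1(1) fin_left by blast+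
  have "?g ` carrier P0 = g0 ` k0 ` carrier P0" by (auto simp: compose_def image_image)
  then have gs: "?g ` carrier P0 = carrier X" using P0(3) g0(2) by (simp add: bij_betw_def)
  have kg: "x \<in> mod_ker P0 X ?g \<longleftrightarrow> x \<in> carrier P0 \<and> k0 x \<in> mod_ker P X g0" for x
    using k0.closed by (auto simp: mod_ker_def compose_def)
  have "mod_ker P0 X ?g \<subseteq> rad A P0"
  proof
    fix x assume "x \<in> mod_ker P0 X ?g"
    then have "x \<in> carrier P0" "k0 x \<in> rad A P" using kg ker_N radP by auto
    then show "x \<in> rad A P0" using i0.surj_rad[of "k0 x"] b0 ik0 by (simp add: bij_betw_def)
  qed
  then have c0: "projective_cover A P0 X ?g"
    unfolding projective_cover_def using pr0 g gs k0.M.superfluous_rad[OF fin0(1) g.sub_ker] by blast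
  let ?K = "P0\<lparr>carrier := mod_ker P0 X ?g\<rparr>"
  have "?f ` carrier P1 = ?i0 ` ext P u ` k1 ` carrier P1" by (auto simp: compose_def image_image)
  also have "\<dots> = ?i0 ` mod_ker P X g0" using P1(3) ext_u_image by (simp add: bij_betw_def)
  also have "\<dots> = mod_ker P0 X ?g"
  proof
    show "?i0 ` mod_ker P X g0 \<subseteq> mod_ker P0 X ?g"
    proof
      fix y assume "y \<in> ?i0 ` mod_ker P X g0"
      then obtain z where z: "z \<in> mod_ker P X g0" "y = ?i0 z" by blast
      have zc: "z \<in> carrier P" using z by (simp add: mod_ker_def)
      have "k0 y = z" using z zc bij_betw_inv_into_right[OF P0(3) zc] by simp
      then show "y \<in> mod_ker P0 X ?g" using kg i0.closed[OF zc] z by simp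
    qed
    show "mod_ker P0 X ?g \<subseteq> ?i0 ` mod_ker P X g0"
    proof
      fix x assume "x \<in> mod_ker P0 X ?g"
      then have "x \<in> carrier P0" "k0 x \<in> mod_ker P X g0" using kg by auto
      then show "x \<in> ?i0 ` mod_ker P X g0" using ik0[of x] by (intro image_eqI[of _ _ "k0 x"]) simp_all
    qed
  qed
  finally have fs: "?f ` carrier P1 = mod_ker P0 X ?g" .
  have f': "?f \<in> mod_hom A P1 ?K" by (rule mod_hom_carrier_restrict[OF f]) (use fs in simp)
  have "mod_ker P1 ?K ?f \<subseteq> rad A P1"
  proof
    fix x assume "x \<in> mod_ker P1 ?K ?f"
    then have "x \<in> carrier P1" "?f x = \<zero>\<^bsub>P0\<^esub>" by (simp_all add: mod_ker_def)
    then have x: "x \<in> carrier P1" "?i0 (ext P u (k1 x)) = \<zero>\<^bsub>P0\<^esub>" by (simp_all only: compose_eq)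
    have kc: "k1 x \<in> idem_sum A s e" using k1.closed[OF x(1)] by simp
    have ec: "ext P u (k1 x) \<in> carrier P" using eu.closed kc by simp
    have "ext P u (k1 x) = k0 (?i0 (ext P u (k1 x)))" using bij_betw_inv_into_right[OF P0(3) ec] ec by simp
    then have "ext P u (k1 x) = \<zero>\<^bsub>P\<^esub>" using x(2) k0.zero by simp
    then have "k1 x \<in> rad A D" using kernel_rad[OF kc] by simp
    then show "x \<in> rad A P1" using i1.surj_rad[of "k1 x"] b1 ik1[OF x(1)] by (simp add: bij_betw_def)
  qed
  then have "superfluous A P1 (mod_ker P1 P0 ?f)"
    using k1.M.superfluous_rad[OF fin0(2) f.sub_ker] by (simp add: mod_ker_def)
  then have "projective_cover A P1 ?K ?f"
    unfolding projective_cover_def using pr1 f' fs by (simp add: mod_ker_def)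
  then show ?thesis using that c0 unfolding min_proj_presentation_def by blast
qed

context
  fixes P1 :: "('a, 'p1) module" and P0 :: "('a, 'p0) module" and f g
  assumes mpp: "min_proj_presentation A P1 P0 f g X"
begin

lemma presentation_props:
  shows "fg_module A P1" "fg_module A P0" "projective A P1" "projective A P0"
    "g \<in> mod_hom A P0 X" "g ` carrier P0 = carrier X"
    "f \<in> mod_hom A P1 P0" "f ` carrier P1 = mod_ker P0 X g"
    "superfluous A P0 (mod_ker P0 X g)" "superfluous A P1 (mod_ker P1 P0 f)"
proof -
  have 1: "projective_cover A P0 X g" "projective_cover A P1 (P0\<lparr>carrier := mod_ker P0 X g\<rparr>) f"
    using mpp by (auto simp: min_proj_presentation_def)
  then show "projective A P1" "projective A P0" "g \<in> mod_hom A P0 X" "g ` carrier P0 = carrier X"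
    "f ` carrier P1 = mod_ker P0 X g" "superfluous A P0 (mod_ker P0 X g)"
    "superfluous A P1 (mod_ker P1 P0 f)"
    by (auto simp: projective_cover_def mod_ker_def)
  then show "fg_module A P1" "fg_module A P0" by (auto simp: projective_def)
  show "f \<in> mod_hom A P1 P0"
    by (rule mod_hom_carrier_mono[where H = "mod_ker P0 X g"]) (use 1 in \<open>auto simp: projective_cover_def mod_ker_def\<close>)
qed

lemma presentation_generators:
  obtains \<alpha> q where "\<alpha> \<in> mod_hom A P P0" "\<alpha> ` carrier P = carrier P0"
    "\<And>i. i < s \<Longrightarrow> q i \<in> carrier P1" "\<And>i. i < s \<Longrightarrow> e i \<odot>\<^bsub>P1\<^esub> q i = q i"
    "\<And>i. i < s \<Longrightarrow> f (q i) = \<alpha> (u i)" "bij_betw (ext P1 q) (idem_sum A s e) (carrier P1)"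
proof -
  note pp = presentation_props
  interpret D: left_module A D by (rule D_left_module)
  interpret g: module_hom A P0 X g by (rule module_homI[OF fg_left_module[OF pp(2)] X pp(5)])
  interpret f: module_hom A P1 P0 f by (rule module_homI[OF fg_left_module[OF pp(1)] g.M.left_module_axioms pp(7)])
  obtain n x h where db: "dual_basis A P n x h" using projective_dual_basis[OF proj] .
  obtain n0 x0 h0 where db0: "dual_basis A P0 n0 x0 h0" using projective_dual_basis[OF pp(4)] .
  obtain n1 x1 h1 where db1: "dual_basis A P1 n1 x1 h1" using projective_dual_basis[OF pp(3)] .
  obtain \<alpha> where \<alpha>: "\<alpha> \<in> mod_hom A P P0" "\<And>y. y \<in> carrier P \<Longrightarrow> g (\<alpha> y) = g0 y"
    using dual_basis_lift[OF P.left_module_axioms g.M.left_module_axioms X db pp(5,6) g0(1)] by blast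
  interpret \<alpha>: module_hom A P P0 \<alpha> by (rule module_homI[OF P.left_module_axioms g.M.left_module_axioms \<alpha>(1)])
  have im: "submodule (\<alpha> ` carrier P) A P0" by (rule \<alpha>.sub_image[OF P.submodule_carrier])
  have "carrier P0 \<subseteq> mod_ker P0 X g <+>\<^bsub>P0\<^esub> \<alpha> ` carrier P"
  proof
    fix y assume y: "y \<in> carrier P0"
    then have "g y \<in> g0 ` carrier P" using g.closed g0(2) by simp
    then obtain z where z: "z \<in> carrier P" "g y = g0 z" by blast
    have "g (y \<ominus>\<^bsub>P0\<^esub> \<alpha> z) = \<zero>\<^bsub>X\<^esub>"
      using g.diff[OF y \<alpha>.closed[OF z(1)]] z \<alpha>(2) g0.N.diff_self g0.closed by simp
    then have "y \<ominus>\<^bsub>P0\<^esub> \<alpha> z \<in> mod_ker P0 X g" using y \<alpha>.closed[OF z(1)] by (simp add: mod_ker_def)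
    moreover have "y = (y \<ominus>\<^bsub>P0\<^esub> \<alpha> z) \<oplus>\<^bsub>P0\<^esub> \<alpha> z" using g.M.mdiff_add[OF y \<alpha>.closed[OF z(1)]] by simp
    ultimately show "y \<in> mod_ker P0 X g <+>\<^bsub>P0\<^esub> \<alpha> ` carrier P" using z unfolding g.M.mem_set_add by blast
  qed
  moreover have "mod_ker P0 X g <+>\<^bsub>P0\<^esub> \<alpha> ` carrier P \<subseteq> carrier P0"
    by (rule g.M.sub_subset[OF g.M.submodule_set_add[OF g.sub_ker im]])
  ultimately have \<alpha>s: "\<alpha> ` carrier P = carrier P0" using pp(9) im unfolding superfluous_def by blast
  have "mod_ker P P0 \<alpha> \<subseteq> rad A P"
  proof -
    have "mod_ker P P0 \<alpha> \<subseteq> mod_ker P X g0"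
    proof
      fix y assume "y \<in> mod_ker P P0 \<alpha>"
      then show "y \<in> mod_ker P X g0" using \<alpha>(2)[of y] g.zero by (simp add: mod_ker_def)
    qed
    then show ?thesis using ker_N radP by simp
  qed
  then have \<alpha>i: "inj_on \<alpha> (carrier P)" by (rule \<alpha>.cover_inj[OF finP \<alpha>s db0])
  have "\<exists>q. q \<in> carrier P1 \<and> e i \<odot>\<^bsub>P1\<^esub> q = q \<and> f q = \<alpha> (u i)" if i: "i < s" for i
  proof -
    have "gen i \<in> idem_sum A s e" "ext P u (gen i) = u i"
      using gen_D[OF i] ext_gen[OF P.left_module_axioms u(1,2) i] by auto
    then have "u i \<in> mod_ker P X g0" using ext_u_image by (metis imageI)
    then have "\<alpha> (u i) \<in> mod_ker P0 X g" using \<alpha>(2) \<alpha>.closed by (auto simp: mod_ker_def)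
    then obtain q where q: "q \<in> carrier P1" "f q = \<alpha> (u i)" using pp(8) by (metis imageE)
    \<comment> \<open>Multiplying \<open>q\<close> by \<open>e i\<close> does not move its image,
      since \<open>e i\<close> fixes \<open>u i\<close>, and makes it fixed by
      \<open>e i\<close>.\<close>
    have "f (e i \<odot>\<^bsub>P1\<^esub> q) = \<alpha> (u i)"
      using f.smult[OF idem(1)[OF i] q(1)] q(2) \<alpha>.smult[OF idem(1)[OF i] u(1)[OF i]] u(2)[OF i] by simp
    moreover have "e i \<odot>\<^bsub>P1\<^esub> (e i \<odot>\<^bsub>P1\<^esub> q) = e i \<odot>\<^bsub>P1\<^esub> q"
      using f.M.lsmult_assoc[OF idem(1)[OF i] idem(1)[OF i] q(1)] idem(2)[OF i] by simp
    ultimately show ?thesis using f.M.lsmult_closed[OF idem(1)[OF i] q(1)] by blast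
  qed
  then obtain q where q: "\<And>i. i < s \<Longrightarrow> q i \<in> carrier P1" "\<And>i. i < s \<Longrightarrow> e i \<odot>\<^bsub>P1\<^esub> q i = q i"
    "\<And>i. i < s \<Longrightarrow> f (q i) = \<alpha> (u i)" by metis
  interpret \<psi>: module_hom A D P1 "ext P1 q"
    by (rule module_homI[OF D_left_module f.M.left_module_axioms ext_hom[OF f.M.left_module_axioms q(1)]])
  have fpsi: "f (ext P1 q v) = \<alpha> (ext P u v)" if v: "v \<in> idem_sum A s e" for v
  proof -
    have t: "(\<lambda>i. v i \<odot>\<^bsub>P1\<^esub> q i) \<in> {..<s} \<rightarrow> carrier P1" "(\<lambda>i. v i \<odot>\<^bsub>P\<^esub> u i) \<in> {..<s} \<rightarrow> carrier P"
      using D_nth[OF v] q(1) u(1) f.M.lsmult_closed P.lsmult_closed by auto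
    have "f (ext P1 q v) = finsum P0 (\<lambda>i. f (v i \<odot>\<^bsub>P1\<^esub> q i)) {..<s}"
      unfolding ext_apply[OF v] by (rule f.finsum[OF t(1)])
    also have "\<dots> = finsum P0 (\<lambda>i. \<alpha> (v i \<odot>\<^bsub>P\<^esub> u i)) {..<s}"
      using D_nth[OF v] q u(1) f.smult \<alpha>.smult \<alpha>.closed g.M.lsmult_closed
      by (intro g.M.M.finsum_cong') (auto simp: P.lsmult_closed)
    also have "\<dots> = \<alpha> (ext P u v)" unfolding ext_apply[OF v] by (rule \<alpha>.finsum[OF t(2), symmetric])
    finally show ?thesis .
  qed
  have im1: "submodule (ext P1 q ` carrier D) A P1" by (rule \<psi>.sub_image[OF D.submodule_carrier])
  have "carrier P1 \<subseteq> mod_ker P1 P0 f <+>\<^bsub>P1\<^esub> ext P1 q ` carrier D"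
  proof
    fix y assume y: "y \<in> carrier P1"
    then have "f y \<in> mod_ker P0 X g" using pp(8) by blast
    then have fy: "f y \<in> carrier P0" "g (f y) = \<zero>\<^bsub>X\<^esub>" by (auto simp: mod_ker_def)
    then obtain z where z: "z \<in> carrier P" "f y = \<alpha> z" using \<alpha>s by (metis imageE)
    then have "z \<in> mod_ker P X g0" using fy \<alpha>(2) by (auto simp: mod_ker_def)
    then obtain v where v: "v \<in> idem_sum A s e" "z = ext P u v" using ext_u_image by blast
    have c: "ext P1 q v \<in> carrier P1" using \<psi>.closed v by simp
    have "f (y \<ominus>\<^bsub>P1\<^esub> ext P1 q v) = \<zero>\<^bsub>P0\<^esub>"
      using f.diff[OF y c] fpsi[OF v(1)] z v g.M.diff_self[OF fy(1)] by simp
    then have "y \<ominus>\<^bsub>P1\<^esub> ext P1 q v \<in> mod_ker P1 P0 f" using y c by (simp add: mod_ker_def)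
    moreover have "y = (y \<ominus>\<^bsub>P1\<^esub> ext P1 q v) \<oplus>\<^bsub>P1\<^esub> ext P1 q v" using f.M.mdiff_add[OF y c] by simp
    ultimately show "y \<in> mod_ker P1 P0 f <+>\<^bsub>P1\<^esub> ext P1 q ` carrier D" using v unfolding f.M.mem_set_add by auto
  qed
  moreover have "mod_ker P1 P0 f <+>\<^bsub>P1\<^esub> ext P1 q ` carrier D \<subseteq> carrier P1"
    by (rule f.M.sub_subset[OF f.M.submodule_set_add[OF f.sub_ker im1]])
  ultimately have \<psi>s: "ext P1 q ` carrier D = carrier P1" using pp(10) im1 unfolding superfluous_def by blast
  have "mod_ker D P1 (ext P1 q) \<subseteq> rad A D"
  proof
    fix v assume "v \<in> mod_ker D P1 (ext P1 q)"
    then have v: "v \<in> idem_sum A s e" "ext P1 q v = \<zero>\<^bsub>P1\<^esub>" by (auto simp: mod_ker_def)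
    have c: "ext P u v \<in> carrier P" using mod_homD(1)[OF ext_hom[OF P.left_module_axioms u(1)]] v by simp
    have "\<alpha> (ext P u v) = \<alpha> \<zero>\<^bsub>P\<^esub>" using fpsi[OF v(1)] v(2) f.zero \<alpha>.zero by simp
    then have "ext P u v = \<zero>\<^bsub>P\<^esub>" using \<alpha>i c by (auto simp: inj_on_def)
    then show "v \<in> rad A D" by (rule kernel_rad[OF v(1)])
  qed
  then have "inj_on (ext P1 q) (carrier D)" by (rule \<psi>.cover_inj[OF finD \<psi>s db1])
  then have "bij_betw (ext P1 q) (idem_sum A s e) (carrier P1)" using \<psi>s by (simp add: bij_betw_def)
  then show ?thesis using that \<alpha>(1) \<alpha>s q by blast
qed

end

end

section \<open>Lengths of the right modules \<open>e A / e I\<close>\<close>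

lemma opp_r_coset: "H #>\<^bsub>opp A\<^esub> a = a <#\<^bsub>A\<^esub> H" and opp_l_coset: "a <#\<^bsub>opp A\<^esub> H = H #>\<^bsub>A\<^esub> a"
  by (simp_all add: r_coset_def l_coset_def)

lemma relpow_subset:
  fixes R S :: "('b \<times> 'b) set"
  assumes "R \<subseteq> S" "(x, y) \<in> R ^^ n" shows "(x, y) \<in> S ^^ n"
  using assms(2)
proof (induction n arbitrary: y)
  case (Suc n)
  then obtain z where "(x, z) \<in> R ^^ n" "(z, y) \<in> R" by auto
  then show ?case using Suc.IH[of z] assms(1) by auto
qed auto

context ring
begin

lemma mem_idem_ideal:
  assumes "ideal I R" "e \<in> carrier R" "e \<otimes> e = e"
  shows "x \<in> e <# I \<longleftrightarrow> x \<in> I \<and> e \<otimes> x = x"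
proof
  assume "x \<in> e <# I"
  then obtain h where h: "h \<in> I" "x = e \<otimes> h" by (auto simp: mem_l_coset)
  then have "h \<in> carrier R" using ideal.Icarr[OF assms(1)] by blast
  then show "x \<in> I \<and> e \<otimes> x = x"
    using h ideal.I_l_closed[OF assms(1)] assms by (simp add: m_assoc[symmetric])
next
  assume "x \<in> I \<and> e \<otimes> x = x"
  then show "x \<in> e <# I" unfolding mem_l_coset by (intro bexI[of _ x]) simp_all
qed

lemma sub_l_coset:
  assumes "ideal I R" "e \<in> carrier R"
  shows "submodule (e <# I) (opp R) (regular_module (opp R))"
proof -
  interpret B: ring "opp R" by (rule ring_opp)
  have "submodule I (opp R) (regular_module (opp R))" using ideal_opp[OF assms(1)] B.ideal_iff by blast
  from B.sub_r_coset[OF this, of e] show ?thesis using assms by (simp add: opp_r_coset)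
qed

text \<open>Both directions of the correspondence for \<open>e A \<rightarrow> e A / e I\<close>: a
  composition series of the quotient lifts to a strict chain above \<open>e I\<close>, and a strict
  chain between \<open>e I\<close> and \<open>e A\<close> pushes down. The first turns the length of
  a factor into steps of a chain elsewhere, the second bounds it from below.\<close>

lemma right_factor_fin:
  assumes fin: "fin_len (opp R) (regular_module (opp R))" and I: "ideal I R" and e: "e \<in> carrier R"
  shows "(e <# I, e <# carrier R) \<in> strict (opp R) ((regular_module (opp R))\<lparr>carrier := e <# carrier R\<rparr>)
           ^^ comp_length (opp R) (right_factor R e I)"
    and "(X, Y) \<in> strict (opp R) (regular_module (opp R)) ^^ n \<Longrightarrow> e <# I \<subseteq> X \<Longrightarrow> Y \<subseteq> e <# carrier R \<Longrightarrow>
      submodule X (opp R) (regular_module (opp R)) \<Longrightarrow> n \<le> comp_length (opp R) (right_factor R e I)"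
proof -
  interpret B: ring "opp R" by (rule ring_opp)
  interpret M: left_module "opp R" "regular_module (opp R)" by (rule B.left_module_regular)
  let ?E = "(regular_module (opp R))\<lparr>carrier := e <# carrier R\<rparr>"
  have Es: "submodule (e <# carrier R) (opp R) (regular_module (opp R))" by (rule sub_l_coset[OF oneideal e])
  have "e <# I \<subseteq> e <# carrier R" using ideal.Icarr[OF I] by (auto simp: l_coset_def)
  then have Is: "submodule (e <# I) (opp R) ?E" using sub_l_coset[OF I e] M.submodule_sub_iff[OF Es] by simp
  interpret E: left_module "opp R" ?E by (rule M.left_module_sub[OF Es])
  interpret q: module_hom "opp R" ?E "quot_module ?E (e <# I)" "E.quot_map (e <# I)" by (rule E.quot_hom[OF Is])
  note surj = E.quot_map_surj[OF Is] and ker = E.quot_map_ker[OF Is]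
  have finq: "fin_len (opp R) (quot_module ?E (e <# I))" by (rule q.fin_surj[OF surj M.fin_sub[OF Es fin]])
  have "({\<zero>\<^bsub>quot_module ?E (e <# I)\<^esub>}, carrier (quot_module ?E (e <# I)))
    \<in> strict (opp R) (quot_module ?E (e <# I)) ^^ comp_length (opp R) (right_factor R e I)"
    using relpow_inf[OF q.N.comp_length_chain[OF finq]] by (simp add: right_factor_def)
  from q.strict_chain_pre[OF surj this q.N.submodule_zero]
  show "(e <# I, e <# carrier R) \<in> strict (opp R) ?E ^^ comp_length (opp R) (right_factor R e I)"
    using ker by (simp add: q.pre_ker q.pre_carrier)
  assume c: "(X, Y) \<in> strict (opp R) (regular_module (opp R)) ^^ n" and X: "e <# I \<subseteq> X" and Y: "Y \<subseteq> e <# carrier R"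
    and Xs: "submodule X (opp R) (regular_module (opp R))"
  have XY: "X \<subseteq> Y" using strict_chain_sub[OF c Xs] by blast
  have "(X, Y) \<in> strict (opp R) ?E ^^ n" using c Y
  proof (induction n arbitrary: Y)
    case (Suc n)
    then obtain Z where Z: "(X, Z) \<in> strict (opp R) (regular_module (opp R)) ^^ n"
      "(Z, Y) \<in> strict (opp R) (regular_module (opp R))" by auto
    moreover have "Z \<subseteq> e <# carrier R" using Z(2) Suc.prems by (auto simp: strict_def)
    ultimately show ?case using Suc M.strict_sub[OF Es, of Z Y] by auto
  qed auto
  moreover have "submodule X (opp R) ?E" using Xs XY Y M.submodule_sub_iff[OF Es] by blast
  ultimately have "(E.quot_map (e <# I) ` X, E.quot_map (e <# I) ` Y) \<in> strict (opp R) (quot_module ?E (e <# I)) ^^ n"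
    using q.strict_chain_image[OF surj] X ker by blast
  then show "n \<le> comp_length (opp R) (right_factor R e I)"
    using q.N.strict_le_comp_length[OF finq _ q.sub_image[OF \<open>submodule X (opp R) ?E\<close>]]
    by (simp add: right_factor_def)
qed

lemma ideal_power_mono:
  assumes "ideal I R" shows "ideal_power R I (Suc n) \<subseteq> ideal_power R I n"
  using ideal_prod_inter[OF assms ideal_power_ideal[OF assms], of n] by simp

text \<open>Nakayama's lemma makes the powers of the radical strictly decreasing until they vanish.\<close>

lemma right_factor_length:
  assumes fl: "fin_len R (regular_module R)" and fr: "fin_len (opp R) (regular_module (opp R))"
    and e: "e \<in> carrier R" "e \<otimes> e = e" and x: "x \<in> ideal_power R (jacobson_radical R) n" "e \<otimes> x = x" "x \<noteq> \<zero>"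
  shows "n + 1 \<le> comp_length (opp R) (right_factor R e (ideal_power R (jacobson_radical R) (n + 1)))"
proof -
  let ?J = "jacobson_radical R" let ?p = "ideal_power R (jacobson_radical R)"
  note J = jacobson_ideal and pI = ideal_power_ideal[OF jacobson_ideal]
  have mono: "?p (m + k) \<subseteq> ?p m" for m k
    by (induction k) (use ideal_power_mono[OF J] in auto)
  have sub: "submodule (e <# ?p m) (opp R) (regular_module (opp R))" for m by (rule sub_l_coset[OF pI e(1)])
  have st: "(e <# ?p (Suc m), e <# ?p m) \<in> strict (opp R) (regular_module (opp R))" if m: "m \<le> n" for m
  proof (rule strictI[OF sub sub])
    have "e <# ?p (Suc m) \<subseteq> e <# ?p m" using ideal_power_mono[OF J, of m] unfolding l_coset_def by blast
    moreover have "e <# ?p (Suc m) \<noteq> e <# ?p m"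
    proof
      assume eq: "e <# ?p (Suc m) = e <# ?p m"
      \<comment> \<open>If the modules \<open>e J^m\<close> stall once, they stall for good: an
        element of \<open>e J^m\<close> is \<open>e\<close> times a sum of products
        \<open>a b\<close> with \<open>a \<in> J^m\<close> and \<open>b \<in> J\<close>, and
        \<open>e a\<close> lies in \<open>J^(m+k)\<close> by induction. Nilpotency then makes
        \<open>x\<close> zero.\<close>
      have step: "e <# ?p m \<subseteq> e <# ?p (m + k)" for k
      proof (induction k)
        case (Suc k)
        have "e <# ?p m \<subseteq> e <# ?p (Suc (m + k))"
        proof
          fix y assume "y \<in> e <# ?p m"
          then have "y \<in> e <# ?p (Suc m)" using eq by simp
          then have y: "y \<in> ideal_prod R (?p m) ?J" "e \<otimes> y = y"
            using mem_idem_ideal[OF pI e, of y "Suc m"] ideal_power_commute[OF J, of m] by auto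
          have "e \<otimes> y \<in> ?p (Suc (m + k))" using y(1)
          proof induction
            case (prod a b)
            have ab: "a \<in> carrier R" "b \<in> carrier R" using prod ideal.Icarr[OF pI] jacobson_carr by auto
            have "e \<otimes> a \<in> e <# ?p m" using prod unfolding mem_l_coset by blast
            then have "e \<otimes> a \<in> e <# ?p (m + k)" using Suc by blast
            then have "e \<otimes> a \<in> ?p (m + k)" using mem_idem_ideal[OF pI e] by blast
            then have "(e \<otimes> a) \<otimes> b \<in> ?p (Suc (m + k))" using ideal_power_prod[OF J _ prod(2)] by blast
            then show ?case using ab e by (simp add: m_assoc)
          next
            case (sum a b)
            have "a \<in> carrier R" "b \<in> carrier R"
              using sum ideal_prod_in_carrier[OF pI J] by blast+
            then show ?case
              using sum(3,4) e additive_subgroup.a_closed[OF ideal.axioms(1)[OF pI[of "Suc (m + k)"]]]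
              by (simp add: r_distr del: ideal_power.simps)
          qed
          then show "y \<in> e <# ?p (Suc (m + k))" using mem_idem_ideal[OF pI e, of y "Suc (m + k)"] y by auto
        qed
        then show ?case by simp
      qed simp
      obtain k where k: "?p k = {\<zero>}" using jacobson_nilpotent[OF fl] .
      have "x \<in> ?p m" using x(1) mono[of m "n - m"] m by auto
      then have "x \<in> e <# ?p m" using x(2) mem_idem_ideal[OF pI e] by blast
      then have "x \<in> e <# ?p (m + k)" using step by blast
      then have "x \<in> ?p (m + k)" using mem_idem_ideal[OF pI e] by blast
      then have "x \<in> ?p k" using mono[of k m] by (auto simp: add.commute)
      then show False using k x(3) by simp
    qed
    ultimately show "e <# ?p (Suc m) \<subset> e <# ?p m" by blast
  qed
  \<comment> \<open>From exponent \<open>n + 1\<close> down to 0 there are \<open>n + 1\<close>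
    strict steps. This is where \<open>c i + 1\<close> in the final estimate comes from.\<close>
  have "(e <# ?p (Suc n), e <# ?p (n - k)) \<in> strict (opp R) (regular_module (opp R)) ^^ (k + 1)" if "k \<le> n" for k
    using that
  proof (induction k)
    case 0
    then show ?case using st[of n] by simp
  next
    case (Suc k)
    have "(e <# ?p (n - k), e <# ?p (n - Suc k)) \<in> strict (opp R) (regular_module (opp R))"
      using st[of "n - Suc k"] Suc.prems by (simp add: Suc_diff_Suc)
    then show ?case using Suc by auto
  qed
  from this[of n] have "(e <# ?p (Suc n), e <# carrier R) \<in> strict (opp R) (regular_module (opp R)) ^^ (n + 1)"
    by simp
  from right_factor_fin(2)[OF fr pI e(1) this subset_refl subset_refl sub] show ?thesis
    by (simp del: ideal_power.simps)
qed

end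

section \<open>The bound for an arbitrary minimal presentation\<close>

context transpose_bound
begin

context
  fixes P1 :: "('a, 'p1) module" and P0 :: "('a, 'p0) module" and f g
  assumes mpp: "min_proj_presentation A P1 P0 f g X"
begin

abbreviation "C \<equiv> ring_dual A P1"
abbreviation "Im \<equiv> (\<lambda>h. compose (carrier P1) h f) ` carrier (ring_dual A P0)"
abbreviation "Jp i \<equiv> ideal_power A (jacobson_radical A) (c i + 1)"

lemma C_module: "left_module (opp A) C"
  by (rule left_module.left_module_ring_dual[OF fg_left_module[OF presentation_props(1)[OF mpp]]])

lemma Im_sub: "submodule Im (opp A) C"
proof -
  note pp = presentation_props[OF mpp]
  interpret P1: left_module A P1 by (rule fg_left_module[OF pp(1)])
  interpret P0: left_module A P0 by (rule fg_left_module[OF pp(2)])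
  have fc: "f x \<in> carrier P0" if "x \<in> carrier P1" for x using mod_homD(1)[OF pp(7) that] .
  have "restrict (\<lambda>h. compose (carrier P1) h f) (carrier (ring_dual A P0)) \<in> mod_hom (opp A) (ring_dual A P0) C"
    by (rule mod_hom_restrictI[OF P0.left_module_ring_dual])
      (auto simp: fun_eq_iff compose_def fc intro: mod_hom_comp[OF P1.left_module_axioms pp(7), unfolded compose_def])
  then interpret m: module_hom "opp A" "ring_dual A P0" C "restrict (\<lambda>h. compose (carrier P1) h f) (carrier (ring_dual A P0))"
    by (rule module_homI[OF P0.left_module_ring_dual C_module])
  have "restrict (\<lambda>h. compose (carrier P1) h f) (carrier (ring_dual A P0)) ` carrier (ring_dual A P0) = Im"
    by (rule image_cong) auto
  then show ?thesis using m.sub_image[OF m.M.submodule_carrier] by simp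
qed

text \<open>A filtration of \<open>C\<close> from \<open>Y 0\<close> to \<open>C\<close> has as many
  strict steps as the sum on the left. On the other side \<open>Y 0 \<subseteq> Y 0 + Im\<close> is
  a single weak cover, and a chain of strict covers above \<open>Y 0 + Im\<close> maps to a strict
  chain in \<open>C / Im\<close>. The comparison leaves the 1 on the right.\<close>

lemma transpose_length:
  shows "(\<Sum>i<s. comp_length (opp A) (right_factor A (e i) (Jp i))) \<le> comp_length (opp A) (quot_module C Im) + 1"
    and "fg_module (opp A) (quot_module C Im)"
proof -
  note pp = presentation_props[OF mpp]
  obtain \<alpha> q where \<alpha>: "\<alpha> \<in> mod_hom A P P0" "\<alpha> ` carrier P = carrier P0"
    and q: "\<And>i. i < s \<Longrightarrow> q i \<in> carrier P1" "\<And>i. i < s \<Longrightarrow> e i \<odot>\<^bsub>P1\<^esub> q i = q i"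
      "\<And>i. i < s \<Longrightarrow> f (q i) = \<alpha> (u i)" and bij: "bij_betw (ext P1 q) (idem_sum A s e) (carrier P1)"
    by (rule presentation_generators[OF mpp]) blast
  interpret P1: left_module A P1 by (rule fg_left_module[OF pp(1)])
  interpret P0: left_module A P0 by (rule fg_left_module[OF pp(2)])
  interpret B: ring "opp A" by (rule ring_opp)
  interpret BM: left_module "opp A" "regular_module (opp A)" by (rule B.left_module_regular)
  interpret C: left_module "opp A" C by (rule C_module)
  interpret \<alpha>: module_hom A P P0 \<alpha> by (rule module_homI[OF P.left_module_axioms P0.left_module_axioms \<alpha>(1)])
  interpret \<psi>: module_hom A D P1 "ext P1 q"
    by (rule module_homI[OF D_left_module P1.left_module_axioms ext_hom[OF P1.left_module_axioms q(1)]])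
  interpret i\<psi>: module_hom A P1 D "restrict (inv_into (carrier D) (ext P1 q)) (carrier P1)"
    by (rule module_homI[OF P1.left_module_axioms D_left_module \<psi>.inverse]) (use bij in simp)
  have JI: "ideal (Jp i) A" for i by (rule ideal_power_ideal[OF jacobson_ideal])
  have zc: "z x \<in> carrier A" if "z \<in> carrier C" "x \<in> carrier P1" for z x
    using that mod_homD(1)[of z A P1 "regular_module A" x] by simp
  have zq: "e i \<otimes> z (q i) = z (q i)" if "z \<in> carrier C" "i < s" for z i
    using mod_homD(3)[of z A P1 "regular_module A" "e i" "q i"] that q idem by simp
  have ev: "restrict (\<lambda>z. z (q i)) (carrier C) \<in> mod_hom (opp A) C (regular_module (opp A))" if i: "i < s" for i
    by (rule mod_hom_restrictI[OF C_module]) (use zc q(1)[OF i] in auto)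
  \<comment> \<open>A map on \<open>P1\<close> is determined by its values at the
    \<open>q i\<close>. With \<open>exists\<close> below, this identifies \<open>C\<close> with the
    direct sum of the right modules \<open>(e i) A\<close>.\<close>
  have joint: "z = z'" if z: "z \<in> carrier C" "z' \<in> carrier C" "\<And>i. i < s \<Longrightarrow> z (q i) = z' (q i)" for z z'
  proof (rule mod_hom_eqI)
    show "z \<in> mod_hom A P1 (regular_module A)" "z' \<in> mod_hom A P1 (regular_module A)" using z by auto
    fix x assume x: "x \<in> carrier P1"
    then obtain v where v: "v \<in> idem_sum A s e" "x = ext P1 q v" using bij by (metis bij_betw_imp_surj_on imageE)
    have t: "(\<lambda>i. v i \<odot>\<^bsub>P1\<^esub> q i) \<in> {..<s} \<rightarrow> carrier P1" using D_nth[OF v(1)] q(1) P1.lsmult_closed by auto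
    have "y x = finsum (regular_module A) (\<lambda>i. v i \<otimes> y (q i)) {..<s}" if y: "y \<in> carrier C" for y
    proof -
      interpret y: module_hom A P1 "regular_module A" y
        by (rule module_homI[OF P1.left_module_axioms left_module_regular]) (use y in simp)
      have "y x = finsum (regular_module A) (\<lambda>i. y (v i \<odot>\<^bsub>P1\<^esub> q i)) {..<s}"
        unfolding v(2) ext_apply[OF v(1)] by (rule y.finsum[OF t])
      also have "\<dots> = finsum (regular_module A) (\<lambda>i. v i \<otimes> y (q i)) {..<s}"
        using D_nth[OF v(1)] q(1) y.smult y.closed by (intro y.N.M.finsum_cong') auto
      finally show ?thesis .
    qed
    moreover have "finsum (regular_module A) (\<lambda>i. v i \<otimes> z (q i)) {..<s} = finsum (regular_module A) (\<lambda>i. v i \<otimes> z' (q i)) {..<s}"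
      using D_nth[OF v(1)] zc[OF z(1)] zc[OF z(2)] q(1) z(3)
      by (intro abelian_monoid.finsum_cong' abelian_group.axioms(1) left_module.axioms(2)[OF left_module_regular]) auto
    ultimately show "z x = z' x" using z(1,2) by simp
  qed
  have exists: "\<exists>z\<in>carrier C. \<forall>i<s. z (q i) = b i"
    if b: "\<And>i. i < s \<Longrightarrow> b i \<in> carrier A" "\<And>i. i < s \<Longrightarrow> e i \<otimes> b i = b i" for b
  proof -
    let ?z = "compose (carrier P1) (ext (regular_module A) b) (restrict (inv_into (carrier D) (ext P1 q)) (carrier P1))"
    have "?z \<in> carrier C"
      using mod_hom_comp[OF P1.left_module_axioms i\<psi>.hom ext_hom[OF left_module_regular, of b]] b by simp
    moreover have "?z (q j) = b j" if j: "j < s" for j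
    proof -
      have "inv_into (idem_sum A s e) (ext P1 q) (q j) = gen j"
        using bij_betw_inv_into_left[OF bij gen_D[OF j]] ext_gen[OF P1.left_module_axioms q(1,2) j] by simp
      then show ?thesis
        using q(1)[OF j] ext_gen[OF left_module_regular, of b, OF _ _ j] b by (simp add: compose_def)
    qed
    ultimately show ?thesis by blast
  qed
  have finC: "fin_len (opp A) C"
  proof (rule fin_joint[OF C_module B.left_module_regular fin_right ev])
    fix z assume z: "z \<in> carrier C" "\<And>i. i < s \<Longrightarrow> restrict (\<lambda>z. z (q i)) (carrier C) z = \<zero>\<^bsub>regular_module (opp A)\<^esub>"
    show "z = \<zero>\<^bsub>C\<^esub>" by (rule joint[OF z(1) C.M.zero_closed]) (use z q(1) in auto)
  qed auto
  interpret qm: module_hom "opp A" C "quot_module C Im" "C.quot_map Im" by (rule C.quot_hom[OF Im_sub])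
  show "fg_module (opp A) (quot_module C Im)"
    by (rule qm.N.fin_fg[OF qm.fin_surj[OF C.quot_map_surj[OF Im_sub] finC]])
  \<comment> \<open>Coordinates from \<open>k\<close> on lie in the powers of the radical, the first
    \<open>k\<close> are free. \<open>Y 0\<close> is the kernel of the map to the direct sum of the
    factors, \<open>Y s\<close> is everything.\<close>
  define Y where "Y k = {z \<in> carrier C. \<forall>i<s. k \<le> i \<longrightarrow> z (q i) \<in> Jp i}" for k
  have Ys: "submodule (Y k) (opp A) C" for k
    unfolding C.submodule_iff Y_def
    using C.M.zero_closed C.M.add.m_closed C.lsmult_closed q(1) additive_subgroup.zero_closed[OF ideal.axioms(1)[OF JI]]
      additive_subgroup.a_closed[OF ideal.axioms(1)[OF JI]] ideal.I_r_closed[OF JI] by auto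
  \<comment> \<open>Evaluation at \<open>q k\<close> maps \<open>Y (Suc k)\<close> onto
    \<open>(e k) A\<close> and pulls \<open>(e k) J^(c k + 1)\<close> back to \<open>Y k\<close>, so
    a composition series of the factor pulls back to a strict chain.\<close>
  have Ystep: "(Y k, Y (Suc k)) \<in> strict (opp A) C ^^ comp_length (opp A) (right_factor A (e k) (Jp k))" if k: "k < s" for k
  proof -
    let ?E = "(regular_module (opp A))\<lparr>carrier := e k <# carrier A\<rparr>"
    let ?C = "C\<lparr>carrier := Y (Suc k)\<rparr>"
    have Es: "submodule (e k <# carrier A) (opp A) (regular_module (opp A))"
      by (rule sub_l_coset[OF oneideal idem(1)[OF k]])
    have memE: "x \<in> e k <# carrier A \<longleftrightarrow> x \<in> carrier A \<and> e k \<otimes> x = x" for x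
      by (rule mem_idem_ideal[OF oneideal idem(1,2)[OF k]])
    have memJ: "x \<in> e k <# Jp k \<longleftrightarrow> x \<in> Jp k \<and> e k \<otimes> x = x" for x
      by (rule mem_idem_ideal[OF JI idem(1,2)[OF k]])
    have YC: "Y k \<subseteq> carrier C" for k by (auto simp: Y_def)
    let ?v = "restrict (\<lambda>z. z (q k)) (Y (Suc k))"
    have "restrict (restrict (\<lambda>z. z (q k)) (carrier C)) (Y (Suc k)) = ?v"
      using YC[of "Suc k"] by (auto simp: restrict_def fun_eq_iff)
    then have v1: "?v \<in> mod_hom (opp A) ?C (regular_module (opp A))"
      using mod_hom_sub[OF C_module Ys ev[OF k], of "Suc k"] by simp
    have v2: "?v ` carrier ?C = e k <# carrier A"
    proof
      show "?v ` carrier ?C \<subseteq> e k <# carrier A"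
      proof
        fix x assume "x \<in> ?v ` carrier ?C"
        then obtain z where z: "z \<in> Y (Suc k)" "x = z (q k)" by auto
        then have zC: "z \<in> carrier C" using YC by blast
        show "x \<in> e k <# carrier A" unfolding memE z(2) using zc[OF zC q(1)[OF k]] zq[OF zC k] by simp
      qed
      show "e k <# carrier A \<subseteq> ?v ` carrier ?C"
      proof
        fix x assume "x \<in> e k <# carrier A"
        then have x: "x \<in> carrier A" "e k \<otimes> x = x" using memE by auto
        define b where "b i = (if i = k then x else \<zero>)" for i
        have "b i \<in> carrier A" "e i \<otimes> b i = b i" if "i < s" for i
          using x idem(1)[OF that] by (auto simp: b_def)
        then obtain z where z: "z \<in> carrier C" "\<forall>i<s. z (q i) = (if i = k then x else \<zero>)"
          using exists[of b] unfolding b_def by blast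
        then have "z \<in> Y (Suc k)"
          using additive_subgroup.zero_closed[OF ideal.axioms(1)[OF JI]] by (auto simp: Y_def)
        then show "x \<in> ?v ` carrier ?C" using z(2) k by (intro image_eqI[of _ _ z]) auto
      qed
    qed
    have v: "?v \<in> mod_hom (opp A) ?C ?E"
      using mod_hom_carrier_restrict[OF v1, of "e k <# carrier A"] v2 by simp
    interpret v: module_hom "opp A" ?C ?E ?v
      by (rule module_homI[OF C.left_module_sub[OF Ys] BM.left_module_sub[OF Es] v])
    have pJ: "v.pre (e k <# Jp k) = Y k"
    proof -
      have "z \<in> v.pre (e k <# Jp k) \<longleftrightarrow> z \<in> Y k" for z
      proof -
        have "z \<in> v.pre (e k <# Jp k) \<longleftrightarrow> z \<in> Y (Suc k) \<and> z (q k) \<in> Jp k"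
          using zq[OF _ k, of z] YC[of "Suc k"] memJ[of "z (q k)"] by (auto simp: v.pre_def)
        also have "\<dots> \<longleftrightarrow> z \<in> Y k" using k by (auto simp: Y_def Suc_le_eq order.order_iff_strict)
        finally show ?thesis .
      qed
      then show ?thesis by blast
    qed
    have Js: "submodule (e k <# Jp k) (opp A) ?E"
      using sub_l_coset[OF JI idem(1)[OF k]] BM.submodule_sub_iff[OF Es] memE memJ ideal.Icarr[OF JI] by blast
    have "v.pre (carrier ?E) = carrier ?C" by (rule v.pre_carrier)
    then have "(Y k, Y (Suc k)) \<in> strict (opp A) ?C ^^ comp_length (opp A) (right_factor A (e k) (Jp k))"
      using v.strict_chain_pre[OF _ right_factor_fin(1)[OF fin_right JI idem(1)[OF k]] Js] v2 pJ by simp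
    moreover have "strict (opp A) ?C \<subseteq> strict (opp A) C" using C.strict_sub[OF Ys] by auto
    ultimately show ?thesis using relpow_subset by metis
  qed
  have Ychain: "(Y 0, Y k) \<in> strict (opp A) C ^^ (\<Sum>i<k. comp_length (opp A) (right_factor A (e i) (Jp i)))" if "k \<le> s" for k
    using that
  proof (induction k)
    case (Suc k)
    then have "(Y 0, Y (Suc k)) \<in> strict (opp A) C ^^ (\<Sum>i<k. comp_length (opp A) (right_factor A (e i) (Jp i)))
      O strict (opp A) C ^^ comp_length (opp A) (right_factor A (e k) (Jp k))"
      using Ystep[of k] by (intro relcompI[of _ "Y k"]) simp_all
    then show ?case by (simp add: relpow_add)
  qed simp
  have Ysc: "Y s = carrier C" by (auto simp: Y_def)
  \<comment> \<open>An element of \<open>Im\<close> outside \<open>Y 0\<close> comes from some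
    \<open>h\<close> whose composite with \<open>\<alpha>\<close> does not land in \<open>J\<close>.
    By \<open>local_hom_gen\<close> such an element generates all of \<open>Im\<close>, so modulo
    \<open>Y 0\<close> the image is zero or simple.\<close>
  have gW: "h' \<in> Y 0 \<or> Im \<subseteq> Z" if Z: "submodule Z (opp A) C" and h': "h' \<in> Im" "h' \<in> Z" for Z h'
  proof (cases "h' \<in> Y 0")
    case False
    obtain h where h: "h \<in> mod_hom A P0 (regular_module A)" "h' = compose (carrier P1) h f" using h' by auto
    have ha: "compose (carrier P) h \<alpha> \<in> mod_hom A P (regular_module A)" if "h \<in> mod_hom A P0 (regular_module A)" for h
      by (rule mod_hom_comp[OF P.left_module_axioms \<alpha>(1) that])
    interpret ha: module_hom A P "regular_module A" "compose (carrier P) h \<alpha>"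
      by (rule module_homI[OF P.left_module_axioms left_module_regular ha[OF h(1)]])
    have nJ: "\<not> compose (carrier P) h \<alpha> ` carrier P \<subseteq> jacobson_radical A"
    proof
      assume J: "compose (carrier P) h \<alpha> ` carrier P \<subseteq> jacobson_radical A"
      have "h' (q i) \<in> Jp i" if i: "i < s" for i
      proof -
        have "{a \<odot>\<^bsub>P\<^esub> x | a x. a \<in> ideal_power A (jacobson_radical A) (c i) \<and> x \<in> carrier P} \<subseteq> ha.pre (Jp i)"
        proof clarify
          fix a x assume a: "a \<in> ideal_power A (jacobson_radical A) (c i)" "x \<in> carrier P"
          have ac: "a \<in> carrier A" using a(1) ideal.Icarr[OF ideal_power_ideal[OF jacobson_ideal]] by blast
          have "compose (carrier P) h \<alpha> (a \<odot>\<^bsub>P\<^esub> x) = a \<otimes> compose (carrier P) h \<alpha> x"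
            using ha.smult[OF ac a(2)] by simp
          also have "\<dots> \<in> Jp i" using ideal_power_prod[OF jacobson_ideal a(1)] J a(2) by auto
          finally show "a \<odot>\<^bsub>P\<^esub> x \<in> ha.pre (Jp i)" using P.lsmult_closed[OF ac a(2)] by (simp add: ha.pre_def)
        qed
        moreover have "submodule (Jp i) A (regular_module A)" using JI ideal_iff by blast
        ultimately have "ideal_times_module A (ideal_power A (jacobson_radical A) (c i)) P \<subseteq> ha.pre (Jp i)"
          unfolding ideal_times_module_def using P.span_least[OF ha.sub_pre] by blast
        then have "compose (carrier P) h \<alpha> (u i) \<in> Jp i" using u_rad[OF i] by (auto simp: ha.pre_def)
        then show ?thesis using h(2) q(1,3)[OF i] u(1)[OF i] by (simp add: compose_def)
      qed
      moreover have "h' \<in> carrier C" using C.sub_carr[OF Z h'(2)] .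
      ultimately show False using False by (auto simp: Y_def)
    qed
    have "compose (carrier P1) k f \<in> Z" if k: "k \<in> mod_hom A P0 (regular_module A)" for k
    proof -
      obtain b where b: "b \<in> carrier A" "\<And>x. x \<in> carrier P \<Longrightarrow> compose (carrier P) k \<alpha> x = compose (carrier P) h \<alpha> x \<otimes> b"
        using local_hom_gen[OF fin_left P.left_module_axioms finP local ha[OF h(1)] ha[OF k] nJ] by blast
      \<comment> \<open>\<open>local_hom_gen\<close> speaks about \<open>P\<close>; surjectivity of
        \<open>\<alpha>\<close> transfers the factorisation to \<open>P0\<close>.\<close>
      have "k y = h y \<otimes> b" if "y \<in> carrier P0" for y
        using that b(2) \<alpha>(2) by (metis (no_types, lifting) compose_eq imageE)
      then have "compose (carrier P1) k f = b \<odot>\<^bsub>C\<^esub> h'"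
        using h(2) mod_homD(1)[OF pp(7)] by (auto simp: fun_eq_iff compose_def)
      then show ?thesis using C.sub_smult[OF Z _ h'(2), of b] b(1) by simp
    qed
    then show ?thesis by auto
  qed simp
  have U: "submodule (Y 0 <+>\<^bsub>C\<^esub> Im) (opp A) C" by (rule C.submodule_set_add[OF Ys Im_sub])
  \<comment> \<open>If \<open>Z\<close> contains \<open>w + h\<close> outside \<open>Y 0\<close>,
    with \<open>w\<close> in \<open>Y 0\<close> and \<open>h\<close> in \<open>Im\<close>, it
    contains \<open>h\<close>, which is outside \<open>Y 0\<close> as well, and so all of
    \<open>Im\<close> by \<open>gW\<close>.\<close>
  have w: "(Y 0, Y 0 <+>\<^bsub>C\<^esub> Im) \<in> wcov (opp A) C"
  proof (rule wcovI[OF Ys U C.set_add_upper(1)[OF Ys Im_sub]])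
    fix Z assume Z: "submodule Z (opp A) C" "Y 0 \<subseteq> Z" "Z \<subseteq> Y 0 <+>\<^bsub>C\<^esub> Im" "Z \<noteq> Y 0 <+>\<^bsub>C\<^esub> Im"
    show "Z = Y 0"
    proof (rule ccontr)
      assume "Z \<noteq> Y 0"
      then obtain z where z: "z \<in> Z" "z \<notin> Y 0" using Z by blast
      then have "z \<in> Y 0 <+>\<^bsub>C\<^esub> Im" using Z(3) by blast
      then obtain w h where wh: "w \<in> Y 0" "h \<in> Im" "z = w \<oplus>\<^bsub>C\<^esub> h" unfolding C.mem_set_add by blast
      have c: "w \<in> carrier C" "h \<in> carrier C" using C.sub_carr[OF Ys wh(1)] C.sub_carr[OF Im_sub wh(2)] .
      have "h \<oplus>\<^bsub>C\<^esub> w \<in> Z" using wh(3) z(1) C.M.a_comm[OF c] by simp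
      then have "h \<in> Z" using C.add_mem_iff[OF Z(1) _ c(2), of w] wh(1) Z(2) by blast
      moreover have "h \<notin> Y 0" using z(2) wh C.sub_add[OF Ys] by blast
      ultimately have "Im \<subseteq> Z" using gW[OF Z(1) wh(2)] by blast
      then show False using Z C.set_add_least[OF Z(1,2)] by blast
    qed
  qed
  obtain m where m: "(Y 0 <+>\<^bsub>C\<^esub> Im, carrier C) \<in> (wcov (opp A) C \<inter> strict (opp A) C) ^^ m"
    using C.cover_chain[OF finC U C.submodule_carrier C.sub_subset[OF U]] .
  have "(Y 0, carrier C) \<in> wcov (opp A) C ^^ Suc m"
    by (rule relpow_Suc_I2[OF w]) (use relpow_inf[OF m] in blast)
  then have "(\<Sum>i<s. comp_length (opp A) (right_factor A (e i) (Jp i))) \<le> Suc m"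
    using C.strict_le_wcov[OF Ychain[of s] _ order_refl _ Ys Ys] Ysc by auto
  moreover have "m \<le> comp_length (opp A) (quot_module C Im)"
  proof -
    have "(C.quot_map Im ` (Y 0 <+>\<^bsub>C\<^esub> Im), C.quot_map Im ` carrier C) \<in> strict (opp A) (quot_module C Im) ^^ m"
      by (rule qm.strict_chain_image[OF C.quot_map_surj[OF Im_sub] _ U])
        (use relpow_inf[OF m] C.quot_map_ker[OF Im_sub] C.set_add_upper(2)[OF Ys Im_sub] in auto)
    then show ?thesis
      by (rule qm.N.strict_le_comp_length[OF qm.fin_surj[OF C.quot_map_surj[OF Im_sub] finC] _ qm.sub_image[OF U]])
  qed
  ultimately show "(\<Sum>i<s. comp_length (opp A) (right_factor A (e i) (Jp i))) \<le> comp_length (opp A) (quot_module C Im) + 1"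
    by simp
qed

end

text \<open>\<open>presentation_exists\<close> guarantees that the chosen tuple is a minimal
  projective presentation, and \<open>transpose_length\<close> holds for all of them.\<close>

lemma Tr_length:
  shows "(\<Sum>i<s. comp_length (opp A) (right_factor A (e i) (ideal_power A (jacobson_radical A) (c i + 1))))
      \<le> comp_length (opp A) (Tr A X) + 1"
    and "fg_module (opp A) (Tr A X)"
proof -
  let ?S = "SOME (P1 :: ('a, 'a fgtype) module, P0 :: ('a, 'a fgtype) module, f, g). min_proj_presentation A P1 P0 f g X"
  obtain P1 P0 f g where S: "?S = (P1, P0, f, g)" by (cases ?S) blast
  obtain Q1 Q0 :: "('a, 'a fgtype) module" and f' g' where "min_proj_presentation A Q1 Q0 f' g' X"
    by (rule presentation_exists)
  then have "case ?S of (P1, P0, f, g) \<Rightarrow> min_proj_presentation A P1 P0 f g X"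
    by (intro someI[of "\<lambda>(P1, P0, f, g). min_proj_presentation A P1 P0 f g X" "(Q1, Q0, f', g')"]) simp
  then have mpp: "min_proj_presentation A P1 P0 f g X" unfolding S by simp
  have "Tr A X = quot_module (ring_dual A P1) ((\<lambda>h. compose (carrier P1) h f) ` carrier (ring_dual A P0))"
    unfolding Tr_def S by simp
  then show "(\<Sum>i<s. comp_length (opp A) (right_factor A (e i) (ideal_power A (jacobson_radical A) (c i + 1))))
      \<le> comp_length (opp A) (Tr A X) + 1" "fg_module (opp A) (Tr A X)"
    using transpose_length[OF mpp] by simp_all
qed

text \<open>\<open>right_factor_length\<close> needs a nonzero element of
  \<open>(e i) J^(c i)\<close>. If there were none, the submodule of all \<open>x\<close> with
  \<open>(e i) A x = 0\<close> would contain \<open>J^(c i) P\<close>, hence \<open>u i\<close>,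
  which is nonzero and fixed by \<open>e i\<close>.\<close>

lemma factor_length:
  assumes i: "i < s"
  shows "c i + 1 \<le> comp_length (opp A) (right_factor A (e i) (ideal_power A (jacobson_radical A) (c i + 1)))"
proof -
  have JI: "ideal (ideal_power A (jacobson_radical A) (c i)) A" by (rule ideal_power_ideal[OF jacobson_ideal])
  have "\<exists>x. x \<in> ideal_power A (jacobson_radical A) (c i) \<and> e i \<otimes> x = x \<and> x \<noteq> \<zero>" (is ?ex)
  proof (rule ccontr)
    assume *: "\<not> ?ex"
    have ez: "e i \<otimes> a = \<zero>" if a: "a \<in> ideal_power A (jacobson_radical A) (c i)" for a
    proof -
      have "e i \<otimes> (e i \<otimes> a) = e i \<otimes> a"
        using idem[OF i] ideal.Icarr[OF JI a] by (simp flip: m_assoc)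
      then show ?thesis using * ideal.I_l_closed[OF JI a idem(1)[OF i]] by blast
    qed
    let ?K = "{x \<in> carrier P. \<forall>b\<in>carrier A. e i \<odot>\<^bsub>P\<^esub> (b \<odot>\<^bsub>P\<^esub> x) = \<zero>\<^bsub>P\<^esub>}"
    have "submodule ?K A P"
      unfolding P.submodule_iff
      using idem(1)[OF i] P.lsmult_closed P.lsmult_r_distr P.smult_r_zero
      by (auto simp flip: P.lsmult_assoc)
    moreover have "{a \<odot>\<^bsub>P\<^esub> x | a x. a \<in> ideal_power A (jacobson_radical A) (c i) \<and> x \<in> carrier P} \<subseteq> ?K"
    proof
      fix y assume "y \<in> {a \<odot>\<^bsub>P\<^esub> x | a x. a \<in> ideal_power A (jacobson_radical A) (c i) \<and> x \<in> carrier P}"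
      then obtain a x where y: "y = a \<odot>\<^bsub>P\<^esub> x" and a: "a \<in> ideal_power A (jacobson_radical A) (c i)" "x \<in> carrier P"
        by blast
      have ac: "a \<in> carrier A" using ideal.Icarr[OF JI a(1)] .
      have "e i \<odot>\<^bsub>P\<^esub> (b \<odot>\<^bsub>P\<^esub> (a \<odot>\<^bsub>P\<^esub> x)) = \<zero>\<^bsub>P\<^esub>" if b: "b \<in> carrier A" for b
      proof -
        have "e i \<odot>\<^bsub>P\<^esub> (b \<odot>\<^bsub>P\<^esub> (a \<odot>\<^bsub>P\<^esub> x)) = (e i \<otimes> (b \<otimes> a)) \<odot>\<^bsub>P\<^esub> x"
          using b ac a(2) idem(1)[OF i] by (simp add: P.lsmult_assoc P.lsmult_closed)
        then show ?thesis using ez[OF ideal.I_l_closed[OF JI a(1) b]] a(2) P.smult_l_zero by simp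
      qed
      then show "y \<in> ?K" using P.lsmult_closed[OF ac a(2)] y by blast
    qed
    ultimately have "u i \<in> ?K" using u_rad[OF i] P.span_least unfolding ideal_times_module_def by blast
    then have "e i \<odot>\<^bsub>P\<^esub> (\<one> \<odot>\<^bsub>P\<^esub> u i) = \<zero>\<^bsub>P\<^esub>" by blast
    then show False using u[OF i] P.lsmult_one by simp
  qed
  then show ?thesis using right_factor_length[OF fin_left fin_right idem[OF i]] by blast
qed

end

section \<open>Commutative artinian rings have finite length\<close>

text \<open>The union of a chain of submodules avoiding \<open>w\<close> again avoids it, so Zorn's
  lemma applies. This supplies maximal elements while only the descending chain condition is
  known.\<close>

lemma (in left_module) avoiding_maximal:
  assumes L: "submodule L A M" "L \<subseteq> W" "w \<notin> L" and W: "submodule W A M"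
  shows "\<exists>W'. submodule W' A M \<and> L \<subseteq> W' \<and> W' \<subseteq> W \<and> w \<notin> W' \<and>
    (\<forall>Z. submodule Z A M \<longrightarrow> W' \<subseteq> Z \<longrightarrow> Z \<subseteq> W \<longrightarrow> Z \<noteq> W' \<longrightarrow> w \<in> Z)"
proof -
  let ?S = "{Z. submodule Z A M \<and> L \<subseteq> Z \<and> Z \<subseteq> W \<and> w \<notin> Z}"
  have "\<exists>Z\<in>?S. \<forall>Y\<in>?S. Z \<subseteq> Y \<longrightarrow> Y = Z"
  proof (rule subset_Zorn_nonempty)
    show "?S \<noteq> {}" using L by blast
    fix C assume C: "C \<noteq> {}" "subset.chain ?S C"
    have mem: "submodule Z A M \<and> L \<subseteq> Z \<and> Z \<subseteq> W \<and> w \<notin> Z" if "Z \<in> C" for Z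
      using that C(2) unfolding subset.chain_def by blast
    have tot: "Z \<subseteq> Z' \<or> Z' \<subseteq> Z" if "Z \<in> C" "Z' \<in> C" for Z Z'
      using that C(2) unfolding subset.chain_def by blast
    have "submodule (\<Union>C) A M"
      unfolding submodule_iff
    proof (intro conjI ballI)
      show "\<Union>C \<subseteq> carrier M" using mem sub_carr by blast
      show "\<zero>\<^bsub>M\<^esub> \<in> \<Union>C" using C(1) mem sub_zero by blast
      show "a \<odot>\<^bsub>M\<^esub> x \<in> \<Union>C" if "a \<in> carrier A" "x \<in> \<Union>C" for a x
        using that mem sub_smult by blast
      fix x y assume "x \<in> \<Union>C" "y \<in> \<Union>C"
      then obtain Z Z' where Z: "Z \<in> C" "Z' \<in> C" "x \<in> Z" "y \<in> Z'" by blast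
      then show "x \<oplus>\<^bsub>M\<^esub> y \<in> \<Union>C"
      proof (cases "Z \<subseteq> Z'")
        case True
        then have "x \<oplus>\<^bsub>M\<^esub> y \<in> Z'" using Z mem[OF Z(2)] sub_add[of Z' x y] by blast
        then show ?thesis using Z by blast
      next
        case False
        then have "y \<in> Z" using Z tot[OF Z(1,2)] by blast
        then have "x \<oplus>\<^bsub>M\<^esub> y \<in> Z" using Z mem[OF Z(1)] sub_add[of Z x y] by blast
        then show ?thesis using Z by blast
      qed
    qed
    then show "\<Union>C \<in> ?S" using C(1) mem by blast
  qed
  then obtain W' where W': "W' \<in> ?S" "\<forall>Y\<in>?S. W' \<subseteq> Y \<longrightarrow> Y = W'" by (rule bexE)
  have "w \<in> Z" if Z: "submodule Z A M" "W' \<subseteq> Z" "Z \<subseteq> W" "Z \<noteq> W'" for Z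
  proof (rule ccontr)
    assume "w \<notin> Z"
    then have "Z \<in> ?S" using Z W'(1) by auto
    then show False using W'(2) Z by blast
  qed
  then show ?thesis using W'(1) by (intro exI[of _ W']) simp
qed

context cring
begin

lemma ideal_sub_iff: "ideal I R \<longleftrightarrow> submodule I R (regular_module R)"
proof -
  have "\<forall>x\<in>I. \<forall>a\<in>carrier R. x \<otimes> a \<in> I" if "submodule I R (regular_module R)"
    using that unfolding left_ideal_iff using m_comm by (metis subsetD)
  then show ?thesis using ideal_iff by blast
qed

text \<open>Dependent choice turns the descending chain condition into the minimum condition, the
  form in which it is used from here on.\<close>

lemma artinian_min:
  assumes art: "artinian R" and P: "P I" "\<And>I. P I \<Longrightarrow> ideal I R"
  obtains K where "P K" "\<And>I. P I \<Longrightarrow> I \<subseteq> K \<Longrightarrow> I = K"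
proof -
  have "\<exists>K. P K \<and> (\<forall>I. P I \<longrightarrow> I \<subseteq> K \<longrightarrow> I = K)"
  proof (rule ccontr)
    assume "\<not> ?thesis"
    then have step: "\<exists>I. P I \<and> I \<subset> K" if "P K" for K using that by blast
    have "\<exists>f. \<forall>n. P (f n) \<and> f (Suc n) \<subset> f n"
      by (rule dependent_nat_choice[of "\<lambda>_ I. P I" "\<lambda>_ K I. I \<subset> K"]) (use P(1) step in blast)+
    then obtain f where f: "\<And>n. P (f n)" "\<And>n. f (Suc n) \<subset> f n" by blast
    then obtain n where "\<forall>m\<ge>n. f m = f n" using art P(2) unfolding artinian_def by (metis psubset_imp_subset)
    then show False using f(2)[of n] by (metis le_SucI order_refl psubset_eq)
  qed
  then show ?thesis using that by blast
qed

lemma maximal_inverse: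
  assumes m: "maximal_submodule R (regular_module R) m" and r: "r \<in> carrier R" "r \<notin> m"
  obtains t where "t \<in> carrier R" "\<one> \<ominus> t \<otimes> r \<in> m"
proof -
  interpret M: left_module R "regular_module R" by (rule left_module_regular)
  obtain n t where nt: "n \<in> m" "t \<in> carrier R" "\<one> = n \<oplus> t \<otimes> r"
    using M.maximal_gen[OF m, of r \<one>] r by auto
  have nc: "n \<in> carrier R" using nt(1) m M.sub_carr[of m n] by (simp add: maximal_submodule_def)
  have "\<one> \<ominus> t \<otimes> r = n" unfolding nt(3) using nc nt(2) r(1) by (simp add: a_minus_def a_assoc r_neg)
  then show ?thesis using that nt by simp
qed

text \<open>\<open>I / L\<close> is a vector space over the field \<open>R / m\<close> with
  descending chain condition, hence of finite dimension. In terms of chains: let \<open>W\<close> be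
  the smallest ideal above \<open>L\<close> joined to \<open>I\<close> by a finite chain; if
  \<open>W \<noteq> L\<close>, a hyperplane \<open>W'\<close> of \<open>W\<close> above
  \<open>L\<close> would prolong the chain.\<close>

lemma layer_finite:
  assumes art: "artinian R" and m: "maximal_submodule R (regular_module R) m"
    and L: "ideal L R" and I: "ideal I R" and LI: "L \<subseteq> I" and mI: "\<And>a x. a \<in> m \<Longrightarrow> x \<in> I \<Longrightarrow> a \<otimes> x \<in> L"
  shows "\<exists>n. (L, I) \<in> wcov R (regular_module R) ^^ n"
proof -
  interpret M: left_module R "regular_module R" by (rule left_module_regular)
  let ?P = "\<lambda>W. ideal W R \<and> L \<subseteq> W \<and> W \<subseteq> I \<and> (\<exists>n. (W, I) \<in> wcov R (regular_module R) ^^ n)"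
  have "?P I" using I LI by (auto intro!: exI[of _ 0])
  then obtain W where W: "?P W" "\<And>Z. ?P Z \<Longrightarrow> Z \<subseteq> W \<Longrightarrow> Z = W"
    by (rule artinian_min[OF art, of ?P]) blast+
  have "W = L"
  proof (rule ccontr)
    assume "W \<noteq> L"
    then obtain w where w: "w \<in> W" "w \<notin> L" using W(1) by blast
    have Ls: "submodule L R (regular_module R)" using L ideal_sub_iff by blast
    have Ws: "submodule W R (regular_module R)" using W(1) ideal_sub_iff by blast
    have LW: "L \<subseteq> W" using W(1) by blast
    obtain W' where W'a: "submodule W' R (regular_module R) \<and> L \<subseteq> W' \<and> W' \<subseteq> W \<and> w \<notin> W' \<and>
      (\<forall>Z. submodule Z R (regular_module R) \<longrightarrow> W' \<subseteq> Z \<longrightarrow> Z \<subseteq> W \<longrightarrow> Z \<noteq> W' \<longrightarrow> w \<in> Z)"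
      using M.avoiding_maximal[OF Ls LW w(2) Ws] by (rule exE)
    then have W': "submodule W' R (regular_module R)" "L \<subseteq> W'" "W' \<subseteq> W" "w \<notin> W'" by blast+
    have W'5: "w \<in> Z" if "submodule Z R (regular_module R)" "W' \<subseteq> Z" "Z \<subseteq> W" "Z \<noteq> W'" for Z
      using W'a that by blast
    have WI: "ideal W R" using W(1) by blast
    have wc: "w \<in> carrier R" using ideal.Icarr[OF WI w(1)] .
    \<comment> \<open>\<open>W'\<close>, maximal without \<open>w\<close>, is a hyperplane. For
      \<open>y\<close> in \<open>W\<close> outside \<open>W'\<close> one has
      \<open>w = w' + r y\<close> with \<open>r\<close> outside \<open>m\<close>, since otherwise
      \<open>r y \<in> L\<close> and \<open>w \<in> W'\<close>. As \<open>r\<close> is invertible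
      modulo \<open>m\<close> and \<open>m y \<subseteq> L\<close>, any \<open>Z\<close> above
      \<open>W'\<close> that contains \<open>w\<close> contains \<open>y\<close>.\<close>
    have "(W', W) \<in> wcov R (regular_module R)"
    proof (rule wcovI[OF W'(1) Ws W'(3)], rule ccontr)
      fix Z assume Z: "submodule Z R (regular_module R)" "W' \<subseteq> Z" "Z \<subseteq> W" "Z \<noteq> W" "Z \<noteq> W'"
      then have wZ: "w \<in> Z" using W'5 by blast
      have "y \<in> Z" if y: "y \<in> W" for y
      proof (cases "y \<in> W'")
        case False
        have yc: "y \<in> carrier R" "y \<in> carrier (regular_module R)" using ideal.Icarr[OF WI y] by auto
        have cy: "submodule (M.cyc y) R (regular_module R)" by (rule M.submodule_cyc[OF yc(2)])
        have "w \<in> W' <+>\<^bsub>regular_module R\<^esub> M.cyc y"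
        proof (rule W'5[OF M.submodule_set_add[OF W'(1) cy] M.set_add_upper(1)[OF W'(1) cy]])
          show "W' <+>\<^bsub>regular_module R\<^esub> M.cyc y \<subseteq> W"
            by (rule M.set_add_least[OF Ws W'(3) M.cyc_least[OF Ws y]])
          show "W' <+>\<^bsub>regular_module R\<^esub> M.cyc y \<noteq> W'"
            using M.set_add_upper(2)[OF W'(1) cy] M.cyc_self[OF yc(2)] False by blast
        qed
        then obtain w' z where "w' \<in> W'" "z \<in> M.cyc y" "w = w' \<oplus>\<^bsub>regular_module R\<^esub> z"
          unfolding M.mem_set_add by blast
        then obtain r where r: "w' \<in> W'" "r \<in> carrier R" "w = w' \<oplus> r \<otimes> y" unfolding M.mem_cyc by auto
        have w'c: "w' \<in> carrier R" using M.sub_carr[OF W'(1) r(1)] by simp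
        have "r \<notin> m"
        proof
          assume "r \<in> m"
          then have "r \<otimes> y \<in> W'" using mI[of r y] y W(1) W'(2) by blast
          then show False using r W'(4) M.sub_add[OF W'(1), of w' "r \<otimes> y"] by simp
        qed
        then obtain t where t: "t \<in> carrier R" "\<one> \<ominus> t \<otimes> r \<in> m" by (rule maximal_inverse[OF m r(2)])
        have "(\<one> \<ominus> t \<otimes> r) \<otimes> y \<in> L" using mI[OF t(2)] y W(1) by blast
        then have 1: "(\<one> \<ominus> t \<otimes> r) \<otimes> y \<in> Z" using W'(2) Z(2) by blast
        have 2: "t \<otimes> (r \<otimes> y) \<in> Z"
        proof -
          have "r \<otimes> y \<oplus> w' \<in> Z" using wZ r(3) a_comm[of w' "r \<otimes> y"] w'c r(2) yc by simp
          then have "r \<otimes> y \<in> Z"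
            using M.add_mem_iff[OF Z(1), of w' "r \<otimes> y"] r yc Z(2) by auto
          then show ?thesis using M.sub_smult[OF Z(1) t(1)] by simp
        qed
        have "(\<one> \<ominus> t \<otimes> r) \<otimes> y \<oplus> t \<otimes> (r \<otimes> y) = y"
          using t(1) r(2) yc(1) by (simp add: a_minus_def l_distr l_minus m_assoc a_assoc l_neg)
        then show ?thesis using M.sub_add[OF Z(1) 1 2] by simp
      qed (use Z in blast)
      then show False using Z by blast
    qed
    then have "?P W'"
    proof -
      obtain n where "(W, I) \<in> wcov R (regular_module R) ^^ n" using W(1) by blast
      then have "(W', I) \<in> wcov R (regular_module R) ^^ Suc n"
        using \<open>(W', W) \<in> wcov R (regular_module R)\<close> by (intro relpow_Suc_I2)
      then show ?thesis using W' W(1) ideal_sub_iff by (meson order_trans)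
    qed
    then show False using W(2)[of W'] W'(3,4) w(1) by blast
  qed
  then show ?thesis using W(1) by blast
qed

lemma maximal_above:
  assumes L: "ideal L R" "\<one> \<notin> L"
  obtains m where "maximal_submodule R (regular_module R) m" "L \<subseteq> m"
proof -
  interpret M: left_module R "regular_module R" by (rule left_module_regular)
  have Ls: "submodule L R (regular_module R)" using L(1) ideal_sub_iff by blast
  obtain m where m: "submodule m R (regular_module R) \<and> L \<subseteq> m \<and> m \<subseteq> carrier (regular_module R) \<and> \<one> \<notin> m \<and>
    (\<forall>Z. submodule Z R (regular_module R) \<longrightarrow> m \<subseteq> Z \<longrightarrow> Z \<subseteq> carrier (regular_module R) \<longrightarrow> Z \<noteq> m \<longrightarrow> \<one> \<in> Z)"
    using M.avoiding_maximal[OF Ls M.sub_subset[OF Ls] L(2) M.submodule_carrier] by (rule exE)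
  have "Z = carrier R" if Z: "submodule Z R (regular_module R)" "\<one> \<in> Z" for Z
    using M.sub_subset[OF Z(1)] M.sub_smult[OF Z(1) _ Z(2)] by auto
  then have "maximal_submodule R (regular_module R) m"
    using m M.sub_subset unfolding maximal_submodule_def by (metis one_closed regular_simps(1))
  then show ?thesis using that m by blast
qed

text \<open>The commutative case of the theorem of Akizuki and Hopkins. \<open>K\<close> is the
  smallest ideal joined to \<open>R\<close> by a finite chain of weak covers. It is shown to be zero
  by way of the smallest \<open>I\<close> with \<open>I K = K\<close>, which is idempotent and lies
  in every maximal ideal.\<close>

lemma artinian_fin:
  assumes art: "artinian R" shows "fin_len R (regular_module R)"
proof -
  interpret M: left_module R "regular_module R" by (rule left_module_regular)
  let ?W = "wcov R (regular_module R)"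
  have maxI: "ideal m R" if "maximal_submodule R (regular_module R) m" for m
    using that ideal_sub_iff by (simp add: maximal_submodule_def)
  let ?P = "\<lambda>K. ideal K R \<and> (\<exists>n. (K, carrier R) \<in> ?W ^^ n)"
  have "?P (carrier R)" using oneideal by (auto intro!: exI[of _ 0])
  then obtain K where K: "?P K" "\<And>I. ?P I \<Longrightarrow> I \<subseteq> K \<Longrightarrow> I = K"
    by (rule artinian_min[OF art, of ?P]) blast+
  have KI: "ideal K R" using K(1) by blast
  \<comment> \<open>From \<open>m K\<close> to \<open>K\<close> there is a finite chain by
    \<open>layer_finite\<close>, so \<open>m K\<close> is joined to \<open>R\<close> as well and
    minimality of \<open>K\<close> gives equality.\<close>
  have mK: "m \<cdot> K = K" if m: "maximal_submodule R (regular_module R) m" for m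
  proof (rule K(2))
    have i: "ideal (m \<cdot> K) R" using ideal_prod_is_ideal maxI[OF m] K(1) by blast
    show s: "m \<cdot> K \<subseteq> K" using ideal_prod_inter[OF maxI[OF m]] K(1) by blast
    have "a \<otimes> x \<in> m \<cdot> K" if "a \<in> m" "x \<in> K" for a x using that by (rule ideal_prod.prod)
    then obtain n where n: "(m \<cdot> K, K) \<in> ?W ^^ n" using layer_finite[OF art m i KI s] by blast
    obtain n' where n': "(K, carrier R) \<in> ?W ^^ n'" using K(1) by blast
    have "(m \<cdot> K, carrier R) \<in> ?W ^^ (n + n')"
      unfolding relpow_add using n n' by (rule relcompI)
    then show "ideal (m \<cdot> K) R \<and> (\<exists>n. (m \<cdot> K, carrier R) \<in> ?W ^^ n)" using i by blast
  qed
  let ?Q = "\<lambda>I. ideal I R \<and> I \<cdot> K = K"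
  have "carrier R \<cdot> K = K" using ideal_prod_one[OF KI] ideal_prod_commute[OF KI oneideal] by simp
  then have "?Q (carrier R)" using oneideal by blast
  then obtain I where I: "?Q I" "\<And>I'. ?Q I' \<Longrightarrow> I' \<subseteq> I \<Longrightarrow> I' = I"
    by (rule artinian_min[OF art, of ?Q]) blast+
  have II: "ideal I R" using I(1) by blast
  \<comment> \<open>\<open>m I\<close> shares the defining property of \<open>I\<close>, because
    \<open>m K = K\<close>; so \<open>m I = I\<close>, and \<open>I \<subseteq> m\<close>.\<close>
  have mI: "I \<subseteq> m" if m: "maximal_submodule R (regular_module R) m" for m
  proof -
    have "(m \<cdot> I) \<cdot> K = K" using ideal_prod_assoc[OF maxI[OF m] II KI] I(1) mK[OF m] by simp
    then have "m \<cdot> I = I"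
      using I(2)[of "m \<cdot> I"] ideal_prod_is_ideal[OF maxI[OF m] II] ideal_prod_inter[OF maxI[OF m] II] by blast
    then show ?thesis using ideal_prod_inter[OF maxI[OF m] II] by blast
  qed
  have sq: "I \<cdot> I = I"
  proof (rule I(2))
    show "ideal (I \<cdot> I) R \<and> (I \<cdot> I) \<cdot> K = K"
      using ideal_prod_is_ideal[OF II II] ideal_prod_assoc[OF II II KI] I(1) by simp
    show "I \<cdot> I \<subseteq> I" using ideal_prod_inter[OF II II] by blast
  qed
  have "K = {\<zero>}"
  proof (rule ccontr)
    assume ne: "K \<noteq> {\<zero>}"
    have zero_prod: "I \<cdot> N = {\<zero>}" if N: "ideal N R" "\<And>y x. y \<in> I \<Longrightarrow> x \<in> N \<Longrightarrow> y \<otimes> x = \<zero>" for N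
    proof
      show "I \<cdot> N \<subseteq> {\<zero>}"
      proof
        fix z assume "z \<in> I \<cdot> N"
        then show "z \<in> {\<zero>}" by induction (use N in auto)
      qed
      show "{\<zero>} \<subseteq> I \<cdot> N"
        using additive_subgroup.zero_closed[OF ideal.axioms(1)[OF ideal_prod_is_ideal[OF II N(1)]]] by blast
    qed
    \<comment> \<open>A Nakayama argument in which minimality replaces finite generation. For the
      smallest \<open>N\<close> with \<open>I N \<noteq> 0\<close> and \<open>x\<close> in
      \<open>N\<close> with \<open>I x \<noteq> 0\<close>, idempotency of \<open>I\<close> gives
      \<open>I x = N\<close>, so \<open>x = y x\<close> with \<open>y\<close> in \<open>I\<close>.
      As \<open>y\<close> lies in every maximal ideal, \<open>1 - y\<close> is a unit and
      \<open>x = 0\<close>.\<close>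
    let ?S = "\<lambda>N. ideal N R \<and> I \<cdot> N \<noteq> {\<zero>}"
    have "?S K" using KI I(1) ne by simp
    then obtain N where N: "?S N" "\<And>N'. ?S N' \<Longrightarrow> N' \<subseteq> N \<Longrightarrow> N' = N"
      by (rule artinian_min[OF art, of ?S]) blast+
    have "\<exists>y\<in>I. \<exists>x\<in>N. y \<otimes> x \<noteq> \<zero>" (is ?ex)
    proof (rule ccontr)
      assume *: "\<not> ?ex"
      have "I \<cdot> N = {\<zero>}" by (rule zero_prod) (use N(1) * in blast)+
      then show False using N(1) by blast
    qed
    then obtain y0 x where x: "y0 \<in> I" "x \<in> N" "y0 \<otimes> x \<noteq> \<zero>" by blast
    have NI: "ideal N R" using N(1) by blast
    have xc: "x \<in> carrier R" using ideal.Icarr[OF NI x(2)] .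
    have PI: "ideal (PIdl x) R" by (rule cgenideal_ideal[OF xc])
    have ne2: "I \<cdot> (PIdl x) \<noteq> {\<zero>}"
      using ideal_prod.prod[OF x(1) cgenideal_self[OF xc], of R] x(3) by auto
    have "PIdl x \<subseteq> N" using cgenideal_minimal[of N x] N(1) x(2) by simp
    moreover have "I \<cdot> (PIdl x) \<subseteq> PIdl x" using ideal_prod_inter[OF II PI] by blast
    moreover have "I \<cdot> (I \<cdot> (PIdl x)) = I \<cdot> (PIdl x)" using ideal_prod_assoc[OF II II PI] sq by simp
    ultimately have "I \<cdot> (PIdl x) = N"
      using N(2)[of "I \<cdot> (PIdl x)"] ideal_prod_is_ideal[OF II PI] ne2 by auto
    then have "x \<in> I \<cdot> (PIdl x)" using x(2) by simp
    moreover have "\<exists>y\<in>I. z = y \<otimes> x" if "z \<in> I \<cdot> (PIdl x)" for z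
      using that
    proof induction
      case (prod a b)
      then obtain r where r: "r \<in> carrier R" "b = r \<otimes> x" by (auto simp: cgenideal_def)
      have "a \<otimes> r \<in> I" using ideal.I_r_closed[OF II prod(1) r(1)] .
      moreover have "a \<otimes> b = (a \<otimes> r) \<otimes> x" using r xc ideal.Icarr[OF II prod(1)] by (simp add: m_assoc)
      ultimately show ?case by blast
    next
      case (sum a b)
      then obtain y y' where y: "y \<in> I" "y' \<in> I" "a = y \<otimes> x" "b = y' \<otimes> x" by blast
      have "y \<oplus> y' \<in> I" using additive_subgroup.a_closed[OF ideal.axioms(1)[OF II]] y by blast
      moreover have "a \<oplus> b = (y \<oplus> y') \<otimes> x" using y xc ideal.Icarr[OF II] by (simp add: l_distr)
      ultimately show ?case by blast
    qed
    ultimately obtain y where y: "y \<in> I" "x = y \<otimes> x" by blast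
    have yc: "y \<in> carrier R" using ideal.Icarr[OF II y(1)] .
    have "\<one> \<in> PIdl (\<one> \<ominus> y)"
    proof (rule ccontr)
      assume n1: "\<one> \<notin> PIdl (\<one> \<ominus> y)"
      have c: "\<one> \<ominus> y \<in> carrier R" using yc by simp
      obtain m where m: "maximal_submodule R (regular_module R) m" "PIdl (\<one> \<ominus> y) \<subseteq> m"
        using maximal_above[OF cgenideal_ideal[OF c] n1] .
      have "\<one> \<ominus> y \<in> m" "y \<in> m" using m(2) cgenideal_self[OF c] mI[OF m(1)] y(1) by auto
      then have "(\<one> \<ominus> y) \<oplus> y \<in> m" using additive_subgroup.a_closed[OF ideal.axioms(1)[OF maxI[OF m(1)]]] by blast
      moreover have "(\<one> \<ominus> y) \<oplus> y = \<one>" using yc by (simp add: a_minus_def a_assoc l_neg)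
      ultimately have "m = carrier R" using ideal.one_imp_carrier[OF maxI[OF m(1)]] by simp
      then show False using m(1) by (simp add: maximal_submodule_def)
    qed
    then obtain t where t: "t \<in> carrier R" "\<one> = t \<otimes> (\<one> \<ominus> y)" by (auto simp: cgenideal_def)
    have "(\<one> \<ominus> y) \<otimes> x = x \<ominus> y \<otimes> x" using yc xc by (simp add: a_minus_def l_distr l_minus)
    also have "\<dots> = \<zero>" using y(2) xc by (simp add: a_minus_def r_neg)
    finally have "t \<otimes> (\<one> \<ominus> y) \<otimes> x = \<zero>" using t(1) yc xc by (simp add: m_assoc)
    then have "x = \<zero>" using t(2) xc by simp
    then show False using x(1,3) ideal.Icarr[OF II x(1)] by simp
  qed
  then obtain n where n: "({\<zero>}, carrier R) \<in> ?W ^^ n" using K(1) by blast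
  obtain \<mu> :: "'a set \<Rightarrow> nat" where "\<forall>X Y. (X, Y) \<in> strict R (regular_module R) \<longrightarrow> {\<zero>} \<subseteq> X \<longrightarrow> Y \<subseteq> carrier R \<longrightarrow> \<mu> X < \<mu> Y"
    using M.wcov_measure[OF n] M.submodule_zero by auto
  then have "\<mu> X < \<mu> Y" if "(X, Y) \<in> strict R (regular_module R)" for X Y
    using that M.sub_zero[of X] M.sub_subset[of Y] by (auto simp: strict_def)
  then show ?thesis unfolding fin_len_def by blast
qed

end

section \<open>Duality over a commutative artinian ring\<close>

text \<open>Maps that agree on the intersection glue: \<open>f x + g y\<close> does not depend on
  the decomposition of \<open>x + y\<close>, since two decompositions differ by an element of
  \<open>X \<inter> Y\<close>.\<close>

lemma sum_hom:
  assumes M: "left_module A M" and E: "left_module A E"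
    and X: "submodule X A M" and Y: "submodule Y A M"
    and f: "f \<in> mod_hom A (M\<lparr>carrier := X\<rparr>) E" and g: "g \<in> mod_hom A (M\<lparr>carrier := Y\<rparr>) E"
    and fg: "\<And>z. z \<in> X \<Longrightarrow> z \<in> Y \<Longrightarrow> f z = g z"
  obtains k where "k \<in> mod_hom A (M\<lparr>carrier := X <+>\<^bsub>M\<^esub> Y\<rparr>) E"
    "\<And>x. x \<in> X \<Longrightarrow> k x = f x" "\<And>y. y \<in> Y \<Longrightarrow> k y = g y"
proof -
  interpret M: left_module A M by (rule M)
  interpret E: left_module A E by (rule E)
  interpret f: module_hom A "M\<lparr>carrier := X\<rparr>" E f by (rule module_homI[OF M.left_module_sub[OF X] E f])
  interpret g: module_hom A "M\<lparr>carrier := Y\<rparr>" E g by (rule module_homI[OF M.left_module_sub[OF Y] E g])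
  have Xc: "x \<in> carrier M" if "x \<in> X" for x using M.sub_carr[OF X that] .
  have Yc: "x \<in> carrier M" if "x \<in> Y" for x using M.sub_carr[OF Y that] .
  have fc: "f x \<in> carrier E" if "x \<in> X" for x using f.closed that by simp
  have gc: "g x \<in> carrier E" if "x \<in> Y" for x using g.closed that by simp
  have uniq: "f x \<oplus>\<^bsub>E\<^esub> g y = f x' \<oplus>\<^bsub>E\<^esub> g y'"
    if "x \<in> X" "y \<in> Y" "x' \<in> X" "y' \<in> Y" "x \<oplus>\<^bsub>M\<^esub> y = x' \<oplus>\<^bsub>M\<^esub> y'" for x y x' y'
  proof -
    note c = Xc[OF that(1)] Yc[OF that(2)] Xc[OF that(3)] Yc[OF that(4)]
    have "x \<ominus>\<^bsub>M\<^esub> x' = y' \<ominus>\<^bsub>M\<^esub> y"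
    proof -
      have "x = (x' \<oplus>\<^bsub>M\<^esub> y') \<ominus>\<^bsub>M\<^esub> y" using M.madd_diff[OF c(1,2)] that(5) by simp
      then have "x \<ominus>\<^bsub>M\<^esub> x' = ((x' \<oplus>\<^bsub>M\<^esub> y') \<ominus>\<^bsub>M\<^esub> y) \<ominus>\<^bsub>M\<^esub> x'" by simp
      also have "\<dots> = (y' \<ominus>\<^bsub>M\<^esub> y) \<oplus>\<^bsub>M\<^esub> (x' \<ominus>\<^bsub>M\<^esub> x')" using c by (simp add: a_minus_def M.M.add.m_ac)
      finally show ?thesis using c M.diff_self by simp
    qed
    moreover have "x \<ominus>\<^bsub>M\<^esub> x' \<in> X" "y' \<ominus>\<^bsub>M\<^esub> y \<in> Y" using M.sub_diff[OF X] M.sub_diff[OF Y] that by auto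
    ultimately have "f (x \<ominus>\<^bsub>M\<^esub> x') = g (y' \<ominus>\<^bsub>M\<^esub> y)" using fg by simp
    moreover have "f x = f (x \<ominus>\<^bsub>M\<^esub> x') \<oplus>\<^bsub>E\<^esub> f x'"
      using f.add[of "x \<ominus>\<^bsub>M\<^esub> x'" x'] M.mdiff_add[OF c(1,3)] \<open>x \<ominus>\<^bsub>M\<^esub> x' \<in> X\<close> that by simp
    moreover have "g y' = g (y' \<ominus>\<^bsub>M\<^esub> y) \<oplus>\<^bsub>E\<^esub> g y"
      using g.add[of "y' \<ominus>\<^bsub>M\<^esub> y" y] M.mdiff_add[OF c(4,2)] \<open>y' \<ominus>\<^bsub>M\<^esub> y \<in> Y\<close> that by simp
    ultimately show ?thesis
      using fc[OF that(3)] gc[OF that(2)] gc[OF \<open>y' \<ominus>\<^bsub>M\<^esub> y \<in> Y\<close>] by (simp add: E.M.add.m_ac)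
  qed
  have XY: "submodule (X <+>\<^bsub>M\<^esub> Y) A M" by (rule M.submodule_set_add[OF X Y])
  define k where "k z = (SOME w. \<exists>x\<in>X. \<exists>y\<in>Y. z = x \<oplus>\<^bsub>M\<^esub> y \<and> w = f x \<oplus>\<^bsub>E\<^esub> g y)" for z
  have k: "k (x \<oplus>\<^bsub>M\<^esub> y) = f x \<oplus>\<^bsub>E\<^esub> g y" if "x \<in> X" "y \<in> Y" for x y
  proof -
    have "\<exists>x'\<in>X. \<exists>y'\<in>Y. x \<oplus>\<^bsub>M\<^esub> y = x' \<oplus>\<^bsub>M\<^esub> y' \<and> k (x \<oplus>\<^bsub>M\<^esub> y) = f x' \<oplus>\<^bsub>E\<^esub> g y'"
      unfolding k_def by (rule someI_ex) (use that in blast)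
    then show ?thesis using uniq that by metis
  qed
  have dec: "\<exists>x\<in>X. \<exists>y\<in>Y. z = x \<oplus>\<^bsub>M\<^esub> y" if "z \<in> X <+>\<^bsub>M\<^esub> Y" for z
    using that unfolding M.mem_set_add by blast
  have "restrict k (carrier (M\<lparr>carrier := X <+>\<^bsub>M\<^esub> Y\<rparr>)) \<in> mod_hom A (M\<lparr>carrier := X <+>\<^bsub>M\<^esub> Y\<rparr>) E"
  proof (rule mod_hom_restrictI[OF M.left_module_sub[OF XY]])
    fix z assume "z \<in> carrier (M\<lparr>carrier := X <+>\<^bsub>M\<^esub> Y\<rparr>)"
    then have "z \<in> X <+>\<^bsub>M\<^esub> Y" by simp
    then obtain x y where z: "x \<in> X" "y \<in> Y" "z = x \<oplus>\<^bsub>M\<^esub> y" using dec[of z] by blast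
    then show "k z \<in> carrier E" using k fc gc by simp
    {
      fix z' assume "z' \<in> carrier (M\<lparr>carrier := X <+>\<^bsub>M\<^esub> Y\<rparr>)"
      then have "z' \<in> X <+>\<^bsub>M\<^esub> Y" by simp
      then obtain x' y' where z': "x' \<in> X" "y' \<in> Y" "z' = x' \<oplus>\<^bsub>M\<^esub> y'" using dec[of z'] by blast
      have "z \<oplus>\<^bsub>M\<^esub> z' = (x \<oplus>\<^bsub>M\<^esub> x') \<oplus>\<^bsub>M\<^esub> (y \<oplus>\<^bsub>M\<^esub> y')"
        using z z' Xc Yc by (simp add: M.M.add.m_ac)
      then have "k (z \<oplus>\<^bsub>M\<^esub> z') = f (x \<oplus>\<^bsub>M\<^esub> x') \<oplus>\<^bsub>E\<^esub> g (y \<oplus>\<^bsub>M\<^esub> y')"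
        using k M.sub_add[OF X z(1) z'(1)] M.sub_add[OF Y z(2) z'(2)] by simp
      also have "\<dots> = (f x \<oplus>\<^bsub>E\<^esub> f x') \<oplus>\<^bsub>E\<^esub> (g y \<oplus>\<^bsub>E\<^esub> g y')" using f.add[of x x'] g.add[of y y'] z z' by simp
      also have "\<dots> = k z \<oplus>\<^bsub>E\<^esub> k z'" using k z z' fc gc by (simp add: E.M.add.m_ac)
      finally show "k (z \<oplus>\<^bsub>M\<lparr>carrier := X <+>\<^bsub>M\<^esub> Y\<rparr>\<^esub> z') = k z \<oplus>\<^bsub>E\<^esub> k z'" by simp
    }
    fix a assume a: "a \<in> carrier A"
    have "k (a \<odot>\<^bsub>M\<^esub> z) = f (a \<odot>\<^bsub>M\<^esub> x) \<oplus>\<^bsub>E\<^esub> g (a \<odot>\<^bsub>M\<^esub> y)"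
      using k[OF M.sub_smult[OF X a z(1)] M.sub_smult[OF Y a z(2)]] z Xc Yc M.lsmult_r_distr[OF a] by simp
    also have "\<dots> = a \<odot>\<^bsub>E\<^esub> k z"
      using f.smult[OF a, of x] g.smult[OF a, of y] z k fc gc E.lsmult_r_distr[OF a] by simp
    finally show "k (a \<odot>\<^bsub>M\<lparr>carrier := X <+>\<^bsub>M\<^esub> Y\<rparr>\<^esub> z) = a \<odot>\<^bsub>E\<^esub> k z" by simp
  qed
  moreover have "restrict k (carrier (M\<lparr>carrier := X <+>\<^bsub>M\<^esub> Y\<rparr>)) x = f x" if "x \<in> X" for x
    using k[OF that M.sub_zero[OF Y]] M.set_add_upper(1)[OF X Y] that Xc fc g.zero by auto
  moreover have "restrict k (carrier (M\<lparr>carrier := X <+>\<^bsub>M\<^esub> Y\<rparr>)) y = g y" if "y \<in> Y" for y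
    using k[OF M.sub_zero[OF X] that] M.set_add_upper(2)[OF X Y] that Yc gc f.zero by auto
  ultimately show ?thesis using that by blast
qed

text \<open>Glue \<open>f\<close> with zero on \<open>Y\<close> by \<open>sum_hom\<close> and
  extend. Projections onto a submodule with a prescribed part of the kernel arise in this
  way.\<close>

lemma injective_extend_zero:
  assumes E: "injective A E" and V: "left_module A V" and fin: "fin_len A V"
    and X: "submodule X A V" and Y: "submodule Y A V" and f: "f \<in> mod_hom A (V\<lparr>carrier := X\<rparr>) E"
    and fY: "\<And>z. z \<in> X \<Longrightarrow> z \<in> Y \<Longrightarrow> f z = \<zero>\<^bsub>E\<^esub>"
  obtains h where "h \<in> mod_hom A V E" "\<And>x. x \<in> X \<Longrightarrow> h x = f x" "\<And>y. y \<in> Y \<Longrightarrow> h y = \<zero>\<^bsub>E\<^esub>"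
proof -
  interpret V: left_module A V by (rule V)
  interpret E: left_module A E using E fg_left_module by (auto simp: injective_def)
  have zero: "restrict (\<lambda>_. \<zero>\<^bsub>E\<^esub>) Y \<in> mod_hom A (V\<lparr>carrier := Y\<rparr>) E"
    using mod_hom_restrictI[OF V.left_module_sub[OF Y], of "\<lambda>_. \<zero>\<^bsub>E\<^esub>" E] E.smult_r_zero by simp
  obtain k where k: "k \<in> mod_hom A (V\<lparr>carrier := X <+>\<^bsub>V\<^esub> Y\<rparr>) E"
    "\<And>x. x \<in> X \<Longrightarrow> k x = f x" "\<And>y. y \<in> Y \<Longrightarrow> k y = restrict (\<lambda>_. \<zero>\<^bsub>E\<^esub>) Y y"
    by (rule sum_hom[OF V E.left_module_axioms X Y f zero]) (use fY that in auto)
  have XY: "submodule (X <+>\<^bsub>V\<^esub> Y) A V" by (rule V.submodule_set_add[OF X Y])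
  obtain h where h: "h \<in> mod_hom A V E" "\<And>x. x \<in> X <+>\<^bsub>V\<^esub> Y \<Longrightarrow> h x = k x"
    by (rule injective_extend[OF E V.fin_fg[OF fin] XY left_module.fin_fg[OF V.left_module_sub[OF XY] V.fin_sub[OF XY fin]] k(1)]) (rule that)
  show ?thesis
    using that[OF h(1)] h(2) k(2,3) V.set_add_upper[OF X Y] by (simp add: subset_iff)
qed

locale dual_setting = cring R
  for R :: "('r, 'k) ring_scheme" (structure) and E :: "('r, 'i) module" +
  assumes fin_R: "fin_len R (regular_module R)"
    and E: "minimal_injective_cogenerator R E"
begin

lemma E_props: "injective R E" "cogenerator R E" "fg_module R E"
  using E by (auto simp: minimal_injective_cogenerator_def injective_def)

sublocale E: left_module R E by (rule fg_left_module[OF E_props(3)])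

lemma fin_E: "fin_len R E" by (rule fg_fin[OF E_props(3) fin_R])

lemma fg_sub:
  assumes V: "left_module R V" "fin_len R V" and X: "submodule X R V" shows "fg_module R (V\<lparr>carrier := X\<rparr>)"
  by (rule left_module.fin_fg[OF left_module.left_module_sub[OF V(1) X] left_module.fin_sub[OF V(1) X V(2)]])

lemma extend:
  assumes V: "left_module R V" "fin_len R V" and X: "submodule X R V" and f: "f \<in> mod_hom R (V\<lparr>carrier := X\<rparr>) E"
  obtains h where "h \<in> mod_hom R V E" "\<And>x. x \<in> X \<Longrightarrow> h x = f x"
  using injective_extend[OF E_props(1) left_module.fin_fg[OF V] X fg_sub[OF V X] f] by blast

text \<open>Minimality: isomorphic simple submodules of \<open>E\<close> coincide. Otherwise a submodule \<open>Y\<close> maximal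
  with respect to containing \<open>z\<close> and avoiding \<open>x\<close> is a direct summand of \<open>E\<close> and still a cogenerator.\<close>

lemma minimal_simple:
  assumes x: "x \<in> carrier E" "x \<noteq> \<zero>\<^bsub>E\<^esub>" and z: "z \<in> carrier E" "z \<noteq> \<zero>\<^bsub>E\<^esub>"
    and ann: "\<And>r. r \<in> carrier R \<Longrightarrow> r \<odot>\<^bsub>E\<^esub> x = \<zero>\<^bsub>E\<^esub> \<longleftrightarrow> r \<odot>\<^bsub>E\<^esub> z = \<zero>\<^bsub>E\<^esub>"
    and inv: "\<And>r. r \<in> carrier R \<Longrightarrow> r \<odot>\<^bsub>E\<^esub> x \<noteq> \<zero>\<^bsub>E\<^esub> \<Longrightarrow> \<exists>t\<in>carrier R. t \<odot>\<^bsub>E\<^esub> (r \<odot>\<^bsub>E\<^esub> x) = x"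
  shows "z \<in> E.cyc x"
proof (rule ccontr)
  assume zx: "z \<notin> E.cyc x"
  \<comment> \<open>\<open>1 - t r\<close> kills \<open>x\<close>, and by \<open>ann\<close> also
    \<open>z\<close>. So the property \<open>inv\<close> passes from \<open>x\<close> to
    \<open>z\<close>: both generate simple modules, and these are isomorphic.\<close>
  have inz: "\<exists>t\<in>carrier R. t \<odot>\<^bsub>E\<^esub> (r \<odot>\<^bsub>E\<^esub> z) = z" if r: "r \<in> carrier R" "r \<odot>\<^bsub>E\<^esub> z \<noteq> \<zero>\<^bsub>E\<^esub>" for r
  proof -
    obtain t where t: "t \<in> carrier R" "t \<odot>\<^bsub>E\<^esub> (r \<odot>\<^bsub>E\<^esub> x) = x" using inv r ann by blast
    have "(\<one> \<ominus> t \<otimes> r) \<odot>\<^bsub>E\<^esub> x = x \<ominus>\<^bsub>E\<^esub> t \<odot>\<^bsub>E\<^esub> (r \<odot>\<^bsub>E\<^esub> x)"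
      using t r x by (simp add: E.diff_smult E.lsmult_one E.lsmult_assoc)
    also have "\<dots> = \<zero>\<^bsub>E\<^esub>" using t(2) E.diff_self[OF x(1)] by simp
    finally have "(\<one> \<ominus> t \<otimes> r) \<odot>\<^bsub>E\<^esub> z = \<zero>\<^bsub>E\<^esub>" using ann t r by simp
    then have "z \<ominus>\<^bsub>E\<^esub> t \<odot>\<^bsub>E\<^esub> (r \<odot>\<^bsub>E\<^esub> z) = \<zero>\<^bsub>E\<^esub>"
      using t r z by (simp add: E.diff_smult E.lsmult_one E.lsmult_assoc)
    then have "z = t \<odot>\<^bsub>E\<^esub> (r \<odot>\<^bsub>E\<^esub> z)" using E.diff_eq_zero[OF z(1)] E.lsmult_closed t(1) r(1) z(1) by simp
    then show ?thesis using t(1) by metis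
  qed
  have "x \<notin> E.cyc z"
  proof
    assume "x \<in> E.cyc z"
    then obtain r where r: "r \<in> carrier R" "x = r \<odot>\<^bsub>E\<^esub> z" unfolding E.mem_cyc by blast
    then obtain t where "t \<in> carrier R" "t \<odot>\<^bsub>E\<^esub> x = z" using inz[of r] x(2) by auto
    then show False using zx unfolding E.mem_cyc by blast
  qed
  let ?P = "\<lambda>Y. submodule Y R E \<and> z \<in> Y \<and> x \<notin> Y"
  obtain Y where Y: "submodule Y R E" "z \<in> Y" "x \<notin> Y"
    and Ymax: "\<And>Z. ?P Z \<Longrightarrow> Y \<subseteq> Z \<Longrightarrow> Z = Y"
  proof (rule fin_max[OF fin_E, of ?P "E.cyc z" "carrier E"])
    show "?P (E.cyc z)" using E.submodule_cyc[OF z(1)] E.cyc_self[OF z(1)] \<open>x \<notin> E.cyc z\<close> by blast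
    show "submodule X R E \<and> X \<subseteq> carrier E" if "?P X" for X using that E.sub_subset by blast
  qed (use E.submodule_carrier in blast)+
  let ?Q = "\<lambda>H. submodule H R E \<and> H \<inter> Y = {\<zero>\<^bsub>E\<^esub>}"
  \<comment> \<open>\<open>H\<close> is maximal among the submodules meeting \<open>Y\<close> in
    zero. The endomorphism \<open>p\<close> below is the identity on \<open>Y\<close> and zero on
    \<open>H\<close>, and turns out to be a projection onto \<open>Y\<close>.\<close>
  obtain H where H: "submodule H R E" "H \<inter> Y = {\<zero>\<^bsub>E\<^esub>}" and Hmax: "\<And>Z. ?Q Z \<Longrightarrow> H \<subseteq> Z \<Longrightarrow> Z = H"
  proof (rule fin_max[OF fin_E, of ?Q "{\<zero>\<^bsub>E\<^esub>}" "carrier E"])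
    show "?Q {\<zero>\<^bsub>E\<^esub>}" using E.submodule_zero E.sub_zero[OF Y(1)] by blast
    show "submodule X R E \<and> X \<subseteq> carrier E" if "?Q X" for X using that E.sub_subset by blast
  qed (use E.submodule_carrier in blast)+
  have rx: "r \<odot>\<^bsub>E\<^esub> x = \<zero>\<^bsub>E\<^esub>" if r: "r \<in> carrier R" "r \<odot>\<^bsub>E\<^esub> x \<in> Y" for r
  proof (rule ccontr)
    assume "r \<odot>\<^bsub>E\<^esub> x \<noteq> \<zero>\<^bsub>E\<^esub>"
    then obtain t where "t \<in> carrier R" "t \<odot>\<^bsub>E\<^esub> (r \<odot>\<^bsub>E\<^esub> x) = x" using inv r(1) by blast
    then show False using E.sub_smult[OF Y(1) _ r(2), of t] Y(3) by simp
  qed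
  have id: "restrict id Y \<in> mod_hom R (E\<lparr>carrier := Y\<rparr>) E"
    using mod_hom_sub[OF E.left_module_axioms Y(1) mod_hom_id[OF E.left_module_axioms]] E.sub_subset[OF Y(1)]
    by (simp add: Int_absorb1)
  obtain p where p: "p \<in> mod_hom R E E" "\<And>y. y \<in> Y \<Longrightarrow> p y = restrict id Y y" and pH: "\<And>y. y \<in> H \<Longrightarrow> p y = \<zero>\<^bsub>E\<^esub>"
    by (rule injective_extend_zero[OF E_props(1) E.left_module_axioms fin_E Y(1) H(1) id]) (use H(2) that in auto)
  interpret p: module_hom R E E p by (rule module_homI[OF E.left_module_axioms E.left_module_axioms p(1)])
  have pY: "p y = y" if "y \<in> Y" for y using p(2)[OF that] that by simp
  have ims: "submodule (p ` carrier E) R E" by (rule p.sub_image[OF E.submodule_carrier])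
  \<comment> \<open>If \<open>x = p w\<close>, then \<open>w\<close> is outside \<open>H\<close>, so
    \<open>H + R w\<close> meets \<open>Y\<close> in some nonzero \<open>y = h + r w\<close>.
    Applying \<open>p\<close> gives \<open>y = r x\<close>, but \<open>r x \<in> Y\<close> forces
    \<open>r x = 0\<close>.\<close>
  have "x \<notin> p ` carrier E"
  proof
    assume "x \<in> p ` carrier E"
    then obtain w where w: "w \<in> carrier E" "x = p w" by blast
    have "w \<notin> H" using pH w x(2) by blast
    have cw: "submodule (E.cyc w) R E" by (rule E.submodule_cyc[OF w(1)])
    have HW: "submodule (H <+>\<^bsub>E\<^esub> E.cyc w) R E" by (rule E.submodule_set_add[OF H(1) cw])
    have "w \<in> H <+>\<^bsub>E\<^esub> E.cyc w" using E.set_add_upper(2)[OF H(1) cw] E.cyc_self[OF w(1)] by blast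
    then have "H <+>\<^bsub>E\<^esub> E.cyc w \<noteq> H" using \<open>w \<notin> H\<close> by blast
    then have "(H <+>\<^bsub>E\<^esub> E.cyc w) \<inter> Y \<noteq> {\<zero>\<^bsub>E\<^esub>}"
      using Hmax[of "H <+>\<^bsub>E\<^esub> E.cyc w"] HW E.set_add_upper(1)[OF H(1) cw] by blast
    then obtain y where y: "y \<in> H <+>\<^bsub>E\<^esub> E.cyc w" "y \<in> Y" "y \<noteq> \<zero>\<^bsub>E\<^esub>"
      using E.sub_zero[OF HW] E.sub_zero[OF Y(1)] by blast
    then obtain h v where "h \<in> H" "v \<in> E.cyc w" "y = h \<oplus>\<^bsub>E\<^esub> v" unfolding E.mem_set_add by blast
    then obtain r where hr: "h \<in> H" "r \<in> carrier R" "y = h \<oplus>\<^bsub>E\<^esub> r \<odot>\<^bsub>E\<^esub> w" unfolding E.mem_cyc by blast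
    have "y = p (h \<oplus>\<^bsub>E\<^esub> r \<odot>\<^bsub>E\<^esub> w)" using pY[OF y(2)] hr(3) by simp
    also have "\<dots> = r \<odot>\<^bsub>E\<^esub> x"
      using p.add[OF E.sub_carr[OF H(1) hr(1)] E.lsmult_closed[OF hr(2) w(1)]] pH[OF hr(1)]
        p.smult[OF hr(2) w(1)] w(2) E.lsmult_closed[OF hr(2) x(1)] by simp
    finally show False using rx[OF hr(2)] y by simp
  qed
  moreover have "Y \<subseteq> p ` carrier E"
  proof
    fix y assume "y \<in> Y"
    then show "y \<in> p ` carrier E" using pY[of y] E.sub_carr[OF Y(1)] by (intro image_eqI[of _ _ y]) auto
  qed
  ultimately have pE: "p ` carrier E = Y" using Ymax[of "p ` carrier E"] ims Y(2) by blast
  have pm: "p \<in> mod_hom R E (E\<lparr>carrier := Y\<rparr>)" by (rule mod_hom_carrier_restrict[OF p(1)]) (use pE in simp)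
  have fgY: "fg_module R (E\<lparr>carrier := Y\<rparr>)" by (rule fg_sub[OF E.left_module_axioms fin_E Y(1)])
  have Yc: "Y \<subseteq> carrier E" by (rule E.sub_subset[OF Y(1)])
  have "injective R (E\<lparr>carrier := Y\<rparr>)"
    unfolding injective_def
  proof (intro conjI allI impI fgY)
    fix X Z :: "('r, 'r fgtype) module" and g f
    assume *: "fg_module R X \<and> fg_module R Z \<and> g \<in> mod_hom R X Z \<and> inj_on g (carrier X) \<and> f \<in> mod_hom R X (E\<lparr>carrier := Y\<rparr>)"
    then have f: "f \<in> mod_hom R X E" "\<And>x. x \<in> carrier X \<Longrightarrow> f x \<in> Y"
      using mod_hom_carrier_mono[OF _ Yc, of f R X] mod_homD(1)[of f R X "E\<lparr>carrier := Y\<rparr>"] by auto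
    then obtain h where h: "h \<in> mod_hom R Z E" "compose (carrier X) h g = f"
      using E_props(1) * unfolding injective_def by blast
    have Z: "left_module R Z" using * fg_left_module by blast
    have "compose (carrier Z) p h \<in> mod_hom R Z (E\<lparr>carrier := Y\<rparr>)" by (rule mod_hom_comp[OF Z h(1) pm])
    moreover have "compose (carrier X) (compose (carrier Z) p h) g = f"
    proof (rule extensionalityI[of _ "carrier X"])
      show "f \<in> extensional (carrier X)" using mod_homD(4)[OF f(1)] .
      fix a assume a: "a \<in> carrier X"
      have ga: "g a \<in> carrier Z" using * mod_homD(1)[of g R X Z a] a by blast
      have "h (g a) = f a" using fun_cong[OF h(2), of a] a by (simp add: compose_eq)
      then show "compose (carrier X) (compose (carrier Z) p h) g a = f a"
        using pY[OF f(2)[OF a]] a ga by (simp add: compose_eq)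
    qed simp
    ultimately show "\<exists>h\<in>mod_hom R Z (E\<lparr>carrier := Y\<rparr>). compose (carrier X) h g = f" by blast
  qed
  moreover have "cogenerator R (E\<lparr>carrier := Y\<rparr>)"
    unfolding cogenerator_def
  proof (intro conjI allI impI ballI fgY)
    fix X :: "('r, 'r fgtype) module" and w
    assume X: "fg_module R X" and w: "w \<in> carrier X" "w \<noteq> \<zero>\<^bsub>X\<^esub>"
    have Xm: "left_module R X" by (rule fg_left_module[OF X])
    obtain f where f: "f \<in> mod_hom R X E" "f w \<noteq> \<zero>\<^bsub>E\<^esub>"
      using E_props(2) X w unfolding cogenerator_def by blast
    have fw: "f w \<in> carrier E" by (rule mod_homD(1)[OF f(1) w(1)])
    show "\<exists>f\<in>mod_hom R X (E\<lparr>carrier := Y\<rparr>). f w \<noteq> \<zero>\<^bsub>E\<lparr>carrier := Y\<rparr>\<^esub>"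
    proof (cases "p (f w) = \<zero>\<^bsub>E\<^esub>")
      case False
      then show ?thesis
        using mod_hom_comp[OF Xm f(1) pm] w(1) by (intro bexI[of _ "compose (carrier X) p f"]) (simp_all add: compose_eq)
    next
      case True
      then have "f w \<notin> Y" using pY f(2) by metis
      have cw: "submodule (E.cyc (f w)) R E" by (rule E.submodule_cyc[OF fw])
      have "f w \<in> Y <+>\<^bsub>E\<^esub> E.cyc (f w)" using E.set_add_upper(2)[OF Y(1) cw] E.cyc_self[OF fw] by blast
      then have "x \<in> Y <+>\<^bsub>E\<^esub> E.cyc (f w)"
        using Ymax[of "Y <+>\<^bsub>E\<^esub> E.cyc (f w)"] \<open>f w \<notin> Y\<close> E.submodule_set_add[OF Y(1) cw]
          E.set_add_upper(1)[OF Y(1) cw] Y(2) by blast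
      then obtain y v where "y \<in> Y" "v \<in> E.cyc (f w)" "x = y \<oplus>\<^bsub>E\<^esub> v" unfolding E.mem_set_add by blast
      then obtain r where yr: "y \<in> Y" "r \<in> carrier R" "x = y \<oplus>\<^bsub>E\<^esub> r \<odot>\<^bsub>E\<^esub> f w" unfolding E.mem_cyc by blast
      have cx: "submodule (E.cyc x) R E" by (rule E.submodule_cyc[OF x(1)])
      \<comment> \<open>The isomorphism \<open>x \<mapsto> z\<close> of the two simple modules.
        Extended to \<open>h\<close> with \<open>h\<close> zero on \<open>Y\<close>, it gives
        \<open>r h (f w) = h x = z\<close> from \<open>x = y + r (f w)\<close>. As
        \<open>p z = z\<close> is nonzero, the composite of \<open>f\<close>, \<open>h\<close> and
        \<open>p\<close> detects \<open>w\<close>.\<close>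
      define \<sigma> where "\<sigma> v = (SOME r. r \<in> carrier R \<and> v = r \<odot>\<^bsub>E\<^esub> x) \<odot>\<^bsub>E\<^esub> z" for v
      have \<sigma>: "\<sigma> (r \<odot>\<^bsub>E\<^esub> x) = r \<odot>\<^bsub>E\<^esub> z" if r: "r \<in> carrier R" for r
      proof -
        let ?r = "SOME r'. r' \<in> carrier R \<and> r \<odot>\<^bsub>E\<^esub> x = r' \<odot>\<^bsub>E\<^esub> x"
        have r': "?r \<in> carrier R \<and> r \<odot>\<^bsub>E\<^esub> x = ?r \<odot>\<^bsub>E\<^esub> x" by (rule someI[of _ r]) (use r in simp)
        then have "(r \<ominus> ?r) \<odot>\<^bsub>E\<^esub> x = \<zero>\<^bsub>E\<^esub>"
          using E.diff_smult[OF r, of ?r x] x(1) E.diff_self[OF E.lsmult_closed[OF r x(1)]] by simp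
        then have "(r \<ominus> ?r) \<odot>\<^bsub>E\<^esub> z = \<zero>\<^bsub>E\<^esub>" using ann r r' by simp
        then show ?thesis
          unfolding \<sigma>_def using E.diff_smult[OF r, of ?r z] r' z(1) E.diff_eq_zero E.lsmult_closed r by simp
      qed
      have \<sigma>h: "restrict \<sigma> (E.cyc x) \<in> mod_hom R (E\<lparr>carrier := E.cyc x\<rparr>) E"
      proof -
        have "restrict \<sigma> (carrier (E\<lparr>carrier := E.cyc x\<rparr>)) \<in> mod_hom R (E\<lparr>carrier := E.cyc x\<rparr>) E"
        proof (rule mod_hom_restrictI[OF E.left_module_sub[OF cx]])
          fix a assume "a \<in> carrier (E\<lparr>carrier := E.cyc x\<rparr>)"
          then obtain ra where ra: "ra \<in> carrier R" "a = ra \<odot>\<^bsub>E\<^esub> x" by (auto simp: E.mem_cyc)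
          then show "\<sigma> a \<in> carrier E" using \<sigma> E.lsmult_closed z(1) by simp
          show "\<sigma> (b \<odot>\<^bsub>E\<lparr>carrier := E.cyc x\<rparr>\<^esub> a) = b \<odot>\<^bsub>E\<^esub> \<sigma> a" if b: "b \<in> carrier R" for b
            using \<sigma>[of "b \<otimes> ra"] \<sigma>[OF ra(1)] ra b x(1) z(1) by (simp add: E.lsmult_assoc)
          fix a' assume "a' \<in> carrier (E\<lparr>carrier := E.cyc x\<rparr>)"
          then obtain rb where rb: "rb \<in> carrier R" "a' = rb \<odot>\<^bsub>E\<^esub> x" by (auto simp: E.mem_cyc)
          show "\<sigma> (a \<oplus>\<^bsub>E\<lparr>carrier := E.cyc x\<rparr>\<^esub> a') = \<sigma> a \<oplus>\<^bsub>E\<^esub> \<sigma> a'"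
            using \<sigma>[of "ra \<oplus> rb"] \<sigma>[OF ra(1)] \<sigma>[OF rb(1)] ra rb x(1) z(1) by (simp add: E.lsmult_l_distr)
        qed
        then show ?thesis by simp
      qed
      obtain h where h: "h \<in> mod_hom R E E" "\<And>v. v \<in> E.cyc x \<Longrightarrow> h v = restrict \<sigma> (E.cyc x) v"
        and hY: "\<And>y. y \<in> Y \<Longrightarrow> h y = \<zero>\<^bsub>E\<^esub>"
      proof (rule injective_extend_zero[OF E_props(1) E.left_module_axioms fin_E cx Y(1) \<sigma>h])
        fix v assume v: "v \<in> E.cyc x" "v \<in> Y"
        then obtain r where r: "r \<in> carrier R" "v = r \<odot>\<^bsub>E\<^esub> x" unfolding E.mem_cyc by blast
        then have "r \<odot>\<^bsub>E\<^esub> z = \<zero>\<^bsub>E\<^esub>" using rx v ann by auto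
        then show "restrict \<sigma> (E.cyc x) v = \<zero>\<^bsub>E\<^esub>" using v \<sigma>[OF r(1)] r(2) by simp
      qed (rule that)
      interpret h: module_hom R E E h by (rule module_homI[OF E.left_module_axioms E.left_module_axioms h(1)])
      have yc: "y \<in> carrier E" by (rule E.sub_carr[OF Y(1) yr(1)])
      have hy: "h y = \<zero>\<^bsub>E\<^esub>" by (rule hY[OF yr(1)])
      have hx: "h x = z" using h(2)[of x] E.cyc_self[OF x(1)] \<sigma>[of \<one>] x(1) z(1) E.lsmult_one by auto
      have "h x = r \<odot>\<^bsub>E\<^esub> h (f w)"
        using h.add[OF yc E.lsmult_closed[OF yr(2) fw]] h.smult[OF yr(2) fw] hy yr(3)
          E.lsmult_closed[OF yr(2) h.closed[OF fw]] by simp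
      then have "z = r \<odot>\<^bsub>E\<^esub> p (h (f w))"
        using hx pY[OF Y(2)] p.smult[OF yr(2) h.closed[OF fw]] by metis
      then have "p (h (f w)) \<noteq> \<zero>\<^bsub>E\<^esub>" using z(2) E.smult_r_zero[OF yr(2)] by metis
      moreover have "compose (carrier X) p (compose (carrier X) h f) \<in> mod_hom R X (E\<lparr>carrier := Y\<rparr>)"
        by (rule mod_hom_comp[OF Xm mod_hom_comp[OF Xm f(1) h(1)] pm])
      ultimately show ?thesis using w(1)
        by (intro bexI[of _ "compose (carrier X) p (compose (carrier X) h f)"]) (simp_all add: compose_eq)
    qed
  qed
  ultimately have "Y = carrier E" using E Y(1) unfolding minimal_injective_cogenerator_def by blast
  then show False using Y(3) x(1) by blast
qed

end

section \<open>Pairings with values in \<open>E\<close> and double annihilators\<close>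

definition perp_right :: "'u set \<Rightarrow> ('r, 'v) module \<Rightarrow> ('r, 'i) module \<Rightarrow> ('u \<Rightarrow> 'v \<Rightarrow> 'i) \<Rightarrow> 'v set" where
  "perp_right F V E b = {v \<in> carrier V. \<forall>u\<in>F. b u v = \<zero>\<^bsub>E\<^esub>}"

text \<open>Symmetric in the two modules, so that the roles can be exchanged (\<open>flip\<close>)
  and annihilators taken from either side. The instance used is evaluation of functionals.\<close>

locale pairing = dual_setting R E
  for R :: "('r, 'k) ring_scheme" (structure) and E :: "('r, 'i) module" +
  fixes U :: "('r, 'u) module" and V :: "('r, 'v) module" and b :: "'u \<Rightarrow> 'v \<Rightarrow> 'i"
  assumes U: "left_module R U" and V: "left_module R V"
    and hom_r: "u \<in> carrier U \<Longrightarrow> restrict (b u) (carrier V) \<in> mod_hom R V E"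
    and hom_l: "v \<in> carrier V \<Longrightarrow> restrict (\<lambda>u. b u v) (carrier U) \<in> mod_hom R U E"
begin

sublocale U: left_module R U by (rule U)
sublocale V: left_module R V by (rule V)

lemma b_closed: "u \<in> carrier U \<Longrightarrow> v \<in> carrier V \<Longrightarrow> b u v \<in> carrier E"
  using mod_homD(1)[OF hom_r, of u v] by simp

lemma b_right:
  "u \<in> carrier U \<Longrightarrow> v \<in> carrier V \<Longrightarrow> w \<in> carrier V \<Longrightarrow> b u (v \<oplus>\<^bsub>V\<^esub> w) = b u v \<oplus>\<^bsub>E\<^esub> b u w"
  "u \<in> carrier U \<Longrightarrow> v \<in> carrier V \<Longrightarrow> r \<in> carrier R \<Longrightarrow> b u (r \<odot>\<^bsub>V\<^esub> v) = r \<odot>\<^bsub>E\<^esub> b u v"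
  "u \<in> carrier U \<Longrightarrow> b u \<zero>\<^bsub>V\<^esub> = \<zero>\<^bsub>E\<^esub>"
  using mod_homD(2,3)[OF hom_r, of u] module_hom.zero[OF module_homI[OF V E.left_module_axioms hom_r], of u]
  by (simp_all add: V.lsmult_closed)

lemma b_left:
  "u \<in> carrier U \<Longrightarrow> v \<in> carrier V \<Longrightarrow> w \<in> carrier U \<Longrightarrow> b (u \<oplus>\<^bsub>U\<^esub> w) v = b u v \<oplus>\<^bsub>E\<^esub> b w v"
  "u \<in> carrier U \<Longrightarrow> v \<in> carrier V \<Longrightarrow> r \<in> carrier R \<Longrightarrow> b (r \<odot>\<^bsub>U\<^esub> u) v = r \<odot>\<^bsub>E\<^esub> b u v"
  "v \<in> carrier V \<Longrightarrow> b \<zero>\<^bsub>U\<^esub> v = \<zero>\<^bsub>E\<^esub>"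
  using mod_homD(2,3)[OF hom_l, of v] module_hom.zero[OF module_homI[OF U E.left_module_axioms hom_l], of v]
  by (simp_all add: U.lsmult_closed)

lemma b_diff_right:
  assumes "u \<in> carrier U" "v \<in> carrier V" "w \<in> carrier V" shows "b u (v \<ominus>\<^bsub>V\<^esub> w) = b u v \<ominus>\<^bsub>E\<^esub> b u w"
  using module_hom.diff[OF module_homI[OF V E.left_module_axioms hom_r[OF assms(1)]] assms(2,3)] assms by simp

lemma perp_sub: "F \<subseteq> carrier U \<Longrightarrow> submodule (perp_right F V E b) R V"
  unfolding V.submodule_iff perp_right_def
  using V.lsmult_closed E.smult_r_zero b_right by auto

text \<open>Minimality of \<open>E\<close> enters here. With \<open>F' = F + R u0\<close>, an
  element of the annihilator of \<open>F\<close> lies in that of \<open>F'\<close> iff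
  \<open>u0\<close> pairs with it to zero. The nonzero values that occur there have equal
  annihilators in \<open>R\<close> and generate simple submodules of \<open>E\<close>, which
  coincide by \<open>minimal_simple\<close>; so one element outside the smaller annihilator
  generates the larger one over it.\<close>

lemma perp_cover:
  assumes c: "(F, F') \<in> wcov R U" shows "(perp_right F' V E b, perp_right F V E b) \<in> wcov R V"
proof (cases "perp_right F V E b \<subseteq> perp_right F' V E b")
  case True
  note cd = wcovD[OF c]
  have Fc: "F \<subseteq> carrier U" "F' \<subseteq> carrier U" using U.sub_subset cd by auto
  show ?thesis using True perp_sub Fc cd(3) by (intro wcovI) (auto simp: perp_right_def)
next
  case False
  note cd = wcovD[OF c]
  have Fc: "F \<subseteq> carrier U" "F' \<subseteq> carrier U" using U.sub_subset cd by auto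
  show ?thesis
  proof (rule wcovI[OF perp_sub[OF Fc(2)] perp_sub[OF Fc(1)]])
    show "perp_right F' V E b \<subseteq> perp_right F V E b" using cd(3) by (auto simp: perp_right_def)
    fix Z assume Z: "submodule Z R V" "perp_right F' V E b \<subseteq> Z" "Z \<subseteq> perp_right F V E b" "Z \<noteq> perp_right F V E b"
    show "Z = perp_right F' V E b"
    proof (rule ccontr)
      assume "Z \<noteq> perp_right F' V E b"
      then obtain v where v: "v \<in> Z" "v \<notin> perp_right F' V E b" using Z by blast
      have vc: "v \<in> carrier V" using V.sub_carr[OF Z(1) v(1)] .
      obtain u0 where u0: "u0 \<in> F'" "b u0 v \<noteq> \<zero>\<^bsub>E\<^esub>" using v(2) vc unfolding perp_right_def by blast
      have u0c: "u0 \<in> carrier U" using u0(1) Fc by blast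
      have vF: "b u v = \<zero>\<^bsub>E\<^esub>" if "u \<in> F" for u using that v(1) Z(3) by (auto simp: perp_right_def)
      have "u0 \<notin> F" using vF u0 by blast
      have gen: "F <+>\<^bsub>U\<^esub> U.cyc u0 = F'" by (rule U.cover_gen[OF cd(1-3) u0(1) \<open>u0 \<notin> F\<close> cd(4)])
      have dec: "\<exists>w\<in>F. \<exists>t\<in>carrier R. u = w \<oplus>\<^bsub>U\<^esub> t \<odot>\<^bsub>U\<^esub> u0" if "u \<in> F'" for u
      proof -
        have "u \<in> F <+>\<^bsub>U\<^esub> U.cyc u0" using that gen by simp
        then obtain w y where "w \<in> F" "y \<in> U.cyc u0" "u = w \<oplus>\<^bsub>U\<^esub> y" unfolding U.mem_set_add by blast
        then show ?thesis unfolding U.mem_cyc by blast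
      qed
      have val: "b (w \<oplus>\<^bsub>U\<^esub> t \<odot>\<^bsub>U\<^esub> u0) y = t \<odot>\<^bsub>E\<^esub> b u0 y"
        if "w \<in> F" "t \<in> carrier R" "y \<in> perp_right F V E b" for w t y
      proof -
        have c: "w \<in> carrier U" "y \<in> carrier V" "b w y = \<zero>\<^bsub>E\<^esub>" using that Fc by (auto simp: perp_right_def)
        then show ?thesis
          using b_left(1)[OF c(1,2) U.lsmult_closed[OF that(2) u0c]] b_left(2)[OF u0c c(2) that(2)]
            E.lsmult_closed[OF that(2) b_closed[OF u0c c(2)]] by simp
      qed
      have "y \<in> Z" if y: "y \<in> perp_right F V E b" for y
      proof -
        have yc: "y \<in> carrier V" using y by (simp add: perp_right_def)
        have "\<exists>r\<in>carrier R. b u0 y = r \<odot>\<^bsub>E\<^esub> b u0 v"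
        proof (cases "b u0 y = \<zero>\<^bsub>E\<^esub>")
          case True
          then show ?thesis using E.smult_l_zero[OF b_closed[OF u0c vc]] by (intro bexI[of _ \<zero>]) auto
        next
          case False
          \<comment> \<open>If \<open>r u0\<close> is outside \<open>F\<close>, it generates
            \<open>F'\<close> over \<open>F\<close> as well, so \<open>u0 = w + t r u0\<close> with
            \<open>w\<close> in \<open>F\<close>, and multiplication of the value at
            \<open>u0\<close> by \<open>r\<close> can be undone by \<open>t\<close>.\<close>
          have inv: "\<exists>t\<in>carrier R. t \<odot>\<^bsub>E\<^esub> (r \<odot>\<^bsub>E\<^esub> b u0 y') = b u0 y'"
            if r: "r \<in> carrier R" "r \<odot>\<^bsub>U\<^esub> u0 \<notin> F" and y': "y' \<in> perp_right F V E b" for r y'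
          proof -
            have ru: "r \<odot>\<^bsub>U\<^esub> u0 \<in> F'" using U.sub_smult[OF cd(2) r(1) u0(1)] .
            have "F <+>\<^bsub>U\<^esub> U.cyc (r \<odot>\<^bsub>U\<^esub> u0) = F'" by (rule U.cover_gen[OF cd(1-3) ru r(2) cd(4)])
            then have "u0 \<in> F <+>\<^bsub>U\<^esub> U.cyc (r \<odot>\<^bsub>U\<^esub> u0)" using u0(1) by simp
            then obtain w y where "w \<in> F" "y \<in> U.cyc (r \<odot>\<^bsub>U\<^esub> u0)" "u0 = w \<oplus>\<^bsub>U\<^esub> y" unfolding U.mem_set_add by blast
            then obtain t where t: "w \<in> F" "t \<in> carrier R" "u0 = w \<oplus>\<^bsub>U\<^esub> t \<odot>\<^bsub>U\<^esub> (r \<odot>\<^bsub>U\<^esub> u0)" unfolding U.mem_cyc by blast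
            then have "u0 = w \<oplus>\<^bsub>U\<^esub> (t \<otimes> r) \<odot>\<^bsub>U\<^esub> u0" using U.lsmult_assoc[OF t(2) r(1) u0c] by simp
            then have "b u0 y' = (t \<otimes> r) \<odot>\<^bsub>E\<^esub> b u0 y'" using val[OF t(1) m_closed[OF t(2) r(1)] y'] by simp
            moreover have "b u0 y' \<in> carrier E" using b_closed[OF u0c] y' by (simp add: perp_right_def)
            ultimately show ?thesis using E.lsmult_assoc[OF t(2) r(1)] t(2) by (metis (no_types))
          qed
          have ann: "r \<odot>\<^bsub>E\<^esub> b u0 y' = \<zero>\<^bsub>E\<^esub> \<longleftrightarrow> r \<odot>\<^bsub>U\<^esub> u0 \<in> F"
            if r: "r \<in> carrier R" and y': "y' \<in> perp_right F V E b" "b u0 y' \<noteq> \<zero>\<^bsub>E\<^esub>" for r y'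
          proof
            assume "r \<odot>\<^bsub>U\<^esub> u0 \<in> F"
            then have "b (r \<odot>\<^bsub>U\<^esub> u0) y' = \<zero>\<^bsub>E\<^esub>" using y'(1) by (simp add: perp_right_def)
            then show "r \<odot>\<^bsub>E\<^esub> b u0 y' = \<zero>\<^bsub>E\<^esub>" using b_left(2)[OF u0c _ r] y'(1) by (simp add: perp_right_def)
          next
            assume z: "r \<odot>\<^bsub>E\<^esub> b u0 y' = \<zero>\<^bsub>E\<^esub>"
            show "r \<odot>\<^bsub>U\<^esub> u0 \<in> F"
            proof (rule ccontr)
              assume "r \<odot>\<^bsub>U\<^esub> u0 \<notin> F"
              then obtain t where "t \<in> carrier R" "t \<odot>\<^bsub>E\<^esub> (r \<odot>\<^bsub>E\<^esub> b u0 y') = b u0 y'" using inv[OF r _ y'(1)] by blast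
              then show False using z y'(2) E.smult_r_zero by simp
            qed
          qed
          have vp: "v \<in> perp_right F V E b" using v(1) Z(3) by blast
          have "b u0 y \<in> E.cyc (b u0 v)"
          proof (rule minimal_simple[OF b_closed[OF u0c vc] u0(2) b_closed[OF u0c yc] False])
            fix r assume r: "r \<in> carrier R"
            show "r \<odot>\<^bsub>E\<^esub> b u0 v = \<zero>\<^bsub>E\<^esub> \<longleftrightarrow> r \<odot>\<^bsub>E\<^esub> b u0 y = \<zero>\<^bsub>E\<^esub>" using ann[OF r vp u0(2)] ann[OF r y False] by simp
            assume "r \<odot>\<^bsub>E\<^esub> b u0 v \<noteq> \<zero>\<^bsub>E\<^esub>"
            then have "r \<odot>\<^bsub>U\<^esub> u0 \<notin> F" using ann[OF r vp u0(2)] by blast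
            then show "\<exists>t\<in>carrier R. t \<odot>\<^bsub>E\<^esub> (r \<odot>\<^bsub>E\<^esub> b u0 v) = b u0 v" using inv[OF r _ vp] by blast
          qed
          then show ?thesis unfolding E.mem_cyc .
        qed
        then obtain r where r: "r \<in> carrier R" "b u0 y = r \<odot>\<^bsub>E\<^esub> b u0 v" by blast
        have rv: "r \<odot>\<^bsub>V\<^esub> v \<in> Z" using V.sub_smult[OF Z(1) r(1) v(1)] .
        have rvc: "r \<odot>\<^bsub>V\<^esub> v \<in> carrier V" using V.sub_carr[OF Z(1) rv] .
        have dp: "y \<ominus>\<^bsub>V\<^esub> r \<odot>\<^bsub>V\<^esub> v \<in> perp_right F V E b" using V.sub_diff[OF perp_sub[OF Fc(1)] y] rv Z(3) by blast
        have d0: "b u0 (y \<ominus>\<^bsub>V\<^esub> r \<odot>\<^bsub>V\<^esub> v) = \<zero>\<^bsub>E\<^esub>"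
          using b_diff_right[OF u0c yc rvc] b_right(2)[OF u0c vc r(1)] r(2) E.diff_self b_closed[OF u0c yc] by simp
        have "y \<ominus>\<^bsub>V\<^esub> r \<odot>\<^bsub>V\<^esub> v \<in> perp_right F' V E b"
          unfolding perp_right_def
        proof (intro CollectI conjI ballI)
          show "y \<ominus>\<^bsub>V\<^esub> r \<odot>\<^bsub>V\<^esub> v \<in> carrier V" using dp by (simp add: perp_right_def)
          fix u assume "u \<in> F'"
          then obtain w t where "w \<in> F" "t \<in> carrier R" "u = w \<oplus>\<^bsub>U\<^esub> t \<odot>\<^bsub>U\<^esub> u0" using dec by blast
          then show "b u (y \<ominus>\<^bsub>V\<^esub> r \<odot>\<^bsub>V\<^esub> v) = \<zero>\<^bsub>E\<^esub>" using val[OF _ _ dp] d0 E.smult_r_zero by simp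
        qed
        then have "y \<ominus>\<^bsub>V\<^esub> r \<odot>\<^bsub>V\<^esub> v \<in> Z" using Z(2) by blast
        then show "y \<in> Z" using V.diff_mem_iff[OF Z(1) rv yc] by simp
      qed
      then show False using Z by blast
    qed
  qed
qed

end

context pairing
begin

sublocale flip: pairing R E V U "\<lambda>v u. b u v"
  by unfold_locales (use hom_r hom_l U V in auto)

text \<open>Taking annihilators twice turns a chain of covers into a chain of at most as many covers,
  so a proper inclusion \<open>F \<subset> F\<^sup>\<bottom>\<^sup>\<bottom>\<close> would contradict the length bound.\<close>

theorem perp_perp:
  assumes fin: "fin_len R U" and nondeg: "\<And>u. u \<in> carrier U \<Longrightarrow> (\<And>v. v \<in> carrier V \<Longrightarrow> b u v = \<zero>\<^bsub>E\<^esub>) \<Longrightarrow> u = \<zero>\<^bsub>U\<^esub>"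
    and F: "submodule F R U"
    and u: "u \<in> carrier U" "\<And>v. v \<in> perp_right F V E b \<Longrightarrow> b u v = \<zero>\<^bsub>E\<^esub>"
  shows "u \<in> F"
proof (rule ccontr)
  assume uF: "u \<notin> F"
  let ?pp = "\<lambda>F. perp_right (perp_right F V E b) U E (\<lambda>v u. b u v)"
  obtain m where m: "({\<zero>\<^bsub>U\<^esub>}, F) \<in> (wcov R U \<inter> strict R U) ^^ m"
    using U.cover_chain[OF fin U.submodule_zero F] U.sub_zero[OF F] by blast
  have "({\<zero>\<^bsub>U\<^esub>}, ?pp F) \<in> wcov R U ^^ m"
    using conjunct1[OF relpow_inf[OF m]]
  proof (induction m arbitrary: F)
    case 0
    \<comment> \<open>Nondegeneracy enters as the start of the induction: zero is its own double
      annihilator.\<close>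
    have "perp_right {\<zero>\<^bsub>U\<^esub>} V E b = carrier V" using b_left(3) by (auto simp: perp_right_def)
    then have "?pp {\<zero>\<^bsub>U\<^esub>} = {\<zero>\<^bsub>U\<^esub>}" using nondeg b_left(3) by (auto simp: perp_right_def)
    then show ?case using 0 by simp
  next
    case (Suc m)
    then obtain G where G: "({\<zero>\<^bsub>U\<^esub>}, G) \<in> wcov R U ^^ m" "(G, F) \<in> wcov R U" by auto
    have "(?pp G, ?pp F) \<in> wcov R U" using flip.perp_cover[OF perp_cover[OF G(2)]] .
    moreover have "({\<zero>\<^bsub>U\<^esub>}, ?pp G) \<in> wcov R U ^^ m" by (rule Suc.IH[OF G(1)])
    ultimately show ?case by auto
  qed
  moreover have "({\<zero>\<^bsub>U\<^esub>}, ?pp F) \<in> strict R U ^^ Suc m"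
  proof -
    have s: "submodule (?pp F) R U"
      by (rule flip.perp_sub) (use V.sub_subset[OF perp_sub[OF U.sub_subset[OF F]]] in simp)
    have "F \<subseteq> ?pp F" using U.sub_subset[OF F] by (auto simp: perp_right_def)
    moreover have "u \<in> ?pp F" using u by (auto simp: perp_right_def)
    ultimately have "(F, ?pp F) \<in> strict R U" using F s uF by (auto simp: strict_def)
    then show ?thesis using relpow_inf[OF m] by auto
  qed
  ultimately have "Suc m \<le> m"
    using U.strict_le_wcov[OF _ _ order_refl order_refl U.submodule_zero U.submodule_zero] by blast
  then show False by simp
qed

end

section \<open>Restriction of scalars and the standard duality\<close>

lemma restrict_simps [simp]:
  "carrier (restrict_scalars A M) = carrier M" "\<zero>\<^bsub>restrict_scalars A M\<^esub> = \<zero>\<^bsub>M\<^esub>"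
  "x \<oplus>\<^bsub>restrict_scalars A M\<^esub> y = x \<oplus>\<^bsub>M\<^esub> y" "r \<odot>\<^bsub>restrict_scalars A M\<^esub> x = (r \<odot>\<^bsub>A\<^esub> \<one>\<^bsub>A\<^esub>) \<odot>\<^bsub>M\<^esub> x"
  by (simp_all add: restrict_scalars_def)

lemma restrict_sub: "restrict_scalars A (M\<lparr>carrier := X\<rparr>) = (restrict_scalars A M)\<lparr>carrier := X\<rparr>"
  by (simp add: restrict_scalars_def)

lemma finsum_restrict: "finsum (restrict_scalars A M) f S = finsum M f S"
  by (simp add: finsum_def finprod_def restrict_scalars_def)

lemma opp_smult [simp]: "r \<odot>\<^bsub>opp A\<^esub> x = r \<odot>\<^bsub>A\<^esub> x"
  by (simp add: opp_def)

lemma restrict_opp: "restrict_scalars (opp A) M = restrict_scalars A M"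
  by (simp add: restrict_scalars_def)

lemma std_dual_simps [simp]:
  "carrier (std_dual R E A M) = mod_hom R (restrict_scalars A M) E"
  "\<zero>\<^bsub>std_dual R E A M\<^esub> = (\<lambda>x\<in>carrier M. \<zero>\<^bsub>E\<^esub>)"
  "f \<oplus>\<^bsub>std_dual R E A M\<^esub> g = (\<lambda>x\<in>carrier M. f x \<oplus>\<^bsub>E\<^esub> g x)"
  "a \<odot>\<^bsub>std_dual R E A M\<^esub> f = (\<lambda>x\<in>carrier M. f (a \<odot>\<^bsub>M\<^esub> x))"
  by (simp_all add: std_dual_def)

context artin_algebra
begin

abbreviation "res \<equiv> restrict_scalars A"

lemma left_module_A: "left_module R A"
  unfolding left_module_def left_module_axioms_def
  using module_axioms by (auto simp: module_def module_axioms_def cring_def)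

lemma scal_closed: "r \<in> carrier R \<Longrightarrow> r \<odot>\<^bsub>A\<^esub> \<one>\<^bsub>A\<^esub> \<in> carrier A"
  by (rule smult_closed) auto

lemma scal_left: "r \<in> carrier R \<Longrightarrow> x \<in> carrier A \<Longrightarrow> (r \<odot>\<^bsub>A\<^esub> \<one>\<^bsub>A\<^esub>) \<otimes>\<^bsub>A\<^esub> x = r \<odot>\<^bsub>A\<^esub> x"
  using smult_mult_left[of r "\<one>\<^bsub>A\<^esub>" x] by simp

lemma scal_right: "r \<in> carrier R \<Longrightarrow> x \<in> carrier A \<Longrightarrow> x \<otimes>\<^bsub>A\<^esub> (r \<odot>\<^bsub>A\<^esub> \<one>\<^bsub>A\<^esub>) = r \<odot>\<^bsub>A\<^esub> x"
  using smult_mult_right[of r x "\<one>\<^bsub>A\<^esub>"] by simp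

lemma left_module_restrict: assumes M: "left_module A M" shows "left_module R (res M)"
proof -
  interpret M: left_module A M by (rule M)
  have "abelian_group (res M)"
    by (rule abelian_groupI) (auto simp: M.M.add.m_ac intro!: bexI[of _ "\<ominus>\<^bsub>M\<^esub> _"] M.M.l_neg)
  moreover have "(r \<otimes> t) \<odot>\<^bsub>A\<^esub> \<one>\<^bsub>A\<^esub> = (r \<odot>\<^bsub>A\<^esub> \<one>\<^bsub>A\<^esub>) \<otimes>\<^bsub>A\<^esub> (t \<odot>\<^bsub>A\<^esub> \<one>\<^bsub>A\<^esub>)" if "r \<in> carrier R" "t \<in> carrier R" for r t
    using that scal_left[of r "t \<odot>\<^bsub>A\<^esub> \<one>\<^bsub>A\<^esub>"] scal_closed by (simp add: smult_assoc1)
  moreover have "\<one> \<odot>\<^bsub>A\<^esub> \<one>\<^bsub>A\<^esub> = \<one>\<^bsub>A\<^esub>" by simp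
  ultimately show ?thesis
    unfolding left_module_def left_module_axioms_def
    using scal_closed by (auto simp: R.ring_axioms M.lsmult_closed M.lsmult_r_distr smult_l_distr M.lsmult_l_distr
        M.lsmult_assoc M.lsmult_one)
qed

lemma submodule_restrict:
  assumes M: "left_module A M" and X: "submodule X A M" shows "submodule X R (res M)"
  using X scal_closed unfolding left_module.submodule_iff[OF M] left_module.submodule_iff[OF left_module_restrict[OF M]]
  by auto

lemma mod_hom_scalars:
  assumes "left_module A M" "f \<in> mod_hom A M N"
  shows "f \<in> mod_hom R (res M) (res N)"
  using assms(2) scal_closed by (auto simp: mod_hom_def)

text \<open>Submodules over \<open>A\<close> are submodules over \<open>R\<close>, so the rank of
  the \<open>R\<close>-module serves.\<close>

lemma fin_restrict:
  assumes M: "left_module A M" and fin: "fin_len R (res M)" shows "fin_len A M"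
proof -
  have "strict A M \<subseteq> strict R (res M)"
    using submodule_restrict[OF M] by (auto simp: strict_def)
  then show ?thesis using fin unfolding fin_len_def by blast
qed

lemma fin_R: "fin_len R (regular_module R)"
  by (rule R.artinian_fin[OF artinian_R])

lemma fin_A: "fin_len R A"
  by (rule fg_fin[OF fg_over_R fin_R])

text \<open>\<open>A\<close> carries two actions of \<open>R\<close>: its own and multiplication by
  \<open>r \<odot> 1\<close>. They agree by \<open>scal_left\<close>, so the identity is a
  homomorphism between the two modules.\<close>

lemma fin_regular_restrict: "fin_len R (res (regular_module A))"
proof (rule fin_joint[OF left_module_restrict[OF A.left_module_regular] left_module_A fin_A, of 1 "\<lambda>_. \<lambda>x\<in>carrier A. x"])
  show "(\<lambda>x\<in>carrier A. x) \<in> mod_hom R (res (regular_module A)) A"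
    using mod_hom_restrictI[OF left_module_restrict[OF A.left_module_regular], of "\<lambda>x. x" A] scal_left by simp
qed auto

lemma fin_regular: "fin_len A (regular_module A)"
  by (rule fin_restrict[OF A.left_module_regular fin_regular_restrict])

lemma fin_restrict_fg: assumes M: "fg_module A M" shows "fin_len R (res M)"
proof -
  interpret M: left_module A M by (rule fg_left_module[OF M])
  obtain n x where x: "x \<in> {..<n} \<rightarrow> carrier M"
    "lin_comb A M n x ` carrier (fun_module A n) = carrier M" using M M.fg_iff by blast
  have fn: "fin_len R (res (fun_module A n))"
  proof (rule fin_joint[OF left_module_restrict[OF A.left_module_fun]
        left_module_restrict[OF A.left_module_regular] fin_regular_restrict])
    show "(\<lambda>v\<in>carrier (fun_module A n). v i) \<in> mod_hom R (res (fun_module A n)) (res (regular_module A))"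
      if "i < n" for i by (rule mod_hom_scalars[OF A.left_module_fun A.coord_hom[OF that]])
    fix x assume "x \<in> carrier (res (fun_module A n))"
      "\<And>i. i < n \<Longrightarrow> (\<lambda>v\<in>carrier (fun_module A n). v i) x = \<zero>\<^bsub>res (regular_module A)\<^esub>"
    then show "x = \<zero>\<^bsub>res (fun_module A n)\<^esub>"
      by (auto simp: fun_module_def fun_eq_iff PiE_def extensional_def)
  qed
  interpret h: module_hom R "res (fun_module A n)" "res M" "lin_comb A M n x"
    by (rule module_homI[OF left_module_restrict[OF A.left_module_fun] left_module_restrict[OF M.left_module_axioms]
        mod_hom_scalars[OF A.left_module_fun M.lin_comb_hom[OF x(1)]]])
  show ?thesis using h.fin_surj[OF _ fn] x(2) by simp
qed

text \<open>Right modules are modules over \<open>opp A\<close>; with this, every fact about left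
  modules over an artin algebra is available for them.\<close>

lemma artin_opp: "artin_algebra R (opp A)"
proof -
  interpret B: ring "opp A" by (rule A.ring_opp)
  have m: "module R (opp A)"
  proof (rule moduleI)
    show "cring R" by (rule R.is_cring)
    show "abelian_group (opp A)" by (rule B.is_abelian_group)
  qed (auto simp: smult_l_distr smult_r_distr smult_assoc1)
  have eq: "submodule X R (opp A) \<longleftrightarrow> submodule X R A" for X
    unfolding left_module.submodule_iff[OF left_module_A]
    using left_module.submodule_iff[of R "opp A" X] m
    by (simp add: left_module_def left_module_axioms_def module_def module_axioms_def cring_def)
  have "fg_module R (opp A)"
    using fg_over_R m unfolding fg_module_def submod_span_def eq
    by (simp add: left_module_def left_module_axioms_def module_def module_axioms_def cring_def)
  then show ?thesis
    using m B.ring_axioms artinian_R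
    by (intro artin_algebra.intro artin_algebra_axioms.intro) (auto simp flip: smult_mult_left smult_mult_right)
qed

lemma fin_regular_opp: "fin_len (opp A) (regular_module (opp A))"
  by (rule artin_algebra.fin_regular[OF artin_opp])

end

section \<open>Lengths and annihilators under the duality\<close>

locale artin_dual = artin_algebra R A
  for R :: "('r, 'k) ring_scheme" (structure) and A :: "('r, 'a) module" (structure) +
  fixes E :: "('r, 'i) module"
  assumes minE: "minimal_injective_cogenerator R E"
begin

sublocale dual_setting R E
  by (intro dual_setting.intro dual_setting_axioms.intro) (use minE fin_R R.is_cring in auto)

abbreviation "dual \<equiv> std_dual R E A"

lemma dual_closed:
  assumes "f \<in> mod_hom R (res M) E"
  shows "x \<in> carrier M \<Longrightarrow> f x \<in> carrier E"
    "x \<in> carrier M \<Longrightarrow> y \<in> carrier M \<Longrightarrow> f (x \<oplus>\<^bsub>M\<^esub> y) = f x \<oplus>\<^bsub>E\<^esub> f y"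
    "r \<in> carrier R \<Longrightarrow> x \<in> carrier M \<Longrightarrow> f ((r \<odot>\<^bsub>A\<^esub> \<one>\<^bsub>A\<^esub>) \<odot>\<^bsub>M\<^esub> x) = r \<odot>\<^bsub>E\<^esub> f x"
  using mod_homD(1-3)[OF assms, simplified] by auto

lemma dual_restrictI:
  assumes "left_module A M" "\<And>x. x \<in> carrier M \<Longrightarrow> f x \<in> carrier E"
    "\<And>x y. x \<in> carrier M \<Longrightarrow> y \<in> carrier M \<Longrightarrow> f (x \<oplus>\<^bsub>M\<^esub> y) = f x \<oplus>\<^bsub>E\<^esub> f y"
    "\<And>r x. r \<in> carrier R \<Longrightarrow> x \<in> carrier M \<Longrightarrow> f ((r \<odot>\<^bsub>A\<^esub> \<one>\<^bsub>A\<^esub>) \<odot>\<^bsub>M\<^esub> x) = r \<odot>\<^bsub>E\<^esub> f x"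
  shows "restrict f (carrier M) \<in> mod_hom R (res M) E"
  using mod_hom_restrictI[OF left_module_restrict[OF assms(1)], of f E] assms by simp

lemma scal_commute:
  assumes M: "left_module A M" and "a \<in> carrier A" "r \<in> carrier R" "x \<in> carrier M"
  shows "a \<odot>\<^bsub>M\<^esub> ((r \<odot>\<^bsub>A\<^esub> \<one>\<^bsub>A\<^esub>) \<odot>\<^bsub>M\<^esub> x) = (r \<odot>\<^bsub>A\<^esub> \<one>\<^bsub>A\<^esub>) \<odot>\<^bsub>M\<^esub> (a \<odot>\<^bsub>M\<^esub> x)"
proof -
  interpret M: left_module A M by (rule M)
  show ?thesis
    using M.lsmult_assoc[OF assms(2) scal_closed[OF assms(3)] assms(4)]
      M.lsmult_assoc[OF scal_closed[OF assms(3)] assms(2) assms(4)] scal_left scal_right assms by simp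
qed

lemma left_module_dual:
  assumes M: "left_module A M" shows "left_module (opp A) (dual M)"
proof -
  interpret M: left_module A M by (rule M)
  let ?D = "dual M" let ?H = "mod_hom R (res M) E"
  have e: "f = g" if "f \<in> ?H" "g \<in> ?H" "\<And>x. x \<in> carrier M \<Longrightarrow> f x = g x" for f g
    using mod_hom_eqI[OF that(1,2)] that(3) by simp
  note d = dual_closed[where M = M]
  have z: "(\<lambda>x\<in>carrier M. \<zero>\<^bsub>E\<^esub>) \<in> ?H" by (rule dual_restrictI[OF M]) (auto simp: E.smult_r_zero)
  have ad: "(\<lambda>x\<in>carrier M. f x \<oplus>\<^bsub>E\<^esub> g x) \<in> ?H" if "f \<in> ?H" "g \<in> ?H" for f g
    by (rule dual_restrictI[OF M]) (use d[OF that(1)] d[OF that(2)] in \<open>auto simp: E.lsmult_r_distr E.M.add.m_ac\<close>)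
  have sm: "(\<lambda>x\<in>carrier M. f (a \<odot>\<^bsub>M\<^esub> x)) \<in> ?H" if "f \<in> ?H" "a \<in> carrier A" for f a
    by (rule dual_restrictI[OF M])
      (use d[OF that(1)] that(2) scal_commute[OF M that(2)] in \<open>auto simp: M.lsmult_r_distr M.lsmult_closed\<close>)
  have "abelian_group ?D"
  proof (rule abelian_groupI)
    fix f assume f: "f \<in> carrier ?D"
    then have fH: "f \<in> ?H" by simp
    have "(\<lambda>x\<in>carrier M. f ((\<ominus>\<^bsub>A\<^esub> \<one>\<^bsub>A\<^esub>) \<odot>\<^bsub>M\<^esub> x)) \<in> carrier ?D" using sm[OF fH] by simp
    moreover have "f ((\<ominus>\<^bsub>A\<^esub> \<one>\<^bsub>A\<^esub>) \<odot>\<^bsub>M\<^esub> x) \<oplus>\<^bsub>E\<^esub> f x = \<zero>\<^bsub>E\<^esub>" if x: "x \<in> carrier M" for x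
    proof -
      have "f ((\<ominus>\<^bsub>A\<^esub> \<one>\<^bsub>A\<^esub>) \<odot>\<^bsub>M\<^esub> x) \<oplus>\<^bsub>E\<^esub> f x = f (((\<ominus>\<^bsub>A\<^esub> \<one>\<^bsub>A\<^esub>) \<odot>\<^bsub>M\<^esub> x) \<oplus>\<^bsub>M\<^esub> x)"
        using d(2)[OF fH, of "(\<ominus>\<^bsub>A\<^esub> \<one>\<^bsub>A\<^esub>) \<odot>\<^bsub>M\<^esub> x" x] x M.lsmult_closed by simp
      also have "((\<ominus>\<^bsub>A\<^esub> \<one>\<^bsub>A\<^esub>) \<odot>\<^bsub>M\<^esub> x) \<oplus>\<^bsub>M\<^esub> x = \<zero>\<^bsub>M\<^esub>"
        using x M.smult_l_minus[of "\<one>\<^bsub>A\<^esub>" x] M.lsmult_one M.M.l_neg by simp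
      also have "f \<zero>\<^bsub>M\<^esub> = \<zero>\<^bsub>E\<^esub>"
        using module_hom.zero[OF module_homI[OF left_module_restrict[OF M] E.left_module_axioms fH]] by simp
      finally show ?thesis .
    qed
    ultimately show "\<exists>g\<in>carrier ?D. g \<oplus>\<^bsub>?D\<^esub> f = \<zero>\<^bsub>?D\<^esub>"
      by (intro bexI[of _ "\<lambda>x\<in>carrier M. f ((\<ominus>\<^bsub>A\<^esub> \<one>\<^bsub>A\<^esub>) \<odot>\<^bsub>M\<^esub> x)"]) (auto simp: fun_eq_iff)
    show "\<zero>\<^bsub>?D\<^esub> \<oplus>\<^bsub>?D\<^esub> f = f" using f ad[OF z, of f] d(1)[OF fH] by (intro e) auto
  next
    fix f g assume "f \<in> carrier ?D" "g \<in> carrier ?D"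
    then show "f \<oplus>\<^bsub>?D\<^esub> g = g \<oplus>\<^bsub>?D\<^esub> f" using d(1) by (auto simp: fun_eq_iff E.M.a_comm)
  next
    fix f g h assume "f \<in> carrier ?D" "g \<in> carrier ?D" "h \<in> carrier ?D"
    then show "f \<oplus>\<^bsub>?D\<^esub> g \<oplus>\<^bsub>?D\<^esub> h = f \<oplus>\<^bsub>?D\<^esub> (g \<oplus>\<^bsub>?D\<^esub> h)" using d(1) by (auto simp: fun_eq_iff E.M.a_assoc)
  qed (use z ad in auto)
  moreover have "\<one>\<^bsub>opp A\<^esub> \<odot>\<^bsub>?D\<^esub> f = f" if f: "f \<in> carrier ?D" for f
    using f sm[of f "\<one>\<^bsub>A\<^esub>"] by (intro e) (auto simp: M.lsmult_one)
  ultimately show ?thesis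
    unfolding left_module_def left_module_axioms_def
    using A.ring_opp sm d(2) by (auto simp: fun_eq_iff M.lsmult_l_distr M.lsmult_assoc M.lsmult_closed)
qed

lemma dual_pairing:
  assumes M: "left_module A M"
  shows "pairing R E (res (dual M)) (res M) (\<lambda>f x. f x)"
proof -
  interpret M: left_module A M by (rule M)
  interpret op: artin_algebra R "opp A" by (rule artin_opp)
  have U: "left_module R (res (dual M))"
    using op.left_module_restrict[OF left_module_dual[OF M]] by (simp add: restrict_opp)
  show ?thesis
  proof (intro pairing.intro pairing_axioms.intro dual_setting_axioms)
    show "left_module R (res (dual M))" by (rule U)
    show "left_module R (res M)" by (rule left_module_restrict[OF M])
    fix f assume f: "f \<in> carrier (res (dual M))"
    then have "restrict f (carrier M) = f" using mod_homD(4)[of f R "res M" E] extensional_restrict by fastforce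
    then show "restrict f (carrier (res M)) \<in> mod_hom R (res M) E" using f by simp
  next
    fix x assume x: "x \<in> carrier (res M)"
    show "restrict (\<lambda>f. f x) (carrier (res (dual M)))
      \<in> mod_hom R (res (dual M)) E"
      by (rule mod_hom_restrictI[OF U]) (use x dual_closed[of _ M] in auto)
  qed
qed

text \<open>A functional that vanishes on finitely many generators over \<open>R\<close> is zero, so
  the evaluations at them embed the dual into a power of \<open>E\<close>.\<close>

lemma fin_dual:
  assumes M: "fg_module A M" shows "fin_len R (res (dual M))"
proof -
  interpret M: left_module A M by (rule fg_left_module[OF M])
  interpret p: pairing R E "res (dual M)" "res M" "\<lambda>f x. f x"
    by (rule dual_pairing[OF M.left_module_axioms])
  have "fg_module R (res M)" by (rule p.V.fin_fg[OF fin_restrict_fg[OF M]])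
  then obtain S where S: "finite S" "S \<subseteq> carrier M" "submod_span R (res M) S = carrier M"
    unfolding fg_module_def by auto
  obtain x where x: "bij_betw x {..<card S} S"
    using ex_bij_betw_nat_finite[OF S(1)] by (metis lessThan_atLeast0)
  have xc: "x i \<in> S" if "i < card S" for i using x that by (auto simp: bij_betw_def)
  show ?thesis
  proof (rule fin_joint[OF p.U E.left_module_axioms fin_E])
    show "restrict (\<lambda>f. f (x i)) (carrier (res (dual M)))
      \<in> mod_hom R (res (dual M)) E" if "i < card S" for i
      by (rule p.hom_l) (use xc[OF that] S(2) in auto)
    fix f assume f: "f \<in> carrier (res (dual M))"
      "\<And>i. i < card S \<Longrightarrow> restrict (\<lambda>f. f (x i)) (carrier (res (dual M))) f = \<zero>\<^bsub>E\<^esub>"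
    interpret f: module_hom R "res M" E f
      by (rule module_homI[OF p.V E.left_module_axioms]) (use f in simp)
    have "S \<subseteq> f.pre {\<zero>\<^bsub>E\<^esub>}"
    proof
      fix y assume y: "y \<in> S"
      then obtain i where "i < card S" "y = x i" using bij_betw_imp_surj_on[OF x] by auto
      then show "y \<in> f.pre {\<zero>\<^bsub>E\<^esub>}" using f y S(2) by (auto simp: f.pre_def)
    qed
    then have "carrier M \<subseteq> f.pre {\<zero>\<^bsub>E\<^esub>}"
      using p.V.span_least[OF f.sub_pre[OF E.submodule_zero], of S] S(3) by simp
    then have "f y = \<zero>\<^bsub>E\<^esub>" if "y \<in> carrier M" for y using that by (auto simp: f.pre_def)
    then show "f = \<zero>\<^bsub>res (dual M)\<^esub>"
      using f.ext by (auto simp: extensional_def fun_eq_iff)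
  qed
qed

lemma fin_dual_opp: assumes M: "fg_module A M" shows "fin_len (opp A) (dual M)"
  by (rule artin_algebra.fin_restrict[OF artin_opp left_module_dual[OF fg_left_module[OF M]]])
    (simp add: restrict_opp fin_dual[OF M])

lemma separate:
  assumes M: "fg_module A M" and X: "submodule X R (res M)" and v: "v \<in> carrier M" "v \<notin> X"
  obtains f where "f \<in> mod_hom R (res M) E" "\<And>x. x \<in> X \<Longrightarrow> f x = \<zero>\<^bsub>E\<^esub>" "f v \<noteq> \<zero>\<^bsub>E\<^esub>"
proof -
  interpret M: left_module R "res M" by (rule left_module_restrict[OF fg_left_module[OF M]])
  have "v \<in> carrier (res M)" using v(1) by simp
  then obtain f where "f \<in> mod_hom R (res M) E" "\<And>x. x \<in> X \<Longrightarrow> f x = \<zero>\<^bsub>E\<^esub>" "f v \<noteq> \<zero>\<^bsub>E\<^esub>"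
    using cogenerator_separates[OF E_props(2) M.fin_fg[OF fin_restrict_fg[OF M]] X _ v(2)] by metis
  then show ?thesis by (rule that)
qed

definition ann :: "('a, 'm) module \<Rightarrow> 'm set \<Rightarrow> ('m \<Rightarrow> 'i) set" where
  "ann M X = {f \<in> carrier (dual M). \<forall>x\<in>X. f x = \<zero>\<^bsub>E\<^esub>}"

lemma ann_sub:
  assumes M: "left_module A M" and X: "submodule X A M" shows "submodule (ann M X) (opp A) (dual M)"
proof -
  interpret M: left_module A M by (rule M)
  interpret D: left_module "opp A" "dual M" by (rule left_module_dual[OF M])
  show ?thesis
    unfolding D.submodule_iff ann_def
    using D.M.zero_closed D.M.add.m_closed D.lsmult_closed M.sub_carr[OF X] M.sub_smult[OF X] by auto
qed

text \<open>\<open>E\<close> is a cogenerator, so some functional vanishes on \<open>X\<close> but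
  not at a chosen element of \<open>Y\<close> outside \<open>X\<close>.\<close>

lemma ann_strict:
  assumes M: "fg_module A M" and XY: "(X, Y) \<in> strict A M"
  shows "(ann M Y, ann M X) \<in> strict (opp A) (dual M)"
proof -
  interpret M: left_module A M by (rule fg_left_module[OF M])
  have s: "submodule X A M" "submodule Y A M" "X \<subset> Y" using XY by (auto simp: strict_def)
  obtain y where y: "y \<in> Y" "y \<notin> X" using s by blast
  obtain f where f: "f \<in> mod_hom R (res M) E" "\<And>x. x \<in> X \<Longrightarrow> f x = \<zero>\<^bsub>E\<^esub>" "f y \<noteq> \<zero>\<^bsub>E\<^esub>"
    using separate[OF M submodule_restrict[OF M.left_module_axioms s(1)] M.sub_carr[OF s(2) y(1)] y(2)] by blast
  then have "f \<in> ann M X" "f \<notin> ann M Y" using y(1) by (auto simp: ann_def)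
  moreover have "ann M Y \<subseteq> ann M X" using s(3) by (auto simp: ann_def)
  ultimately show ?thesis using ann_sub[OF M.left_module_axioms] s by (auto simp: strict_def)
qed

text \<open>Annihilators turn a composition series of \<open>M\<close> into a strict chain of the
  same length in \<open>D M\<close>. Applied to the transpose, this carries the lower bound over to
  \<open>DTr\<close>.\<close>

lemma dual_length:
  assumes M: "fg_module A M"
  shows "comp_length A M \<le> comp_length (opp A) (dual M)"
proof -
  interpret M: left_module A M by (rule fg_left_module[OF M])
  interpret D: left_module "opp A" "dual M" by (rule left_module_dual[OF M.left_module_axioms])
  have fin: "fin_len A M" by (rule fg_fin[OF M fin_regular])
  have "(ann M Y, ann M X) \<in> strict (opp A) (dual M) ^^ n" if "(X, Y) \<in> strict A M ^^ n" for X Y n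
    using that
  proof (induction n arbitrary: Y)
    case (Suc n)
    then obtain Z where "(X, Z) \<in> strict A M ^^ n" "(Z, Y) \<in> strict A M" by auto
    then show ?case using Suc.IH[of Z] ann_strict[OF M] by (intro relpow_Suc_I2)
  qed auto
  then have "(ann M (carrier M), ann M {\<zero>\<^bsub>M\<^esub>}) \<in> strict (opp A) (dual M) ^^ comp_length A M"
    using relpow_inf[OF M.comp_length_chain[OF fin]] by blast
  then show ?thesis
    by (rule D.strict_le_comp_length[OF fin_dual_opp[OF M] _ ann_sub[OF M.left_module_axioms M.submodule_carrier]])
qed

end

section \<open>Direct sums and socles\<close>

context left_module
begin

lemma direct_sum_ex:
  assumes "internal_direct_sum A M s N" "x \<in> carrier M"
  obtains f where "\<And>i. i \<in> {1..s} \<Longrightarrow> f i \<in> N i" "x = finsum M f {1..s}"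
  using assms unfolding internal_direct_sum_def by (metis PiE_mem)

text \<open>Uniqueness in the definition concerns extensional families; arbitrary families are
  compared after restriction to \<open>{1..s}\<close>.\<close>

lemma direct_sum_unique:
  assumes ds: "internal_direct_sum A M s N"
    and f: "\<And>i. i \<in> {1..s} \<Longrightarrow> f i \<in> N i" and g: "\<And>i. i \<in> {1..s} \<Longrightarrow> g i \<in> N i"
    and eq: "finsum M f {1..s} = finsum M g {1..s}" and i: "i \<in> {1..s}"
  shows "f i = g i"
proof -
  have N: "submodule (N i) A M" if "i \<in> {1..s}" for i using ds that by (simp add: internal_direct_sum_def)
  have fc: "f \<in> {1..s} \<rightarrow> carrier M" "g \<in> {1..s} \<rightarrow> carrier M" using sub_carr[OF N] f g by auto
  let ?f = "restrict f {1..s}" and ?g = "restrict g {1..s}"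
  have s: "finsum M ?f {1..s} = finsum M f {1..s}" "finsum M ?g {1..s} = finsum M g {1..s}"
    using fc by (auto intro!: M.finsum_cong')
  have "finsum M f {1..s} \<in> carrier M" using fc by (intro M.finsum_closed)
  then have "\<exists>!h. h \<in> (\<Pi>\<^sub>E i\<in>{1..s}. N i) \<and> finsum M f {1..s} = finsum M h {1..s}"
    using ds unfolding internal_direct_sum_def by blast
  moreover have "?f \<in> (\<Pi>\<^sub>E i\<in>{1..s}. N i)" "?g \<in> (\<Pi>\<^sub>E i\<in>{1..s}. N i)" using f g by auto
  ultimately have "?f = ?g" using s eq by metis
  then show ?thesis using i by (metis restrict_apply')
qed

lemma simple_sub_iff:
  assumes S: "submodule S A M"
  shows "simple_module A (M\<lparr>carrier := S\<rparr>) \<longleftrightarrow>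
    S \<noteq> {\<zero>\<^bsub>M\<^esub>} \<and> (\<forall>Z. submodule Z A M \<longrightarrow> Z \<subseteq> S \<longrightarrow> Z = {\<zero>\<^bsub>M\<^esub>} \<or> Z = S)"
  unfolding simple_module_def using submodule_sub_iff[OF S] by auto

lemma soc_sub: "submodule (soc A M) A M"
  unfolding soc_def using sub_carr by (intro span_sub) blast

lemma simple_le_soc:
  assumes "submodule S A M" "simple_module A (M\<lparr>carrier := S\<rparr>)" shows "S \<subseteq> soc A M"
  unfolding soc_def using assms span_incl[of "\<Union>{S. submodule S A M \<and> simple_module A (M\<lparr>carrier := S\<rparr>)}"] by blast

lemma soc_least:
  assumes "submodule N A M" "\<And>S. submodule S A M \<Longrightarrow> simple_module A (M\<lparr>carrier := S\<rparr>) \<Longrightarrow> S \<subseteq> N"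
  shows "soc A M \<subseteq> N"
  unfolding soc_def using assms by (intro span_least) blast+

text \<open>A nonzero submodule contains a minimal one by finite length, and that one lies in the
  simple socle, hence equals it.\<close>

lemma simple_soc_least:
  assumes fin: "fin_len A M" and s: "simple_module A (M\<lparr>carrier := soc A M\<rparr>)"
    and X: "submodule X A M" "X \<noteq> {\<zero>\<^bsub>M\<^esub>}"
  shows "soc A M \<subseteq> X"
proof -
  obtain S where S: "submodule S A M" "S \<subseteq> X" "S \<noteq> {\<zero>\<^bsub>M\<^esub>}"
    "\<And>Z. submodule Z A M \<Longrightarrow> Z \<subseteq> S \<Longrightarrow> Z = {\<zero>\<^bsub>M\<^esub>} \<or> Z = S"
    by (rule min_sub_exists[OF fin X]) (rule that)
  then have "S \<subseteq> soc A M" using simple_le_soc simple_sub_iff by blast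
  then show ?thesis using s simple_sub_iff[OF soc_sub] S by blast
qed

lemma simple_cyc:
  assumes "submodule S A M" "simple_module A (M\<lparr>carrier := S\<rparr>)" "x \<in> S" "x \<noteq> \<zero>\<^bsub>M\<^esub>" shows "cyc x = S"
proof -
  have xc: "x \<in> carrier M" using sub_carr assms by blast
  show ?thesis
    using assms(2) submodule_cyc[OF xc] cyc_least[OF assms(1,3)] cyc_self[OF xc] assms(4)
    unfolding simple_sub_iff[OF assms(1)] by blast
qed

lemma ideal_times_sub: "I \<subseteq> carrier A \<Longrightarrow> submodule (ideal_times_module A I M) A M"
  unfolding ideal_times_module_def using lsmult_closed by (intro span_sub) blast

lemma ideal_times_zero_iff:
  assumes I: "I \<subseteq> carrier A"
  shows "ideal_times_module A I M = {\<zero>\<^bsub>M\<^esub>} \<longleftrightarrow> (\<forall>a\<in>I. \<forall>x\<in>carrier M. a \<odot>\<^bsub>M\<^esub> x = \<zero>\<^bsub>M\<^esub>)"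
proof
  let ?G = "{a \<odot>\<^bsub>M\<^esub> x | a x. a \<in> I \<and> x \<in> carrier M}"
  assume "ideal_times_module A I M = {\<zero>\<^bsub>M\<^esub>}"
  then have "?G \<subseteq> {\<zero>\<^bsub>M\<^esub>}" unfolding ideal_times_module_def using span_incl[of ?G] by simp
  then show "\<forall>a\<in>I. \<forall>x\<in>carrier M. a \<odot>\<^bsub>M\<^esub> x = \<zero>\<^bsub>M\<^esub>" by blast
next
  let ?G = "{a \<odot>\<^bsub>M\<^esub> x | a x. a \<in> I \<and> x \<in> carrier M}"
  assume "\<forall>a\<in>I. \<forall>x\<in>carrier M. a \<odot>\<^bsub>M\<^esub> x = \<zero>\<^bsub>M\<^esub>"
  then have "?G \<subseteq> {\<zero>\<^bsub>M\<^esub>}" by blast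
  then have "ideal_times_module A I M \<subseteq> {\<zero>\<^bsub>M\<^esub>}"
    unfolding ideal_times_module_def by (rule span_least[OF submodule_zero])
  then show "ideal_times_module A I M = {\<zero>\<^bsub>M\<^esub>}" using sub_zero[OF ideal_times_sub[OF I]] by blast
qed

text \<open>Nilpotency of the radical provides an exponent as required in the \<open>LEAST\<close>,
  so that its defining property can be used; exponent 0 would mean that \<open>1\<close> kills the
  nonzero \<open>M\<close>.\<close>

lemma loewy_props:
  assumes fin: "fin_len A (regular_module A)" and ne: "carrier M \<noteq> {\<zero>\<^bsub>M\<^esub>}"
  shows "loewy_length A M \<noteq> 0"
    and "ideal_times_module A (ideal_power A (jacobson_radical A) (loewy_length A M)) M = {\<zero>\<^bsub>M\<^esub>}"
    and "n < loewy_length A M \<Longrightarrow> ideal_times_module A (ideal_power A (jacobson_radical A) n) M \<noteq> {\<zero>\<^bsub>M\<^esub>}"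
proof -
  let ?Z = "\<lambda>n. ideal_times_module A (ideal_power A (jacobson_radical A) n) M = {\<zero>\<^bsub>M\<^esub>}"
  have sub: "ideal_power A (jacobson_radical A) n \<subseteq> carrier A" for n
    using ideal.Icarr[OF A.ideal_power_ideal[OF A.jacobson_ideal]] by blast
  obtain n where "ideal_power A (jacobson_radical A) n = {\<zero>\<^bsub>A\<^esub>}" using A.jacobson_nilpotent[OF fin] .
  then have "?Z n" using ideal_times_zero_iff[OF sub[of n]] smult_l_zero by simp
  then show Z: "?Z (loewy_length A M)" unfolding loewy_length_def by (rule LeastI)
  show "\<not> ?Z n" if "n < loewy_length A M" for n using that not_less_Least unfolding loewy_length_def by blast
  show "loewy_length A M \<noteq> 0"
  proof
    assume "loewy_length A M = 0"
    then have "\<forall>x\<in>carrier M. \<one>\<^bsub>A\<^esub> \<odot>\<^bsub>M\<^esub> x = \<zero>\<^bsub>M\<^esub>" using Z ideal_times_zero_iff[OF sub[of 0]] by simp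
    then have "x = \<zero>\<^bsub>M\<^esub>" if "x \<in> carrier M" for x using that lsmult_one[OF that] by simp
    then show False using ne M.zero_closed by blast
  qed
qed

end

text \<open>Coordinates are chosen, and their uniqueness makes the choice additive and
  linear.\<close>

lemma (in left_module) direct_sum_projections:
  assumes ds: "internal_direct_sum A M s N"
  obtains p where "\<And>i. i \<in> {1..s} \<Longrightarrow> p i \<in> mod_hom A M (M\<lparr>carrier := N i\<rparr>)"
    "\<And>x. x \<in> carrier M \<Longrightarrow> x = finsum M (\<lambda>i. p i x) {1..s}"
    "\<And>i j x. i \<in> {1..s} \<Longrightarrow> j \<in> {1..s} \<Longrightarrow> x \<in> N i \<Longrightarrow> p j x = (if j = i then x else \<zero>\<^bsub>M\<^esub>)"
proof -
  have N: "submodule (N i) A M" if "i \<in> {1..s}" for i using ds that by (simp add: internal_direct_sum_def)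
  have "\<forall>x. \<exists>f. x \<in> carrier M \<longrightarrow> (\<forall>i\<in>{1..s}. f i \<in> N i) \<and> x = finsum M f {1..s}"
    using direct_sum_ex[OF ds] by metis
  then obtain q where q: "\<And>x i. x \<in> carrier M \<Longrightarrow> i \<in> {1..s} \<Longrightarrow> q x i \<in> N i"
    "\<And>x. x \<in> carrier M \<Longrightarrow> x = finsum M (q x) {1..s}" by metis
  have qc: "q x i \<in> carrier M" if "x \<in> carrier M" "i \<in> {1..s}" for x i using sub_carr[OF N[OF that(2)] q(1)[OF that]] .
  have qP: "q x \<in> {1..s} \<rightarrow> carrier M" if "x \<in> carrier M" for x using qc[OF that] by blast
  have uniq: "q x i = g i" if "x \<in> carrier M" "\<And>i. i \<in> {1..s} \<Longrightarrow> g i \<in> N i" "x = finsum M g {1..s}" "i \<in> {1..s}" for x g i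
    using direct_sum_unique[OF ds, of "q x" g, OF q(1)[OF that(1)] that(2) _ that(4)] q(2)[OF that(1)] that(3) by simp
  let ?p = "\<lambda>i. restrict (\<lambda>x. q x i) (carrier M)"
  show ?thesis
  proof (rule that[of ?p])
    fix i assume i: "i \<in> {1..s}"
    show "?p i \<in> mod_hom A M (M\<lparr>carrier := N i\<rparr>)"
    proof (rule mod_hom_restrictI[OF left_module_axioms])
      fix x assume x: "x \<in> carrier M"
      show "q x i \<in> carrier (M\<lparr>carrier := N i\<rparr>)" using q(1)[OF x i] by simp
      show "q (x \<oplus>\<^bsub>M\<^esub> y) i = q x i \<oplus>\<^bsub>M\<lparr>carrier := N i\<rparr>\<^esub> q y i" if y: "y \<in> carrier M" for y
      proof -
        have "q (x \<oplus>\<^bsub>M\<^esub> y) i = (\<lambda>i. q x i \<oplus>\<^bsub>M\<^esub> q y i) i"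
        proof (rule uniq[OF _ _ _ i])
          show "x \<oplus>\<^bsub>M\<^esub> y = finsum M (\<lambda>i. q x i \<oplus>\<^bsub>M\<^esub> q y i) {1..s}"
            using M.finsum_addf[OF qP[OF x] qP[OF y]] q(2)[OF x] q(2)[OF y] by simp
        qed (use x y sub_add[OF N q(1)[OF x] q(1)[OF y]] in auto)
        then show ?thesis by simp
      qed
      show "q (a \<odot>\<^bsub>M\<^esub> x) i = a \<odot>\<^bsub>M\<lparr>carrier := N i\<rparr>\<^esub> q x i" if a: "a \<in> carrier A" for a
      proof -
        have "q (a \<odot>\<^bsub>M\<^esub> x) i = (\<lambda>i. a \<odot>\<^bsub>M\<^esub> q x i) i"
        proof (rule uniq[OF _ _ _ i])
          show "a \<odot>\<^bsub>M\<^esub> x = finsum M (\<lambda>i. a \<odot>\<^bsub>M\<^esub> q x i) {1..s}"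
            using finsum_smult[OF a qP[OF x]] q(2)[OF x] by simp
        qed (use x a lsmult_closed sub_smult[OF N a q(1)[OF x]] in auto)
        then show ?thesis by simp
      qed
    qed
    fix j x assume j: "j \<in> {1..s}" and x: "x \<in> N i"
    have xc: "x \<in> carrier M" by (rule sub_carr[OF N[OF i] x])
    have "q x j = (\<lambda>j. if i = j then x else \<zero>\<^bsub>M\<^esub>) j"
    proof (rule uniq[OF xc _ _ j])
      show "x = finsum M (\<lambda>j. if i = j then x else \<zero>\<^bsub>M\<^esub>) {1..s}"
        using M.add.finprod_singleton[OF i, of "\<lambda>_. x"] xc by (simp add: finsum_def)
    qed (use x sub_zero[OF N] in auto)
    then show "?p j x = (if j = i then x else \<zero>\<^bsub>M\<^esub>)" using xc by auto
  next
    fix x assume x: "x \<in> carrier M"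
    then show "x = finsum M (\<lambda>i. ?p i x) {1..s}" using q(2)[OF x] by simp
  qed
qed

section \<open>The projective case\<close>

text \<open>Verifies the hypotheses of \<open>transpose_bound\<close> for \<open>P\<close> with
  \<open>soc P\<close> as kernel. The shift by \<open>Suc\<close> passes from families on
  \<open>{1..s}\<close> to families below \<open>s\<close>. For \<open>s = 0\<close> the radical is
  zero and \<open>P\<close> is simple, so the socle is not inside the radical; hence the assumption
  on \<open>s\<close>.\<close>

lemma projective_transpose_bound:
  fixes A :: "('a, 'k) ring_scheme" and P :: "('a, 'p) module"
  assumes A: "ring A" and fl: "fin_len A (regular_module A)" and fr: "fin_len (opp A) (regular_module (opp A))"
    and P: "projective A P" "indecomposable A P" and s: "s \<noteq> 0"
    and ds: "internal_direct_sum A (P\<lparr>carrier := rad A P\<rparr>) s M"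
    and Mi: "\<And>i. i \<in> {1..s} \<Longrightarrow> loewy_length A (P\<lparr>carrier := M i\<rparr>) = c i \<and> primitive_idempotent A (e i) \<and>
       mod_iso A (P\<lparr>carrier := soc A (P\<lparr>carrier := M i\<rparr>)\<rparr>) (left_factor A (e i) (jacobson_radical A))"
  obtains u where "transpose_bound A s (\<lambda>i. e (Suc i)) P (rad A P) (quot_module P (soc A P))
      (left_module.quot_map P (soc A P)) u (\<lambda>i. c (Suc i))"
    and "\<And>i. i \<in> {1..s} \<Longrightarrow> c i \<noteq> 0"
proof -
  interpret A: ring A by (rule A)
  have fgP: "fg_module A P" using P(1) by (simp add: projective_def)
  interpret P: left_module A P by (rule fg_left_module[OF fgP])
  have finP: "fin_len A P" by (rule fg_fin[OF fgP fl])
  obtain N where N': "largest_proper A P N" using projective_local[OF fl P] .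
  have N: "largest_proper A P (rad A P)" using P.largest_rad[OF N'] N' by simp
  let ?N = "rad A P" let ?J = "jacobson_radical A"
  have Ns: "submodule ?N A P" "?N \<noteq> carrier P" using N by (auto simp: largest_proper_def)
  interpret N: left_module A "P\<lparr>carrier := ?N\<rparr>" by (rule P.left_module_sub[OF Ns(1)])
  have MN: "submodule (M i) A (P\<lparr>carrier := ?N\<rparr>)" if "i \<in> {1..s}" for i
    using ds that by (simp add: internal_direct_sum_def)
  have MP: "submodule (M i) A P" "M i \<subseteq> ?N" if "i \<in> {1..s}" for i
    using MN[OF that] P.submodule_sub_iff[OF Ns(1)] by auto
  have JI: "ideal (ideal_power A ?J n) A" for n by (rule A.ideal_power_ideal[OF A.jacobson_ideal])
  obtain p0 where p0: "p0 \<in> carrier P" "p0 \<notin> ?N" using Ns P.sub_subset by blast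
  define S where "S i = soc A (P\<lparr>carrier := M i\<rparr>)" for i
  have Mmod: "left_module A (P\<lparr>carrier := M i\<rparr>)" if "i \<in> {1..s}" for i
    by (rule P.left_module_sub[OF MP(1)[OF that]])
  have finM: "fin_len A (P\<lparr>carrier := M i\<rparr>)" if "i \<in> {1..s}" for i
    by (rule P.fin_sub[OF MP(1)[OF that] finP])
  have SM: "submodule (S i) A (P\<lparr>carrier := M i\<rparr>)" if "i \<in> {1..s}" for i
    unfolding S_def by (rule left_module.soc_sub[OF Mmod[OF that]])
  have SP: "submodule (S i) A P" "S i \<subseteq> M i" if "i \<in> {1..s}" for i
    using SM[OF that] P.submodule_sub_iff[OF MP(1)[OF that]] by auto
  have LF: "left_module A (left_factor A (e i) ?J)" if "i \<in> {1..s}" for i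
    using A.left_module_left_factor[OF fl] Mi[OF that] by blast
  have Ssimple: "simple_module A (P\<lparr>carrier := S i\<rparr>)" if "i \<in> {1..s}" for i
    using mod_iso_simple[OF P.left_module_sub[OF SP(1)[OF that]] LF[OF that]] Mi[OF that]
      A.left_factor_simple[OF fl] by (simp add: S_def)
  have Sleast: "S i \<subseteq> X" if "i \<in> {1..s}" "submodule X A P" "X \<subseteq> M i" "X \<noteq> {\<zero>\<^bsub>P\<^esub>}" for i X
    using left_module.simple_soc_least[OF Mmod finM, of i X] that Ssimple[OF that(1)]
      P.submodule_sub_iff[OF MP(1)[OF that(1)]] by (simp add: S_def)
  \<comment> \<open>The vector that corresponds to the class of \<open>e i\<close> under the
    isomorphism of the socle with \<open>A (e i) / J (e i)\<close>.\<close>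
  have "\<exists>u\<in>S i. e i \<odot>\<^bsub>P\<^esub> u = u \<and> u \<noteq> \<zero>\<^bsub>P\<^esub>" if i: "i \<in> {1..s}" for i
  proof -
    have prim: "primitive_idempotent A (e i)" using Mi[OF i] by blast
    then have ec: "e i \<in> carrier A" by (simp add: primitive_idempotent_def)
    obtain f where f: "f \<in> mod_hom A (P\<lparr>carrier := S i\<rparr>) (left_factor A (e i) ?J)"
      "bij_betw f (S i) (carrier (left_factor A (e i) ?J))"
      using Mi[OF i] by (auto simp: mod_iso_def S_def)
    interpret f: module_hom A "P\<lparr>carrier := S i\<rparr>" "left_factor A (e i) ?J" f
      by (rule module_homI[OF P.left_module_sub[OF SP(1)[OF i]] LF[OF i] f(1)])
    obtain x where x: "x \<in> carrier (left_factor A (e i) ?J)" "x \<noteq> \<zero>\<^bsub>left_factor A (e i) ?J\<^esub>"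
      "e i \<odot>\<^bsub>left_factor A (e i) ?J\<^esub> x = x" using A.left_factor_idem[OF fl prim] by blast
    obtain u where u: "u \<in> S i" "f u = x" using f(2) x(1) by (metis bij_betw_imp_surj_on imageE)
    have eu: "e i \<odot>\<^bsub>P\<^esub> u \<in> S i" by (rule P.sub_smult[OF SP(1)[OF i] ec u(1)])
    have "f (e i \<odot>\<^bsub>P\<^esub> u) = f u" using f.smult[OF ec, of u] u x(3) by simp
    then have "e i \<odot>\<^bsub>P\<^esub> u = u" using f(2) eu u(1) by (auto simp: bij_betw_def inj_on_def)
    moreover have "u \<noteq> \<zero>\<^bsub>P\<^esub>" using f.zero u(2) x(2) by auto
    ultimately show ?thesis using u(1) by blast
  qed
  then obtain w where w: "\<And>i. i \<in> {1..s} \<Longrightarrow> w i \<in> S i" "\<And>i. i \<in> {1..s} \<Longrightarrow> e i \<odot>\<^bsub>P\<^esub> w i = w i"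
    "\<And>i. i \<in> {1..s} \<Longrightarrow> w i \<noteq> \<zero>\<^bsub>P\<^esub>" by metis
  have wP: "w i \<in> carrier P" if "i \<in> {1..s}" for i using P.sub_carr[OF SP(1)[OF that] w(1)[OF that]] .
  have Mne: "M i \<noteq> {\<zero>\<^bsub>P\<^esub>}" if "i \<in> {1..s}" for i using w(1,3)[OF that] SP(2)[OF that] by blast
  have c0: "c i \<noteq> 0" if i: "i \<in> {1..s}" for i
    using left_module.loewy_props(1)[OF Mmod[OF i] fl] Mne[OF i] Mi[OF i] by simp
  \<comment> \<open>With \<open>n = c i - 1\<close> the module \<open>J^n (M i)\<close> is nonzero,
    so it contains the simple socle \<open>S i\<close>. As
    \<open>M i \<subseteq> rad P = J p0\<close>, one more factor \<open>J\<close> is available and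
    \<open>J^n (M i) \<subseteq> J^(c i) P\<close>.\<close>
  have wrad: "w i \<in> ideal_times_module A (ideal_power A ?J (c i)) P" if i: "i \<in> {1..s}" for i
  proof -
    interpret Q: left_module A "P\<lparr>carrier := M i\<rparr>" by (rule Mmod[OF i])
    obtain n where n: "c i = Suc n" using c0[OF i] not0_implies_Suc by blast
    let ?X = "ideal_times_module A (ideal_power A ?J n) (P\<lparr>carrier := M i\<rparr>)"
    have JC: "ideal_power A ?J m \<subseteq> carrier A" for m using ideal.Icarr[OF JI] by blast
    have X: "submodule ?X A P" "?X \<subseteq> M i"
      using Q.ideal_times_sub[OF JC] P.submodule_sub_iff[OF MP(1)[OF i]] by auto
    have "?X \<noteq> {\<zero>\<^bsub>P\<^esub>}" using Q.loewy_props(3)[OF fl, of n] Mne[OF i] Mi[OF i] n by simp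
    then have wX: "w i \<in> ?X" using Sleast[OF i X] w(1)[OF i] by blast
    let ?Y = "ideal_times_module A (ideal_power A ?J (c i)) P"
    have Ys: "submodule ?Y A P" by (rule P.ideal_times_sub[OF JC])
    have "submodule (?Y \<inter> M i) A (P\<lparr>carrier := M i\<rparr>)"
      using P.submodule_Int[OF Ys MP(1)[OF i]] P.submodule_sub_iff[OF MP(1)[OF i]] by simp
    moreover have "a \<odot>\<^bsub>P\<^esub> x \<in> ?Y \<inter> M i" if a: "a \<in> ideal_power A ?J n" "x \<in> M i" for a x
    proof -
      have ac: "a \<in> carrier A" using JC a(1) by blast
      obtain j where j: "j \<in> ?J" "x = j \<odot>\<^bsub>P\<^esub> p0"
        using P.local_rad_eq[OF fl N p0, of x] a(2) MP(2)[OF i] by blast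
      have "a \<odot>\<^bsub>P\<^esub> x = (a \<otimes>\<^bsub>A\<^esub> j) \<odot>\<^bsub>P\<^esub> p0"
        using P.lsmult_assoc[OF ac A.jacobson_carr[OF j(1)] p0(1)] j(2) by simp
      moreover have "a \<otimes>\<^bsub>A\<^esub> j \<in> ideal_power A ?J (c i)"
        using A.ideal_power_prod[OF A.jacobson_ideal a(1) j(1)] n by simp
      ultimately have "a \<odot>\<^bsub>P\<^esub> x \<in> {a \<odot>\<^bsub>P\<^esub> x | a x. a \<in> ideal_power A ?J (c i) \<and> x \<in> carrier P}"
        using p0(1) by blast
      then have "a \<odot>\<^bsub>P\<^esub> x \<in> ?Y" unfolding ideal_times_module_def by (rule subsetD[OF P.span_incl])
      then show ?thesis using P.sub_smult[OF MP(1)[OF i] ac a(2)] by blast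
    qed
    then have "{a \<odot>\<^bsub>P\<lparr>carrier := M i\<rparr>\<^esub> x | a x. a \<in> ideal_power A ?J n \<and> x \<in> carrier (P\<lparr>carrier := M i\<rparr>)} \<subseteq> ?Y \<inter> M i"
      by auto
    ultimately have "?X \<subseteq> ?Y \<inter> M i" unfolding ideal_times_module_def[of _ "ideal_power A ?J n"] by (rule Q.span_least)
    then show ?thesis using wX by blast
  qed
  let ?u = "\<lambda>i. w (Suc i)"
  have Sc: "Suc i \<in> {1..s}" if "i < s" for i using that by auto
  have reidx: "finsum P (\<lambda>i. f (Suc i)) {..<s} = finsum P f {1..s}" if "f \<in> {1..s} \<rightarrow> carrier P" for f
    using P.M.finsum_reindex[of f Suc "{..<s}"] that by (simp add: image_Suc_lessThan)
  have fsN: "finsum (P\<lparr>carrier := ?N\<rparr>) f {1..s} = finsum P f {1..s}" if "\<And>i. i \<in> {1..s} \<Longrightarrow> f i \<in> M i" for f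
    by (rule P.finsum_sub[OF Ns(1)]) (use that MP(2) in blast)
  have uniq: "f i = g i" if "\<And>i. i \<in> {1..s} \<Longrightarrow> f i \<in> M i" "\<And>i. i \<in> {1..s} \<Longrightarrow> g i \<in> M i"
    "finsum P f {1..s} = finsum P g {1..s}" "i \<in> {1..s}" for f g i
    using N.direct_sum_unique[OF ds that(1,2) _ that(4)] fsN[OF that(1)] fsN[OF that(2)] that(3) by simp
  have zero: "finsum P (\<lambda>_. \<zero>\<^bsub>P\<^esub>) {1..s} = \<zero>\<^bsub>P\<^esub>" by simp
  have zM: "\<zero>\<^bsub>P\<^esub> \<in> M i" if "i \<in> {1..s}" for i by (rule P.sub_zero[OF MP(1)[OF that]])
  let ?K = "{finsum P (\<lambda>i. v i \<odot>\<^bsub>P\<^esub> ?u i) {..<s} | v. v \<in> {..<s} \<rightarrow> carrier A}"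
  \<comment> \<open>Otherwise \<open>P\<close> would be simple and its radical zero, but the radical
    contains the nonzero \<open>w 1\<close>.\<close>
  have soc_N: "T \<subseteq> ?N" if T: "submodule T A P" "simple_module A (P\<lparr>carrier := T\<rparr>)" for T
  proof (rule ccontr)
    assume "\<not> T \<subseteq> ?N"
    then have "T = carrier P" using N T(1) unfolding largest_proper_def by blast
    then have "?N = {\<zero>\<^bsub>P\<^esub>}" using T P.simple_sub_iff[OF T(1)] Ns P.sub_subset by blast
    then show False using s w(1,3)[of 1] SP(2)[of 1] MP(2)[of 1] by auto
  qed
  have socN: "soc A P \<subseteq> ?N" by (rule P.soc_least[OF Ns(1) soc_N])
  have "soc A P = ?K"
  proof
    have uc: "?u \<in> {..<s} \<rightarrow> carrier P" using wP Sc by auto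
    have Ks: "submodule ?K A P" by (rule P.submodule_combinations[OF uc])
    show "soc A P \<subseteq> ?K"
    proof (rule P.soc_least[OF Ks])
      fix T assume T: "submodule T A P" "simple_module A (P\<lparr>carrier := T\<rparr>)"
      show "T \<subseteq> ?K"
      proof
        fix t assume t: "t \<in> T"
        then have "t \<in> carrier (P\<lparr>carrier := ?N\<rparr>)" using soc_N[OF T] by auto
        then obtain f where f: "\<And>i. i \<in> {1..s} \<Longrightarrow> f i \<in> M i" "t = finsum (P\<lparr>carrier := ?N\<rparr>) f {1..s}"
          using N.direct_sum_ex[OF ds] by blast
        then have tf: "t = finsum P f {1..s}" using fsN by simp
        have fc: "f i \<in> carrier P" if "i \<in> {1..s}" for i using P.sub_carr[OF MP(1)[OF that] f(1)[OF that]] .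
        have sm: "a \<odot>\<^bsub>P\<^esub> t = finsum P (\<lambda>i. a \<odot>\<^bsub>P\<^esub> f i) {1..s}" if "a \<in> carrier A" for a
          unfolding tf by (rule P.finsum_smult[OF that]) (use fc in auto)
        \<comment> \<open>If \<open>f i \<noteq> 0\<close>, then \<open>w i = a (f i)\<close> for
          some \<open>a\<close>, because \<open>S i\<close> lies in every nonzero submodule of
          \<open>M i\<close>. So \<open>a t\<close> is nonzero and generates the simple
          \<open>T\<close>; from \<open>t = b a t\<close> follows
          \<open>f i = b a (f i) = b (w i)\<close>.\<close>
        have "f i \<in> S i" if i: "i \<in> {1..s}" for i
        proof (cases "f i = \<zero>\<^bsub>P\<^esub>")
          case True
          then show ?thesis using P.sub_zero[OF SP(1)[OF i]] by simp
        next
          case False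
          have "S i \<subseteq> P.cyc (f i)"
            by (rule Sleast[OF i P.submodule_cyc[OF fc[OF i]] P.cyc_least[OF MP(1)[OF i] f(1)[OF i]]])
              (use P.cyc_self[OF fc[OF i]] False in blast)
          then have "w i \<in> P.cyc (f i)" using w(1)[OF i] by blast
          then obtain a where a: "a \<in> carrier A" "w i = a \<odot>\<^bsub>P\<^esub> f i" unfolding P.mem_cyc by blast
          have afM: "a \<odot>\<^bsub>P\<^esub> f j \<in> M j" if "j \<in> {1..s}" for j using P.sub_smult[OF MP(1)[OF that] a(1) f(1)[OF that]] .
          have "a \<odot>\<^bsub>P\<^esub> t \<noteq> \<zero>\<^bsub>P\<^esub>"
          proof
            assume "a \<odot>\<^bsub>P\<^esub> t = \<zero>\<^bsub>P\<^esub>"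
            then have "a \<odot>\<^bsub>P\<^esub> f i = \<zero>\<^bsub>P\<^esub>"
              using uniq[of "\<lambda>i. a \<odot>\<^bsub>P\<^esub> f i" "\<lambda>_. \<zero>\<^bsub>P\<^esub>", OF afM zM _ i] sm[OF a(1)] zero by simp
            then show False using a(2) w(3)[OF i] by simp
          qed
          then have "P.cyc (a \<odot>\<^bsub>P\<^esub> t) = T"
            using P.simple_cyc[OF T P.sub_smult[OF T(1) a(1) t]] by blast
          then have "t \<in> P.cyc (a \<odot>\<^bsub>P\<^esub> t)" using t by simp
          then obtain b where b: "b \<in> carrier A" "t = b \<odot>\<^bsub>P\<^esub> (a \<odot>\<^bsub>P\<^esub> t)" unfolding P.mem_cyc by blast
          have eqs: "finsum P f {1..s} = finsum P (\<lambda>i. b \<odot>\<^bsub>P\<^esub> (a \<odot>\<^bsub>P\<^esub> f i)) {1..s}"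
            unfolding tf[symmetric]
            using b(2) sm[OF a(1)] P.finsum_smult[OF b(1), of "\<lambda>i. a \<odot>\<^bsub>P\<^esub> f i" "{1..s}"] P.lsmult_closed[OF a(1) fc] by auto
          have "b \<odot>\<^bsub>P\<^esub> (a \<odot>\<^bsub>P\<^esub> f j) \<in> M j" if "j \<in> {1..s}" for j
            using P.sub_smult[OF MP(1)[OF that] b(1) afM[OF that]] .
          note bM = this
          have "f i = b \<odot>\<^bsub>P\<^esub> (a \<odot>\<^bsub>P\<^esub> f i)"
            using uniq[of f "\<lambda>j. b \<odot>\<^bsub>P\<^esub> (a \<odot>\<^bsub>P\<^esub> f j)", OF f(1) bM eqs i] .
          then show ?thesis using P.sub_smult[OF SP(1)[OF i] b(1) w(1)[OF i]] a(2) by simp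
        qed
        then have "\<exists>v\<in>carrier A. f i = v \<odot>\<^bsub>P\<^esub> w i" if "i \<in> {1..s}" for i
          using P.simple_cyc[OF SP(1) Ssimple w(1) w(3), of i] that P.mem_cyc[of "f i" "w i"] by blast
        then obtain v where v: "\<And>i. i \<in> {1..s} \<Longrightarrow> v i \<in> carrier A" "\<And>i. i \<in> {1..s} \<Longrightarrow> f i = v i \<odot>\<^bsub>P\<^esub> w i"
          by metis
        have "t = finsum P (\<lambda>i. f (Suc i)) {..<s}" using reidx[of f] tf fc by auto
        also have "\<dots> = finsum P (\<lambda>i. v (Suc i) \<odot>\<^bsub>P\<^esub> ?u i) {..<s}"
          using v Sc wP P.lsmult_closed by (intro P.M.finsum_cong') auto
        finally show "t \<in> ?K" using v(1) Sc by (intro CollectI exI[of _ "\<lambda>i. v (Suc i)"]) auto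
      qed
    qed
    show "?K \<subseteq> soc A P"
    proof
      fix y assume "y \<in> ?K"
      then obtain v where v: "v \<in> {..<s} \<rightarrow> carrier A" "y = finsum P (\<lambda>i. v i \<odot>\<^bsub>P\<^esub> ?u i) {..<s}" by blast
      have "v i \<odot>\<^bsub>P\<^esub> ?u i \<in> soc A P" if i: "i < s" for i
        using P.sub_smult[OF P.soc_sub, of "v i" "?u i"] v(1) i w(1)[OF Sc[OF i]]
          P.simple_le_soc[OF SP(1) Ssimple, OF Sc[OF i] Sc[OF i]] by blast
      then show "y \<in> soc A P" unfolding v(2) by (intro P.sub_finsum[OF P.soc_sub]) auto
    qed
  qed
  note socK = this
  have "transpose_bound A s (\<lambda>i. e (Suc i)) P ?N (quot_module P (soc A P)) (P.quot_map (soc A P)) ?u (\<lambda>i. c (Suc i))"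
  proof (intro transpose_bound.intro idempotents.intro idempotents_axioms.intro transpose_bound_axioms.intro A fl fr P(1) N)
    fix i assume i: "i < s"
    have prim: "primitive_idempotent A (e (Suc i))" using Mi[OF Sc[OF i]] by blast
    then show "e (Suc i) \<in> carrier A" "e (Suc i) \<otimes>\<^bsub>A\<^esub> e (Suc i) = e (Suc i)" "primitive_idempotent A (e (Suc i))"
      by (auto simp: primitive_idempotent_def)
    show "?u i \<in> carrier P" "e (Suc i) \<odot>\<^bsub>P\<^esub> ?u i = ?u i" "?u i \<noteq> \<zero>\<^bsub>P\<^esub>"
      "?u i \<in> ideal_times_module A (ideal_power A ?J (c (Suc i))) P"
      using wP w(2,3) wrad Sc[OF i] by blast+
    fix v assume v: "v \<in> {..<s} \<rightarrow> carrier A" "finsum P (\<lambda>i. v i \<odot>\<^bsub>P\<^esub> ?u i) {..<s} = \<zero>\<^bsub>P\<^esub>"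
    let ?f = "\<lambda>i. v (i - 1) \<odot>\<^bsub>P\<^esub> w i"
    have fM: "?f j \<in> M j" if j: "j \<in> {1..s}" for j
    proof -
      have "j - 1 \<in> {..<s}" using j by auto
      then have "v (j - 1) \<in> carrier A" using v(1) by blast
      then show ?thesis using P.sub_smult[OF MP(1)[OF j]] w(1)[OF j] SP(2)[OF j] by blast
    qed
    have "finsum P ?f {1..s} = \<zero>\<^bsub>P\<^esub>" using reidx[of ?f] v(2) fM P.sub_carr[OF MP(1)] by auto
    then show "v i \<odot>\<^bsub>P\<^esub> ?u i = \<zero>\<^bsub>P\<^esub>" using uniq[of ?f "\<lambda>_. \<zero>\<^bsub>P\<^esub>", OF fM zM _ Sc[OF i]] zero by simp
  qed (use P.left_module_quot[OF P.soc_sub] P.quot_map[OF P.soc_sub] P.quot_map_surj[OF P.soc_sub]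
      P.quot_map_ker[OF P.soc_sub] socK socN in simp_all)
  then show ?thesis using that c0 by blast
qed

section \<open>The injective case\<close>

text \<open>Dual to \<open>projective_local\<close>: if the minimal \<open>S\<close> meets
  \<open>L\<close> in zero, the identity of \<open>S\<close> and zero on \<open>L\<close> extend to
  an endomorphism. It fixes \<open>S\<close>, so it is not nilpotent, hence bijective, and
  \<open>L = 0\<close>.\<close>

lemma injective_uniform:
  assumes fin: "fin_len A (regular_module A)" and I: "injective A I" and ind: "indecomposable A I"
  obtains S where "submodule S A I" "S \<noteq> {\<zero>\<^bsub>I\<^esub>}"
    "\<And>L. submodule L A I \<Longrightarrow> L \<noteq> {\<zero>\<^bsub>I\<^esub>} \<Longrightarrow> S \<subseteq> L"
proof -
  have fg: "fg_module A I" using I by (simp add: injective_def)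
  interpret I: left_module A I by (rule fg_left_module[OF fg])
  have finI: "fin_len A I" by (rule fg_fin[OF fg fin])
  have ne: "carrier I \<noteq> {\<zero>\<^bsub>I\<^esub>}" using ind by (simp add: indecomposable_def)
  obtain S where S: "submodule S A I" "S \<subseteq> carrier I" "S \<noteq> {\<zero>\<^bsub>I\<^esub>}"
    "\<And>Z. submodule Z A I \<Longrightarrow> Z \<subseteq> S \<Longrightarrow> Z = {\<zero>\<^bsub>I\<^esub>} \<or> Z = S"
    by (rule I.min_sub_exists[OF finI I.submodule_carrier ne]) (rule that)
  have "S \<subseteq> L" if L: "submodule L A I" "L \<noteq> {\<zero>\<^bsub>I\<^esub>}" for L
  proof (rule ccontr)
    assume nS: "\<not> S \<subseteq> L"
    have "S \<inter> L = {\<zero>\<^bsub>I\<^esub>} \<or> S \<inter> L = S" by (rule S(4)[OF I.submodule_Int[OF S(1) L(1)]]) blast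
    then have int: "S \<inter> L = {\<zero>\<^bsub>I\<^esub>}" using nS by blast
    have id: "restrict id S \<in> mod_hom A (I\<lparr>carrier := S\<rparr>) I"
      using mod_hom_sub[OF I.left_module_axioms S(1) mod_hom_id[OF I.left_module_axioms]] S(2) by (simp add: Int_absorb1)
    obtain \<phi> where \<phi>: "\<phi> \<in> mod_hom A I I" "\<And>z. z \<in> S \<Longrightarrow> \<phi> z = restrict id S z" and \<phi>L: "\<And>z. z \<in> L \<Longrightarrow> \<phi> z = \<zero>\<^bsub>I\<^esub>"
      by (rule injective_extend_zero[OF I I.left_module_axioms finI S(1) L(1) id]) (use int that in auto)
    have \<phi>S: "\<phi> z = z" if "z \<in> S" for z using \<phi>(2)[OF that] that by simp
    obtain z where z: "z \<in> S" "z \<noteq> \<zero>\<^bsub>I\<^esub>" using S(3) I.sub_zero[OF S(1)] by blast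
    have "(\<phi> ^^ n) z = z" for n by (induction n) (use \<phi>S z in auto)
    then have "\<not> (\<exists>n. \<forall>x\<in>carrier I. (\<phi> ^^ n) x = \<zero>\<^bsub>I\<^esub>)" using z S(2) by (metis subsetD)
    then have bij: "bij_betw \<phi> (carrier I) (carrier I)" using I.fitting[OF finI ind \<phi>(1)] by blast
    obtain l where l: "l \<in> L" "l \<noteq> \<zero>\<^bsub>I\<^esub>" using L I.sub_zero by blast
    have "\<phi> l = \<phi> \<zero>\<^bsub>I\<^esub>" using \<phi>L l(1) I.sub_zero[OF L(1)] by simp
    then show False using bij l I.sub_carr[OF L(1) l(1)] by (auto simp: bij_betw_def inj_on_def)
  qed
  then show ?thesis using that S by blast
qed

lemma primitive_opp: "primitive_idempotent (opp A) e = primitive_idempotent A e"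
  unfolding primitive_idempotent_def by auto

lemma right_factor_opp: "right_factor (opp A) e N = left_factor A e N"
  by (simp add: right_factor_def left_factor_def opp_l_coset opp_opp)

context artin_dual
begin

text \<open>The double annihilator theorem on the side of \<open>D M\<close>, where it rests on
  \<open>perp_perp\<close> and so on minimality of \<open>E\<close>. On the side of
  \<open>M\<close>, in \<open>mem_ann_ann\<close>, separation by functionals is enough.\<close>

lemma ann_ann:
  assumes M: "fg_module A M" and F: "submodule F (opp A) (dual M)"
    and f: "f \<in> carrier (dual M)" "\<And>x. x \<in> carrier M \<Longrightarrow> (\<And>g. g \<in> F \<Longrightarrow> g x = \<zero>\<^bsub>E\<^esub>) \<Longrightarrow> f x = \<zero>\<^bsub>E\<^esub>"
  shows "f \<in> F"
proof -
  interpret p: pairing R E "res (dual M)" "res M" "\<lambda>f x. f x"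
    by (rule dual_pairing[OF fg_left_module[OF M]])
  have Fs: "submodule F R (res (dual M))"
    using artin_algebra.submodule_restrict[OF artin_opp left_module_dual[OF fg_left_module[OF M]] F]
    by (simp add: restrict_opp)
  show ?thesis
  proof (rule p.perp_perp[OF fin_dual[OF M] _ Fs])
    show "f \<in> carrier (res (dual M))" using f by simp
    show "f v = \<zero>\<^bsub>E\<^esub>" if "v \<in> perp_right F (res M) E (\<lambda>f x. f x)" for v
      using f(2)[of v] that by (simp add: perp_right_def)
    fix u assume u: "u \<in> carrier (res (dual M))"
      "\<And>v. v \<in> carrier (res M) \<Longrightarrow> u v = \<zero>\<^bsub>E\<^esub>"
    have "u \<in> extensional (carrier M)" using u(1) mod_homD(4)[of u R "res M" E] by simp
    then show "u = \<zero>\<^bsub>res (dual M)\<^esub>"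
      using u(2) by (auto simp: extensional_def fun_eq_iff)
  qed
qed

lemma mem_ann_ann:
  assumes M: "fg_module A M" and X: "submodule X A M" and x: "x \<in> carrier M" "\<And>f. f \<in> ann M X \<Longrightarrow> f x = \<zero>\<^bsub>E\<^esub>"
  shows "x \<in> X"
proof (rule ccontr)
  assume "x \<notin> X"
  then obtain f where "f \<in> mod_hom R (res M) E" "\<And>x. x \<in> X \<Longrightarrow> f x = \<zero>\<^bsub>E\<^esub>" "f x \<noteq> \<zero>\<^bsub>E\<^esub>"
    using separate[OF M submodule_restrict[OF fg_left_module[OF M] X] x(1)] by metis
  then show False using x(2)[of f] by (auto simp: ann_def)
qed

text \<open>Annihilation reverses inclusions: by \<open>ann_ann\<close> a proper \<open>L\<close>
  has nonzero common zeros, and these form a submodule, which contains \<open>S\<close>.\<close>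

lemma dual_local:
  assumes M: "fg_module A M" and S: "submodule S A M" "S \<noteq> {\<zero>\<^bsub>M\<^esub>}"
    "\<And>L. submodule L A M \<Longrightarrow> L \<noteq> {\<zero>\<^bsub>M\<^esub>} \<Longrightarrow> S \<subseteq> L"
  shows "largest_proper (opp A) (dual M) (ann M S)"
proof -
  interpret M: left_module A M by (rule fg_left_module[OF M])
  interpret D: left_module "opp A" "dual M" by (rule left_module_dual[OF M.left_module_axioms])
  have "ann M S \<noteq> carrier (dual M)"
  proof
    assume eq: "ann M S = carrier (dual M)"
    obtain z where z: "z \<in> S" "z \<noteq> \<zero>\<^bsub>M\<^esub>" using S(2) M.sub_zero[OF S(1)] by blast
    have "z \<in> {\<zero>\<^bsub>M\<^esub>}"
    proof (rule mem_ann_ann[OF M M.submodule_zero])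
      show "z \<in> carrier M" by (rule M.sub_carr[OF S(1) z(1)])
      show "f z = \<zero>\<^bsub>E\<^esub>" if "f \<in> ann M {\<zero>\<^bsub>M\<^esub>}" for f
      proof -
        have "f \<in> ann M S" unfolding eq using that by (simp add: ann_def)
        then show ?thesis using z(1) by (simp add: ann_def)
      qed
    qed
    then show False using z by simp
  qed
  moreover have "L \<subseteq> ann M S" if L: "submodule L (opp A) (dual M)" "L \<noteq> carrier (dual M)" for L
  proof -
    let ?X = "{x \<in> carrier M. \<forall>g\<in>L. g x = \<zero>\<^bsub>E\<^esub>}"
    have gL: "g \<in> mod_hom R (res M) E" if "g \<in> L" for g using D.sub_carr[OF L(1) that] by simp
    have Xs: "submodule ?X A M"
      unfolding M.submodule_iff
    proof (intro conjI ballI)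
      show "\<zero>\<^bsub>M\<^esub> \<in> ?X"
        using module_hom.zero[OF module_homI[OF left_module_restrict[OF M.left_module_axioms] E.left_module_axioms gL]] by simp
      show "x \<oplus>\<^bsub>M\<^esub> y \<in> ?X" if xy: "x \<in> ?X" "y \<in> ?X" for x y
      proof -
        have "g (x \<oplus>\<^bsub>M\<^esub> y) = \<zero>\<^bsub>E\<^esub>" if g: "g \<in> L" for g
        proof -
          have "g x = \<zero>\<^bsub>E\<^esub>" "g y = \<zero>\<^bsub>E\<^esub>" using xy g by blast+
          then show ?thesis using dual_closed(2)[OF gL[OF g], of x y] xy E.M.l_zero[OF E.M.zero_closed] by auto
        qed
        then show ?thesis using xy M.M.a_closed by simp
      qed
      show "a \<odot>\<^bsub>M\<^esub> x \<in> ?X" if a: "a \<in> carrier A" "x \<in> ?X" for a x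
      proof -
        have "g (a \<odot>\<^bsub>M\<^esub> x) = \<zero>\<^bsub>E\<^esub>" if g: "g \<in> L" for g
        proof -
          have "a \<odot>\<^bsub>dual M\<^esub> g \<in> L" using D.sub_smult[OF L(1) _ g, of a] a(1) by simp
          then have "(a \<odot>\<^bsub>dual M\<^esub> g) x = \<zero>\<^bsub>E\<^esub>" using a(2) by blast
          then show ?thesis using a(2) by simp
        qed
        then show ?thesis using a M.lsmult_closed by simp
      qed
    qed blast
    have "?X \<noteq> {\<zero>\<^bsub>M\<^esub>}"
    proof
      assume X0: "?X = {\<zero>\<^bsub>M\<^esub>}"
      have "f \<in> L" if f: "f \<in> carrier (dual M)" for f
      proof (rule ann_ann[OF M L(1) f])
        fix x assume "x \<in> carrier M" "\<And>g. g \<in> L \<Longrightarrow> g x = \<zero>\<^bsub>E\<^esub>"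
        then have "x = \<zero>\<^bsub>M\<^esub>" using X0 by blast
        then show "f x = \<zero>\<^bsub>E\<^esub>"
          using module_hom.zero[OF module_homI[OF left_module_restrict[OF M.left_module_axioms] E.left_module_axioms], of f] f by simp
      qed
      then show False using L D.sub_subset by blast
    qed
    then have "S \<subseteq> ?X" by (rule S(3)[OF Xs])
    then show ?thesis using D.sub_carr[OF L(1)] by (auto simp: ann_def)
  qed
  ultimately show ?thesis using ann_sub[OF M.left_module_axioms S(1)] unfolding largest_proper_def by blast
qed

section \<open>The module \<open>D A\<close> and projectivity of \<open>D I\<close>\<close>

abbreviation "DA \<equiv> std_dual R E (opp A) (regular_module (opp A))"

lemma DA_module: "left_module A DA" and DA_fg: "fg_module A DA"
proof -
  interpret op: artin_dual R "opp A" E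
    by (intro artin_dual.intro artin_opp artin_dual_axioms.intro minE)
  interpret B: ring "opp A" by (rule A.ring_opp)
  interpret B: left_module "opp A" "regular_module (opp A)" by (rule ring.left_module_regular[OF A.ring_opp])
  have fgB: "fg_module (opp A) (regular_module (opp A))" by (rule B.fin_fg[OF fin_regular_opp])
  show m: "left_module A DA" using op.left_module_dual[OF B.left_module_axioms] by (simp add: opp_opp)
  have "fin_len A DA" using op.fin_dual_opp[OF fgB] by (simp add: opp_opp)
  then show "fg_module A DA" by (rule left_module.fin_fg[OF m])
qed

lemma DA_separates:
  assumes "a \<in> carrier A" "b \<in> carrier A" "\<And>\<gamma>. \<gamma> \<in> carrier DA \<Longrightarrow> \<gamma> a = \<gamma> b" shows "a = b"
proof (rule ccontr)
  interpret op: artin_dual R "opp A" E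
    by (intro artin_dual.intro artin_opp artin_dual_axioms.intro minE)
  interpret B: ring "opp A" by (rule A.ring_opp)
  interpret B: left_module "opp A" "regular_module (opp A)" by (rule ring.left_module_regular[OF A.ring_opp])
  have fgB: "fg_module (opp A) (regular_module (opp A))" by (rule B.fin_fg[OF fin_regular_opp])
  assume "a \<noteq> b"
  then have ne: "a \<ominus>\<^bsub>regular_module (opp A)\<^esub> b \<notin> {\<zero>\<^bsub>regular_module (opp A)\<^esub>}"
    using B.diff_eq_zero[of a b] assms by simp
  have c: "a \<ominus>\<^bsub>regular_module (opp A)\<^esub> b \<in> carrier (regular_module (opp A))"
    using B.sub_diff[OF B.submodule_carrier, of a b] assms by simp
  obtain \<gamma> where \<gamma>: "\<gamma> \<in> mod_hom R (restrict_scalars (opp A) (regular_module (opp A))) E"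
    "\<gamma> (a \<ominus>\<^bsub>regular_module (opp A)\<^esub> b) \<noteq> \<zero>\<^bsub>E\<^esub>"
    using op.separate[OF fgB op.submodule_restrict[OF B.left_module_axioms B.submodule_zero] c ne] by blast
  interpret \<gamma>: module_hom R "restrict_scalars (opp A) (regular_module (opp A))" E \<gamma>
    by (rule module_homI[OF op.left_module_restrict[OF B.left_module_axioms] E.left_module_axioms \<gamma>(1)])
  have "\<gamma> (a \<ominus>\<^bsub>regular_module (opp A)\<^esub> b) \<oplus>\<^bsub>E\<^esub> \<gamma> b = \<gamma> a"
    using \<gamma>.add[of "a \<ominus>\<^bsub>regular_module (opp A)\<^esub> b" b] c B.mdiff_add[of a b] assms by simp
  moreover have "\<gamma> a = \<gamma> b" using assms(3)[of \<gamma>] \<gamma>(1) by simp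
  moreover have cc: "\<gamma> a \<in> carrier E" "\<gamma> b \<in> carrier E" "\<gamma> (a \<ominus>\<^bsub>regular_module (opp A)\<^esub> b) \<in> carrier E"
    using \<gamma>.closed assms c by auto
  ultimately have "\<gamma> (a \<ominus>\<^bsub>regular_module (opp A)\<^esub> b) = \<zero>\<^bsub>E\<^esub>"
    using E.madd_diff[OF cc(3,2)] E.diff_self[OF cc(2)] by simp
  then show False using \<gamma>(2) by simp
qed

text \<open>Biduality for \<open>A\<close>: the evaluations form a submodule of the bidual with
  annihilator zero, and by \<open>perp_perp\<close> such a submodule is everything.\<close>

lemma DA_evaluation:
  assumes \<xi>: "\<xi> \<in> mod_hom R (res DA) E"
  obtains a where "a \<in> carrier A" "\<And>\<gamma>. \<gamma> \<in> carrier DA \<Longrightarrow> \<xi> \<gamma> = \<gamma> a"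
proof -
  interpret DA: left_module A DA by (rule DA_module)
  interpret p: pairing R E "res (dual DA)" "res DA" "\<lambda>f x. f x"
    by (rule dual_pairing[OF DA_module])
  note \<gamma>d = mod_homD(1-3)[where M = "restrict_scalars (opp A) (regular_module (opp A))", simplified]
  let ?ev = "\<lambda>a. \<lambda>\<gamma>\<in>carrier DA. \<gamma> a" let ?F = "?ev ` carrier A"
  have evm: "?ev a \<in> mod_hom R (res DA) E" if a: "a \<in> carrier A" for a
  proof (rule dual_restrictI[OF DA_module])
    show "\<gamma> a \<in> carrier E" if "\<gamma> \<in> carrier DA" for \<gamma> using \<gamma>d(1) that a by simp
    show "(\<gamma> \<oplus>\<^bsub>DA\<^esub> \<delta>) a = \<gamma> a \<oplus>\<^bsub>E\<^esub> \<delta> a" for \<gamma> \<delta> using a by simp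
    show "((r \<odot>\<^bsub>A\<^esub> \<one>\<^bsub>A\<^esub>) \<odot>\<^bsub>DA\<^esub> \<gamma>) a = r \<odot>\<^bsub>E\<^esub> \<gamma> a" if "r \<in> carrier R" "\<gamma> \<in> carrier DA" for r \<gamma>
      using \<gamma>d(3)[of \<gamma> R E r a] that a scal_left[of r a] scal_right[of r a] by simp
  qed
  have Fs: "submodule ?F R (res (dual DA))"
    unfolding p.U.submodule_iff
  proof (intro conjI ballI)
    show "?F \<subseteq> carrier (res (dual DA))" using evm by auto
    have "\<gamma> \<zero>\<^bsub>A\<^esub> = \<zero>\<^bsub>E\<^esub>" if "\<gamma> \<in> carrier DA" for \<gamma>
    proof -
      have "\<gamma> (\<zero> \<odot>\<^bsub>A\<^esub> \<one>\<^bsub>A\<^esub>) = \<zero> \<odot>\<^bsub>E\<^esub> \<gamma> \<one>\<^bsub>A\<^esub>"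
        using \<gamma>d(3)[of \<gamma> R E \<zero> "\<one>\<^bsub>A\<^esub>"] that scal_left[of \<zero> "\<one>\<^bsub>A\<^esub>"] by simp
      moreover have "\<zero> \<odot>\<^bsub>A\<^esub> \<one>\<^bsub>A\<^esub> = \<zero>\<^bsub>A\<^esub>" using left_module.smult_l_zero[OF left_module_A] by simp
      ultimately show ?thesis using E.smult_l_zero \<gamma>d(1)[of \<gamma> R E "\<one>\<^bsub>A\<^esub>"] that by simp
    qed
    then show "\<zero>\<^bsub>res (dual DA)\<^esub> \<in> ?F"
      by (intro image_eqI[of _ _ "\<zero>\<^bsub>A\<^esub>"]) (auto simp: fun_eq_iff)
    show "x \<oplus>\<^bsub>res (dual DA)\<^esub> y \<in> ?F" if xy: "x \<in> ?F" "y \<in> ?F" for x y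
    proof -
      obtain a where a: "a \<in> carrier A" "x = ?ev a" using xy(1) by blast
      obtain b where b: "b \<in> carrier A" "y = ?ev b" using xy(2) by blast
      have "\<gamma> (a \<oplus>\<^bsub>A\<^esub> b) = \<gamma> a \<oplus>\<^bsub>E\<^esub> \<gamma> b" if "\<gamma> \<in> carrier DA" for \<gamma>
        using \<gamma>d(2)[of \<gamma> R E a b] that a(1) b(1) by simp
      then have "x \<oplus>\<^bsub>res (dual DA)\<^esub> y = ?ev (a \<oplus>\<^bsub>A\<^esub> b)"
        unfolding a(2) b(2) by (simp add: fun_eq_iff)
      then show ?thesis using a(1) b(1) by (intro image_eqI[of _ _ "a \<oplus>\<^bsub>A\<^esub> b"]) simp_all
    qed
    show "r \<odot>\<^bsub>res (dual DA)\<^esub> x \<in> ?F" if r: "r \<in> carrier R" "x \<in> ?F" for r x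
    proof -
      obtain a where a: "a \<in> carrier A" "x = ?ev a" using r(2) by blast
      have sc: "(r \<odot>\<^bsub>A\<^esub> \<one>\<^bsub>A\<^esub>) \<odot>\<^bsub>DA\<^esub> \<gamma> \<in> carrier DA" if "\<gamma> \<in> carrier DA" for \<gamma>
        using DA.lsmult_closed[OF scal_closed[OF \<open>r \<in> carrier R\<close>] that] .
      have "r \<odot>\<^bsub>res (dual DA)\<^esub> x = ?ev (r \<odot>\<^bsub>A\<^esub> a)"
      proof
        fix \<gamma>
        show "(r \<odot>\<^bsub>res (dual DA)\<^esub> x) \<gamma> = ?ev (r \<odot>\<^bsub>A\<^esub> a) \<gamma>"
        proof (cases "\<gamma> \<in> carrier DA")
          case True
          then have "(r \<odot>\<^bsub>res (dual DA)\<^esub> x) \<gamma> = ((r \<odot>\<^bsub>A\<^esub> \<one>\<^bsub>A\<^esub>) \<odot>\<^bsub>DA\<^esub> \<gamma>) a"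
            using a(2) sc[OF True] by simp
          also have "\<dots> = \<gamma> (r \<odot>\<^bsub>A\<^esub> a)" using a(1) scal_right[OF \<open>r \<in> carrier R\<close> a(1)] by simp
          finally show ?thesis using True by simp
        qed simp
      qed
      then show ?thesis using a(1) left_module.lsmult_closed[OF left_module_A r(1)] by blast
    qed
  qed
  have "\<xi> \<in> ?F"
  proof (rule p.perp_perp[OF fin_dual[OF DA_fg] _ Fs])
    show "\<xi> \<in> carrier (res (dual DA))" using \<xi> by simp
    show "\<xi> \<gamma> = \<zero>\<^bsub>E\<^esub>" if \<gamma>: "\<gamma> \<in> perp_right ?F (res DA) E (\<lambda>f x. f x)" for \<gamma>
    proof -
      have g: "\<gamma> \<in> carrier DA" "\<And>a. a \<in> carrier A \<Longrightarrow> \<gamma> a = \<zero>\<^bsub>E\<^esub>" using \<gamma> by (auto simp: perp_right_def)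
      have "\<gamma> \<in> extensional (carrier A)" using mod_homD(4)[of \<gamma> R "restrict_scalars (opp A) (regular_module (opp A))" E] g(1) by simp
      then have "\<gamma> = \<zero>\<^bsub>DA\<^esub>" using g(2) by (auto simp: extensional_def fun_eq_iff)
      then show ?thesis
        using module_hom.zero[OF module_homI[OF left_module_restrict[OF DA_module] E.left_module_axioms \<xi>]] by simp
    qed
    fix u assume u: "u \<in> carrier (res (dual DA))"
      "\<And>v. v \<in> carrier (res DA) \<Longrightarrow> u v = \<zero>\<^bsub>E\<^esub>"
    have "u \<in> extensional (carrier DA)" using u(1) mod_homD(4)[of u R "res DA" E] by simp
    then show "u = \<zero>\<^bsub>res (dual DA)\<^esub>"
      using u(2) by (auto simp: extensional_def fun_eq_iff)
  qed
  then show ?thesis using that by auto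
qed

text \<open>A functional \<open>f\<close> that does not vanish on \<open>S\<close> embeds
  \<open>I\<close> into \<open>D A\<close>: send \<open>x\<close> to the functional
  \<open>a \<mapsto> f (a x)\<close>; the kernel does not contain \<open>S\<close>, so it is zero.
  Injectivity gives a retraction \<open>\<rho>\<close>. For a functional \<open>g\<close> on
  \<open>I\<close> the composite with \<open>\<rho>\<close> is evaluation at some \<open>h g\<close>
  in \<open>A\<close>, whence \<open>g = (h g) f\<close>. So \<open>f\<close> generates
  \<open>D I\<close>, and \<open>f\<close> with \<open>h\<close> is a dual basis.\<close>

lemma dual_projective:
  assumes I: "injective A I" and S: "submodule S A I" "S \<noteq> {\<zero>\<^bsub>I\<^esub>}"
    "\<And>L. submodule L A I \<Longrightarrow> L \<noteq> {\<zero>\<^bsub>I\<^esub>} \<Longrightarrow> S \<subseteq> L"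
  shows "projective (opp A) (dual I)"
proof -
  have fg: "fg_module A I" using I by (simp add: injective_def)
  interpret I: left_module A I by (rule fg_left_module[OF fg])
  interpret D: left_module "opp A" "dual I" by (rule left_module_dual[OF I.left_module_axioms])
  interpret DA: left_module A DA by (rule DA_module)
  interpret B: ring "opp A" by (rule A.ring_opp)
  have "ann I S \<noteq> carrier (dual I)" "ann I S \<subseteq> carrier (dual I)"
    using dual_local[OF fg S] by (auto simp: largest_proper_def ann_def)
  then obtain f where f: "f \<in> carrier (dual I)" "f \<notin> ann I S" by blast
  have fm: "f \<in> mod_hom R (res I) E" using f(1) by simp
  interpret f: module_hom R "res I" E f
    by (rule module_homI[OF left_module_restrict[OF I.left_module_axioms] E.left_module_axioms fm])
  define \<iota> where "\<iota> = (\<lambda>x\<in>carrier I. \<lambda>a\<in>carrier A. f (a \<odot>\<^bsub>I\<^esub> x))"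
  have \<iota>c: "(\<lambda>a\<in>carrier A. f (a \<odot>\<^bsub>I\<^esub> x)) \<in> carrier DA" if x: "x \<in> carrier I" for x
  proof -
    have "restrict (\<lambda>a. f (a \<odot>\<^bsub>I\<^esub> x)) (carrier (restrict_scalars (opp A) (regular_module (opp A))))
       \<in> mod_hom R (restrict_scalars (opp A) (regular_module (opp A))) E"
    proof (rule mod_hom_restrictI[OF artin_algebra.left_module_restrict[OF artin_opp ring.left_module_regular[OF A.ring_opp]]])
      fix a assume "a \<in> carrier (restrict_scalars (opp A) (regular_module (opp A)))"
      then have a: "a \<in> carrier A" by simp
      show "f (a \<odot>\<^bsub>I\<^esub> x) \<in> carrier E" using f.closed I.lsmult_closed a x by simp
      show "f ((a \<oplus>\<^bsub>restrict_scalars (opp A) (regular_module (opp A))\<^esub> b) \<odot>\<^bsub>I\<^esub> x) = f (a \<odot>\<^bsub>I\<^esub> x) \<oplus>\<^bsub>E\<^esub> f (b \<odot>\<^bsub>I\<^esub> x)"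
        if "b \<in> carrier (restrict_scalars (opp A) (regular_module (opp A)))" for b
        using that a x f.add[of "a \<odot>\<^bsub>I\<^esub> x" "b \<odot>\<^bsub>I\<^esub> x"] by (simp add: I.lsmult_l_distr I.lsmult_closed)
      show "f ((r \<odot>\<^bsub>restrict_scalars (opp A) (regular_module (opp A))\<^esub> a) \<odot>\<^bsub>I\<^esub> x) = r \<odot>\<^bsub>E\<^esub> f (a \<odot>\<^bsub>I\<^esub> x)" if r: "r \<in> carrier R" for r
        using a x r f.smult[OF r, of "a \<odot>\<^bsub>I\<^esub> x"] scal_closed[OF r] scal_left[OF r a] scal_right[OF r a]
          I.lsmult_assoc[OF scal_closed[OF r] a x] by (simp add: I.lsmult_closed)
    qed
    then show ?thesis by simp
  qed
  have \<iota>: "\<iota> \<in> mod_hom A I DA"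
    unfolding \<iota>_def
  proof (rule mod_hom_restrictI[OF I.left_module_axioms \<iota>c])
    fix x assume x: "x \<in> carrier I"
    show "(\<lambda>a\<in>carrier A. f (a \<odot>\<^bsub>I\<^esub> (x \<oplus>\<^bsub>I\<^esub> y))) = (\<lambda>a\<in>carrier A. f (a \<odot>\<^bsub>I\<^esub> x)) \<oplus>\<^bsub>DA\<^esub> (\<lambda>a\<in>carrier A. f (a \<odot>\<^bsub>I\<^esub> y))"
      if y: "y \<in> carrier I" for y
      using x y f.add by (auto simp: fun_eq_iff I.lsmult_r_distr I.lsmult_closed)
    show "(\<lambda>a\<in>carrier A. f (a \<odot>\<^bsub>I\<^esub> (b \<odot>\<^bsub>I\<^esub> x))) = b \<odot>\<^bsub>DA\<^esub> (\<lambda>a\<in>carrier A. f (a \<odot>\<^bsub>I\<^esub> x))" if b: "b \<in> carrier A" for b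
      using x b by (auto simp: fun_eq_iff I.lsmult_assoc)
  qed
  interpret \<iota>: module_hom A I DA \<iota> by (rule module_homI[OF I.left_module_axioms DA_module \<iota>])
  have inj: "inj_on \<iota> (carrier I)"
  proof (rule ccontr)
    assume "\<not> inj_on \<iota> (carrier I)"
    then have "mod_ker I DA \<iota> \<noteq> {\<zero>\<^bsub>I\<^esub>}" using \<iota>.inj_iff by blast
    then have Sk: "S \<subseteq> mod_ker I DA \<iota>" by (rule S(3)[OF \<iota>.sub_ker])
    have "f x = \<zero>\<^bsub>E\<^esub>" if x: "x \<in> S" for x
    proof -
      have xc: "x \<in> carrier I" "\<iota> x = \<zero>\<^bsub>DA\<^esub>" using Sk x by (auto simp: mod_ker_def)
      have "\<iota> x \<one>\<^bsub>A\<^esub> = \<zero>\<^bsub>E\<^esub>" unfolding xc(2) by simp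
      then show ?thesis using xc(1) I.lsmult_one by (simp add: \<iota>_def)
    qed
    then show False using f by (simp add: ann_def)
  qed
  let ?X = "\<iota> ` carrier I"
  have Xs: "submodule ?X A DA" by (rule \<iota>.sub_image[OF I.submodule_carrier])
  have \<iota>X: "\<iota> \<in> mod_hom A I (DA\<lparr>carrier := ?X\<rparr>)" by (rule mod_hom_carrier_restrict[OF \<iota>]) simp
  interpret \<iota>X: module_hom A I "DA\<lparr>carrier := ?X\<rparr>" \<iota>
    by (rule module_homI[OF I.left_module_axioms DA.left_module_sub[OF Xs] \<iota>X])
  have bX: "bij_betw \<iota> (carrier I) (carrier (DA\<lparr>carrier := ?X\<rparr>))" using inj by (simp add: bij_betw_def)
  have fgX: "fg_module A (DA\<lparr>carrier := ?X\<rparr>)" by (rule \<iota>X.fg_surj[OF fg]) simp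
  obtain \<rho> where \<rho>: "\<rho> \<in> mod_hom A DA I"
    "\<And>y. y \<in> ?X \<Longrightarrow> \<rho> y = restrict (inv_into (carrier I) \<iota>) (carrier (DA\<lparr>carrier := ?X\<rparr>)) y"
    using injective_extend[OF I DA_fg Xs fgX \<iota>X.inverse[OF bX]] by metis
  have \<rho>\<iota>: "\<rho> (\<iota> x) = x" if "x \<in> carrier I" for x
    using \<rho>(2)[of "\<iota> x"] that inv_into_f_f[OF inj that] by simp
  interpret \<rho>: module_hom A DA I \<rho> by (rule module_homI[OF DA_module I.left_module_axioms \<rho>(1)])
  have ex: "\<exists>a\<in>carrier A. \<forall>\<gamma>\<in>carrier DA. g (\<rho> \<gamma>) = \<gamma> a" if g: "g \<in> carrier (dual I)" for g
  proof -
    have "compose (carrier (res DA)) g \<rho> \<in> mod_hom R (res DA) E"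
      by (rule mod_hom_comp[OF left_module_restrict[OF DA_module] mod_hom_scalars[OF DA_module \<rho>(1)]]) (use g in simp)
    then obtain a where "a \<in> carrier A" "\<And>\<gamma>. \<gamma> \<in> carrier DA \<Longrightarrow> compose (carrier (res DA)) g \<rho> \<gamma> = \<gamma> a"
      by (rule DA_evaluation) blast
    then show ?thesis by (intro bexI[of _ a]) (auto simp: compose_eq)
  qed
  define h where "h g = (SOME a. a \<in> carrier A \<and> (\<forall>\<gamma>\<in>carrier DA. g (\<rho> \<gamma>) = \<gamma> a))" for g
  have h: "h g \<in> carrier A" "\<And>\<gamma>. \<gamma> \<in> carrier DA \<Longrightarrow> g (\<rho> \<gamma>) = \<gamma> (h g)" if "g \<in> carrier (dual I)" for g
    using someI_ex[of "\<lambda>a. a \<in> carrier A \<and> (\<forall>\<gamma>\<in>carrier DA. g (\<rho> \<gamma>) = \<gamma> a)"] ex[OF that] unfolding h_def by blast+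
  note \<gamma>d = mod_homD(1-3)[where M = "restrict_scalars (opp A) (regular_module (opp A))", simplified]
  \<comment> \<open>\<open>h\<close> is a choice. It is linear because functionals separate the
    elements of \<open>A\<close>, so that \<open>h g\<close> is unique.\<close>
  have hm: "restrict h (carrier (dual I)) \<in> mod_hom (opp A) (dual I) (regular_module (opp A))"
  proof (rule mod_hom_restrictI[OF D.left_module_axioms])
    fix g assume g: "g \<in> carrier (dual I)"
    show "h g \<in> carrier (regular_module (opp A))" using h(1)[OF g] by simp
    show "h (g \<oplus>\<^bsub>dual I\<^esub> g') = h g \<oplus>\<^bsub>regular_module (opp A)\<^esub> h g'" if g': "g' \<in> carrier (dual I)" for g'
    proof -
      have gg: "g \<oplus>\<^bsub>dual I\<^esub> g' \<in> carrier (dual I)" using D.M.a_closed[OF g g'] .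
      have "h (g \<oplus>\<^bsub>dual I\<^esub> g') = h g \<oplus>\<^bsub>A\<^esub> h g'"
      proof (rule DA_separates[OF h(1)[OF gg]])
        show "h g \<oplus>\<^bsub>A\<^esub> h g' \<in> carrier A" using h(1) g g' by simp
        fix \<gamma> assume \<gamma>: "\<gamma> \<in> carrier DA"
        have "\<gamma> (h (g \<oplus>\<^bsub>dual I\<^esub> g')) = g (\<rho> \<gamma>) \<oplus>\<^bsub>E\<^esub> g' (\<rho> \<gamma>)"
          using h(2)[OF gg \<gamma>] \<rho>.closed[OF \<gamma>] by simp
        also have "\<dots> = \<gamma> (h g) \<oplus>\<^bsub>E\<^esub> \<gamma> (h g')" using h(2)[OF g \<gamma>] h(2)[OF g' \<gamma>] by simp
        also have "\<dots> = \<gamma> (h g \<oplus>\<^bsub>A\<^esub> h g')" using \<gamma>d(2)[of \<gamma> R E "h g" "h g'"] \<gamma> h(1) g g' by simp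
        finally show "\<gamma> (h (g \<oplus>\<^bsub>dual I\<^esub> g')) = \<gamma> (h g \<oplus>\<^bsub>A\<^esub> h g')" .
      qed
      then show ?thesis by simp
    qed
    show "h (b \<odot>\<^bsub>dual I\<^esub> g) = b \<odot>\<^bsub>regular_module (opp A)\<^esub> h g" if b: "b \<in> carrier (opp A)" for b
    proof -
      have bA: "b \<in> carrier A" using b by simp
      have bg: "b \<odot>\<^bsub>dual I\<^esub> g \<in> carrier (dual I)" using D.lsmult_closed[OF b g] .
      have "h (b \<odot>\<^bsub>dual I\<^esub> g) = h g \<otimes>\<^bsub>A\<^esub> b"
      proof (rule DA_separates[OF h(1)[OF bg]])
        show "h g \<otimes>\<^bsub>A\<^esub> b \<in> carrier A" using h(1)[OF g] bA by simp
        fix \<gamma> assume \<gamma>: "\<gamma> \<in> carrier DA"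
        have b\<gamma>: "b \<odot>\<^bsub>DA\<^esub> \<gamma> \<in> carrier DA" by (rule DA.lsmult_closed[OF bA \<gamma>])
        have "\<gamma> (h (b \<odot>\<^bsub>dual I\<^esub> g)) = g (b \<odot>\<^bsub>I\<^esub> \<rho> \<gamma>)"
          using h(2)[OF bg \<gamma>] \<rho>.closed[OF \<gamma>] by simp
        also have "\<dots> = g (\<rho> (b \<odot>\<^bsub>DA\<^esub> \<gamma>))" by (simp only: \<rho>.smult[OF bA \<gamma>])
        also have "\<dots> = (b \<odot>\<^bsub>DA\<^esub> \<gamma>) (h g)" by (rule h(2)[OF g b\<gamma>])
        also have "\<dots> = \<gamma> (h g \<otimes>\<^bsub>A\<^esub> b)" using h(1)[OF g] by simp
        finally show "\<gamma> (h (b \<odot>\<^bsub>dual I\<^esub> g)) = \<gamma> (h g \<otimes>\<^bsub>A\<^esub> b)" .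
      qed
      then show ?thesis by simp
    qed
  qed
  have eq: "g = h g \<odot>\<^bsub>dual I\<^esub> f" if g: "g \<in> carrier (dual I)" for g
  proof
    fix x
    show "g x = (h g \<odot>\<^bsub>dual I\<^esub> f) x"
    proof (cases "x \<in> carrier I")
      case True
      have "g x = g (\<rho> (\<iota> x))" using \<rho>\<iota>[OF True] by simp
      also have "\<dots> = \<iota> x (h g)" by (rule h(2)[OF g \<iota>.closed[OF True]])
      also have "\<dots> = (h g \<odot>\<^bsub>dual I\<^esub> f) x" using True h(1)[OF g] by (simp add: \<iota>_def)
      finally show ?thesis .
    next
      case False
      then show ?thesis using mod_homD(4)[of g R "res I" E] g by (auto simp: extensional_def)
    qed
  qed
  have "dual_basis (opp A) (dual I) 1 (\<lambda>_. f) (\<lambda>_. restrict h (carrier (dual I)))"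
    unfolding dual_basis_def
  proof (intro conjI ballI allI impI hm)
    show "(\<lambda>_. f) \<in> {..<1} \<rightarrow> carrier (dual I)" using f(1) by auto
    fix g assume g: "g \<in> carrier (dual I)"
    have one: "{..<1} = {0::nat}" by auto
    have c: "h g \<odot>\<^bsub>dual I\<^esub> f \<in> carrier (dual I)" using D.lsmult_closed[OF _ f(1), of "h g"] h(1)[OF g] by simp
    have "finsum (dual I) (\<lambda>i. h g \<odot>\<^bsub>dual I\<^esub> f) {0::nat} = h g \<odot>\<^bsub>dual I\<^esub> f"
      using D.M.finsum_insert[of "{}" "0::nat" "\<lambda>i. h g \<odot>\<^bsub>dual I\<^esub> f"] c D.M.r_zero[OF c]
      by (simp only: D.M.finsum_empty) auto
    then show "g = finsum (dual I) (\<lambda>i. restrict h (carrier (dual I)) g \<odot>\<^bsub>dual I\<^esub> f) {..<1::nat}"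
      unfolding one using eq[OF g] g by (simp only: restrict_apply') 
  qed
  then show ?thesis by (rule dual_basis_projective[OF D.left_module_axioms])
qed

end

text \<open>A simple top means a single maximal submodule. A nonzero class in
  \<open>A e / J e\<close> fixed by \<open>e\<close> corresponds to the class of some
  \<open>x\<close>, so \<open>e x\<close> stays outside the radical.\<close>

lemma (in left_module) local_of_top:
  assumes fl: "fin_len A (regular_module A)" and fin: "fin_len A M" and e: "primitive_idempotent A e"
    and iso: "mod_iso A (module_top A M) (left_factor A e (jacobson_radical A))"
  obtains x where "largest_proper A M (rad A M)" "x \<in> carrier M" "e \<odot>\<^bsub>M\<^esub> x \<notin> rad A M"
proof -
  have ec: "e \<in> carrier A" using e by (simp add: primitive_idempotent_def)
  let ?F = "left_factor A e (jacobson_radical A)"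
  have T: "left_module A (module_top A M)" unfolding module_top_def by (rule left_module_quot[OF submodule_rad])
  have F: "left_module A ?F" by (rule A.left_module_left_factor[OF fl e])
  have "simple_module A (module_top A M)" by (rule mod_iso_simple[OF T F iso A.left_factor_simple[OF fl e]])
  then have "maximal_submodule A M (rad A M)"
    unfolding module_top_def maximal_iff using simple_quot_iff[OF submodule_rad] by blast
  then have l: "largest_proper A M (rad A M)" by (rule simple_top_largest[OF fin])
  obtain f where f: "f \<in> mod_hom A (module_top A M) ?F" "bij_betw f (carrier (module_top A M)) (carrier ?F)"
    using iso by (auto simp: mod_iso_def)
  interpret f: module_hom A "module_top A M" ?F f by (rule module_homI[OF T F f(1)])
  interpret q: module_hom A M "quot_module M (rad A M)" "quot_map (rad A M)" by (rule quot_hom[OF submodule_rad])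
  obtain y where y: "y \<in> carrier ?F" "y \<noteq> \<zero>\<^bsub>?F\<^esub>" "e \<odot>\<^bsub>?F\<^esub> y = y" using A.left_factor_idem[OF fl e] .
  obtain z where z: "z \<in> carrier (module_top A M)" "f z = y" using f(2) y(1) by (metis bij_betw_imp_surj_on imageE)
  obtain x where x: "x \<in> carrier M" "z = quot_map (rad A M) x"
    using z(1) unfolding module_top_def quot_map_surj[OF submodule_rad, symmetric] by blast
  have "e \<odot>\<^bsub>M\<^esub> x \<notin> rad A M"
  proof
    assume "e \<odot>\<^bsub>M\<^esub> x \<in> rad A M"
    then have "quot_map (rad A M) (e \<odot>\<^bsub>M\<^esub> x) = \<zero>\<^bsub>quot_module M (rad A M)\<^esub>"
      using quot_map_ker[OF submodule_rad] by (auto simp: mod_ker_def)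
    then have "e \<odot>\<^bsub>module_top A M\<^esub> z = \<zero>\<^bsub>module_top A M\<^esub>" using q.smult[OF ec x(1)] x(2) by (simp add: module_top_def)
    then show False using f.smult[OF ec z(1)] f.zero z(2) y by simp
  qed
  then show ?thesis using that l x(1) by blast
qed

context artin_dual
begin

lemma finsum_dual:
  assumes M: "left_module A M" and f: "f \<in> S \<rightarrow> carrier (dual M)" and x: "x \<in> carrier M"
  shows "finsum (dual M) f S x = finsum E (\<lambda>i. f i x) S"
proof -
  interpret D: left_module "opp A" "dual M" by (rule left_module_dual[OF M])
  interpret p: pairing R E "res (dual M)" "res M" "\<lambda>f x. f x"
    by (rule dual_pairing[OF M])
  interpret h: module_hom R "res (dual M)" E
    "restrict (\<lambda>u. u x) (carrier (res (dual M)))"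
    by (rule module_homI[OF p.U E.left_module_axioms p.hom_l]) (use x in simp)
  have "finsum (dual M) f S \<in> carrier (dual M)" using f by (rule D.M.finsum_closed)
  then have "finsum (dual M) f S x =
     restrict (\<lambda>u. u x) (carrier (res (dual M))) (finsum (res (dual M)) f S)"
    by (simp add: finsum_restrict)
  also have "\<dots> = finsum E (\<lambda>i. restrict (\<lambda>u. u x) (carrier (res (dual M))) (f i)) S"
    by (rule h.finsum) (use f in simp)
  also have "\<dots> = finsum E (\<lambda>i. f i x) S"
    using f dual_closed(1)[OF _ x] by (intro E.M.finsum_cong') (auto simp: Pi_iff)
  finally show ?thesis .
qed

lemma dual_hom:
  assumes M: "left_module A M" and N: "left_module A N" and h: "h \<in> mod_hom A M N" and f: "f \<in> carrier (dual N)"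
  shows "compose (carrier M) f h \<in> carrier (dual M)"
  using mod_hom_comp[OF left_module_restrict[OF M] mod_hom_scalars[OF M h], of f E] f by simp

text \<open>Separate \<open>e x\<close> from \<open>L\<close> by \<open>g\<close> and precompose
  with the action of \<open>e\<close>: the functional \<open>e g\<close> is fixed by
  \<open>e\<close> and still vanishes on the submodule \<open>L\<close>.\<close>

lemma separate_idem:
  assumes M: "fg_module A M" and L: "submodule L A M" and e: "e \<in> carrier A" "e \<otimes>\<^bsub>A\<^esub> e = e"
    and x: "x \<in> carrier M" "e \<odot>\<^bsub>M\<^esub> x \<notin> L"
  obtains f where "f \<in> ann M L" "e \<odot>\<^bsub>dual M\<^esub> f = f" "f x \<noteq> \<zero>\<^bsub>E\<^esub>"
proof -
  interpret M: left_module A M by (rule fg_left_module[OF M])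
  interpret D: left_module "opp A" "dual M" by (rule left_module_dual[OF M.left_module_axioms])
  obtain g where g: "g \<in> mod_hom R (res M) E" "\<And>x. x \<in> L \<Longrightarrow> g x = \<zero>\<^bsub>E\<^esub>" "g (e \<odot>\<^bsub>M\<^esub> x) \<noteq> \<zero>\<^bsub>E\<^esub>"
    using separate[OF M submodule_restrict[OF M.left_module_axioms L] M.lsmult_closed[OF e(1) x(1)] x(2)] by metis
  let ?f = "e \<odot>\<^bsub>dual M\<^esub> g"
  have gD: "g \<in> carrier (dual M)" using g(1) by simp
  have fD: "?f \<in> carrier (dual M)" by (rule D.lsmult_closed[OF _ gD]) (use e(1) in simp)
  have "?f \<in> ann M L"
    using fD g(2) M.sub_smult[OF L e(1)] M.sub_carr[OF L] by (simp add: ann_def)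
  moreover have "e \<odot>\<^bsub>dual M\<^esub> ?f = ?f"
    using D.lsmult_assoc[of e e g] e gD by (simp del: std_dual_simps(4))
  moreover have "?f x \<noteq> \<zero>\<^bsub>E\<^esub>" using g(3) x(1) by simp
  ultimately show ?thesis by (rule that)
qed

end

text \<open>The maps \<open>h k\<close> are the components of the projection of \<open>I\<close> onto \<open>I / soc I\<close>.\<close>

locale socle_quotient = artin_dual R A E
  for R :: "('r, 'k) ring_scheme" (structure) and A :: "('r, 'a) module" (structure) and E :: "('r, 'i) module" +
  fixes I :: "('a, 'q) module" and S :: "'q set" and t :: nat and N :: "nat \<Rightarrow> ('a, 'v) module"
    and h :: "nat \<Rightarrow> 'q \<Rightarrow> 'v" and e :: "nat \<Rightarrow> 'a" and c :: "nat \<Rightarrow> nat"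
  assumes inj: "injective A I"
    and S: "submodule S A I" "S \<noteq> {\<zero>\<^bsub>I\<^esub>}" "\<And>L. submodule L A I \<Longrightarrow> L \<noteq> {\<zero>\<^bsub>I\<^esub>} \<Longrightarrow> S \<subseteq> L"
    and t: "t \<noteq> 0"
    and N: "k < t \<Longrightarrow> left_module A (N k)"
    and h: "k < t \<Longrightarrow> h k \<in> mod_hom A I (N k)"
    and lift: "\<lbrakk>k < t; x \<in> carrier (N k)\<rbrakk> \<Longrightarrow> \<exists>y\<in>carrier I. h k y = x \<and> (\<forall>j<t. j \<noteq> k \<longrightarrow> h j y = \<zero>\<^bsub>N j\<^esub>)"
    and kernel: "y \<in> carrier I \<Longrightarrow> y \<in> S \<longleftrightarrow> (\<forall>k<t. h k y = \<zero>\<^bsub>N k\<^esub>)"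
    and prim: "k < t \<Longrightarrow> primitive_idempotent A (e k)"
    and top: "k < t \<Longrightarrow> mod_iso A (module_top A (N k)) (left_factor A (e k) (jacobson_radical A))"
    and c: "k < t \<Longrightarrow> loewy_length A (N k) = c k"
begin

abbreviation "J \<equiv> jacobson_radical A"
abbreviation "Q \<equiv> dual I"
abbreviation "X \<equiv> dual (I\<lparr>carrier := rad A I\<rparr>)"

lemma fgI: "fg_module A I" using inj by (simp add: injective_def)

sublocale I: left_module A I by (rule fg_left_module[OF fgI])
sublocale Q: left_module "opp A" Q by (rule left_module_dual[OF I.left_module_axioms])

lemma h_hom: "k < t \<Longrightarrow> module_hom A I (N k) (h k)"
  by (rule module_homI[OF I.left_module_axioms N h])

lemma h_surj: assumes k: "k < t" shows "h k ` carrier I = carrier (N k)"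
proof -
  interpret h: module_hom A I "N k" "h k" by (rule h_hom[OF k])
  show ?thesis using h.closed lift[OF k] by blast
qed

lemma fgN: "k < t \<Longrightarrow> fg_module A (N k)"
  by (rule module_hom.fg_surj[OF h_hom fgI h_surj])

lemma finN: "k < t \<Longrightarrow> fin_len A (N k)"
  by (rule fg_fin[OF fgN fin_regular])

lemma idem: "k < t \<Longrightarrow> e k \<in> carrier A" "k < t \<Longrightarrow> e k \<otimes>\<^bsub>A\<^esub> e k = e k"
  using prim by (auto simp: primitive_idempotent_def)

lemma localN: "k < t \<Longrightarrow> largest_proper A (N k) (rad A (N k))"
  and topN: "k < t \<Longrightarrow> \<exists>x\<in>carrier (N k). e k \<odot>\<^bsub>N k\<^esub> x \<notin> rad A (N k)"
  using left_module.local_of_top[OF N fin_regular finN prim top, of k] by blast+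

lemma ne: "k < t \<Longrightarrow> carrier (N k) \<noteq> {\<zero>\<^bsub>N k\<^esub>}"
proof
  assume k: "k < t" and z: "carrier (N k) = {\<zero>\<^bsub>N k\<^esub>}"
  interpret N: left_module A "N k" by (rule N[OF k])
  show False using topN[OF k] N.sub_zero[OF N.submodule_rad] N.lsmult_closed[OF idem(1)[OF k]] z by auto
qed

lemma c_ne: "k < t \<Longrightarrow> c k \<noteq> 0"
  using left_module.loewy_props(1)[OF N fin_regular ne, of k] c by simp

text \<open>A maximal submodule that does not contain \<open>S\<close> is zero. Then
  \<open>I = S\<close>, and all components \<open>h k\<close> vanish, against
  \<open>N 0 \<noteq> 0\<close>.\<close>

lemma S_rad: "S \<subseteq> rad A I"
proof -
  have "S \<subseteq> W" if W: "maximal_submodule A I W" for W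
  proof (rule S(3))
    show "submodule W A I" using W by (simp add: maximal_submodule_def)
    show "W \<noteq> {\<zero>\<^bsub>I\<^esub>}"
    proof
      assume "W = {\<zero>\<^bsub>I\<^esub>}"
      then have "S = carrier I" using W S(1,2) I.sub_zero[OF S(1)] unfolding maximal_submodule_def by blast
      then have "\<forall>x\<in>carrier (N 0). x = \<zero>\<^bsub>N 0\<^esub>" using kernel h_surj[of 0] t by (metis imageE neq0_conv)
      then show False using ne[of 0] t left_module.submodule_zero[OF N, of 0] left_module.sub_subset[OF N, of 0] by blast
    qed
  qed
  then show ?thesis using I.sub_subset[OF S(1)] by (auto simp: rad_def)
qed

text \<open>For the converse, each component of \<open>v\<close> lies in
  \<open>rad (N k) = J p\<close> and is lifted to an element of \<open>rad I\<close> with no other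
  components. The sum \<open>?w\<close> of the lifts has the components of \<open>v\<close>, so the
  difference lies in \<open>S\<close>, which is inside the radical.\<close>

lemma rad_iff: assumes v: "v \<in> carrier I" shows "v \<in> rad A I \<longleftrightarrow> (\<forall>k<t. h k v \<in> rad A (N k))"
proof (intro iffI allI impI)
  fix k assume "v \<in> rad A I" "k < t"
  then show "h k v \<in> rad A (N k)" by (intro module_hom.surj_rad[OF h_hom h_surj])
next
  assume r: "\<forall>k<t. h k v \<in> rad A (N k)"
  have "\<exists>z\<in>rad A I. h k z = h k v \<and> (\<forall>j<t. j \<noteq> k \<longrightarrow> h j z = \<zero>\<^bsub>N j\<^esub>)" if k: "k < t" for k
  proof -
    interpret N: left_module A "N k" by (rule N[OF k])
    obtain p where p: "p \<in> carrier (N k)" "p \<notin> rad A (N k)" using topN[OF k] N.lsmult_closed[OF idem(1)[OF k]] by blast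
    obtain j where j: "j \<in> J" "h k v = j \<odot>\<^bsub>N k\<^esub> p"
      using N.local_rad_eq[OF fin_regular localN[OF k] p, of "h k v"] r k by blast
    obtain y where y: "y \<in> carrier I" "h k y = p" "\<forall>j<t. j \<noteq> k \<longrightarrow> h j y = \<zero>\<^bsub>N j\<^esub>" using lift[OF k p(1)] by blast
    have jc: "j \<in> carrier A" by (rule A.jacobson_carr[OF j(1)])
    have "h k (j \<odot>\<^bsub>I\<^esub> y) = h k v" using mod_homD(3)[OF h[OF k] jc y(1)] y(2) j(2) by simp
    moreover have "h i (j \<odot>\<^bsub>I\<^esub> y) = \<zero>\<^bsub>N i\<^esub>" if "i < t" "i \<noteq> k" for i
      using mod_homD(3)[OF h[OF that(1)] jc y(1)] y(3) that left_module.smult_r_zero[OF N[OF that(1)] jc] by simp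
    ultimately show ?thesis using I.radical_smult_rad[OF y(1) j(1)] by blast
  qed
  then obtain z where z: "\<And>k. k < t \<Longrightarrow> z k \<in> rad A I" "\<And>k. k < t \<Longrightarrow> h k (z k) = h k v"
    "\<And>k j. k < t \<Longrightarrow> j < t \<Longrightarrow> j \<noteq> k \<Longrightarrow> h j (z k) = \<zero>\<^bsub>N j\<^esub>" by metis
  have zr: "z \<in> {..<t} \<rightarrow> rad A I" using z(1) by blast
  have zc: "z \<in> {..<t} \<rightarrow> carrier I" using zr I.sub_carr[OF I.submodule_rad] by blast
  let ?w = "finsum I z {..<t}"
  have w: "?w \<in> rad A I" by (rule I.sub_finsum[OF I.submodule_rad zr])
  have wc: "?w \<in> carrier I" using I.sub_carr[OF I.submodule_rad w] .
  have "h k (v \<ominus>\<^bsub>I\<^esub> ?w) = \<zero>\<^bsub>N k\<^esub>" if k: "k < t" for k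
  proof -
    interpret h: module_hom A I "N k" "h k" by (rule h_hom[OF k])
    have "h k ?w = finsum (N k) (\<lambda>i. h k (z i)) {..<t}" by (rule h.finsum[OF zc])
    also have "\<dots> = finsum (N k) (\<lambda>i. if k = i then h k v else \<zero>\<^bsub>N k\<^esub>) {..<t}"
      using z k h.closed[OF v] by (intro h.N.M.finsum_cong') auto
    also have "\<dots> = h k v"
      using h.N.M.add.finprod_singleton[of k "{..<t}" "\<lambda>_. h k v"] k h.closed[OF v] by (simp add: finsum_def)
    finally show ?thesis using h.diff[OF v wc] h.N.diff_self h.closed[OF v] by simp
  qed
  then have "v \<ominus>\<^bsub>I\<^esub> ?w \<in> S" using kernel[of "v \<ominus>\<^bsub>I\<^esub> ?w"] v wc I.sub_diff[OF I.submodule_carrier] by blast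
  then have "v \<ominus>\<^bsub>I\<^esub> ?w \<in> rad A I" using S_rad by blast
  then show "v \<in> rad A I" using I.diff_mem_iff[OF I.submodule_rad w v] by blast
qed

text \<open>By way of the dual: the functionals vanishing on \<open>S\<close> form the radical of
  the local module \<open>Q\<close>, hence have the form \<open>j q\<close> with
  \<open>j \<in> J\<close>, and \<open>(j q) z = q (j z) = 0\<close>.\<close>

lemma killed_S:
  assumes z: "z \<in> carrier I" "\<And>j. j \<in> J \<Longrightarrow> j \<odot>\<^bsub>I\<^esub> z = \<zero>\<^bsub>I\<^esub>" shows "z \<in> S"
proof (rule mem_ann_ann[OF fgI S(1) z(1)])
  fix f assume f: "f \<in> ann I S"
  have l: "largest_proper (opp A) Q (ann I S)" by (rule dual_local[OF fgI S])
  obtain q where q: "q \<in> carrier Q" "q \<notin> ann I S"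
    using l Q.sub_subset unfolding largest_proper_def by blast
  obtain j where j: "j \<in> jacobson_radical (opp A)" "f = j \<odot>\<^bsub>Q\<^esub> q"
    using Q.local_rad_eq[OF fin_regular_opp l q f] .
  have "j \<in> J" using j(1) A.jacobson_opp[OF fin_regular fin_regular_opp] by simp
  then show "f z = \<zero>\<^bsub>E\<^esub>"
    using z j(2) module_hom.zero[OF module_homI[OF left_module_restrict[OF I.left_module_axioms] E.left_module_axioms], of q] q(1)
    by simp
qed

lemma dual_J_power: "ideal_power (opp A) (jacobson_radical (opp A)) n = ideal_power A J n"
  using A.jacobson_opp[OF fin_regular fin_regular_opp] A.ideal_power_opp[OF A.jacobson_ideal] by simp

text \<open>\<open>f (b y) = (b f) y\<close> and functionals separate points, so vanishing of
  \<open>J^n Q\<close> at \<open>y\<close> forces \<open>J^n y = 0\<close>.\<close>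

lemma power_killed:
  assumes y: "y \<in> carrier I"
    and z: "\<And>g. g \<in> ideal_times_module (opp A) (ideal_power (opp A) (jacobson_radical (opp A)) n) Q \<Longrightarrow> g y = \<zero>\<^bsub>E\<^esub>"
    and b: "b \<in> ideal_power A J n"
  shows "b \<odot>\<^bsub>I\<^esub> y = \<zero>\<^bsub>I\<^esub>"
proof -
  have bc: "b \<in> carrier A" by (rule ideal.Icarr[OF A.ideal_power_ideal[OF A.jacobson_ideal] b])
  have "b \<odot>\<^bsub>I\<^esub> y \<in> {\<zero>\<^bsub>I\<^esub>}"
  proof (rule mem_ann_ann[OF fgI I.submodule_zero I.lsmult_closed[OF bc y]])
    fix f assume "f \<in> ann I {\<zero>\<^bsub>I\<^esub>}"
    then have f: "f \<in> carrier Q" by (simp add: ann_def)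
    have "b \<odot>\<^bsub>Q\<^esub> f \<in> {a \<odot>\<^bsub>Q\<^esub> x | a x. a \<in> ideal_power (opp A) (jacobson_radical (opp A)) n \<and> x \<in> carrier Q}"
      using b f unfolding dual_J_power by blast
    then have "b \<odot>\<^bsub>Q\<^esub> f \<in> ideal_times_module (opp A) (ideal_power (opp A) (jacobson_radical (opp A)) n) Q"
      unfolding ideal_times_module_def by (rule subsetD[OF Q.span_incl])
    then have "(b \<odot>\<^bsub>Q\<^esub> f) y = \<zero>\<^bsub>E\<^esub>" by (rule z)
    then show "f (b \<odot>\<^bsub>I\<^esub> y) = \<zero>\<^bsub>E\<^esub>" using y by simp
  qed
  then show ?thesis by simp
qed

text \<open>From \<open>J^(c k) y = 0\<close> follows \<open>J^(c k - 1) y \<subseteq> S\<close> by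
  \<open>killed_S\<close>, and \<open>h k\<close> kills \<open>S\<close>. If \<open>h k y\<close>
  generated \<open>N k\<close>, then \<open>J^(c k - 1)\<close> would annihilate \<open>N k\<close>,
  against the Loewy length.\<close>

lemma power_killed_rad:
  assumes y: "y \<in> carrier I" and k: "k < t" and z: "\<And>b. b \<in> ideal_power A J (c k) \<Longrightarrow> b \<odot>\<^bsub>I\<^esub> y = \<zero>\<^bsub>I\<^esub>"
  shows "h k y \<in> rad A (N k)"
proof (rule ccontr)
  assume nr: "h k y \<notin> rad A (N k)"
  interpret h: module_hom A I "N k" "h k" by (rule h_hom[OF k])
  obtain n where n: "c k = Suc n" using c_ne[OF k] not0_implies_Suc by blast
  have JI: "ideal (ideal_power A J n) A" by (rule A.ideal_power_ideal[OF A.jacobson_ideal])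
  have J: "ideal_power A J n \<subseteq> carrier A" using ideal.Icarr[OF JI] by blast
  have ker: "a \<odot>\<^bsub>N k\<^esub> h k y = \<zero>\<^bsub>N k\<^esub>" if a: "a \<in> ideal_power A J n" for a
  proof -
    have ac: "a \<in> carrier A" using a J by blast
    have "a \<odot>\<^bsub>I\<^esub> y \<in> S"
    proof (rule killed_S[OF I.lsmult_closed[OF ac y]])
      fix j assume j: "j \<in> J"
      have "j \<otimes>\<^bsub>A\<^esub> a \<in> ideal_power A J (c k)" unfolding n ideal_power.simps by (rule ideal_prod.prod[OF j a])
      then show "j \<odot>\<^bsub>I\<^esub> (a \<odot>\<^bsub>I\<^esub> y) = \<zero>\<^bsub>I\<^esub>" using z I.lsmult_assoc[OF A.jacobson_carr[OF j] ac y] by simp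
    qed
    then have "h k (a \<odot>\<^bsub>I\<^esub> y) = \<zero>\<^bsub>N k\<^esub>" using kernel[OF I.lsmult_closed[OF ac y]] k by blast
    then show ?thesis using h.smult[OF ac y] by simp
  qed
  have hc: "h k y \<in> carrier (N k)" by (rule h.closed[OF y])
  have gen: "h.N.cyc (h k y) = carrier (N k)"
    by (rule h.N.largest_gen[OF localN[OF k] h.N.submodule_cyc[OF hc] h.N.cyc_self[OF hc] nr])
  have "a \<odot>\<^bsub>N k\<^esub> x = \<zero>\<^bsub>N k\<^esub>" if a: "a \<in> ideal_power A J n" and x: "x \<in> carrier (N k)" for a x
  proof -
    obtain b where b: "b \<in> carrier A" "x = b \<odot>\<^bsub>N k\<^esub> h k y" using x unfolding gen[symmetric] h.N.mem_cyc by blast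
    have "a \<odot>\<^bsub>N k\<^esub> x = (a \<otimes>\<^bsub>A\<^esub> b) \<odot>\<^bsub>N k\<^esub> h k y" using h.N.lsmult_assoc[OF subsetD[OF J a] b(1) hc] b(2) by simp
    then show ?thesis using ker[OF ideal.I_r_closed[OF JI a b(1)]] by simp
  qed
  then have "ideal_times_module A (ideal_power A J n) (N k) = {\<zero>\<^bsub>N k\<^esub>}"
    using h.N.ideal_times_zero_iff[OF J] by blast
  then show False using h.N.loewy_props(3)[OF fin_regular ne[OF k], of n] c[OF k] n by simp
qed

text \<open>\<open>u k\<close> is \<open>f k\<close> after \<open>h k\<close>, with
  \<open>f k\<close> fixed by \<open>e k\<close> and zero on \<open>rad (N k)\<close>. Restriction
  of functionals to \<open>rad I\<close> has kernel \<open>ann I (rad A I)\<close>. This is the span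
  of the \<open>u k\<close>, because the common zeros of the span lie in \<open>rad I\<close>; the
  depth of \<open>u k\<close> in \<open>Q\<close> is likewise checked on common zeros.\<close>

theorem dual_transpose_bound:
  obtains g0 u where "transpose_bound (opp A) t e Q (ann I S) X g0 u c"
proof -
  have "\<exists>f x. f \<in> ann (N k) (rad A (N k)) \<and> e k \<odot>\<^bsub>dual (N k)\<^esub> f = f \<and> x \<in> carrier (N k) \<and> f x \<noteq> \<zero>\<^bsub>E\<^esub>"
    if k: "k < t" for k
  proof -
    obtain x where x: "x \<in> carrier (N k)" "e k \<odot>\<^bsub>N k\<^esub> x \<notin> rad A (N k)" using topN[OF k] by blast
    show ?thesis
      by (rule separate_idem[OF fgN[OF k] left_module.submodule_rad[OF N[OF k]] idem[OF k] x]) (use x(1) in blast)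
  qed
  then obtain f x where f: "\<And>k. k < t \<Longrightarrow> f k \<in> ann (N k) (rad A (N k))"
    "\<And>k. k < t \<Longrightarrow> e k \<odot>\<^bsub>dual (N k)\<^esub> f k = f k"
    "\<And>k. k < t \<Longrightarrow> x k \<in> carrier (N k)" "\<And>k. k < t \<Longrightarrow> f k (x k) \<noteq> \<zero>\<^bsub>E\<^esub>" by metis
  have fD: "f k \<in> carrier (dual (N k))" if "k < t" for k using f(1)[OF that] by (simp add: ann_def)
  have f_hom: "module_hom R (res (N k)) E (f k)" if k: "k < t" for k
    by (rule module_homI[OF left_module_restrict[OF N[OF k]] E.left_module_axioms]) (use fD[OF k] in simp)
  have f_rad: "f k z = \<zero>\<^bsub>E\<^esub>" if "k < t" "z \<in> rad A (N k)" for k z using f(1)[OF that(1)] that(2) by (simp add: ann_def)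
  have f_e: "f k (e k \<odot>\<^bsub>N k\<^esub> z) = f k z" if k: "k < t" and z: "z \<in> carrier (N k)" for k z
  proof -
    have "(e k \<odot>\<^bsub>dual (N k)\<^esub> f k) z = f k z" using f(2)[OF k] by simp
    then show ?thesis using z by simp
  qed
  define u where "u k = compose (carrier I) (f k) (h k)" for k
  have uQ: "u k \<in> carrier Q" if k: "k < t" for k
    unfolding u_def by (rule dual_hom[OF I.left_module_axioms N[OF k] h[OF k] fD[OF k]])
  have u_val: "u k y = f k (h k y)" if "y \<in> carrier I" for k y using that by (simp add: u_def compose_eq)
  have hc: "h k y \<in> carrier (N k)" if "k < t" "y \<in> carrier I" for k y by (rule mod_homD(1)[OF h[OF that(1)] that(2)])
  have hs: "h k (a \<odot>\<^bsub>I\<^esub> y) = a \<odot>\<^bsub>N k\<^esub> h k y" if "k < t" "a \<in> carrier A" "y \<in> carrier I" for k a y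
    by (rule mod_homD(3)[OF h[OF that(1)] that(2,3)])
  have uc: "u \<in> {..<t} \<rightarrow> carrier Q" using uQ by blast
  have vu: "(a \<odot>\<^bsub>Q\<^esub> u k) y = f k (a \<odot>\<^bsub>N k\<^esub> h k y)" if "k < t" "a \<in> carrier A" "y \<in> carrier I" for k a y
    using that u_val[OF I.lsmult_closed[OF that(2,3)]] hs[OF that] by simp
  have sum_val: "finsum Q (\<lambda>i. v i \<odot>\<^bsub>Q\<^esub> u i) {..<t} y = finsum E (\<lambda>i. f i (v i \<odot>\<^bsub>N i\<^esub> h i y)) {..<t}"
    if v: "v \<in> {..<t} \<rightarrow> carrier A" and y: "y \<in> carrier I" for v y
  proof -
    have vuc: "(\<lambda>i. v i \<odot>\<^bsub>Q\<^esub> u i) \<in> {..<t} \<rightarrow> carrier Q"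
    proof
      fix i assume "i \<in> {..<t}"
      then show "v i \<odot>\<^bsub>Q\<^esub> u i \<in> carrier Q" using Q.lsmult_closed[OF _ uQ, of "v i" i] v by auto
    qed
    have fc: "f i (v i \<odot>\<^bsub>N i\<^esub> h i y) \<in> carrier E" if i: "i < t" for i
    proof -
      have "v i \<odot>\<^bsub>N i\<^esub> h i y \<in> carrier (N i)" using left_module.lsmult_closed[OF N[OF i] _ hc[OF i y], of "v i"] v i by blast
      then show ?thesis using module_hom.closed[OF f_hom[OF i]] by simp
    qed
    have vi: "v i \<in> carrier A" if "i < t" for i using v that by blast
    show ?thesis unfolding finsum_dual[OF I.left_module_axioms vuc y]
      using vu[OF _ vi y] fc by (intro E.M.finsum_cong') (auto simp del: std_dual_simps)
  qed
  let ?K = "{finsum Q (\<lambda>i. v i \<odot>\<^bsub>Q\<^esub> u i) {..<t} | v. v \<in> {..<t} \<rightarrow> carrier (opp A)}"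
  have Ks: "submodule ?K (opp A) Q" by (rule Q.submodule_combinations[OF uc])
  have uK: "u k \<in> ?K" if "k < t" for k using Q.lin_comb_gen[OF uc that] unfolding Q.lin_comb_image[OF uc] .
  have K_rad: "ann I (rad A I) = ?K"
  proof
    show "?K \<subseteq> ann I (rad A I)"
    proof
      fix g assume g: "g \<in> ?K"
      then obtain v where v: "v \<in> {..<t} \<rightarrow> carrier A" "g = finsum Q (\<lambda>i. v i \<odot>\<^bsub>Q\<^esub> u i) {..<t}" by auto
      have "g y = \<zero>\<^bsub>E\<^esub>" if y: "y \<in> rad A I" for y
      proof -
        have yc: "y \<in> carrier I" using I.sub_carr[OF I.submodule_rad y] .
        have "f i (v i \<odot>\<^bsub>N i\<^esub> h i y) = \<zero>\<^bsub>E\<^esub>" if i: "i < t" for i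
        proof (rule f_rad[OF i])
          have "h i y \<in> rad A (N i)" using rad_iff[OF yc] y i by blast
          then show "v i \<odot>\<^bsub>N i\<^esub> h i y \<in> rad A (N i)"
            using left_module.sub_smult[OF N[OF i] left_module.submodule_rad[OF N[OF i]]] v(1) i by blast
        qed
        then have "finsum E (\<lambda>i. f i (v i \<odot>\<^bsub>N i\<^esub> h i y)) {..<t} = finsum E (\<lambda>i. \<zero>\<^bsub>E\<^esub>) {..<t}"
          by (intro E.M.finsum_cong') auto
        then show ?thesis unfolding v(2) sum_val[OF v(1) yc] by simp
      qed
      then show "g \<in> ann I (rad A I)" using Q.sub_carr[OF Ks g] by (simp add: ann_def)
    qed
    show "ann I (rad A I) \<subseteq> ?K"
    proof
      fix g assume g: "g \<in> ann I (rad A I)"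
      show "g \<in> ?K"
      proof (rule ann_ann[OF fgI Ks])
        show "g \<in> carrier Q" using g by (simp add: ann_def)
        fix y assume y: "y \<in> carrier I" "\<And>g. g \<in> ?K \<Longrightarrow> g y = \<zero>\<^bsub>E\<^esub>"
        \<comment> \<open>Outside the radical \<open>h k y\<close> would generate
          \<open>N k\<close>, so \<open>a (h k y) = x k\<close> for some \<open>a\<close>. Then
          \<open>a (u k)\<close>, which lies in \<open>?K\<close>, has at \<open>y\<close> the
          nonzero value \<open>f k (x k)\<close>.\<close>
        have "h k y \<in> rad A (N k)" if k: "k < t" for k
        proof (rule ccontr)
          assume nr: "h k y \<notin> rad A (N k)"
          interpret N: left_module A "N k" by (rule N[OF k])
          have "x k \<in> N.cyc (h k y)"
            using N.largest_gen[OF localN[OF k] N.submodule_cyc N.cyc_self nr] hc[OF k y(1)] f(3)[OF k] by blast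
          then obtain a where a: "a \<in> carrier A" "x k = a \<odot>\<^bsub>N k\<^esub> h k y" unfolding N.mem_cyc by blast
          have "a \<odot>\<^bsub>Q\<^esub> u k \<in> ?K" by (rule Q.sub_smult[OF Ks _ uK[OF k]]) (use a(1) in simp)
          then have "(a \<odot>\<^bsub>Q\<^esub> u k) y = \<zero>\<^bsub>E\<^esub>" by (rule y(2))
          then show False using vu[OF k a(1) y(1)] a(2) f(4)[OF k] by simp
        qed
        then have "y \<in> rad A I" using rad_iff[OF y(1)] by blast
        then show "g y = \<zero>\<^bsub>E\<^esub>" using g by (simp add: ann_def)
      qed
    qed
  qed
  define g0 where "g0 = (\<lambda>g\<in>carrier Q. restrict g (rad A I))"
  have g0_mem: "restrict g (rad A I) \<in> carrier X" if g: "g \<in> carrier Q" for g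
    using mod_hom_sub[OF left_module_restrict[OF I.left_module_axioms] submodule_restrict[OF I.left_module_axioms I.submodule_rad], of g E] g
    by (simp add: restrict_sub)
  have Im: "left_module A (I\<lparr>carrier := rad A I\<rparr>)" by (rule I.left_module_sub[OF I.submodule_rad])
  have rad_c: "y \<in> carrier I" if "y \<in> rad A I" for y using I.sub_carr[OF I.submodule_rad that] .
  have g0: "g0 \<in> mod_hom (opp A) Q X"
    unfolding g0_def
  proof (rule mod_hom_restrictI[OF Q.left_module_axioms g0_mem])
    show "restrict (g \<oplus>\<^bsub>Q\<^esub> g') (rad A I) = restrict g (rad A I) \<oplus>\<^bsub>X\<^esub> restrict g' (rad A I)" for g g'
      using rad_c by (auto simp: fun_eq_iff)
    show "restrict (a \<odot>\<^bsub>Q\<^esub> g) (rad A I) = a \<odot>\<^bsub>X\<^esub> restrict g (rad A I)" if "a \<in> carrier (opp A)" for a g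
      using that rad_c I.sub_smult[OF I.submodule_rad] by (auto simp: fun_eq_iff)
  qed
  have g0_surj: "g0 ` carrier Q = carrier X"
  proof
    show "g0 ` carrier Q \<subseteq> carrier X" using mod_homD(1)[OF g0] by blast
    show "carrier X \<subseteq> g0 ` carrier Q"
    proof
      fix g assume g: "g \<in> carrier X"
      then have "g \<in> mod_hom R ((res I)\<lparr>carrier := rad A I\<rparr>) E" by (simp add: restrict_sub)
      then obtain g' where g': "g' \<in> mod_hom R (res I) E" "\<And>y. y \<in> rad A I \<Longrightarrow> g' y = g y"
        using extend[OF left_module_restrict[OF I.left_module_axioms] fin_restrict_fg[OF fgI]
            submodule_restrict[OF I.left_module_axioms I.submodule_rad]] by metis
      have "g \<in> extensional (rad A I)" using mod_homD(4)[of g R "res (I\<lparr>carrier := rad A I\<rparr>)" E] g by simp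
      then have "g = restrict g' (rad A I)" using g'(2) by (auto simp: extensional_def fun_eq_iff)
      then show "g \<in> g0 ` carrier Q" using g'(1) by (intro image_eqI[of _ _ g']) (simp_all add: g0_def)
    qed
  qed
  have g0_ker: "mod_ker Q X g0 = ann I (rad A I)"
    unfolding mod_ker_def ann_def g0_def by (auto simp: fun_eq_iff restrict_def split: if_splits)
  have "transpose_bound (opp A) t e Q (ann I S) X g0 u c"
  proof (intro transpose_bound.intro idempotents.intro idempotents_axioms.intro transpose_bound_axioms.intro A.ring_opp)
    show "fin_len (opp A) (regular_module (opp A))" by (rule fin_regular_opp)
    show "fin_len (opp (opp A)) (regular_module (opp (opp A)))" unfolding opp_opp by (rule fin_regular)
    show "projective (opp A) Q" by (rule dual_projective[OF inj S])
    show "left_module (opp A) X" by (rule left_module_dual[OF Im])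
    show "largest_proper (opp A) Q (ann I S)" by (rule dual_local[OF fgI S])
    show "g0 \<in> mod_hom (opp A) Q X" "g0 ` carrier Q = carrier X" by (rule g0, rule g0_surj)
    show "mod_ker Q X g0 = ?K" unfolding g0_ker by (rule K_rad)
    show "mod_ker Q X g0 \<subseteq> ann I S" unfolding g0_ker using S_rad by (auto simp: ann_def)
    fix k assume k: "k < t"
    show "e k \<in> carrier (opp A)" "e k \<otimes>\<^bsub>opp A\<^esub> e k = e k" "primitive_idempotent (opp A) (e k)"
      using idem[OF k] prim[OF k] by (simp_all add: primitive_opp)
    show "u k \<in> carrier Q" by (rule uQ[OF k])
    show "e k \<odot>\<^bsub>Q\<^esub> u k = u k"
    proof (rule mod_hom_eqI)
      show "e k \<odot>\<^bsub>Q\<^esub> u k \<in> mod_hom R (res I) E"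
        using Q.lsmult_closed[OF _ uQ[OF k], of "e k"] idem(1)[OF k] by simp
      show "u k \<in> mod_hom R (res I) E" using uQ[OF k] by simp
      fix y assume "y \<in> carrier (res I)"
      then have y: "y \<in> carrier I" by simp
      show "(e k \<odot>\<^bsub>Q\<^esub> u k) y = u k y"
        unfolding vu[OF k idem(1)[OF k] y] u_val[OF y] by (rule f_e[OF k hc[OF k y]])
    qed
    obtain y where y: "y \<in> carrier I" "h k y = x k" using lift[OF k f(3)[OF k]] by blast
    show "u k \<noteq> \<zero>\<^bsub>Q\<^esub>"
    proof
      assume "u k = \<zero>\<^bsub>Q\<^esub>"
      then have "u k y = \<zero>\<^bsub>E\<^esub>" using y(1) by simp
      then show False using u_val[OF y(1)] y(2) f(4)[OF k] by simp
    qed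
    let ?T = "ideal_times_module (opp A) (ideal_power (opp A) (jacobson_radical (opp A)) (c k)) Q"
    have "ideal_power (opp A) (jacobson_radical (opp A)) (c k) \<subseteq> carrier (opp A)"
      unfolding dual_J_power using ideal.Icarr[OF A.ideal_power_ideal[OF A.jacobson_ideal]] by auto
    then have Ts: "submodule ?T (opp A) Q" by (rule Q.ideal_times_sub)
    show "u k \<in> ?T"
    proof (rule ann_ann[OF fgI Ts uQ[OF k]])
      fix y assume y: "y \<in> carrier I" "\<And>g. g \<in> ?T \<Longrightarrow> g y = \<zero>\<^bsub>E\<^esub>"
      have "h k y \<in> rad A (N k)"
      proof (rule power_killed_rad[OF y(1) k])
        show "b \<odot>\<^bsub>I\<^esub> y = \<zero>\<^bsub>I\<^esub>" if "b \<in> ideal_power A J (c k)" for b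
          using power_killed[of y "c k" b] y that by blast
      qed
      then show "u k y = \<zero>\<^bsub>E\<^esub>" unfolding u_val[OF y(1)] by (rule f_rad[OF k])
    qed
    fix v assume v: "v \<in> {..<t} \<rightarrow> carrier (opp A)" "finsum Q (\<lambda>i. v i \<odot>\<^bsub>Q\<^esub> u i) {..<t} = \<zero>\<^bsub>Q\<^esub>"
    have vA: "v \<in> {..<t} \<rightarrow> carrier A" using v(1) by simp
    have vk: "v k \<in> carrier A" using vA k by blast
    show "v k \<odot>\<^bsub>Q\<^esub> u k = \<zero>\<^bsub>Q\<^esub>"
    proof (rule mod_hom_eqI)
      show "v k \<odot>\<^bsub>Q\<^esub> u k \<in> mod_hom R (res I) E"
        using Q.lsmult_closed[OF _ uQ[OF k], of "v k"] vk by simp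
      show "\<zero>\<^bsub>Q\<^esub> \<in> mod_hom R (res I) E" using Q.M.zero_closed by simp
      fix y assume "y \<in> carrier (res I)"
      then have y: "y \<in> carrier I" by simp
      \<comment> \<open>Independence is tested at an element with the \<open>k\<close>-th component
        of \<open>y\<close> and no others: there the sum reduces to its \<open>k\<close>-th
        term.\<close>
      obtain y' where y': "y' \<in> carrier I" "h k y' = h k y" "\<forall>j<t. j \<noteq> k \<longrightarrow> h j y' = \<zero>\<^bsub>N j\<^esub>"
        using lift[OF k hc[OF k y]] by blast
      have fk: "f k (v k \<odot>\<^bsub>N k\<^esub> h k y) \<in> carrier E"
        using module_hom.closed[OF f_hom[OF k]] left_module.lsmult_closed[OF N[OF k] vk hc[OF k y]] by simp
      have other: "f i (v i \<odot>\<^bsub>N i\<^esub> h i y') = \<zero>\<^bsub>E\<^esub>" if i: "i < t" "i \<noteq> k" for i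
      proof -
        have "v i \<odot>\<^bsub>N i\<^esub> h i y' = \<zero>\<^bsub>N i\<^esub>" using y'(3) i left_module.smult_r_zero[OF N[OF i(1)]] vA by auto
        then show ?thesis using module_hom.zero[OF f_hom[OF i(1)]] by simp
      qed
      have "finsum E (\<lambda>i. f i (v i \<odot>\<^bsub>N i\<^esub> h i y')) {..<t} = finsum E (\<lambda>i. if k = i then f k (v k \<odot>\<^bsub>N k\<^esub> h k y) else \<zero>\<^bsub>E\<^esub>) {..<t}"
        using other y'(2) fk by (intro E.M.finsum_cong') auto
      also have "\<dots> = f k (v k \<odot>\<^bsub>N k\<^esub> h k y)"
        using E.M.add.finprod_singleton[of k "{..<t}" "\<lambda>_. f k (v k \<odot>\<^bsub>N k\<^esub> h k y)"] k fk by (simp add: finsum_def)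
      finally have "f k (v k \<odot>\<^bsub>N k\<^esub> h k y) = finsum Q (\<lambda>i. v i \<odot>\<^bsub>Q\<^esub> u i) {..<t} y'"
        using sum_val[OF vA y'(1)] by simp
      then show "(v k \<odot>\<^bsub>Q\<^esub> u k) y = \<zero>\<^bsub>Q\<^esub> y" unfolding vu[OF k vk y] v(2) using y y'(1) by simp
    qed
  qed
  then show ?thesis by (rule that)
qed

end

section \<open>The two estimates for the Auslander--Reiten translates\<close>

context artin_dual
begin

text \<open>The smallest nonzero submodule \<open>S\<close> from \<open>injective_uniform\<close> is
  simple and is the whole socle. \<open>h k\<close> is the quotient map followed by a projection of
  the decomposition.\<close>

lemma socle_quotient_exists:
  fixes I :: "('a, 'q) module"
  assumes inj: "injective A I" and ind: "indecomposable A I" and t: "t \<noteq> 0"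
    and ds: "internal_direct_sum A (quot_module I (soc A I)) t N"
    and Ni: "\<And>i. i \<in> {1..t} \<Longrightarrow> loewy_length A ((quot_module I (soc A I))\<lparr>carrier := N i\<rparr>) = c i \<and>
       primitive_idempotent A (e i) \<and>
       mod_iso A (module_top A ((quot_module I (soc A I))\<lparr>carrier := N i\<rparr>)) (left_factor A (e i) (jacobson_radical A))"
  obtains S h where "socle_quotient R A E I S t (\<lambda>k. (quot_module I (soc A I))\<lparr>carrier := N (Suc k)\<rparr>) h
    (\<lambda>k. e (Suc k)) (\<lambda>k. c (Suc k))"
proof -
  let ?V = "quot_module I (soc A I)"
  have fgI: "fg_module A I" using inj by (simp add: injective_def)
  interpret I: left_module A I by (rule fg_left_module[OF fgI])
  have ss: "submodule (soc A I) A I" by (rule I.soc_sub)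
  interpret V: left_module A ?V by (rule I.left_module_quot[OF ss])
  obtain S where S: "submodule S A I" "S \<noteq> {\<zero>\<^bsub>I\<^esub>}" "\<And>L. submodule L A I \<Longrightarrow> L \<noteq> {\<zero>\<^bsub>I\<^esub>} \<Longrightarrow> S \<subseteq> L"
    using injective_uniform[OF fin_regular inj ind] by blast
  have "simple_module A (I\<lparr>carrier := S\<rparr>)"
    unfolding I.simple_sub_iff[OF S(1)] using S(2,3) by blast
  then have Ssoc: "S \<subseteq> soc A I" by (rule I.simple_le_soc[OF S(1)])
  have "soc A I \<subseteq> S"
  proof (rule I.soc_least[OF S(1)])
    fix T assume T: "submodule T A I" "simple_module A (I\<lparr>carrier := T\<rparr>)"
    then have "T \<noteq> {\<zero>\<^bsub>I\<^esub>}" "\<forall>Z. submodule Z A I \<longrightarrow> Z \<subseteq> T \<longrightarrow> Z = {\<zero>\<^bsub>I\<^esub>} \<or> Z = T"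
      unfolding I.simple_sub_iff[OF T(1)] by blast+
    then show "T \<subseteq> S" using S(1) S(2) S(3)[OF T(1)] by blast
  qed
  then have soc: "soc A I = S" using Ssoc by blast
  have N: "submodule (N i) A ?V" if "i \<in> {1..t}" for i using ds that by (simp add: internal_direct_sum_def)
  obtain p where p: "\<And>i. i \<in> {1..t} \<Longrightarrow> p i \<in> mod_hom A ?V (?V\<lparr>carrier := N i\<rparr>)"
    "\<And>x. x \<in> carrier ?V \<Longrightarrow> x = finsum ?V (\<lambda>i. p i x) {1..t}"
    "\<And>i j x. i \<in> {1..t} \<Longrightarrow> j \<in> {1..t} \<Longrightarrow> x \<in> N i \<Longrightarrow> p j x = (if j = i then x else \<zero>\<^bsub>?V\<^esub>)"
    by (rule V.direct_sum_projections[OF ds]) (rule that)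
  let ?q = "I.quot_map (soc A I)"
  interpret q: module_hom A I ?V ?q by (rule I.quot_hom[OF ss])
  let ?h = "\<lambda>k. compose (carrier I) (p (Suc k)) ?q"
  have Sc: "Suc k \<in> {1..t}" if "k < t" for k using that by simp
  have "socle_quotient R A E I S t (\<lambda>k. ?V\<lparr>carrier := N (Suc k)\<rparr>) ?h (\<lambda>k. e (Suc k)) (\<lambda>k. c (Suc k))"
  proof (intro socle_quotient.intro artin_dual_axioms socle_quotient_axioms.intro inj S t)
    fix k assume k: "k < t"
    show "left_module A (?V\<lparr>carrier := N (Suc k)\<rparr>)" by (rule V.left_module_sub[OF N[OF Sc[OF k]]])
    show "?h k \<in> mod_hom A I (?V\<lparr>carrier := N (Suc k)\<rparr>)"
      by (rule mod_hom_comp[OF I.left_module_axioms q.hom p(1)[OF Sc[OF k]]])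
    show "primitive_idempotent A (e (Suc k))"
      "mod_iso A (module_top A (?V\<lparr>carrier := N (Suc k)\<rparr>)) (left_factor A (e (Suc k)) (jacobson_radical A))"
      "loewy_length A (?V\<lparr>carrier := N (Suc k)\<rparr>) = c (Suc k)"
      using Ni[OF Sc[OF k]] by blast+
    fix x assume "x \<in> carrier (?V\<lparr>carrier := N (Suc k)\<rparr>)"
    then have x: "x \<in> N (Suc k)" by simp
    have "x \<in> carrier ?V" by (rule V.sub_carr[OF N[OF Sc[OF k]] x])
    then obtain y where y: "y \<in> carrier I" "x = ?q y" unfolding I.quot_map_surj[OF ss, symmetric] by blast
    have "?h j y = (if j = k then x else \<zero>\<^bsub>?V\<^esub>)" if j: "j < t" for j
      using p(3)[OF Sc[OF k] Sc[OF j] x] y by (simp add: compose_eq)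
    then show "\<exists>y\<in>carrier I. ?h k y = x \<and> (\<forall>j<t. j \<noteq> k \<longrightarrow> ?h j y = \<zero>\<^bsub>?V\<lparr>carrier := N (Suc j)\<rparr>\<^esub>)"
      using y(1) k by (intro bexI[of _ y]) auto
  next
    fix y assume y: "y \<in> carrier I"
    have qy: "?q y \<in> carrier ?V" by (rule q.closed[OF y])
    have "y \<in> S \<longleftrightarrow> ?q y = \<zero>\<^bsub>?V\<^esub>"
      using I.quot_map_ker[OF ss] y unfolding soc mod_ker_def by blast
    also have "\<dots> \<longleftrightarrow> (\<forall>k<t. ?h k y = \<zero>\<^bsub>?V\<^esub>)"
    proof
      assume z: "?q y = \<zero>\<^bsub>?V\<^esub>"
      show "\<forall>k<t. ?h k y = \<zero>\<^bsub>?V\<^esub>"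
      proof (intro allI impI)
        fix k assume k: "k < t"
        show "?h k y = \<zero>\<^bsub>?V\<^esub>"
          using p(3)[OF Sc[OF k] Sc[OF k] V.sub_zero[OF N[OF Sc[OF k]]]] z y by (simp add: compose_eq)
      qed
    next
      assume h: "\<forall>k<t. ?h k y = \<zero>\<^bsub>?V\<^esub>"
      have "p i (?q y) = \<zero>\<^bsub>?V\<^esub>" if i: "i \<in> {1..t}" for i
      proof -
        have "i - 1 < t" "Suc (i - 1) = i" using i by auto
        then show ?thesis using h y by (metis compose_eq)
      qed
      then have "finsum ?V (\<lambda>i. p i (?q y)) {1..t} = finsum ?V (\<lambda>i. \<zero>\<^bsub>?V\<^esub>) {1..t}"
        by (intro V.M.finsum_cong') auto
      then show "?q y = \<zero>\<^bsub>?V\<^esub>" using p(2)[OF qy] by simp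
    qed
    finally show "y \<in> S \<longleftrightarrow> (\<forall>k<t. ?h k y = \<zero>\<^bsub>?V\<lparr>carrier := N (Suc k)\<rparr>\<^esub>)" by simp
  qed
  then show ?thesis by (rule that)
qed

text \<open>\<open>Tr\<close> gives a module over \<open>opp A\<close>; \<open>dual_length\<close>
  is used over that ring, and \<open>opp (opp A) = A\<close> returns the result to left
  modules.\<close>

lemma DTr_length:
  fixes P :: "('a, 'p) module"
  assumes P: "projective A P" "indecomposable A P" and s: "s \<noteq> 0"
    and ds: "internal_direct_sum A (P\<lparr>carrier := rad A P\<rparr>) s M"
    and Mi: "\<And>i. i \<in> {1..s} \<Longrightarrow> loewy_length A (P\<lparr>carrier := M i\<rparr>) = c i \<and> primitive_idempotent A (e i) \<and>
       mod_iso A (P\<lparr>carrier := soc A (P\<lparr>carrier := M i\<rparr>)\<rparr>) (left_factor A (e i) (jacobson_radical A))"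
  shows "(\<Sum>i=1..s. comp_length (opp A) (right_factor A (e i) (ideal_power A (jacobson_radical A) (c i + 1))))
      \<le> comp_length A (DTr R E A (quot_module P (soc A P))) + 1"
    and "i \<in> {1..s} \<Longrightarrow> c i \<noteq> 0 \<and>
      c i + 1 \<le> comp_length (opp A) (right_factor A (e i) (ideal_power A (jacobson_radical A) (c i + 1)))"
proof -
  obtain u where u: "transpose_bound A s (\<lambda>i. e (Suc i)) P (rad A P) (quot_module P (soc A P))
      (left_module.quot_map P (soc A P)) u (\<lambda>i. c (Suc i))"
    and c: "\<And>i. i \<in> {1..s} \<Longrightarrow> c i \<noteq> 0"
    by (rule projective_transpose_bound[OF A.ring_axioms fin_regular fin_regular_opp P s ds Mi]) blast+
  interpret tb: transpose_bound A s "\<lambda>i. e (Suc i)" P "rad A P" "quot_module P (soc A P)"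
    "left_module.quot_map P (soc A P)" u "\<lambda>i. c (Suc i)" by (rule u)
  interpret op: artin_dual R "opp A" E
    by (intro artin_dual.intro artin_opp artin_dual_axioms.intro minE)
  have "comp_length (opp A) (Tr A (quot_module P (soc A P))) \<le> comp_length A (DTr R E A (quot_module P (soc A P)))"
    using op.dual_length[OF tb.Tr_length(2)] by (simp add: DTr_def opp_opp)
  then show "(\<Sum>i=1..s. comp_length (opp A) (right_factor A (e i) (ideal_power A (jacobson_radical A) (c i + 1))))
      \<le> comp_length A (DTr R E A (quot_module P (soc A P))) + 1"
    using tb.Tr_length(1) by (simp add: sum.atLeast1_atMost_eq del: ideal_power.simps)
  assume i: "i \<in> {1..s}"
  then have "i - 1 < s" "Suc (i - 1) = i" by auto
  then show "c i \<noteq> 0 \<and> c i + 1 \<le> comp_length (opp A) (right_factor A (e i) (ideal_power A (jacobson_radical A) (c i + 1)))"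
    using tb.factor_length[of "i - 1"] c[OF i] by metis
qed

text \<open>The estimate is used over \<open>opp A\<close>, whose right factors are the left factors
  of \<open>A\<close>, with the same powers of the radical.\<close>

lemma TrD_length:
  fixes I :: "('a, 'q) module"
  assumes I: "injective A I" "indecomposable A I" and t: "t \<noteq> 0"
    and ds: "internal_direct_sum A (quot_module I (soc A I)) t N"
    and Ni: "\<And>i. i \<in> {1..t} \<Longrightarrow> loewy_length A ((quot_module I (soc A I))\<lparr>carrier := N i\<rparr>) = c i \<and>
       primitive_idempotent A (e i) \<and>
       mod_iso A (module_top A ((quot_module I (soc A I))\<lparr>carrier := N i\<rparr>)) (left_factor A (e i) (jacobson_radical A))"
  shows "(\<Sum>i=1..t. comp_length A (left_factor A (e i) (ideal_power A (jacobson_radical A) (c i + 1))))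
      \<le> comp_length A (TrD R E A (I\<lparr>carrier := rad A I\<rparr>)) + 1"
    and "i \<in> {1..t} \<Longrightarrow> c i \<noteq> 0 \<and>
      c i + 1 \<le> comp_length A (left_factor A (e i) (ideal_power A (jacobson_radical A) (c i + 1)))"
proof -
  obtain S h where "socle_quotient R A E I S t (\<lambda>k. (quot_module I (soc A I))\<lparr>carrier := N (Suc k)\<rparr>) h
      (\<lambda>k. e (Suc k)) (\<lambda>k. c (Suc k))"
    by (rule socle_quotient_exists[OF I t ds Ni])
  then interpret sq: socle_quotient R A E I S t "\<lambda>k. (quot_module I (soc A I))\<lparr>carrier := N (Suc k)\<rparr>" h
      "\<lambda>k. e (Suc k)" "\<lambda>k. c (Suc k)" .
  obtain g0 u where tb: "transpose_bound (opp A) t (\<lambda>k. e (Suc k)) sq.Q (ann I S) sq.X g0 u (\<lambda>k. c (Suc k))"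
    by (rule sq.dual_transpose_bound)
  interpret tb: transpose_bound "opp A" t "\<lambda>k. e (Suc k)" sq.Q "ann I S" sq.X g0 u "\<lambda>k. c (Suc k)" by (rule tb)
  have eq: "right_factor (opp A) x (ideal_power (opp A) (jacobson_radical (opp A)) n) =
      left_factor A x (ideal_power A (jacobson_radical A) n)" for x n
    by (simp only: right_factor_opp sq.dual_J_power)
  note Tr = tb.Tr_length(1)[unfolded eq opp_opp] and fl = tb.factor_length[unfolded eq opp_opp]
  show "(\<Sum>i=1..t. comp_length A (left_factor A (e i) (ideal_power A (jacobson_radical A) (c i + 1))))
      \<le> comp_length A (TrD R E A (I\<lparr>carrier := rad A I\<rparr>)) + 1"
    using Tr by (simp add: sum.atLeast1_atMost_eq TrD_def del: ideal_power.simps)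
  assume i: "i \<in> {1..t}"
  then have "i - 1 < t" "Suc (i - 1) = i" by auto
  then show "c i \<noteq> 0 \<and> c i + 1 \<le> comp_length A (left_factor A (e i) (ideal_power A (jacobson_radical A) (c i + 1)))"
    using fl[of "i - 1"] sq.c_ne[of "i - 1"] by metis
qed

end

text \<open>Integers, so that the subtraction of 1 is genuine: for \<open>s = 0\<close> all three
  lower bounds are \<open>- 1\<close>. Otherwise summation of \<open>c i + 1 \<le> l i\<close> and
  of \<open>1 \<le> c i\<close> gives the last two inequalities.\<close>

lemma int_sum_bounds:
  fixes l c :: "nat \<Rightarrow> nat" and L :: nat
  assumes "s \<noteq> 0 \<Longrightarrow> (\<Sum>i=1..s. l i) \<le> L + 1" "\<And>i. s \<noteq> 0 \<Longrightarrow> i \<in> {1..s} \<Longrightarrow> c i \<noteq> 0 \<and> c i + 1 \<le> l i"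
  shows "int L \<ge> (\<Sum>i=1..s. int (l i)) - 1 \<and>
    (\<Sum>i=1..s. int (l i)) - 1 \<ge> (int s - 1) + (\<Sum>i=1..s. int (c i)) \<and>
    (int s - 1) + (\<Sum>i=1..s. int (c i)) \<ge> 2 * int s - 1"
proof (cases "s = 0")
  case False
  have "int (\<Sum>i=1..s. l i) \<le> int L + 1" using assms(1)[OF False] by linarith
  moreover have "(\<Sum>i=1..s. 1 + int (c i)) \<le> (\<Sum>i=1..s. int (l i))"
    by (rule sum_mono) (use assms(2)[OF False] in force)
  moreover have "(\<Sum>i=1..s. 1) \<le> (\<Sum>i=1..s. int (c i))"
    by (rule sum_mono) (use assms(2)[OF False] in force)
  ultimately show ?thesis by (simp add: sum.distrib)
qed simp

theorem proposition5p1p2: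
  fixes R :: "('r, 'k) ring_scheme" and A :: "('r, 'a) module" and E :: "('r, 'i) module"
  assumes "artin_algebra R A" and "minimal_injective_cogenerator R E"
  shows
   "(\<forall>(P :: ('a, 'p) module) (s :: nat) (M :: nat \<Rightarrow> 'p set) (c :: nat \<Rightarrow> nat) (e :: nat \<Rightarrow> 'a).
       projective A P \<and> indecomposable A P \<and>
       internal_direct_sum A (P\<lparr>carrier := rad A P\<rparr>) s M \<and>
       (\<forall>i\<in>{1..s}. loewy_length A (P\<lparr>carrier := M i\<rparr>) = c i \<and>
          primitive_idempotent A (e i) \<and>
          mod_iso A (P\<lparr>carrier := soc A (P\<lparr>carrier := M i\<rparr>)\<rparr>)
            (left_factor A (e i) (jacobson_radical A))) \<longrightarrow>
       int (comp_length A (DTr R E A (quot_module P (soc A P))))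
         \<ge> (\<Sum>i=1..s. int (comp_length (opp A)
              (right_factor A (e i) (ideal_power A (jacobson_radical A) (c i + 1))))) - 1 \<and>
       (\<Sum>i=1..s. int (comp_length (opp A)
              (right_factor A (e i) (ideal_power A (jacobson_radical A) (c i + 1))))) - 1
         \<ge> (int s - 1) + (\<Sum>i=1..s. int (c i)) \<and>
       (int s - 1) + (\<Sum>i=1..s. int (c i)) \<ge> 2 * int s - 1) \<and>
    (\<forall>(I :: ('a, 'q) module) (t :: nat) (N :: nat \<Rightarrow> 'q set set) (c :: nat \<Rightarrow> nat) (e :: nat \<Rightarrow> 'a).
       injective A I \<and> indecomposable A I \<and>
       internal_direct_sum A (quot_module I (soc A I)) t N \<and>
       (\<forall>i\<in>{1..t}. loewy_length A ((quot_module I (soc A I))\<lparr>carrier := N i\<rparr>) = c i \<and>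
          primitive_idempotent A (e i) \<and>
          mod_iso A (module_top A ((quot_module I (soc A I))\<lparr>carrier := N i\<rparr>))
            (left_factor A (e i) (jacobson_radical A))) \<longrightarrow>
       int (comp_length A (TrD R E A (I\<lparr>carrier := rad A I\<rparr>)))
         \<ge> (\<Sum>i=1..t. int (comp_length A
              (left_factor A (e i) (ideal_power A (jacobson_radical A) (c i + 1))))) - 1 \<and>
       (\<Sum>i=1..t. int (comp_length A
              (left_factor A (e i) (ideal_power A (jacobson_radical A) (c i + 1))))) - 1
         \<ge> (int t - 1) + (\<Sum>i=1..t. int (c i)) \<and>
       (int t - 1) + (\<Sum>i=1..t. int (c i)) \<ge> 2 * int t - 1)"
proof -
  interpret artin_dual R A E
    by (intro artin_dual.intro artin_dual_axioms.intro assms)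
  show ?thesis
  proof ((rule conjI; intro allI impI), goal_cases)
    case (1 P s M c e)
    then have P: "projective A P" "indecomposable A P" "internal_direct_sum A (P\<lparr>carrier := rad A P\<rparr>) s M"
      and Mi: "\<And>i. i \<in> {1..s} \<Longrightarrow> loewy_length A (P\<lparr>carrier := M i\<rparr>) = c i \<and> primitive_idempotent A (e i) \<and>
        mod_iso A (P\<lparr>carrier := soc A (P\<lparr>carrier := M i\<rparr>)\<rparr>) (left_factor A (e i) (jacobson_radical A))"
      by blast+
    show ?case
      by (rule int_sum_bounds) (rule DTr_length[OF P(1,2) _ P(3) Mi]; assumption)+
  next
    case (2 I t N c e)
    then have I: "injective A I" "indecomposable A I" "internal_direct_sum A (quot_module I (soc A I)) t N"
      and Ni: "\<And>i. i \<in> {1..t} \<Longrightarrow> loewy_length A ((quot_module I (soc A I))\<lparr>carrier := N i\<rparr>) = c i \<and>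
        primitive_idempotent A (e i) \<and>
        mod_iso A (module_top A ((quot_module I (soc A I))\<lparr>carrier := N i\<rparr>)) (left_factor A (e i) (jacobson_radical A))"
      by blast+
    show ?case
      by (rule int_sum_bounds) (rule TrD_length[OF I(1,2) _ I(3) Ni]; assumption)+
  qed
qed

end
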